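(* Let $(M,\omega)$ be a symplectic manifold of dimension $2n\ge 4$ which is the first element of a contact quadruple $(M,N,\alpha,\pi)$ (with $d\alpha=\pi^*\omega$), let $(P,\mu)$ be the corresponding induced symplectic manifold, and let $\nabla$ be an arbitrary symplectic connection on $(M,\omega)$. For a smooth symmetric $2$-tensor field $\hat s$ on $M$, a smooth vector field $U$ on $M$ and a smooth function $f$ on $M$, let $\nabla^P$ be the induced connection on $P$ defined in the context. Then, for any choice of $\hat s$, $U$ and $f$, $\nabla^P$ is a symplectic connection on $(P,\mu)$. The vector field $E$ on $P$ is affine ($L_E\nabla^P=0$) and symplectic ($L_E\mu=0$); the vector field $\partial_s$ on $P$ is affine ($L_{\partial_s}\nabla^P=0$) and conformal ($L_{\partial_s}\mu=2\mu$). Furthermore, choose $$\hat s=\frac{-1}{2(n+1)}\,r^\nabla,$$ $$\omega(U,X)=\frac{2}{2n+1}\operatorname{Tr}\big[Y\mapsto(\nabla_Y\sigma)X\big]\quad\text{for all } X,$$ $$f=\frac{1}{2n(n+1)^2}\operatorname{Tr}\big((\rho^\nabla)^2\big)+\frac1n\operatorname{Tr}\big[X\mapsto\nabla_XU\big].$$ Then, for this choice: (a) the connection $\nabla^P$ on $(P,\mu)$ is Ricci-flat (its Ricci tensor is zero); (b) if the symplectic connection $\nabla$ on $(M,\omega)$ is of Ricci type, then the connection $\nabla^P$ on $(P,\mu)$ is flat; (c) if the connection $\nabla^P$ is locally symmetric ($\nabla^PR^{\nabla^P}=0$), then $\nabla$ is of Ricci type, hence $\nabla^P$ is flat.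
   Context: Symplectic connection: a torsion-free linear connection $\nabla$ on a symplectic manifold $(M,\omega)$ with $\nabla\omega=0$. Contact quadruple $(M,N,\alpha,\pi)$: $M$ is a smooth manifold of dimension $2n$, $N$ a smooth manifold of dimension $2n+1$, $\alpha$ a $1$-form on $N$ with $\alpha\wedge(d\alpha)^n$ nowhere vanishing, $\pi:N\to M$ a smooth surjective submersion, and $d\alpha=\pi^*\omega$ with $\omega$ a symplectic form on $M$. Induced symplectic manifold: $P=N\times\mathbb R$ with $\mu=2e^{2s}\,ds\wedge p_1^*\alpha+e^{2s}\,d(p_1^*\alpha)=d(e^{2s}p_1^*\alpha)$, where $s$ is the coordinate on $\mathbb R$ and $p_1:P\to N$ is the projection on the first factor. Let $p=\pi\circ p_1:P\to M$. Let $Z$ be the Reeb field on $N$ ($i(Z)d\alpha=0$, $\alpha(Z)=1$), and let $E$ be the vector field on $P$ with $p_{1*}E=Z$, $ds(E)=0$. For a vector field $X$ on $M$, $\bar{\bar X}$ is the vector field on $P$ with $p_*\bar{\bar X}=X$, $(p_1^*\alpha)(\bar{\bar X})=0$, $ds(\bar{\bar X})=0$. Curvature and Ricci conventions: $R^\nabla(X,Y)Z=\nabla_X\nabla_YZ-\nabla_Y\nabla_XZ-\nabla_{[X,Y]}Z$ and $r^\nabla(X,Y)=\operatorname{Tr}[Z\mapsto R^\nabla(X,Z)Y]$ (a symmetric tensor for symplectic connections). The Ricci endomorphism $\rho^\nabla$ is defined by $r^\nabla(X,Y)=\omega(X,\rho^\nabla Y)$. Ricci type: the curvature of a symplectic connection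 decomposes under the symplectic group as $R^\nabla=E^\nabla+W^\nabla$, where $$E^\nabla(X,Y)Z=\tfrac{1}{2(n+1)}\big[2\omega(X,Y)\rho^\nabla Z-\omega(Y,Z)\rho^\nabla X+\omega(X,Z)\rho^\nabla Y-r^\nabla(Y,Z)X+r^\nabla(X,Z)Y\big]$$ depends only on the Ricci tensor and all traces of $W^\nabla$ vanish. $\nabla$ is of Ricci type if $W^\nabla=0$. Induced connection: given $\hat s,U,f$, let $\sigma$ be the endomorphism of $TM$ defined by $\hat s(X,Y)=\omega(X,\sigma Y)$. The connection $\nabla^P$ on $P$ is determined by, for vector fields $X,Y$ on $M$, $$\nabla^P_{\bar{\bar X}}\bar{\bar Y}=\overline{\overline{\nabla_XY}}-\tfrac12p^*(\omega(X,Y))E-p^*(\hat s(X,Y))\partial_s,$$ $$\nabla^P_E\bar{\bar X}=\nabla^P_{\bar{\bar X}}E=2\,\overline{\overline{\sigma X}}+p^*(\omega(X,U))\partial_s,\qquad \nabla^P_{\partial_s}\bar{\bar X}=\nabla^P_{\bar{\bar X}}\partial_s=\bar{\bar X},$$ $$\nabla^P_EE=p^*f\,\partial_s-2\,\overline{\overline U},\qquad \nabla^P_E\partial_s=\nabla^P_{\partial_s}E=E,\qquad \nabla^P_{\partial_s}\partial_s=\partial_s.$$ *)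

theory Defs
  imports "HOL-Analysis.Analysis" "HOL-Combinatorics.Combinatorics"
begin

section \<open>Smooth maps between open subsets of Euclidean spaces\<close>

text \<open>Only used for open \<open>S\<close>.\<close>

primrec Ck_on :: "nat \<Rightarrow> 'a::euclidean_space set \<Rightarrow> ('a \<Rightarrow> 'b::euclidean_space) \<Rightarrow> bool" where
  "Ck_on 0 S f = continuous_on S f"
| "Ck_on (Suc k) S f =
     ((\<forall>x\<in>S. f differentiable (at x)) \<and>
      (\<forall>v. Ck_on k S (\<lambda>x. frechet_derivative f (at x) v)))"

definition smooth_on :: "'a::euclidean_space set \<Rightarrow> ('a \<Rightarrow> 'b::euclidean_space) \<Rightarrow> bool" where
  "smooth_on S f \<longleftrightarrow> (\<forall>k. Ck_on k S f)"


section \<open>Smooth manifolds, tangent spaces, differentials\<close>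

text \<open>
  The points of a manifold are all elements of a type. Its smooth structure is given by an atlas
  in which one chart around each point is singled out: \<open>M a = (U, \<phi>)\<close> is a chart with \<open>a \<in> U\<close>,
  and the atlas is \<open>range M\<close>. Every atlas contains a sub-atlas of this form, defining the same
  smooth structure.

  The tangent space at \<open>x\<close> is identified with the model space \<open>'e\<close> by means of the differential
  at \<open>x\<close> of the chart \<open>M x\<close>. So a vector field is a function \<open>'m \<Rightarrow> 'e\<close>, an endomorphism field is
  a function \<open>'m \<Rightarrow> 'e \<Rightarrow> 'e\<close>, and so on. Such functions need not look smooth (the identifications
  may jump from point to point): smoothness and all differential operators are expressed
  through the components in one fixed chart.
\<close>

type_synonym ('m, 'e) manifold = "'m \<Rightarrow> 'm set \<times> ('m \<Rightarrow> 'e)"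

definition chart_dom :: "('m, 'e) manifold \<Rightarrow> 'm \<Rightarrow> 'm set" where
  "chart_dom M a = fst (M a)"

definition chart_map :: "('m, 'e) manifold \<Rightarrow> 'm \<Rightarrow> 'm \<Rightarrow> 'e" where
  "chart_map M a = snd (M a)"

definition chart_inv :: "('m, 'e) manifold \<Rightarrow> 'm \<Rightarrow> 'e \<Rightarrow> 'm" where
  "chart_inv M a = inv_into (chart_dom M a) (chart_map M a)"

definition chart_img :: "('m, 'e) manifold \<Rightarrow> 'm \<Rightarrow> 'e set" where
  "chart_img M a = chart_map M a ` chart_dom M a"

definition smooth_manifold ::
    "('m::{t2_space,second_countable_topology}, 'e::euclidean_space) manifold \<Rightarrow> bool" where
  "smooth_manifold M \<longleftrightarrow>
     (\<forall>a. a \<in> chart_dom M a \<and> open (chart_dom M a) \<and> open (chart_img M a) \<and>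
          homeomorphism (chart_dom M a) (chart_img M a) (chart_map M a) (chart_inv M a)) \<and>
     (\<forall>a b. smooth_on (chart_map M a ` (chart_dom M a \<inter> chart_dom M b))
              (chart_map M b \<circ> chart_inv M a))"

definition euclid_mfd :: "('e, 'e) manifold" where
  "euclid_mfd = (\<lambda>_. (UNIV, \<lambda>y. y))"

definition prod_mfd ::
    "('m, 'e) manifold \<Rightarrow> ('n, 'f) manifold \<Rightarrow> ('m \<times> 'n, 'e \<times> 'f) manifold" where
  "prod_mfd M N = (\<lambda>(a, b).
     (chart_dom M a \<times> chart_dom N b, map_prod (chart_map M a) (chart_map N b)))"

definition smooth_map ::
    "('m::topological_space, 'e::euclidean_space) manifold \<Rightarrow>
     ('n::topological_space, 'f::euclidean_space) manifold \<Rightarrow> ('m \<Rightarrow> 'n) \<Rightarrow> bool" where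
  "smooth_map M N F \<longleftrightarrow> continuous_on UNIV F \<and>
     (\<forall>a b. smooth_on (chart_map M a ` (chart_dom M a \<inter> F -` chart_dom N b))
              (chart_map N b \<circ> F \<circ> chart_inv M a))"

abbreviation smooth_fun :: "('m::topological_space, 'e::euclidean_space) manifold \<Rightarrow> ('m \<Rightarrow> real) \<Rightarrow> bool" where
  "smooth_fun M f \<equiv> smooth_map M euclid_mfd f"

text \<open>The differential \<open>F\<^sub>*\<close> of \<open>F\<close> at \<open>x\<close>, from the tangent space at \<open>x\<close> to the one at \<open>F x\<close>.\<close>

definition tmap ::
    "('m, 'e::euclidean_space) manifold \<Rightarrow> ('n, 'f::euclidean_space) manifold \<Rightarrow>
     ('m \<Rightarrow> 'n) \<Rightarrow> 'm \<Rightarrow> 'e \<Rightarrow> 'f" where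
  "tmap M N F x =
     frechet_derivative (chart_map N (F x) \<circ> F \<circ> chart_inv M x) (at (chart_map M x x))"

abbreviation dfun :: "('m, 'e::euclidean_space) manifold \<Rightarrow> ('m \<Rightarrow> real) \<Rightarrow> 'm \<Rightarrow> 'e \<Rightarrow> real" where
  "dfun M f \<equiv> tmap M euclid_mfd f"

text \<open>
  For \<open>x\<close> in the domain of the chart at \<open>a\<close>: the components of a tangent vector at \<open>x\<close> in that
  chart, and conversely the tangent vector at \<open>x\<close> with given components.
\<close>

definition vec_to_chart :: "('m, 'e::euclidean_space) manifold \<Rightarrow> 'm \<Rightarrow> 'm \<Rightarrow> 'e \<Rightarrow> 'e" where
  "vec_to_chart M a x = frechet_derivative (chart_map M a \<circ> chart_inv M x) (at (chart_map M x x))"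

definition vec_of_chart :: "('m, 'e::euclidean_space) manifold \<Rightarrow> 'm \<Rightarrow> 'm \<Rightarrow> 'e \<Rightarrow> 'e" where
  "vec_of_chart M a x = frechet_derivative (chart_map M x \<circ> chart_inv M a) (at (chart_map M a x))"


section \<open>Vector fields, covariant tensors, exterior derivative\<close>

definition loc_vf :: "('m, 'e::euclidean_space) manifold \<Rightarrow> 'm \<Rightarrow> ('m \<Rightarrow> 'e) \<Rightarrow> 'e \<Rightarrow> 'e" where
  "loc_vf M a X y = vec_to_chart M a (chart_inv M a y) (X (chart_inv M a y))"

definition smooth_vf :: "('m, 'e::euclidean_space) manifold \<Rightarrow> ('m \<Rightarrow> 'e) \<Rightarrow> bool" where
  "smooth_vf M X \<longleftrightarrow> (\<forall>a. smooth_on (chart_img M a) (loc_vf M a X))"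

definition vf_app :: "('m, 'e::euclidean_space) manifold \<Rightarrow> ('m \<Rightarrow> 'e) \<Rightarrow> ('m \<Rightarrow> real) \<Rightarrow> 'm \<Rightarrow> real" where
  "vf_app M X f x = dfun M f x (X x)"

definition lie_bracket :: "('m, 'e::euclidean_space) manifold \<Rightarrow> ('m \<Rightarrow> 'e) \<Rightarrow> ('m \<Rightarrow> 'e) \<Rightarrow> 'm \<Rightarrow> 'e" where
  "lie_bracket M X Y x =
     frechet_derivative (loc_vf M x Y) (at (chart_map M x x)) (X x)
   - frechet_derivative (loc_vf M x X) (at (chart_map M x x)) (Y x)"

definition loc_form1 :: "('m, 'e::euclidean_space) manifold \<Rightarrow> 'm \<Rightarrow> ('m \<Rightarrow> 'e \<Rightarrow> real) \<Rightarrow> 'e \<Rightarrow> 'e \<Rightarrow> real" where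
  "loc_form1 M a \<alpha> y v = (let x = chart_inv M a y in \<alpha> x (vec_of_chart M a x v))"

definition loc_tensor2 ::
    "('m, 'e::euclidean_space) manifold \<Rightarrow> 'm \<Rightarrow> ('m \<Rightarrow> 'e \<Rightarrow> 'e \<Rightarrow> real) \<Rightarrow> 'e \<Rightarrow> 'e \<Rightarrow> 'e \<Rightarrow> real" where
  "loc_tensor2 M a b y u v =
     (let x = chart_inv M a y in b x (vec_of_chart M a x u) (vec_of_chart M a x v))"

definition smooth_form1 :: "('m, 'e::euclidean_space) manifold \<Rightarrow> ('m \<Rightarrow> 'e \<Rightarrow> real) \<Rightarrow> bool" where
  "smooth_form1 M \<alpha> \<longleftrightarrow> (\<forall>x. linear (\<alpha> x)) \<and>
     (\<forall>a v. smooth_on (chart_img M a) (\<lambda>y. loc_form1 M a \<alpha> y v))"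

definition smooth_tensor2 :: "('m, 'e::euclidean_space) manifold \<Rightarrow> ('m \<Rightarrow> 'e \<Rightarrow> 'e \<Rightarrow> real) \<Rightarrow> bool" where
  "smooth_tensor2 M b \<longleftrightarrow> (\<forall>x. bilinear (b x)) \<and>
     (\<forall>a u v. smooth_on (chart_img M a) (\<lambda>y. loc_tensor2 M a b y u v))"

definition smooth_sym2 :: "('m, 'e::euclidean_space) manifold \<Rightarrow> ('m \<Rightarrow> 'e \<Rightarrow> 'e \<Rightarrow> real) \<Rightarrow> bool" where
  "smooth_sym2 M b \<longleftrightarrow> smooth_tensor2 M b \<and> (\<forall>x u v. b x u v = b x v u)"

definition pullback1 ::
    "('m, 'e::euclidean_space) manifold \<Rightarrow> ('n, 'f::euclidean_space) manifold \<Rightarrow>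
     ('m \<Rightarrow> 'n) \<Rightarrow> ('n \<Rightarrow> 'f \<Rightarrow> real) \<Rightarrow> 'm \<Rightarrow> 'e \<Rightarrow> real" where
  "pullback1 M N F \<alpha> x u = \<alpha> (F x) (tmap M N F x u)"

definition pullback2 ::
    "('m, 'e::euclidean_space) manifold \<Rightarrow> ('n, 'f::euclidean_space) manifold \<Rightarrow>
     ('m \<Rightarrow> 'n) \<Rightarrow> ('n \<Rightarrow> 'f \<Rightarrow> 'f \<Rightarrow> real) \<Rightarrow> 'm \<Rightarrow> 'e \<Rightarrow> 'e \<Rightarrow> real" where
  "pullback2 M N F b x u v = b (F x) (tmap M N F x u) (tmap M N F x v)"

text \<open>
  Exterior derivatives in the coordinates of the chart at \<open>x\<close>; in invariant terms
  \<open>d\<alpha>(X,Y) = X(\<alpha>(Y)) - Y(\<alpha>(X)) - \<alpha>([X,Y])\<close>, and similarly for 2-forms.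
\<close>

definition ext_d1 :: "('m, 'e::euclidean_space) manifold \<Rightarrow> ('m \<Rightarrow> 'e \<Rightarrow> real) \<Rightarrow> 'm \<Rightarrow> 'e \<Rightarrow> 'e \<Rightarrow> real" where
  "ext_d1 M \<alpha> x u v =
     frechet_derivative (\<lambda>y. loc_form1 M x \<alpha> y v) (at (chart_map M x x)) u
   - frechet_derivative (\<lambda>y. loc_form1 M x \<alpha> y u) (at (chart_map M x x)) v"

definition ext_d2 ::
    "('m, 'e::euclidean_space) manifold \<Rightarrow> ('m \<Rightarrow> 'e \<Rightarrow> 'e \<Rightarrow> real) \<Rightarrow> 'm \<Rightarrow> 'e \<Rightarrow> 'e \<Rightarrow> 'e \<Rightarrow> real" where
  "ext_d2 M \<omega> x u v w =
     frechet_derivative (\<lambda>y. loc_tensor2 M x \<omega> y v w) (at (chart_map M x x)) u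
   - frechet_derivative (\<lambda>y. loc_tensor2 M x \<omega> y u w) (at (chart_map M x x)) v
   + frechet_derivative (\<lambda>y. loc_tensor2 M x \<omega> y u v) (at (chart_map M x x)) w"

text \<open>
  A \<open>p\<close>-form at a point is a function of the first \<open>p\<close> entries of a sequence of tangent vectors.
  The normalisation is the one with \<open>(\<alpha> \<and> \<beta>)(u,v) = \<alpha>(u)\<beta>(v) - \<alpha>(v)\<beta>(u)\<close> for 1-forms.
\<close>

definition wedge ::
    "nat \<Rightarrow> nat \<Rightarrow> ((nat \<Rightarrow> 'e) \<Rightarrow> real) \<Rightarrow> ((nat \<Rightarrow> 'e) \<Rightarrow> real) \<Rightarrow> (nat \<Rightarrow> 'e) \<Rightarrow> real" where
  "wedge p q \<alpha> \<beta> v =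
     (\<Sum>\<sigma> | \<sigma> permutes {..<p + q}.
        real_of_int (sign \<sigma>) * \<alpha> (\<lambda>i. v (\<sigma> i)) * \<beta> (\<lambda>i. v (\<sigma> (p + i)))) / (fact p * fact q)"

primrec wedge_pow2 :: "((nat \<Rightarrow> 'e) \<Rightarrow> real) \<Rightarrow> nat \<Rightarrow> (nat \<Rightarrow> 'e) \<Rightarrow> real" where
  "wedge_pow2 \<beta> 0 = (\<lambda>_. 1)"
| "wedge_pow2 \<beta> (Suc k) = wedge 2 (2 * k) \<beta> (wedge_pow2 \<beta> k)"


section \<open>Symplectic and contact structures\<close>

definition symplectic_form :: "('m, 'e::euclidean_space) manifold \<Rightarrow> ('m \<Rightarrow> 'e \<Rightarrow> 'e \<Rightarrow> real) \<Rightarrow> bool" where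
  "symplectic_form M \<omega> \<longleftrightarrow> smooth_tensor2 M \<omega> \<and>
     (\<forall>x u. \<omega> x u u = 0) \<and>
     (\<forall>x u v w. ext_d2 M \<omega> x u v w = 0) \<and>
     (\<forall>x u. (\<forall>v. \<omega> x u v = 0) \<longrightarrow> u = 0)"

definition contact_form :: "nat \<Rightarrow> ('n, 'f::euclidean_space) manifold \<Rightarrow> ('n \<Rightarrow> 'f \<Rightarrow> real) \<Rightarrow> bool" where
  "contact_form n N \<alpha> \<longleftrightarrow> smooth_form1 N \<alpha> \<and>
     (\<forall>x. \<exists>v. wedge 1 (2 * n) (\<lambda>v. \<alpha> x (v 0))
                (wedge_pow2 (\<lambda>v. ext_d1 N \<alpha> x (v 0) (v 1)) n) v \<noteq> 0)"

definition surj_submersion ::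
    "('n::topological_space, 'f::euclidean_space) manifold \<Rightarrow>
     ('m::topological_space, 'e::euclidean_space) manifold \<Rightarrow> ('n \<Rightarrow> 'm) \<Rightarrow> bool" where
  "surj_submersion N M F \<longleftrightarrow> smooth_map N M F \<and> surj F \<and> (\<forall>x. surj (tmap N M F x))"

definition contact_quadruple ::
    "nat \<Rightarrow> ('m::{t2_space,second_countable_topology}, 'e::euclidean_space) manifold \<Rightarrow>
     ('n::{t2_space,second_countable_topology}, 'f::euclidean_space) manifold \<Rightarrow>
     ('n \<Rightarrow> 'f \<Rightarrow> real) \<Rightarrow> ('n \<Rightarrow> 'm) \<Rightarrow> ('m \<Rightarrow> 'e \<Rightarrow> 'e \<Rightarrow> real) \<Rightarrow> bool" where
  "contact_quadruple n M N \<alpha> \<pi> \<omega> \<longleftrightarrow>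
     smooth_manifold M \<and> DIM('e) = 2 * n \<and>
     smooth_manifold N \<and> DIM('f) = 2 * n + 1 \<and>
     contact_form n N \<alpha> \<and> surj_submersion N M \<pi> \<and>
     symplectic_form M \<omega> \<and> ext_d1 N \<alpha> = pullback2 N M \<pi> \<omega>"


section \<open>Linear connections\<close>

text \<open>
  A connection is a map on pairs of smooth vector fields. As an operation on arbitrary functions
  it is extended by zero, so that two equal connections are equal as HOL functions.
\<close>

definition linear_connection ::
    "('m::topological_space, 'e::euclidean_space) manifold \<Rightarrow>
     (('m \<Rightarrow> 'e) \<Rightarrow> ('m \<Rightarrow> 'e) \<Rightarrow> 'm \<Rightarrow> 'e) \<Rightarrow> bool" where
  "linear_connection M D \<longleftrightarrow>
     (\<forall>X Y. smooth_vf M X \<and> smooth_vf M Y \<longrightarrow> smooth_vf M (D X Y)) \<and>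
     (\<forall>X X' Y. smooth_vf M X \<and> smooth_vf M X' \<and> smooth_vf M Y \<longrightarrow>
        D (\<lambda>x. X x + X' x) Y = (\<lambda>x. D X Y x + D X' Y x)) \<and>
     (\<forall>X Y Y'. smooth_vf M X \<and> smooth_vf M Y \<and> smooth_vf M Y' \<longrightarrow>
        D X (\<lambda>x. Y x + Y' x) = (\<lambda>x. D X Y x + D X Y' x)) \<and>
     (\<forall>g X Y. smooth_fun M g \<and> smooth_vf M X \<and> smooth_vf M Y \<longrightarrow>
        D (\<lambda>x. g x *\<^sub>R X x) Y = (\<lambda>x. g x *\<^sub>R D X Y x)) \<and>
     (\<forall>g X Y. smooth_fun M g \<and> smooth_vf M X \<and> smooth_vf M Y \<longrightarrow>
        D X (\<lambda>x. g x *\<^sub>R Y x) = (\<lambda>x. vf_app M X g x *\<^sub>R Y x + g x *\<^sub>R D X Y x)) \<and>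
     (\<forall>X Y. \<not> (smooth_vf M X \<and> smooth_vf M Y) \<longrightarrow> D X Y = (\<lambda>_. 0))"

definition torsion_free ::
    "('m, 'e::euclidean_space) manifold \<Rightarrow> (('m \<Rightarrow> 'e) \<Rightarrow> ('m \<Rightarrow> 'e) \<Rightarrow> 'm \<Rightarrow> 'e) \<Rightarrow> bool" where
  "torsion_free M D \<longleftrightarrow>
     (\<forall>X Y x. smooth_vf M X \<and> smooth_vf M Y \<longrightarrow> D X Y x - D Y X x - lie_bracket M X Y x = 0)"

definition parallel2 ::
    "('m, 'e::euclidean_space) manifold \<Rightarrow> (('m \<Rightarrow> 'e) \<Rightarrow> ('m \<Rightarrow> 'e) \<Rightarrow> 'm \<Rightarrow> 'e) \<Rightarrow>
     ('m \<Rightarrow> 'e \<Rightarrow> 'e \<Rightarrow> real) \<Rightarrow> bool" where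
  "parallel2 M D \<omega> \<longleftrightarrow>
     (\<forall>X Y Z x. smooth_vf M X \<and> smooth_vf M Y \<and> smooth_vf M Z \<longrightarrow>
        vf_app M X (\<lambda>x. \<omega> x (Y x) (Z x)) x - \<omega> x (D X Y x) (Z x) - \<omega> x (Y x) (D X Z x) = 0)"

definition symplectic_connection ::
    "('m::{t2_space,second_countable_topology}, 'e::euclidean_space) manifold \<Rightarrow>
     ('m \<Rightarrow> 'e \<Rightarrow> 'e \<Rightarrow> real) \<Rightarrow> (('m \<Rightarrow> 'e) \<Rightarrow> ('m \<Rightarrow> 'e) \<Rightarrow> 'm \<Rightarrow> 'e) \<Rightarrow> bool" where
  "symplectic_connection M \<omega> D \<longleftrightarrow>
     smooth_manifold M \<and> symplectic_form M \<omega> \<and>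
     linear_connection M D \<and> torsion_free M D \<and> parallel2 M D \<omega>"

definition curv ::
    "('m, 'e::euclidean_space) manifold \<Rightarrow> (('m \<Rightarrow> 'e) \<Rightarrow> ('m \<Rightarrow> 'e) \<Rightarrow> 'm \<Rightarrow> 'e) \<Rightarrow>
     ('m \<Rightarrow> 'e) \<Rightarrow> ('m \<Rightarrow> 'e) \<Rightarrow> ('m \<Rightarrow> 'e) \<Rightarrow> 'm \<Rightarrow> 'e" where
  "curv M D X Y Z x = D X (D Y Z) x - D Y (D X Z) x - D (lie_bracket M X Y) Z x"

definition flat_connection ::
    "('m, 'e::euclidean_space) manifold \<Rightarrow> (('m \<Rightarrow> 'e) \<Rightarrow> ('m \<Rightarrow> 'e) \<Rightarrow> 'm \<Rightarrow> 'e) \<Rightarrow> bool" where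
  "flat_connection M D \<longleftrightarrow>
     (\<forall>X Y Z x. smooth_vf M X \<and> smooth_vf M Y \<and> smooth_vf M Z \<longrightarrow> curv M D X Y Z x = 0)"

definition locally_symmetric ::
    "('m, 'e::euclidean_space) manifold \<Rightarrow> (('m \<Rightarrow> 'e) \<Rightarrow> ('m \<Rightarrow> 'e) \<Rightarrow> 'm \<Rightarrow> 'e) \<Rightarrow> bool" where
  "locally_symmetric M D \<longleftrightarrow>
     (\<forall>V X Y Z x. smooth_vf M V \<and> smooth_vf M X \<and> smooth_vf M Y \<and> smooth_vf M Z \<longrightarrow>
        D V (curv M D X Y Z) x - curv M D (D V X) Y Z x
          - curv M D X (D V Y) Z x - curv M D X Y (D V Z) x = 0)"

definition affine_vf ::
    "('m, 'e::euclidean_space) manifold \<Rightarrow> (('m \<Rightarrow> 'e) \<Rightarrow> ('m \<Rightarrow> 'e) \<Rightarrow> 'm \<Rightarrow> 'e) \<Rightarrow> ('m \<Rightarrow> 'e) \<Rightarrow> bool" where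
  "affine_vf M D V \<longleftrightarrow> smooth_vf M V \<and>
     (\<forall>X Y x. smooth_vf M X \<and> smooth_vf M Y \<longrightarrow>
        lie_bracket M V (D X Y) x - D (lie_bracket M V X) Y x - D X (lie_bracket M V Y) x = 0)"

text \<open>The equation \<open>L\<^sub>V b = c b\<close> for a covariant 2-tensor \<open>b\<close>, evaluated on vector fields.\<close>

definition lie_scales2 ::
    "('m, 'e::euclidean_space) manifold \<Rightarrow> ('m \<Rightarrow> 'e) \<Rightarrow> ('m \<Rightarrow> 'e \<Rightarrow> 'e \<Rightarrow> real) \<Rightarrow> real \<Rightarrow> bool" where
  "lie_scales2 M V b c \<longleftrightarrow>
     (\<forall>X Y x. smooth_vf M X \<and> smooth_vf M Y \<longrightarrow>
        vf_app M V (\<lambda>x. b x (X x) (Y x)) x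
          - b x (lie_bracket M V X x) (Y x) - b x (X x) (lie_bracket M V Y x)
        = c * b x (X x) (Y x))"

definition symplectic_vf ::
    "('m, 'e::euclidean_space) manifold \<Rightarrow> ('m \<Rightarrow> 'e \<Rightarrow> 'e \<Rightarrow> real) \<Rightarrow> ('m \<Rightarrow> 'e) \<Rightarrow> bool" where
  "symplectic_vf M \<omega> V \<longleftrightarrow> smooth_vf M V \<and> lie_scales2 M V \<omega> 0"


section \<open>Traces, Ricci tensor, Ricci type\<close>

definition lin_trace :: "('e::euclidean_space \<Rightarrow> 'e) \<Rightarrow> real" where
  "lin_trace T = (\<Sum>b\<in>Basis. T b \<bullet> b)"

text \<open>
  The value at a point of an operation that is linear over smooth functions: apply it to any
  smooth fields extending the given tangent vectors.
\<close>

definition endo_at ::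
    "('m, 'e::euclidean_space) manifold \<Rightarrow> (('m \<Rightarrow> 'e) \<Rightarrow> 'm \<Rightarrow> 'e) \<Rightarrow> 'm \<Rightarrow> 'e \<Rightarrow> 'e" where
  "endo_at M A x u = (THE w. \<forall>V. smooth_vf M V \<and> V x = u \<longrightarrow> A V x = w)"

definition curv_at ::
    "('m, 'e::euclidean_space) manifold \<Rightarrow> (('m \<Rightarrow> 'e) \<Rightarrow> ('m \<Rightarrow> 'e) \<Rightarrow> 'm \<Rightarrow> 'e) \<Rightarrow>
     'm \<Rightarrow> 'e \<Rightarrow> 'e \<Rightarrow> 'e \<Rightarrow> 'e" where
  "curv_at M D x u v w = (THE r. \<forall>X Y Z. smooth_vf M X \<and> smooth_vf M Y \<and> smooth_vf M Z \<and>
      X x = u \<and> Y x = v \<and> Z x = w \<longrightarrow> curv M D X Y Z x = r)"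

definition ricci ::
    "('m, 'e::euclidean_space) manifold \<Rightarrow> (('m \<Rightarrow> 'e) \<Rightarrow> ('m \<Rightarrow> 'e) \<Rightarrow> 'm \<Rightarrow> 'e) \<Rightarrow> 'm \<Rightarrow> 'e \<Rightarrow> 'e \<Rightarrow> real" where
  "ricci M D x u v = lin_trace (\<lambda>w. curv_at M D x u w v)"

definition ricci_flat ::
    "('m, 'e::euclidean_space) manifold \<Rightarrow> (('m \<Rightarrow> 'e) \<Rightarrow> ('m \<Rightarrow> 'e) \<Rightarrow> 'm \<Rightarrow> 'e) \<Rightarrow> bool" where
  "ricci_flat M D \<longleftrightarrow> (\<forall>x u v. ricci M D x u v = 0)"

definition endo_of ::
    "('m \<Rightarrow> 'e \<Rightarrow> 'e \<Rightarrow> real) \<Rightarrow> ('m \<Rightarrow> 'e \<Rightarrow> 'e \<Rightarrow> real) \<Rightarrow> 'm \<Rightarrow> 'e \<Rightarrow> 'e" where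
  "endo_of \<omega> b x v = (THE w. \<forall>u. b x u v = \<omega> x u w)"

definition ricci_endo ::
    "('m, 'e::euclidean_space) manifold \<Rightarrow> ('m \<Rightarrow> 'e \<Rightarrow> 'e \<Rightarrow> real) \<Rightarrow>
     (('m \<Rightarrow> 'e) \<Rightarrow> ('m \<Rightarrow> 'e) \<Rightarrow> 'm \<Rightarrow> 'e) \<Rightarrow> 'm \<Rightarrow> 'e \<Rightarrow> 'e" where
  "ricci_endo M \<omega> D = endo_of \<omega> (ricci M D)"

definition ricci_part ::
    "nat \<Rightarrow> ('m, 'e::euclidean_space) manifold \<Rightarrow> ('m \<Rightarrow> 'e \<Rightarrow> 'e \<Rightarrow> real) \<Rightarrow>
     (('m \<Rightarrow> 'e) \<Rightarrow> ('m \<Rightarrow> 'e) \<Rightarrow> 'm \<Rightarrow> 'e) \<Rightarrow> 'm \<Rightarrow> 'e \<Rightarrow> 'e \<Rightarrow> 'e \<Rightarrow> 'e" where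
  "ricci_part n M \<omega> D x u v w = (let \<rho> = ricci_endo M \<omega> D x; r = ricci M D x in
     (1 / (2 * (real n + 1))) *\<^sub>R
       ((2 * \<omega> x u v) *\<^sub>R \<rho> w - \<omega> x v w *\<^sub>R \<rho> u + \<omega> x u w *\<^sub>R \<rho> v - r v w *\<^sub>R u + r u w *\<^sub>R v))"

definition weyl_part ::
    "nat \<Rightarrow> ('m, 'e::euclidean_space) manifold \<Rightarrow> ('m \<Rightarrow> 'e \<Rightarrow> 'e \<Rightarrow> real) \<Rightarrow>
     (('m \<Rightarrow> 'e) \<Rightarrow> ('m \<Rightarrow> 'e) \<Rightarrow> 'm \<Rightarrow> 'e) \<Rightarrow> 'm \<Rightarrow> 'e \<Rightarrow> 'e \<Rightarrow> 'e \<Rightarrow> 'e" where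
  "weyl_part n M \<omega> D x u v w = curv_at M D x u v w - ricci_part n M \<omega> D x u v w"

definition ricci_type ::
    "nat \<Rightarrow> ('m, 'e::euclidean_space) manifold \<Rightarrow> ('m \<Rightarrow> 'e \<Rightarrow> 'e \<Rightarrow> real) \<Rightarrow>
     (('m \<Rightarrow> 'e) \<Rightarrow> ('m \<Rightarrow> 'e) \<Rightarrow> 'm \<Rightarrow> 'e) \<Rightarrow> bool" where
  "ricci_type n M \<omega> D \<longleftrightarrow> (\<forall>x u v w. weyl_part n M \<omega> D x u v w = 0)"


section \<open>The induced symplectic manifold and the induced connection\<close>

abbreviation P_mfd :: "('n, 'f) manifold \<Rightarrow> ('n \<times> real, 'f \<times> real) manifold" where
  "P_mfd N \<equiv> prod_mfd N euclid_mfd"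

definition ds_form :: "('n, 'f::euclidean_space) manifold \<Rightarrow> 'n \<times> real \<Rightarrow> 'f \<times> real \<Rightarrow> real" where
  "ds_form N = dfun (P_mfd N) snd"

definition p1_alpha ::
    "('n, 'f::euclidean_space) manifold \<Rightarrow> ('n \<Rightarrow> 'f \<Rightarrow> real) \<Rightarrow> 'n \<times> real \<Rightarrow> 'f \<times> real \<Rightarrow> real" where
  "p1_alpha N \<alpha> = pullback1 (P_mfd N) N fst \<alpha>"

text \<open>This is \<open>d(exp(2s) p\<^sub>1\<^sup>*\<alpha>)\<close>, expanded by the Leibniz rule.\<close>

definition P_form ::
    "('n, 'f::euclidean_space) manifold \<Rightarrow> ('n \<Rightarrow> 'f \<Rightarrow> real) \<Rightarrow>
     'n \<times> real \<Rightarrow> 'f \<times> real \<Rightarrow> 'f \<times> real \<Rightarrow> real" where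
  "P_form N \<alpha> q u v =
     2 * exp (2 * snd q) *
       (ds_form N q u * p1_alpha N \<alpha> q v - ds_form N q v * p1_alpha N \<alpha> q u)
   + exp (2 * snd q) * ext_d1 (P_mfd N) (p1_alpha N \<alpha>) q u v"

definition reeb :: "('n, 'f::euclidean_space) manifold \<Rightarrow> ('n \<Rightarrow> 'f \<Rightarrow> real) \<Rightarrow> 'n \<Rightarrow> 'f" where
  "reeb N \<alpha> x = (THE z. (\<forall>w. ext_d1 N \<alpha> x z w = 0) \<and> \<alpha> x z = 1)"

definition E_field ::
    "('n, 'f::euclidean_space) manifold \<Rightarrow> ('n \<Rightarrow> 'f \<Rightarrow> real) \<Rightarrow> 'n \<times> real \<Rightarrow> 'f \<times> real" where
  "E_field N \<alpha> q =
     (THE e. tmap (P_mfd N) N fst q e = reeb N \<alpha> (fst q) \<and> ds_form N q e = 0)"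

definition s_field :: "('n, 'f::euclidean_space) manifold \<Rightarrow> 'n \<times> real \<Rightarrow> 'f \<times> real" where
  "s_field N q = (THE e. tmap (P_mfd N) N fst q e = 0 \<and> ds_form N q e = 1)"

definition hlift ::
    "('m, 'e::euclidean_space) manifold \<Rightarrow> ('n, 'f::euclidean_space) manifold \<Rightarrow>
     ('n \<Rightarrow> 'f \<Rightarrow> real) \<Rightarrow> ('n \<Rightarrow> 'm) \<Rightarrow> ('m \<Rightarrow> 'e) \<Rightarrow> 'n \<times> real \<Rightarrow> 'f \<times> real" where
  "hlift M N \<alpha> \<pi> X q =
     (THE w. tmap (P_mfd N) M (\<pi> \<circ> fst) q w = X ((\<pi> \<circ> fst) q) \<and>
             p1_alpha N \<alpha> q w = 0 \<and> ds_form N q w = 0)"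

definition is_induced_connection ::
    "('m, 'e::euclidean_space) manifold \<Rightarrow>
     ('n::{t2_space,second_countable_topology}, 'f::euclidean_space) manifold \<Rightarrow>
     ('n \<Rightarrow> 'f \<Rightarrow> real) \<Rightarrow> ('n \<Rightarrow> 'm) \<Rightarrow> ('m \<Rightarrow> 'e \<Rightarrow> 'e \<Rightarrow> real) \<Rightarrow>
     (('m \<Rightarrow> 'e) \<Rightarrow> ('m \<Rightarrow> 'e) \<Rightarrow> 'm \<Rightarrow> 'e) \<Rightarrow>
     ('m \<Rightarrow> 'e \<Rightarrow> 'e \<Rightarrow> real) \<Rightarrow> ('m \<Rightarrow> 'e) \<Rightarrow> ('m \<Rightarrow> real) \<Rightarrow>
     (('n \<times> real \<Rightarrow> 'f \<times> real) \<Rightarrow> ('n \<times> real \<Rightarrow> 'f \<times> real) \<Rightarrow> 'n \<times> real \<Rightarrow> 'f \<times> real) \<Rightarrow> bool" where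
  "is_induced_connection M N \<alpha> \<pi> \<omega> D s U f DP \<longleftrightarrow>
     (let p = \<pi> \<circ> fst; h = hlift M N \<alpha> \<pi>; E = E_field N \<alpha>; S = s_field N; \<sigma> = endo_of \<omega> s in
      linear_connection (P_mfd N) DP \<and>
      (\<forall>X Y. smooth_vf M X \<and> smooth_vf M Y \<longrightarrow>
         DP (h X) (h Y) = (\<lambda>q. h (D X Y) q
            - (1 / 2 * \<omega> (p q) (X (p q)) (Y (p q))) *\<^sub>R E q
            - s (p q) (X (p q)) (Y (p q)) *\<^sub>R S q)) \<and>
      (\<forall>X. smooth_vf M X \<longrightarrow>
         DP E (h X) = (\<lambda>q. 2 *\<^sub>R h (\<lambda>x. \<sigma> x (X x)) q + \<omega> (p q) (X (p q)) (U (p q)) *\<^sub>R S q) \<and>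
         DP (h X) E = (\<lambda>q. 2 *\<^sub>R h (\<lambda>x. \<sigma> x (X x)) q + \<omega> (p q) (X (p q)) (U (p q)) *\<^sub>R S q) \<and>
         DP S (h X) = h X \<and> DP (h X) S = h X) \<and>
      DP E E = (\<lambda>q. f (p q) *\<^sub>R S q - 2 *\<^sub>R h U q) \<and>
      DP E S = E \<and> DP S E = E \<and> DP S S = S)"

definition induced_connection ::
    "('m, 'e::euclidean_space) manifold \<Rightarrow>
     ('n::{t2_space,second_countable_topology}, 'f::euclidean_space) manifold \<Rightarrow>
     ('n \<Rightarrow> 'f \<Rightarrow> real) \<Rightarrow> ('n \<Rightarrow> 'm) \<Rightarrow> ('m \<Rightarrow> 'e \<Rightarrow> 'e \<Rightarrow> real) \<Rightarrow>
     (('m \<Rightarrow> 'e) \<Rightarrow> ('m \<Rightarrow> 'e) \<Rightarrow> 'm \<Rightarrow> 'e) \<Rightarrow>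
     ('m \<Rightarrow> 'e \<Rightarrow> 'e \<Rightarrow> real) \<Rightarrow> ('m \<Rightarrow> 'e) \<Rightarrow> ('m \<Rightarrow> real) \<Rightarrow>
     ('n \<times> real \<Rightarrow> 'f \<times> real) \<Rightarrow> ('n \<times> real \<Rightarrow> 'f \<times> real) \<Rightarrow> 'n \<times> real \<Rightarrow> 'f \<times> real" where
  "induced_connection M N \<alpha> \<pi> \<omega> D s U f = (THE DP. is_induced_connection M N \<alpha> \<pi> \<omega> D s U f DP)"

text \<open>Recall that \<open>(\<nabla>\<^sub>Y\<sigma>)X = \<nabla>\<^sub>Y(\<sigma>X) - \<sigma>(\<nabla>\<^sub>YX)\<close>.\<close>

definition canonical_choice ::
    "nat \<Rightarrow> ('m, 'e::euclidean_space) manifold \<Rightarrow> ('m \<Rightarrow> 'e \<Rightarrow> 'e \<Rightarrow> real) \<Rightarrow>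
     (('m \<Rightarrow> 'e) \<Rightarrow> ('m \<Rightarrow> 'e) \<Rightarrow> 'm \<Rightarrow> 'e) \<Rightarrow>
     ('m \<Rightarrow> 'e \<Rightarrow> 'e \<Rightarrow> real) \<Rightarrow> ('m \<Rightarrow> 'e) \<Rightarrow> ('m \<Rightarrow> real) \<Rightarrow> bool" where
  "canonical_choice n M \<omega> D s U f \<longleftrightarrow>
     (let \<sigma> = endo_of \<omega> s; \<rho> = ricci_endo M \<omega> D in
      (\<forall>x u v. s x u v = - 1 / (2 * (real n + 1)) * ricci M D x u v) \<and>
      (\<forall>X x. smooth_vf M X \<longrightarrow>
         \<omega> x (U x) (X x) = 2 / (2 * real n + 1) *
           lin_trace (endo_at M (\<lambda>Y x. D Y (\<lambda>x. \<sigma> x (X x)) x - \<sigma> x (D Y X x)) x)) \<and>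
      (\<forall>x. f x = 1 / (2 * real n * (real n + 1)\<^sup>2) * lin_trace (\<rho> x \<circ> \<rho> x)
                 + 1 / real n * lin_trace (endo_at M (\<lambda>X. D X U) x)))"

end

theory Submission
  imports Defs "HOL-Real_Asymp.Real_Asymp"
begin

text \<open>
  Why the theorem holds. Let \<open>p : P \<rightarrow> M\<close> be the projection. The tangent space of \<open>P\<close> splits into the
  horizontal lifts \<open>hl u\<close> of the vectors of \<open>M\<close>, the Reeb direction \<open>E\<close> and \<open>S = \<partial>\<^sub>s\<close>; the contact
  condition says precisely that this is a splitting (\<open>tangent_N_zero\<close>). The only non-zero bracket
  of the frame fields that is not lifted from \<open>M\<close> is the component \<open>- \<omega>(X,Y) E\<close> of the bracket of two
  lifts. The frame fields span all vector fields over the smooth functions, hence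
  two connections with the same values on them coincide, and every identity between tensors
  on \<open>P\<close> needs to be checked on them only (\<open>tensor_zero_on_frame\<close>). This gives uniqueness, and it reduces the
  assertions that the connection is symplectic, that \<open>E\<close> and \<open>S\<close> are affine, and that they preserve
  or rescale \<open>\<mu>\<close> to short computations with the defining formulas. For existence, a field on \<open>P\<close> is
  a section of the pull-back of the tangent bundle of \<open>M\<close> together with two functions; the induced
  connection is the sum of the pull-back connection, two trivial connections and a tensor (\<open>DP0\<close>).

  The key to the curvature is that \<open>\<nabla>\<^sup>P S\<close> is the identity. Since the torsion vanishes, \<open>R(A,B)S = 0\<close>;
  since \<open>S\<close> is also affine, \<open>R(S,A)B = 0\<close>; since \<open>R\<close> takes values in the symplectic Lie algebra, its
  values have no \<open>E\<close>-component. So only horizontal components matter for the Ricci tensor, and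
  these are three explicit expressions in \<open>R\<^sup>\<nabla>\<close>, \<open>\<sigma>\<close>, \<open>U\<close> and \<open>f\<close>. The canonical choice says exactly that
  their traces vanish (\<open>ricci_hl_hl\<close>, \<open>ricci_E_hl\<close>, \<open>ricci_E_E\<close>), and for this choice the
  horizontal part of \<open>R(X,Y)Z\<close> on lifts is the Weyl part of the curvature of \<open>\<nabla>\<close> (\<open>R_horizontal_weyl\<close>).

  If \<open>\<nabla>\<^sup>P R = 0\<close>, differentiating \<open>R(A,B)S = 0\<close> in the direction \<open>C\<close> gives \<open>R(A,B)C = 0\<close>: the connection is flat and
  the Weyl part vanishes. Conversely, let the Weyl part vanish. The second Bianchi identity on
  lifts, in which the bracket term \<open>- \<omega>(X,Y) E\<close> survives, relates the remaining components of \<open>R\<close>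
  (\<open>bianchi_lift\<close>). Applied to a lift, its trace kills \<open>R\<close> on three lifts, and what is left has the
  form \<open>\<omega>(x,y) F(z) + cyclic = 0\<close>, which forces \<open>F = 0\<close> in dimension at least four
  (\<open>cyclic_wedge_zero\<close>); applied to \<open>E\<close>, it kills the other components in the same way.

  The first half of the development builds the calculus that these arguments presuppose: smooth
  functions, directional derivatives, brackets, bump functions, tensoriality and curvature on a
  manifold. There everything is reduced to directional derivatives of Euclidean-valued functions, of which
  charts and their changes are instances.
\<close>

section \<open>Calculus of smooth maps between Euclidean spaces\<close>

lemma Ck_on_SucD:
  assumes "Ck_on (Suc k) S f" "x \<in> S"
  shows "(f has_derivative frechet_derivative f (at x)) (at x)"
  using assms by (simp add: frechet_derivative_works[symmetric])

lemma Ck_on_cong_imp: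
  "open S \<Longrightarrow> (\<And>x. x \<in> S \<Longrightarrow> f x = g x) \<Longrightarrow> Ck_on k S f \<Longrightarrow> Ck_on k S g"
proof (induction k arbitrary: f g)
  case 0
  then show ?case by (metis Ck_on.simps(1) continuous_on_cong)
next
  case (Suc k)
  have d: "(g has_derivative frechet_derivative f (at x)) (at x)" if "x \<in> S" for x
    using has_derivative_transform_within_open[OF Ck_on_SucD[OF Suc.prems(3) that] Suc.prems(1) that] Suc.prems(2)
    by blast
  have "Ck_on k S (\<lambda>x. frechet_derivative g (at x) v)" for v
    by (rule Suc.IH[of "\<lambda>x. frechet_derivative f (at x) v"])
       (use Suc.prems frechet_derivative_at[OF d] in auto)
  with d show ?case by (auto simp: differentiable_def)
qed

lemma Ck_on_SucI:
  assumes "\<And>x. x \<in> S \<Longrightarrow> (f has_derivative f' x) (at x)" "\<And>v. Ck_on k S (\<lambda>x. f' x v)" "open S"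
  shows "Ck_on (Suc k) S f"
proof -
  have "Ck_on k S (\<lambda>x. frechet_derivative f (at x) v)" for v
    by (rule Ck_on_cong_imp[OF assms(3) _ assms(2)[of v]])
       (use frechet_derivative_at[OF assms(1)] in auto)
  then show ?thesis using assms(1) by (auto simp: differentiable_def)
qed

lemma Ck_on_mono: "T \<subseteq> S \<Longrightarrow> Ck_on k S f \<Longrightarrow> Ck_on k T f"
  by (induction k arbitrary: f) (auto intro: continuous_on_subset)

lemma Ck_on_less: "Ck_on (Suc k) S f \<Longrightarrow> Ck_on k S f"
proof (induction k arbitrary: f)
  case 0
  then show ?case
    by (auto intro!: differentiable_imp_continuous_on simp: differentiable_on_def differentiable_at_withinI)
next
  case (Suc k)
  then show ?case by (metis Ck_on.simps(2))
qed

lemma Ck_on_local: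
  "(\<And>x. x \<in> S \<Longrightarrow> \<exists>T. open T \<and> x \<in> T \<and> Ck_on k T f) \<Longrightarrow> Ck_on k S f"
proof (induction k arbitrary: f)
  case 0
  show ?case unfolding Ck_on.simps
  proof (rule continuous_at_imp_continuous_on, intro ballI)
    fix x assume "x \<in> S"
    from 0[OF this] obtain T where "open T" "x \<in> T" "continuous_on T f" by auto
    then show "isCont f x" by (simp add: continuous_on_eq_continuous_at)
  qed
next
  case (Suc k)
  have "f differentiable at x" if "x \<in> S" for x using Suc.prems[OF that] by auto
  moreover have "Ck_on k S (\<lambda>x. frechet_derivative f (at x) v)" for v
    by (rule Suc.IH) (use Suc.prems in fastforce)
  ultimately show ?case by auto
qed

lemma Ck_on_const: "Ck_on k S (\<lambda>x. c)"
  by (induction k arbitrary: c) (auto intro: continuous_on_const)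

lemma Ck_on_bounded_linear:
  assumes "bounded_linear L" "open S"
  shows "Ck_on k S f \<Longrightarrow> Ck_on k S (\<lambda>x. L (f x))"
proof (induction k arbitrary: f)
  case 0
  then show ?case using assms linear_continuous_on_compose[of S f L]
    by (simp add: bounded_linear.linear)
next
  case (Suc k)
  show ?case
    by (rule Ck_on_SucI[where f' = "\<lambda>x v. L (frechet_derivative f (at x) v)"])
       (use Suc assms in \<open>auto intro!: bounded_linear.has_derivative[OF assms(1)] simp: frechet_derivative_works[symmetric]\<close>)
qed

lemma Ck_on_add: "open S \<Longrightarrow> Ck_on k S f \<Longrightarrow> Ck_on k S g \<Longrightarrow> Ck_on k S (\<lambda>x. f x + g x)"
proof (induction k arbitrary: f g)
  case 0
  then show ?case by (auto intro: continuous_intros)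
next
  case (Suc k)
  show ?case
    by (rule Ck_on_SucI[where f' = "\<lambda>x v. frechet_derivative f (at x) v + frechet_derivative g (at x) v"])
       (use Suc in \<open>auto intro!: has_derivative_add simp: frechet_derivative_works[symmetric]\<close>)
qed

lemma Ck_on_sum: "open S \<Longrightarrow> (\<And>i. i \<in> I \<Longrightarrow> Ck_on k S (f i)) \<Longrightarrow> Ck_on k S (\<lambda>x. \<Sum>i\<in>I. f i x)"
  by (induction I rule: infinite_finite_induct) (auto intro: Ck_on_const Ck_on_add)

lemma Ck_on_bilinear:
  assumes "bounded_bilinear L"
  shows "open S \<Longrightarrow> Ck_on k S f \<Longrightarrow> Ck_on k S g \<Longrightarrow> Ck_on k S (\<lambda>x. L (f x) (g x))"
proof (induction k arbitrary: f g)
  case 0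
  then show ?case using bounded_bilinear.continuous_on[OF assms] by auto
next
  case (Suc k)
  have fg: "Ck_on k S f" "Ck_on k S g" using Suc.prems Ck_on_less by blast+
  show ?case
  proof (rule Ck_on_SucI[where f' = "\<lambda>x v. L (f x) (frechet_derivative g (at x) v) + L (frechet_derivative f (at x) v) (g x)"])
    show "Ck_on k S (\<lambda>x. L (f x) (frechet_derivative g (at x) v) + L (frechet_derivative f (at x) v) (g x))" for v
      using Suc fg by (intro Ck_on_add Suc.IH) auto
    show "((\<lambda>x. L (f x) (g x)) has_derivative (\<lambda>v. L (f x) (frechet_derivative g (at x) v) + L (frechet_derivative f (at x) v) (g x))) (at x)" if "x \<in> S" for x
      using bounded_bilinear.FDERIV[OF assms Ck_on_SucD Ck_on_SucD, OF Suc.prems(2) that Suc.prems(3) that] .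
  qed (use Suc in auto)
qed

lemma linear_basis_expand:
  fixes L :: "'a::euclidean_space \<Rightarrow> 'b::real_vector"
  shows "linear L \<Longrightarrow> L v = (\<Sum>b\<in>Basis. (v \<bullet> b) *\<^sub>R L b)"
  by (metis (no_types, lifting) euclidean_representation linear_scale linear_sum sum.cong)

lemma Ck_on_compose:
  assumes "open S" "open T"
  shows "Ck_on k S f \<Longrightarrow> Ck_on k T g \<Longrightarrow> f ` S \<subseteq> T \<Longrightarrow> Ck_on k S (\<lambda>x. g (f x))"
proof (induction k arbitrary: f g)
  case 0
  then show ?case using continuous_on_compose2 by auto
next
  case (Suc k)
  have f: "Ck_on k S f" using Suc.prems Ck_on_less by blast
  show ?case
  proof (rule Ck_on_SucI[where f' = "\<lambda>x v. frechet_derivative g (at (f x)) (frechet_derivative f (at x) v)"])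
    fix x assume x: "x \<in> S"
    show "((\<lambda>x. g (f x)) has_derivative (\<lambda>v. frechet_derivative g (at (f x)) (frechet_derivative f (at x) v))) (at x)"
      using has_derivative_compose[OF Ck_on_SucD[OF Suc.prems(1) x] Ck_on_SucD[OF Suc.prems(2), of "f x"]] x Suc.prems(3)
      by auto
  next
    fix v
    show "Ck_on k S (\<lambda>x. frechet_derivative g (at (f x)) (frechet_derivative f (at x) v))"
    proof (rule Ck_on_cong_imp[OF assms(1)])
      show "Ck_on k S (\<lambda>x. \<Sum>b\<in>Basis. (frechet_derivative f (at x) v \<bullet> b) *\<^sub>R frechet_derivative g (at (f x)) b)"
        using Suc f assms
        by (intro Ck_on_sum Ck_on_bilinear[OF bounded_bilinear_scaleR] Ck_on_bilinear[OF bounded_bilinear_inner]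
            Ck_on_const Suc.IH) auto
      fix x assume x: "x \<in> S"
      have "linear (frechet_derivative g (at (f x)))"
        by (rule linear_frechet_derivative) (use Suc.prems x in auto)
      then show "(\<Sum>b\<in>Basis. (frechet_derivative f (at x) v \<bullet> b) *\<^sub>R frechet_derivative g (at (f x)) b) = frechet_derivative g (at (f x)) (frechet_derivative f (at x) v)"
        by (rule linear_basis_expand[symmetric])
    qed
  qed (use assms in auto)
qed

lemma Ck_on_inverse:
  fixes f :: "'a::euclidean_space \<Rightarrow> real"
  assumes "open S" and nz: "\<And>x. x \<in> S \<Longrightarrow> f x \<noteq> 0"
  shows "Ck_on k S f \<Longrightarrow> Ck_on k S (\<lambda>x. inverse (f x))"
proof (induction k)
  case 0
  then show ?case using nz by (auto intro: continuous_intros)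
next
  case (Suc k)
  have i: "Ck_on k S (\<lambda>x. inverse (f x))" using Suc Ck_on_less by blast
  show ?case
  proof (rule Ck_on_SucI[where f' = "\<lambda>x v. (-1) * (inverse (f x) * (frechet_derivative f (at x) v * inverse (f x)))"])
    fix x assume x: "x \<in> S"
    show "((\<lambda>x. inverse (f x)) has_derivative (\<lambda>v. (-1) * (inverse (f x) * (frechet_derivative f (at x) v * inverse (f x))))) (at x)"
      using Deriv.has_derivative_inverse[OF nz[OF x] Ck_on_SucD[OF Suc.prems x]] by (simp add: mult.assoc)
  next
    show "Ck_on k S (\<lambda>x. (-1) * (inverse (f x) * (frechet_derivative f (at x) v * inverse (f x))))" for v
      using Suc.prems by (intro Ck_on_bilinear[OF bounded_bilinear_mult] Ck_on_const i assms(1)) auto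
  qed (use assms in auto)
qed

lemma Ck_on_exp:
  fixes f :: "'a::euclidean_space \<Rightarrow> real"
  assumes "open S"
  shows "Ck_on k S f \<Longrightarrow> Ck_on k S (\<lambda>x. exp (f x))"
proof (induction k)
  case 0
  then show ?case by (auto intro: continuous_intros)
next
  case (Suc k)
  have i: "Ck_on k S (\<lambda>x. exp (f x))" using Suc Ck_on_less by blast
  show ?case
  proof (rule Ck_on_SucI[where f' = "\<lambda>x v. exp (f x) * frechet_derivative f (at x) v"])
    fix x assume x: "x \<in> S"
    show "((\<lambda>x. exp (f x)) has_derivative (\<lambda>v. exp (f x) * frechet_derivative f (at x) v)) (at x)"
      using has_derivative_exp[OF Ck_on_SucD[OF Suc.prems x]] by (simp add: mult.commute)
  next
    show "Ck_on k S (\<lambda>x. exp (f x) * frechet_derivative f (at x) v)" for v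
      using Suc.prems by (intro Ck_on_bilinear[OF bounded_bilinear_mult] i assms(1)) auto
  qed (use assms in auto)
qed

subsection \<open>Solutions of linear equations with smooth coefficients\<close>

text \<open>The factor \<open>h\<close> is only continuous: the product is still differentiable where \<open>g\<close> vanishes.\<close>

lemma has_derivative_scaleR_at_zero:
  fixes h :: "'a::euclidean_space \<Rightarrow> real" and g :: "'a \<Rightarrow> 'b::euclidean_space"
  assumes h: "isCont h a" and g: "(g has_derivative g') (at a)" and z: "g a = 0"
  shows "((\<lambda>x. h x *\<^sub>R g x) has_derivative (\<lambda>v. h a *\<^sub>R g' v)) (at a)"
proof -
  have bl: "bounded_linear g'" using g has_derivative_bounded_linear by blast
  obtain K where K: "\<And>v. norm (g' v) \<le> norm v * K" using bounded_linear.bounded[OF bl] by blast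
  have e: "h x *\<^sub>R g x - h a *\<^sub>R g a - h a *\<^sub>R g' (x - a) = h x *\<^sub>R (g x - g a - g' (x - a)) + (h x - h a) *\<^sub>R g' (x - a)" for x
    using z by (simp add: algebra_simps)
  have 1: "((\<lambda>x. norm (g x - g a - g' (x - a)) / norm (x - a)) \<longlongrightarrow> 0) (at a)"
    using g by (simp add: has_derivative_iff_norm)
  have h1: "((\<lambda>x. \<bar>h x\<bar> * (norm (g x - g a - g' (x - a)) / norm (x - a)) + \<bar>h x - h a\<bar> * K) \<longlongrightarrow> \<bar>h a\<bar> * 0 + \<bar>h a - h a\<bar> * K) (at a)"
    using h unfolding isCont_def by (intro tendsto_intros 1)
  have "((\<lambda>x. norm (h x *\<^sub>R g x - h a *\<^sub>R g a - h a *\<^sub>R g' (x - a)) / norm (x - a)) \<longlongrightarrow> 0) (at a)"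
  proof (rule Lim_null_comparison)
    show "\<forall>\<^sub>F x in at a. norm (norm (h x *\<^sub>R g x - h a *\<^sub>R g a - h a *\<^sub>R g' (x - a)) / norm (x - a))
       \<le> \<bar>h x\<bar> * (norm (g x - g a - g' (x - a)) / norm (x - a)) + \<bar>h x - h a\<bar> * K"
      unfolding eventually_at_filter
    proof (intro always_eventually allI impI)
      fix x assume "x \<noteq> a"
      then have p: "norm (x - a) > 0" by simp
      have "norm (h x *\<^sub>R g x - h a *\<^sub>R g a - h a *\<^sub>R g' (x - a)) \<le> \<bar>h x\<bar> * norm (g x - g a - g' (x - a)) + \<bar>h x - h a\<bar> * norm (g' (x - a))"
        unfolding e by (metis norm_scaleR norm_triangle_ineq)
      also have "\<dots> \<le> \<bar>h x\<bar> * norm (g x - g a - g' (x - a)) + \<bar>h x - h a\<bar> * (norm (x - a) * K)"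
        by (intro add_left_mono mult_left_mono K) auto
      finally show "norm (norm (h x *\<^sub>R g x - h a *\<^sub>R g a - h a *\<^sub>R g' (x - a)) / norm (x - a))
       \<le> \<bar>h x\<bar> * (norm (g x - g a - g' (x - a)) / norm (x - a)) + \<bar>h x - h a\<bar> * K"
        using p by (simp add: field_simps)
    qed
    show "((\<lambda>x. \<bar>h x\<bar> * (norm (g x - g a - g' (x - a)) / norm (x - a)) + \<bar>h x - h a\<bar> * K) \<longlongrightarrow> 0) (at a)"
      using h1 by simp
  qed
  then show ?thesis
    using bounded_linear_compose[OF bounded_linear_scaleR_right[of "h a"] bl]
    by (simp add: has_derivative_iff_norm)
qed

text \<open>
  \<open>A a\<close> is bounded below by some \<open>m > 0\<close>, and \<open>e x\<close> bounds the operator norm of \<open>A x - A a\<close>. Where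
  \<open>e x < m/2\<close>, the solutions \<open>w x\<close> are bounded, and \<open>A a (w x - w a)\<close> is small with \<open>c x - c a\<close> and \<open>e x\<close>.
\<close>

lemma linear_solve_continuous:
  fixes A :: "'x::euclidean_space \<Rightarrow> 'a::euclidean_space \<Rightarrow> 'b::euclidean_space"
  assumes S: "open S" and lin: "\<And>x. x \<in> S \<Longrightarrow> linear (A x)" and inj: "\<And>x. x \<in> S \<Longrightarrow> inj (A x)"
    and A: "\<And>v. continuous_on S (\<lambda>x. A x v)" and c: "continuous_on S c"
    and w: "\<And>x. x \<in> S \<Longrightarrow> A x (w x) = c x"
  shows "continuous_on S w"
proof (rule continuous_at_imp_continuous_on, intro ballI)
  fix a assume a: "a \<in> S"
  obtain m where m: "m > 0" "\<And>v. m * norm v \<le> norm (A a v)"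
    using linear_inj_bounded_below_pos[OF lin[OF a] inj[OF a]] by metis
  define e where "e x = (\<Sum>b\<in>Basis. norm (A x b - A a b))" for x
  have cA: "isCont (\<lambda>x. A x v) a" for v using A a S by (simp add: continuous_on_eq_continuous_at)
  have cc: "isCont c a" using c a S by (simp add: continuous_on_eq_continuous_at)
  have e0: "(e \<longlongrightarrow> 0) (at a)"
  proof -
    have "((\<lambda>x. \<Sum>b\<in>Basis. norm (A x b - A a b)) \<longlongrightarrow> (\<Sum>b\<in>Basis. norm (A a b - A a b))) (at a)"
      using cA unfolding isCont_def by (intro tendsto_intros)
    then show ?thesis by (simp add: e_def[abs_def])
  qed
  have eb: "norm (A x v - A a v) \<le> e x * norm v" if "x \<in> S" for x v
  proof -
    have "A x v - A a v = (\<Sum>b\<in>Basis. (v \<bullet> b) *\<^sub>R (A x b - A a b))"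
      unfolding linear_basis_expand[OF lin[OF that], of v] linear_basis_expand[OF lin[OF a], of v]
      by (simp add: sum_subtractf scaleR_diff_right)
    also have "norm \<dots> \<le> (\<Sum>b\<in>Basis. norm v * norm (A x b - A a b))"
      by (rule order_trans[OF norm_sum], rule sum_mono) (auto intro!: mult_right_mono Basis_le_norm)
    finally show ?thesis by (simp add: e_def sum_distrib_left mult.commute)
  qed
  have ev: "\<forall>\<^sub>F x in at a. x \<in> S \<and> e x < m / 2"
    using eventually_at_in_open'[OF S a] order_tendstoD(2)[OF e0, of "m/2"] m by (auto elim: eventually_elim2)
  have key: "norm (w x - w a) \<le> (norm (c x - c a) + e x * (2 / m * norm (c x))) / m" if "x \<in> S \<and> e x < m / 2" for x
  proof -
    have x: "x \<in> S" "e x < m / 2" using that by auto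
    have e0: "e x \<ge> 0" by (simp add: e_def sum_nonneg)
    have "m * norm (w x) \<le> norm (A a (w x))" by (rule m)
    also have "\<dots> \<le> norm (c x) + norm (A x (w x) - A a (w x))"
      using w[OF x(1)] by (metis norm_triangle_sub add.commute norm_minus_commute)
    also have "\<dots> \<le> norm (c x) + m / 2 * norm (w x)"
      using eb[OF x(1), of "w x"] x(2) mult_right_mono[of "e x" "m/2" "norm (w x)"] by auto
    finally have wb: "norm (w x) \<le> 2 / m * norm (c x)" using m by (simp add: field_simps)
    have "m * norm (w x - w a) \<le> norm (A a (w x - w a))" by (rule m)
    also have "A a (w x - w a) = (c x - c a) - (A x (w x) - A a (w x))"
      using w x a by (simp add: linear_diff[OF lin[OF a]])
    also have "norm \<dots> \<le> norm (c x - c a) + e x * norm (w x)"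
      by (rule order_trans[OF norm_triangle_ineq4]) (use eb[OF x(1)] in auto)
    also have "\<dots> \<le> norm (c x - c a) + e x * (2 / m * norm (c x))"
      by (intro add_left_mono mult_left_mono wb e0)
    finally show ?thesis using m by (simp add: field_simps)
  qed
  have "((\<lambda>x. w x - w a) \<longlongrightarrow> 0) (at a)"
  proof (rule Lim_null_comparison)
    show "\<forall>\<^sub>F x in at a. norm (w x - w a) \<le> (norm (c x - c a) + e x * (2 / m * norm (c x))) / m"
      using ev by (rule eventually_mono) (rule key)
    have "((\<lambda>x. (norm (c x - c a) + e x * (2 / m * norm (c x))) / m) \<longlongrightarrow> (norm (c a - c a) + 0 * (2 / m * norm (c a))) / m) (at a)"
      using m(1) cc unfolding isCont_def by (intro tendsto_intros e0) auto
    then show "((\<lambda>x. (norm (c x - c a) + e x * (2 / m * norm (c x))) / m) \<longlongrightarrow> 0) (at a)" by simp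
  qed
  then show "isCont w a" by (simp add: isCont_def LIM_zero_iff)
qed

text \<open>
  The derivative of a solution solves \<open>A x (w' x) = c' x - (A' x) (w x)\<close>, which has the same
  coefficients and a right-hand side with one derivative less than \<open>c\<close>: this drives the induction.
\<close>

lemma Ck_on_linear_solve:
  fixes A :: "'x::euclidean_space \<Rightarrow> 'a::euclidean_space \<Rightarrow> 'b::euclidean_space"
  assumes S: "open S" and lin: "\<And>x. x \<in> S \<Longrightarrow> linear (A x)" and inj: "\<And>x. x \<in> S \<Longrightarrow> inj (A x)"
    and dim: "DIM('a) = DIM('b)"
  shows "(\<And>v. Ck_on k S (\<lambda>x. A x v)) \<Longrightarrow> Ck_on k S c \<Longrightarrow> (\<And>x. x \<in> S \<Longrightarrow> A x (w x) = c x) \<Longrightarrow> Ck_on k S w"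
proof (induction k arbitrary: c w)
  case 0
  then show ?case using linear_solve_continuous[OF S lin inj] by simp
next
  case (Suc k)
  define B where "B x = inv (A x)" for x
  have B: "linear (B x)" "B x (A x v) = v" "A x (B x u) = u" if "x \<in> S" for x u v
  proof -
    have s: "surj (A x)" using linear_injective_imp_surjective[OF lin inj] that dim by auto
    then have AB: "B x (A x v) = v" "A x (B x u) = u" for u v
      using inj[OF that] unfolding B_def by (auto simp: surj_f_inv_f)
    then show "B x (A x v) = v" "A x (B x u) = u" by auto
    show "linear (B x)"
      by (rule linearI; rule injD[OF inj[OF that]])
         (simp_all add: AB linear_add[OF lin[OF that]] linear_scale[OF lin[OF that]])
  qed
  have wk: "Ck_on k S w" by (rule Suc.IH[of c w]) (use Suc.prems Ck_on_less in blast)+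
  have wc: "continuous_on S w"
    by (rule linear_solve_continuous[OF S lin inj _ _ Suc.prems(3)])
       (use Suc.prems Ck_on_less in \<open>auto intro!: differentiable_imp_continuous_on simp: differentiable_on_def differentiable_at_withinI\<close>)
  define r where "r x v = frechet_derivative c (at x) v - (\<Sum>b\<in>Basis. (w x \<bullet> b) *\<^sub>R frechet_derivative (\<lambda>x. A x b) (at x) v)" for x v
  show ?case
  proof (rule Ck_on_SucI[where f' = "\<lambda>x v. B x (r x v)"])
    fix a assume a: "a \<in> S"
    have wa: "isCont (\<lambda>x. w x \<bullet> b) a" for b using wc a S by (auto simp: continuous_on_eq_continuous_at intro: continuous_intros)
    have d: "((\<lambda>x. c x - (\<Sum>b\<in>Basis. (w x \<bullet> b) *\<^sub>R (A x b - A a b))) has_derivative r a) (at a)"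
      unfolding r_def
      by (intro has_derivative_diff has_derivative_sum has_derivative_scaleR_at_zero wa
          Ck_on_SucD[OF Suc.prems(2) a] has_derivative_eq_rhs[OF has_derivative_diff[OF Ck_on_SucD[OF Suc.prems(1) a] has_derivative_const]]) auto
    have "((\<lambda>x. B a (c x - (\<Sum>b\<in>Basis. (w x \<bullet> b) *\<^sub>R (A x b - A a b)))) has_derivative (\<lambda>v. B a (r a v))) (at a)"
      using bounded_linear.has_derivative[OF _ d] B(1)[OF a] by (simp add: linear_conv_bounded_linear)
    moreover have "B a (c x - (\<Sum>b\<in>Basis. (w x \<bullet> b) *\<^sub>R (A x b - A a b))) = w x" if "x \<in> S" for x
    proof -
      have "(\<Sum>b\<in>Basis. (w x \<bullet> b) *\<^sub>R (A x b - A a b)) = A x (w x) - A a (w x)"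
        unfolding linear_basis_expand[OF lin[OF that], of "w x"] linear_basis_expand[OF lin[OF a], of "w x"]
        by (simp add: sum_subtractf scaleR_diff_right)
      then show ?thesis using Suc.prems(3)[OF that] B(2)[OF a] by simp
    qed
    ultimately show "(w has_derivative (\<lambda>v. B a (r a v))) (at a)"
      using has_derivative_transform_within_open[OF _ S a] by blast
  next
    fix v
    show "Ck_on k S (\<lambda>x. B x (r x v))"
    proof (rule Suc.IH)
      show "Ck_on k S (\<lambda>x. r x v)"
      proof (rule Ck_on_cong_imp[OF S])
        show "Ck_on k S (\<lambda>x. frechet_derivative c (at x) v + (-1) *\<^sub>R (\<Sum>b\<in>Basis. (w x \<bullet> b) *\<^sub>R frechet_derivative (\<lambda>x. A x b) (at x) v))"
          using Suc.prems wk
          by (intro Ck_on_add Ck_on_sum Ck_on_bilinear[OF bounded_bilinear_scaleR] Ck_on_bilinear[OF bounded_bilinear_inner] Ck_on_const S) auto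
      qed (simp add: r_def)
    qed (use Suc.prems Ck_on_less B in blast)+
  qed (use S in auto)
qed

subsection \<open>Symmetry of second derivatives\<close>

text \<open>
  The second difference \<open>f (x + su + sv) - f (x + su) - f (x + sv) + f x\<close> is \<open>s\<^sup>2\<close> times a value of the
  mixed derivative near \<open>x\<close>, by two applications of the mean value theorem.
\<close>

lemma second_difference_mean_value:
  fixes f :: "'a::euclidean_space \<Rightarrow> real"
  assumes S: "ball x r \<subseteq> S" and f: "Ck_on (Suc (Suc 0)) S f" and s: "0 < s" "s * (norm u + norm v) < r"
  shows "\<exists>y. norm (y - x) \<le> s * (norm u + norm v) \<and>
     f (x + s *\<^sub>R u + s *\<^sub>R v) - f (x + s *\<^sub>R u) - f (x + s *\<^sub>R v) + f x =
       s\<^sup>2 * frechet_derivative (\<lambda>z. frechet_derivative f (at z) u) (at y) v"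
proof -
  define D where "D z = frechet_derivative f (at z) u" for z
  have nb: "norm (a *\<^sub>R u + b *\<^sub>R v) \<le> s * (norm u + norm v)" if "0 \<le> a" "a \<le> s" "0 \<le> b" "b \<le> s" for a b
  proof -
    have "norm (a *\<^sub>R u + b *\<^sub>R v) \<le> a * norm u + b * norm v"
      using norm_triangle_ineq[of "a *\<^sub>R u" "b *\<^sub>R v"] that by simp
    also have "\<dots> \<le> s * norm u + s * norm v" using that by (intro add_mono mult_right_mono) auto
    finally show ?thesis by (simp add: algebra_simps)
  qed
  have inS: "x + (a *\<^sub>R u + b *\<^sub>R v) \<in> S" if "0 \<le> a" "a \<le> s" "0 \<le> b" "b \<le> s" for a b
  proof -
    have "dist x (x + z) = norm z" for z by (metis add_diff_cancel_left' dist_commute dist_norm)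
    then show ?thesis using nb[OF that] s by (intro subsetD[OF S]) simp
  qed
  have lin: "linear (frechet_derivative f (at z))" if "z \<in> S" for z
    using f that by (intro linear_frechet_derivative) auto
  have lin2: "linear (frechet_derivative D (at z))" if "z \<in> S" for z
    using f that unfolding D_def by (intro linear_frechet_derivative) auto
  define \<phi> where "\<phi> t = f (x + (t *\<^sub>R u + s *\<^sub>R v)) - f (x + (t *\<^sub>R u + 0 *\<^sub>R v))" for t
  have d1: "((\<lambda>t. f (x + (t *\<^sub>R u + b *\<^sub>R v))) has_real_derivative D (x + (t *\<^sub>R u + b *\<^sub>R v))) (at t)"
    if "0 \<le> t" "t \<le> s" "0 \<le> b" "b \<le> s" for t b
  proof -
    have i: "((\<lambda>t. x + (t *\<^sub>R u + b *\<^sub>R v)) has_derivative (\<lambda>h. h *\<^sub>R u)) (at t)"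
      by (auto intro!: derivative_eq_intros)
    have "((\<lambda>t. f (x + (t *\<^sub>R u + b *\<^sub>R v))) has_derivative (\<lambda>h. frechet_derivative f (at (x + (t *\<^sub>R u + b *\<^sub>R v))) (h *\<^sub>R u))) (at t)"
      using has_derivative_compose[OF i Ck_on_SucD[OF f inS[OF that]]] .
    then show ?thesis
      by (simp add: has_field_derivative_def D_def linear_scale[OF lin[OF inS[OF that]]] mult_commute_abs)
  qed
  have d2: "((\<lambda>b. D (x + (t *\<^sub>R u + b *\<^sub>R v))) has_real_derivative frechet_derivative D (at (x + (t *\<^sub>R u + b *\<^sub>R v))) v) (at b)"
    if "0 \<le> t" "t \<le> s" "0 \<le> b" "b \<le> s" for t b
  proof -
    have i: "((\<lambda>b. x + (t *\<^sub>R u + b *\<^sub>R v)) has_derivative (\<lambda>h. h *\<^sub>R v)) (at b)"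
      by (auto intro!: derivative_eq_intros)
    have "Ck_on (Suc 0) S D" using f unfolding D_def by simp
    then have "((\<lambda>b. D (x + (t *\<^sub>R u + b *\<^sub>R v))) has_derivative (\<lambda>h. frechet_derivative D (at (x + (t *\<^sub>R u + b *\<^sub>R v))) (h *\<^sub>R v))) (at b)"
      using has_derivative_compose[OF i Ck_on_SucD[OF _ inS[OF that]]] by blast
    then show ?thesis
      by (simp add: has_field_derivative_def linear_scale[OF lin2[OF inS[OF that]]] mult_commute_abs)
  qed
  have "\<exists>t. 0 < t \<and> t < s \<and> \<phi> s - \<phi> 0 = (s - 0) * (D (x + (t *\<^sub>R u + s *\<^sub>R v)) - D (x + (t *\<^sub>R u + 0 *\<^sub>R v)))"
    unfolding \<phi>_def by (rule MVT2[OF s(1)]) (intro DERIV_diff d1, use s in auto)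
  then obtain t where t: "0 < t" "t < s" and e1: "\<phi> s - \<phi> 0 = s * (D (x + (t *\<^sub>R u + s *\<^sub>R v)) - D (x + (t *\<^sub>R u + 0 *\<^sub>R v)))"
    by auto
  have "\<exists>b. 0 < b \<and> b < s \<and> D (x + (t *\<^sub>R u + s *\<^sub>R v)) - D (x + (t *\<^sub>R u + 0 *\<^sub>R v)) = (s - 0) * frechet_derivative D (at (x + (t *\<^sub>R u + b *\<^sub>R v))) v"
    by (rule MVT2[OF s(1)]) (intro d2, use t in auto)
  then obtain b where b: "0 < b" "b < s" and e2: "D (x + (t *\<^sub>R u + s *\<^sub>R v)) - D (x + (t *\<^sub>R u + 0 *\<^sub>R v)) = s * frechet_derivative D (at (x + (t *\<^sub>R u + b *\<^sub>R v))) v"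
    by auto
  have "\<phi> s - \<phi> 0 = s\<^sup>2 * frechet_derivative D (at (x + (t *\<^sub>R u + b *\<^sub>R v))) v"
    using e1 e2 by (simp add: power2_eq_square)
  moreover have "\<phi> s - \<phi> 0 = f (x + s *\<^sub>R u + s *\<^sub>R v) - f (x + s *\<^sub>R u) - f (x + s *\<^sub>R v) + f x"
    by (simp add: \<phi>_def add.assoc)
  ultimately show ?thesis
    using nb[of t b] t b unfolding D_def by (intro exI[of _ "x + (t *\<^sub>R u + b *\<^sub>R v)"]) auto
qed

text \<open>
  The second difference is symmetric in \<open>u\<close> and \<open>v\<close>, and after division by \<open>s\<^sup>2\<close> it is a value of either
  mixed derivative at a point close to \<open>x\<close>; both mixed derivatives are continuous.
\<close>

lemma second_derivative_symmetric_real: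
  fixes f :: "'a::euclidean_space \<Rightarrow> real"
  assumes S: "open S" "x \<in> S" and f: "Ck_on (Suc (Suc 0)) S f"
  shows "frechet_derivative (\<lambda>z. frechet_derivative f (at z) u) (at x) v =
         frechet_derivative (\<lambda>z. frechet_derivative f (at z) v) (at x) u"
proof -
  define F where "F u v z = frechet_derivative (\<lambda>z. frechet_derivative f (at z) u) (at z) v" for u v z
  obtain r where r: "r > 0" "ball x r \<subseteq> S" using S open_contains_ball by blast
  define K where "K = norm u + norm v + 1"
  have K: "K > 0" "norm u + norm v \<le> K" by (auto simp: K_def add_nonneg_pos)
  have cF: "isCont (F u v) x" for u v
    using f S unfolding F_def by (auto simp: continuous_on_eq_continuous_at)
  show ?thesis
  proof (rule ccontr)
    assume ne: "\<not> ?thesis"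
    define e where "e = \<bar>F u v x - F v u x\<bar> / 2"
    have e: "e > 0" using ne by (simp add: e_def F_def)
    obtain d1 where d1: "d1 > 0" "\<And>y. dist y x < d1 \<Longrightarrow> dist (F u v y) (F u v x) < e"
      using cF[of u v] e unfolding continuous_at_eps_delta by blast
    obtain d2 where d2: "d2 > 0" "\<And>y. dist y x < d2 \<Longrightarrow> dist (F v u y) (F v u x) < e"
      using cF[of v u] e unfolding continuous_at_eps_delta by blast
    define s where "s = min r (min d1 d2) / (2 * K)"
    have s0: "s > 0" using r d1 d2 K by (simp add: s_def)
    have "s * (norm u + norm v) \<le> s * K" using K s0 by (intro mult_left_mono) auto
    also have "\<dots> = min r (min d1 d2) / 2" using K by (simp add: s_def)
    finally have sK: "s * (norm u + norm v) < r" "s * (norm u + norm v) < d1" "s * (norm u + norm v) < d2"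
      using r d1 d2 by linarith+
    obtain y where y: "norm (y - x) \<le> s * (norm u + norm v)"
      "f (x + s *\<^sub>R u + s *\<^sub>R v) - f (x + s *\<^sub>R u) - f (x + s *\<^sub>R v) + f x = s\<^sup>2 * F u v y"
      using second_difference_mean_value[OF r(2) f s0 sK(1)] unfolding F_def by blast
    have sK': "s * (norm v + norm u) < r" using sK by (simp add: add.commute)
    obtain y' where y': "norm (y' - x) \<le> s * (norm v + norm u)"
      "f (x + s *\<^sub>R v + s *\<^sub>R u) - f (x + s *\<^sub>R v) - f (x + s *\<^sub>R u) + f x = s\<^sup>2 * F v u y'"
      using second_difference_mean_value[OF r(2) f s0 sK'] unfolding F_def by blast
    have "s\<^sup>2 * F u v y = s\<^sup>2 * F v u y'"
      using y(2) y'(2) by (simp add: algebra_simps)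
    then have eq: "F u v y = F v u y'" using s0 by simp
    have "dist (F u v y) (F u v x) < e" using d1(2)[of y] y(1) sK by (simp add: dist_norm)
    moreover have "dist (F v u y') (F v u x) < e" using d2(2)[of y'] y'(1) sK by (simp add: dist_norm add.commute)
    ultimately show False unfolding eq e_def dist_real_def by (simp add: abs_if split: if_splits)
  qed
qed

lemma frechet_derivative_inner_left:
  "f differentiable (at x) \<Longrightarrow> frechet_derivative (\<lambda>z. f z \<bullet> b) (at x) = (\<lambda>v. frechet_derivative f (at x) v \<bullet> b)"
  by (rule frechet_derivative_at[symmetric])
     (auto intro!: derivative_eq_intros simp: frechet_derivative_works[symmetric])

subsection \<open>Smooth maps\<close>

lemma smooth_onD:
  assumes "smooth_on S f" "x \<in> S"
  shows "(f has_derivative frechet_derivative f (at x)) (at x)"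
  using assms Ck_on_SucD[of 0 S f] by (simp add: smooth_on_def)

lemma smooth_on_imp_Ck: "smooth_on S f \<Longrightarrow> Ck_on k S f"
  by (simp add: smooth_on_def)

lemma smooth_on_continuous: "smooth_on S f \<Longrightarrow> continuous_on S f"
  using smooth_on_imp_Ck[of S f 0] by simp

lemma smooth_on_cong: "open S \<Longrightarrow> (\<And>x. x \<in> S \<Longrightarrow> f x = g x) \<Longrightarrow> smooth_on S f \<Longrightarrow> smooth_on S g"
  unfolding smooth_on_def using Ck_on_cong_imp by metis

lemma smooth_on_mono: "smooth_on S f \<Longrightarrow> T \<subseteq> S \<Longrightarrow> smooth_on T f"
  unfolding smooth_on_def using Ck_on_mono by metis

lemma smooth_on_local: "(\<And>x. x \<in> S \<Longrightarrow> \<exists>T. open T \<and> x \<in> T \<and> smooth_on T f) \<Longrightarrow> smooth_on S f"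
  unfolding smooth_on_def by (intro allI Ck_on_local) blast

lemma smooth_on_const: "smooth_on S (\<lambda>x. c)"
  by (simp add: smooth_on_def Ck_on_const)

lemma smooth_on_bounded_linear: "bounded_linear L \<Longrightarrow> open S \<Longrightarrow> smooth_on S f \<Longrightarrow> smooth_on S (\<lambda>x. L (f x))"
  by (simp add: smooth_on_def Ck_on_bounded_linear)

lemma Ck_on_ident: "Ck_on k S (\<lambda>x. x)"
  by (cases k) (auto simp: Ck_on_const)

lemma smooth_on_ident: "smooth_on S (\<lambda>x. x)"
  by (simp add: smooth_on_def Ck_on_ident)

lemma smooth_on_add: "open S \<Longrightarrow> smooth_on S f \<Longrightarrow> smooth_on S g \<Longrightarrow> smooth_on S (\<lambda>x. f x + g x)"
  by (simp add: smooth_on_def Ck_on_add)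

lemma smooth_on_bilinear:
  "bounded_bilinear L \<Longrightarrow> open S \<Longrightarrow> smooth_on S f \<Longrightarrow> smooth_on S g \<Longrightarrow> smooth_on S (\<lambda>x. L (f x) (g x))"
  by (simp add: smooth_on_def Ck_on_bilinear)

lemma smooth_on_compose:
  "open S \<Longrightarrow> open T \<Longrightarrow> smooth_on S f \<Longrightarrow> smooth_on T g \<Longrightarrow> f ` S \<subseteq> T \<Longrightarrow> smooth_on S (\<lambda>x. g (f x))"
  by (simp add: smooth_on_def Ck_on_compose)

lemma smooth_on_inverse:
  fixes f :: "'a::euclidean_space \<Rightarrow> real"
  shows "open S \<Longrightarrow> (\<And>x. x \<in> S \<Longrightarrow> f x \<noteq> 0) \<Longrightarrow> smooth_on S f \<Longrightarrow> smooth_on S (\<lambda>x. inverse (f x))"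
  by (simp add: smooth_on_def Ck_on_inverse)

lemma smooth_on_exp:
  fixes f :: "'a::euclidean_space \<Rightarrow> real"
  shows "open S \<Longrightarrow> smooth_on S f \<Longrightarrow> smooth_on S (\<lambda>x. exp (f x))"
  by (simp add: smooth_on_def Ck_on_exp)

lemma smooth_on_linear_solve:
  fixes A :: "'x::euclidean_space \<Rightarrow> 'a::euclidean_space \<Rightarrow> 'b::euclidean_space"
  assumes "open S" "\<And>x. x \<in> S \<Longrightarrow> linear (A x)" "\<And>x. x \<in> S \<Longrightarrow> inj (A x)" "DIM('a) = DIM('b)"
    "\<And>v. smooth_on S (\<lambda>x. A x v)" "smooth_on S c" "\<And>x. x \<in> S \<Longrightarrow> A x (w x) = c x"
  shows "smooth_on S w"
  unfolding smooth_on_def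
  by (rule allI, rule Ck_on_linear_solve[where A = A and c = c]) (use assms in \<open>auto simp: smooth_on_def\<close>)

lemma smooth_on_derivative_const: "smooth_on S f \<Longrightarrow> smooth_on S (\<lambda>x. frechet_derivative f (at x) v)"
  unfolding smooth_on_def using Ck_on.simps(2) by blast

lemma smooth_on_sum:
  "open S \<Longrightarrow> (\<And>i. i \<in> I \<Longrightarrow> smooth_on S (f i)) \<Longrightarrow> smooth_on S (\<lambda>x. \<Sum>i\<in>I. f i x)"
  by (simp add: smooth_on_def Ck_on_sum)

lemma linear_frechet_smooth: "smooth_on S f \<Longrightarrow> x \<in> S \<Longrightarrow> linear (frechet_derivative f (at x))"
  using smooth_onD has_derivative_linear by blast

lemma smooth_on_derivative:
  assumes S: "open S" and "smooth_on S f" "smooth_on S g"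
  shows "smooth_on S (\<lambda>x. frechet_derivative f (at x) (g x))"
proof (rule smooth_on_cong[OF S])
  show "smooth_on S (\<lambda>x. \<Sum>b\<in>Basis. (g x \<bullet> b) *\<^sub>R frechet_derivative f (at x) b)"
    by (intro smooth_on_sum smooth_on_bilinear[OF bounded_bilinear_scaleR] smooth_on_bilinear[OF bounded_bilinear_inner]
        smooth_on_const smooth_on_derivative_const assms)
qed (use linear_basis_expand[OF linear_frechet_smooth] assms in metis)

lemma second_derivative_symmetric:
  fixes f :: "'a::euclidean_space \<Rightarrow> 'b::euclidean_space"
  assumes S: "open S" "x \<in> S" and f: "smooth_on S f"
  shows "frechet_derivative (\<lambda>z. frechet_derivative f (at z) u) (at x) v =
         frechet_derivative (\<lambda>z. frechet_derivative f (at z) v) (at x) u"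
proof (rule euclidean_eqI)
  fix b :: 'b assume "b \<in> Basis"
  have df: "f differentiable at z" if "z \<in> S" for z
    using smooth_onD[OF f that] by (auto simp: differentiable_def)
  have df': "(\<lambda>z. frechet_derivative f (at z) u) differentiable at z" if "z \<in> S" for z u
    using smooth_onD[OF smooth_on_derivative_const[OF f] that] by (auto simp: differentiable_def)
  have *: "frechet_derivative (\<lambda>z. frechet_derivative (\<lambda>z. f z \<bullet> b) (at z) u) (at x) v =
     frechet_derivative (\<lambda>z. frechet_derivative f (at z) u) (at x) v \<bullet> b" for u v
  proof -
    have "frechet_derivative (\<lambda>z. frechet_derivative (\<lambda>z. f z \<bullet> b) (at z) u) (at x) =
      frechet_derivative (\<lambda>z. frechet_derivative f (at z) u \<bullet> b) (at x)"
    proof (rule frechet_derivative_transform_within_open[symmetric, OF _ S])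
      show "(\<lambda>z. frechet_derivative f (at z) u \<bullet> b) differentiable at x"
        using df'[OF S(2)] by simp
      show "frechet_derivative f (at z) u \<bullet> b = frechet_derivative (\<lambda>z. f z \<bullet> b) (at z) u" if "z \<in> S" for z
        by (simp add: frechet_derivative_inner_left[OF df[OF that]])
    qed
    then show ?thesis by (simp add: frechet_derivative_inner_left[OF df'[OF S(2)]])
  qed
  have "smooth_on S (\<lambda>z. f z \<bullet> b)"
    by (intro smooth_on_bilinear[OF bounded_bilinear_inner] smooth_on_const S f)
  from second_derivative_symmetric_real[OF S smooth_on_imp_Ck[OF this]] *
  show "frechet_derivative (\<lambda>z. frechet_derivative f (at z) u) (at x) v \<bullet> b =
         frechet_derivative (\<lambda>z. frechet_derivative f (at z) v) (at x) u \<bullet> b" by metis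
qed

subsection \<open>Smooth bump functions\<close>

text \<open>
  The functions \<open>exp (-1/t) / t\<^sup>m\<close>, extended by \<open>0\<close> to \<open>t \<le> 0\<close>. The derivative of each is a linear
  combination of two others, so that all of them are smooth by one induction.
\<close>

definition flat_fun :: "nat \<Rightarrow> real \<Rightarrow> real" where
  "flat_fun m t = (if t > 0 then exp (- inverse t) * inverse t ^ m else 0)"

lemma flat_fun_deriv:
  "(flat_fun m has_real_derivative (flat_fun (m + 2) t - real m * flat_fun (Suc m) t)) (at t)"
proof -
  consider "t > 0" | "t < 0" | "t = 0" by linarith
  then show ?thesis
  proof cases
    case 1
    have "((\<lambda>t. exp (- inverse t) * inverse t ^ m) has_real_derivative
       flat_fun (m + 2) t - real m * flat_fun (Suc m) t) (at t)"
    proof (cases m)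
      case (Suc j)
      have i: "(inverse has_real_derivative - (inverse t ^ Suc (Suc 0))) (at t)"
        using 1 DERIV_inverse[of t UNIV] by simp
      have "((\<lambda>t. inverse t ^ Suc j) has_real_derivative real (Suc j) * (- (inverse t ^ Suc (Suc 0)) * inverse t ^ j)) (at t)"
        using DERIV_power_Suc[OF i, of j] by (simp add: algebra_simps)
      from DERIV_mult[OF DERIV_chain2[OF DERIV_exp DERIV_minus[OF i]] this] show ?thesis
        using 1 Suc by (simp add: flat_fun_def algebra_simps)
    qed (use 1 in \<open>auto intro!: derivative_eq_intros simp: flat_fun_def power2_eq_square\<close>)
    then show ?thesis
      by (rule has_field_derivative_transform_within_open[of _ _ _ "{0<..}"]) (use 1 in \<open>auto simp: flat_fun_def\<close>)
  next
    case 2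
    have "((\<lambda>t. 0) has_real_derivative 0) (at t)" by simp
    then have "(flat_fun m has_real_derivative 0) (at t)"
      by (rule has_field_derivative_transform_within_open[of _ _ _ "{..<0}"]) (use 2 in \<open>auto simp: flat_fun_def\<close>)
    then show ?thesis using 2 by (simp add: flat_fun_def)
  next
    case 3
    have "((\<lambda>h. (flat_fun m (0 + h) - flat_fun m 0) / h) \<longlongrightarrow> 0) (at 0)"
    proof (rule filterlim_split_at)
      show "((\<lambda>h. (flat_fun m (0 + h) - flat_fun m 0) / h) \<longlongrightarrow> 0) (at_left 0)"
        by (rule Lim_transform_eventually[OF tendsto_const])
           (auto simp: flat_fun_def eventually_at_filter)
      have "((\<lambda>h. exp (- inverse h) * inverse h ^ m / h) \<longlongrightarrow> 0) (at_right (0::real))"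
        by real_asymp
      then show "((\<lambda>h. (flat_fun m (0 + h) - flat_fun m 0) / h) \<longlongrightarrow> 0) (at_right 0)"
        by (rule Lim_transform_eventually)
           (auto simp: flat_fun_def eventually_at_filter)
    qed
    then show ?thesis using 3 by (simp add: DERIV_def flat_fun_def)
  qed
qed

lemma smooth_on_flat_fun: "smooth_on UNIV (flat_fun m)"
proof -
  have "Ck_on k UNIV (flat_fun m)" for k
  proof (induction k arbitrary: m)
    case 0
    then show ?case
      using DERIV_isCont[OF flat_fun_deriv] by (auto intro!: continuous_at_imp_continuous_on)
  next
    case (Suc k)
    show ?case
    proof (rule Ck_on_SucI)
      show "(flat_fun m has_derivative (\<lambda>v. (flat_fun (m + 2) t + (- real m) * flat_fun (Suc m) t) * v)) (at t)" for t
        using flat_fun_deriv[of m t] by (simp add: has_field_derivative_def)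
      show "Ck_on k UNIV (\<lambda>t. (flat_fun (m + 2) t + (- real m) * flat_fun (Suc m) t) * v)" for v
        by (intro Ck_on_bilinear[OF bounded_bilinear_mult] Ck_on_add Suc Ck_on_const) auto
    qed auto
  qed
  then show ?thesis by (simp add: smooth_on_def)
qed

lemma smooth_step:
  obtains g :: "real \<Rightarrow> real" where "smooth_on UNIV g" "\<And>t. t \<le> 1 \<Longrightarrow> g t = 1" "\<And>t. t \<ge> 2 \<Longrightarrow> g t = 0"
proof -
  let ?a = "\<lambda>t. flat_fun 0 (2 + (-1) * t)" and ?b = "\<lambda>t. flat_fun 0 (t + (-1))"
  have pos: "?a t + ?b t > 0" for t
    by (cases "t < 2") (auto simp: flat_fun_def add_pos_nonneg)
  have "smooth_on UNIV ?a" "smooth_on UNIV ?b"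
    by (rule smooth_on_compose[OF _ _ _ smooth_on_flat_fun];
        (intro smooth_on_add smooth_on_const smooth_on_ident smooth_on_bilinear[OF bounded_bilinear_mult])?; simp)+
  then have "smooth_on UNIV (\<lambda>t. ?a t * inverse (?a t + ?b t))"
    using pos by (intro smooth_on_bilinear[OF bounded_bilinear_mult] smooth_on_inverse smooth_on_add) (auto simp: less_imp_neq[THEN not_sym])
  moreover have "?a t * inverse (?a t + ?b t) = 1" if "t \<le> 1" for t
    using that pos[of t] by (simp add: flat_fun_def)
  moreover have "?a t * inverse (?a t + ?b t) = 0" if "t \<ge> 2" for t
    using that by (simp add: flat_fun_def)
  ultimately show ?thesis using that by blast
qed

lemma smooth_bump_ball:
  fixes c :: "'a::euclidean_space"
  assumes "r > 0"
  obtains g :: "'a \<Rightarrow> real" where "smooth_on UNIV g" "\<And>y. dist y c \<le> r \<Longrightarrow> g y = 1" "\<And>y. dist y c \<ge> 2 * r \<Longrightarrow> g y = 0"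
proof -
  obtain h where h: "smooth_on UNIV h" "\<And>t. t \<le> 1 \<Longrightarrow> h t = 1" "\<And>t. t \<ge> 2 \<Longrightarrow> h (t::real) = (0::real)"
    using smooth_step by blast
  let ?q = "\<lambda>y. inverse (r\<^sup>2) * ((y + (- c)) \<bullet> (y + (- c)))"
  have "smooth_on UNIV ?q"
    by (intro smooth_on_bilinear[OF bounded_bilinear_mult] smooth_on_bilinear[OF bounded_bilinear_inner]
          smooth_on_add smooth_on_ident smooth_on_const open_UNIV)
  then have "smooth_on UNIV (\<lambda>y. h (?q y))"
    by (rule smooth_on_compose[OF _ _ _ h(1), rotated 2]) auto
  moreover have q: "?q y = (dist y c / r)\<^sup>2" for y
    by (simp add: dist_norm power_divide power2_norm_eq_inner field_simps)
  moreover have "h (?q y) = 1" if "dist y c \<le> r" for y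
    using that assms unfolding q by (intro h(2)) (simp add: power_le_one)
  moreover have "h (?q y) = 0" if "dist y c \<ge> 2 * r" for y
  proof -
    have "2 \<le> dist y c / r" using that assms by (simp add: field_simps)
    then have "2 \<le> (dist y c / r)\<^sup>2" using power_mono[of 2 "dist y c / r" 2] by simp
    then show ?thesis unfolding q by (rule h(3))
  qed
  ultimately show ?thesis using that by blast
qed

section \<open>Differential calculus on a manifold\<close>

lemma frechet_derivative_cong_open:
  assumes "open W" "z \<in> W" "\<And>y. y \<in> W \<Longrightarrow> f y = g y"
  shows "frechet_derivative f (at z) = frechet_derivative g (at z)"
proof -
  have "(f has_derivative f') (at z) \<longleftrightarrow> (g has_derivative f') (at z)" for f'
    using has_derivative_transform_within_open[OF _ assms(1,2)] assms(3) by metis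
  then show ?thesis by (simp add: frechet_derivative_def)
qed

text \<open>
  The product rule, \<open>F'(z)(Y z)\<close> being bilinear in \<open>F'\<close> and \<open>Y\<close>. In the commutator of two such derivatives
  the last summand cancels, as it is symmetric in \<open>u\<close> and \<open>Y z\<close>.
\<close>

lemma frechet_derivative_along:
  assumes S: "open S" "z \<in> S" and F: "smooth_on S F" and Y: "smooth_on S Y"
  shows "frechet_derivative (\<lambda>z. frechet_derivative F (at z) (Y z)) (at z) u =
    frechet_derivative F (at z) (frechet_derivative Y (at z) u)
    + frechet_derivative (\<lambda>z'. frechet_derivative F (at z') (Y z)) (at z) u"
proof -
  note lin = linear_frechet_smooth[OF F]
  have d: "((\<lambda>z. frechet_derivative F (at z) b) has_derivative frechet_derivative (\<lambda>z. frechet_derivative F (at z) b) (at z)) (at z)" for b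
    by (rule smooth_onD[OF smooth_on_derivative_const[OF F] S(2)])
  have 1: "((\<lambda>z'. \<Sum>b\<in>Basis. (Y z' \<bullet> b) *\<^sub>R frechet_derivative F (at z') b) has_derivative
     (\<lambda>u. \<Sum>b\<in>Basis. (Y z \<bullet> b) *\<^sub>R frechet_derivative (\<lambda>z. frechet_derivative F (at z) b) (at z) u
         + (frechet_derivative Y (at z) u \<bullet> b) *\<^sub>R frechet_derivative F (at z) b)) (at z)"
    by (intro has_derivative_sum has_derivative_scaleR d has_derivative_inner_left smooth_onD[OF Y S(2)])
  have 2: "((\<lambda>z'. \<Sum>b\<in>Basis. (Y z \<bullet> b) *\<^sub>R frechet_derivative F (at z') b) has_derivative
     (\<lambda>u. \<Sum>b\<in>Basis. (Y z \<bullet> b) *\<^sub>R frechet_derivative (\<lambda>z. frechet_derivative F (at z) b) (at z) u)) (at z)"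
    by (intro has_derivative_sum has_derivative_scaleR_right d)
  have "frechet_derivative (\<lambda>z. frechet_derivative F (at z) (Y z)) (at z) =
     frechet_derivative (\<lambda>z'. \<Sum>b\<in>Basis. (Y z' \<bullet> b) *\<^sub>R frechet_derivative F (at z') b) (at z)"
    using linear_basis_expand[OF lin] by (intro frechet_derivative_cong_open[OF S]) auto
  moreover have "frechet_derivative (\<lambda>z'. frechet_derivative F (at z') (Y z)) (at z) =
     frechet_derivative (\<lambda>z'. \<Sum>b\<in>Basis. (Y z \<bullet> b) *\<^sub>R frechet_derivative F (at z') b) (at z)"
    using linear_basis_expand[OF lin] by (intro frechet_derivative_cong_open[OF S]) auto
  ultimately show ?thesis
    unfolding frechet_derivative_at[OF 1, symmetric] frechet_derivative_at[OF 2, symmetric]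
      linear_basis_expand[OF lin[OF S(2)], of "frechet_derivative Y (at z) u"]
    by (simp add: sum.distrib add.commute)
qed

subsection \<open>Smooth functions with values in a Euclidean space\<close>

text \<open>
  All differential operators below are expressed by two notions: smoothness of a Euclidean-valued
  function on an open set, and its derivative in the direction of a tangent vector. Since charts
  are such functions, changes of coordinates and differentials of maps are directional
  derivatives, and every rule of transformation is an instance of the chain rule.
\<close>

definition smooth_in :: "('m, 'e::euclidean_space) manifold \<Rightarrow> 'm set \<Rightarrow> ('m \<Rightarrow> 'b::euclidean_space) \<Rightarrow> bool" where
  "smooth_in M V f \<longleftrightarrow> (\<forall>a. smooth_on (chart_map M a ` (V \<inter> chart_dom M a)) (f \<circ> chart_inv M a))"

definition dderiv :: "('m, 'e::euclidean_space) manifold \<Rightarrow> ('m \<Rightarrow> 'b::euclidean_space) \<Rightarrow> 'm \<Rightarrow> 'e \<Rightarrow> 'b" where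
  "dderiv M f x = frechet_derivative (f \<circ> chart_inv M x) (at (chart_map M x x))"

definition vf_in :: "('m, 'e::euclidean_space) manifold \<Rightarrow> 'm set \<Rightarrow> ('m \<Rightarrow> 'e) \<Rightarrow> bool" where
  "vf_in M V X \<longleftrightarrow> (\<forall>a. smooth_in M (V \<inter> chart_dom M a) (\<lambda>x. vec_to_chart M a x (X x)))"

lemma vec_to_chart_eq_dderiv: "vec_to_chart M a x = dderiv M (chart_map M a) x"
  by (simp add: vec_to_chart_def dderiv_def)

lemma tmap_eq_dderiv: "tmap M N F x = dderiv M (chart_map N (F x) \<circ> F) x"
  by (simp add: tmap_def dderiv_def comp_assoc)

lemma chart_euclid [simp]:
  "chart_map euclid_mfd a = (\<lambda>y. y)" "chart_dom euclid_mfd a = UNIV" "chart_inv euclid_mfd a = (\<lambda>y. y)"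
  "chart_img euclid_mfd a = UNIV"
  by (auto simp: chart_map_def chart_dom_def chart_inv_def chart_img_def euclid_mfd_def inv_into_def fun_eq_iff)

lemma tmap_euclid: "tmap M euclid_mfd f = dderiv M f"
  by (simp add: fun_eq_iff tmap_eq_dderiv comp_def)

lemma vf_app_eq_dderiv: "vf_app M X f x = dderiv M f x (X x)"
  by (simp add: vf_app_def tmap_euclid)

lemma loc_vf_eq: "loc_vf M a X = (\<lambda>x. vec_to_chart M a x (X x)) \<circ> chart_inv M a"
  by (simp add: loc_vf_def fun_eq_iff)

lemma lie_bracket_eq:
  "lie_bracket M X Y x = dderiv M (\<lambda>y. vec_to_chart M x y (Y y)) x (X x) - dderiv M (\<lambda>y. vec_to_chart M x y (X y)) x (Y x)"
  by (simp add: lie_bracket_def loc_vf_eq dderiv_def)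

lemma lie_bracket_antisym: "lie_bracket M X Y x = - lie_bracket M Y X x"
  by (simp add: lie_bracket_def)

lemma smooth_map_iff:
  "smooth_map M N F \<longleftrightarrow> continuous_on UNIV F \<and> (\<forall>b. smooth_in M (F -` chart_dom N b) (chart_map N b \<circ> F))"
  unfolding smooth_map_def smooth_in_def by (subst all_comm) (simp add: comp_assoc Int_commute)

locale smooth_mfd =
  fixes M :: "('m::{t2_space,second_countable_topology}, 'e::euclidean_space) manifold"
  assumes smooth_mfd: "smooth_manifold M"
begin

lemma dom_mem [simp]: "x \<in> chart_dom M x"
  and dom_open [simp]: "open (chart_dom M a)"
  and img_open [simp]: "open (chart_map M a ` chart_dom M a)"
  and chart_homeo: "homeomorphism (chart_dom M a) (chart_map M a ` chart_dom M a) (chart_map M a) (chart_inv M a)"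
  and chart_change_smooth:
    "smooth_on (chart_map M a ` (chart_dom M a \<inter> chart_dom M b)) (chart_map M b \<circ> chart_inv M a)"
  using smooth_mfd by (auto simp: smooth_manifold_def chart_img_def)

lemma inv_map [simp]: "x \<in> chart_dom M a \<Longrightarrow> chart_inv M a (chart_map M a x) = x"
  using chart_homeo by (simp add: homeomorphism_def)

lemma image_open: "open V \<Longrightarrow> open (chart_map M a ` (V \<inter> chart_dom M a))"
proof -
  assume "open V"
  then have "openin (top_of_set (chart_dom M a)) (V \<inter> chart_dom M a)" by (auto simp: openin_open)
  then have "openin (top_of_set (chart_map M a ` chart_dom M a)) (chart_map M a ` (V \<inter> chart_dom M a))"
    using homeomorphism_imp_open_map[OF chart_homeo] by blast
  then show ?thesis using img_open openin_open_eq by blast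
qed

lemma image_open': "open V \<Longrightarrow> V \<subseteq> chart_dom M a \<Longrightarrow> open (chart_map M a ` V)"
  using image_open[of V a] by (simp add: Int_absorb2)

lemma chart_continuous: "continuous_on (chart_dom M a) (chart_map M a)"
  using chart_homeo homeomorphism_def by blast

lemma chart_inv_continuous: "continuous_on (chart_map M a ` chart_dom M a) (chart_inv M a)"
  using chart_homeo homeomorphism_def by blast

lemma smooth_inD: "smooth_in M V f \<Longrightarrow> V \<subseteq> chart_dom M a \<Longrightarrow> smooth_on (chart_map M a ` V) (f \<circ> chart_inv M a)"
  unfolding smooth_in_def by (metis Int_absorb2)

lemma smooth_in_mono: "smooth_in M V f \<Longrightarrow> W \<subseteq> V \<Longrightarrow> smooth_in M W f"
  unfolding smooth_in_def by (blast intro: smooth_on_mono)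

lemma smooth_in_local:
  assumes "\<And>x. x \<in> V \<Longrightarrow> \<exists>W. open W \<and> x \<in> W \<and> smooth_in M W f"
  shows "smooth_in M V f"
  unfolding smooth_in_def
proof (intro allI smooth_on_local)
  fix a y assume "y \<in> chart_map M a ` (V \<inter> chart_dom M a)"
  then obtain x where x: "x \<in> V" "x \<in> chart_dom M a" "y = chart_map M a x" by blast
  obtain W where W: "open W" "x \<in> W" "smooth_in M W f" using assms[OF x(1)] by blast
  show "\<exists>T. open T \<and> y \<in> T \<and> smooth_on T (f \<circ> chart_inv M a)"
    using W x image_open[OF W(1), of a]
    by (intro exI[of _ "chart_map M a ` (W \<inter> chart_dom M a)"]) (auto simp: smooth_in_def)
qed

lemma smooth_in_chartI:
  assumes V: "open V" "V \<subseteq> chart_dom M a" and f: "smooth_on (chart_map M a ` V) (f \<circ> chart_inv M a)"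
  shows "smooth_in M V f"
  unfolding smooth_in_def
proof
  fix b
  have o: "open (chart_map M b ` (V \<inter> chart_dom M b))" using V image_open by blast
  have "smooth_on (chart_map M b ` (V \<inter> chart_dom M b)) (\<lambda>y. (f \<circ> chart_inv M a) ((chart_map M a \<circ> chart_inv M b) y))"
    by (rule smooth_on_compose[OF o image_open'[OF V] smooth_on_mono[OF chart_change_smooth] f]) (use V in auto)
  then show "smooth_on (chart_map M b ` (V \<inter> chart_dom M b)) (f \<circ> chart_inv M b)"
    by (rule smooth_on_cong[OF o, rotated]) (use V in auto)
qed

lemma smooth_in_cong:
  assumes "open V" "\<And>x. x \<in> V \<Longrightarrow> f x = g x" "smooth_in M V f"
  shows "smooth_in M V g"
  unfolding smooth_in_def
proof
  fix a
  show "smooth_on (chart_map M a ` (V \<inter> chart_dom M a)) (g \<circ> chart_inv M a)"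
    by (rule smooth_on_cong[OF image_open[OF assms(1)], of _ "f \<circ> chart_inv M a"])
       (use assms in \<open>auto simp: smooth_in_def\<close>)
qed

lemma smooth_in_const: "smooth_in M V (\<lambda>x. c)"
  by (simp add: smooth_in_def comp_def smooth_on_const)

lemma smooth_in_add: "open V \<Longrightarrow> smooth_in M V f \<Longrightarrow> smooth_in M V g \<Longrightarrow> smooth_in M V (\<lambda>x. f x + g x)"
  unfolding smooth_in_def comp_def by (intro allI smooth_on_add image_open; simp)

lemma smooth_in_bounded_linear: "bounded_linear L \<Longrightarrow> open V \<Longrightarrow> smooth_in M V f \<Longrightarrow> smooth_in M V (\<lambda>x. L (f x))"
  unfolding smooth_in_def comp_def by (intro allI, rule smooth_on_bounded_linear[where L = L]; simp add: image_open)

lemma smooth_in_bilinear: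
  "bounded_bilinear L \<Longrightarrow> open V \<Longrightarrow> smooth_in M V f \<Longrightarrow> smooth_in M V g \<Longrightarrow> smooth_in M V (\<lambda>x. L (f x) (g x))"
  unfolding smooth_in_def comp_def by (intro allI, rule smooth_on_bilinear[where L = L]; simp add: image_open)

lemma smooth_in_sum: "open V \<Longrightarrow> (\<And>i. i \<in> I \<Longrightarrow> smooth_in M V (f i)) \<Longrightarrow> smooth_in M V (\<lambda>x. \<Sum>i\<in>I. f i x)"
  by (induction I rule: infinite_finite_induct) (auto intro: smooth_in_const smooth_in_add)

lemma smooth_in_minus: "open V \<Longrightarrow> smooth_in M V f \<Longrightarrow> smooth_in M V (\<lambda>x. - f x)"
  by (rule smooth_in_bounded_linear[OF bounded_linear_minus[OF bounded_linear_ident]])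

lemma smooth_in_diff: "open V \<Longrightarrow> smooth_in M V f \<Longrightarrow> smooth_in M V g \<Longrightarrow> smooth_in M V (\<lambda>x. f x - g x)"
  using smooth_in_add[of V f "\<lambda>x. - g x"] smooth_in_minus[of V g] by simp

lemma smooth_in_scaleR: "open V \<Longrightarrow> smooth_in M V f \<Longrightarrow> smooth_in M V g \<Longrightarrow> smooth_in M V (\<lambda>x. f x *\<^sub>R g x)"
  by (rule smooth_in_bilinear[OF bounded_bilinear_scaleR])

lemma smooth_in_inner: "open V \<Longrightarrow> smooth_in M V f \<Longrightarrow> smooth_in M V g \<Longrightarrow> smooth_in M V (\<lambda>x. f x \<bullet> g x)"
  by (rule smooth_in_bilinear[OF bounded_bilinear_inner])

lemma smooth_in_mult:
  fixes f :: "'m \<Rightarrow> real"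
  shows "open V \<Longrightarrow> smooth_in M V f \<Longrightarrow> smooth_in M V g \<Longrightarrow> smooth_in M V (\<lambda>x. f x * g x)"
  by (rule smooth_in_bilinear[OF bounded_bilinear_mult])

lemma smooth_in_exp:
  fixes f :: "'m \<Rightarrow> real"
  shows "open V \<Longrightarrow> smooth_in M V f \<Longrightarrow> smooth_in M V (\<lambda>x. exp (f x))"
  unfolding smooth_in_def comp_def by (intro allI smooth_on_exp image_open; simp)

lemma smooth_in_compose_euclid:
  assumes "open V" "open T" "smooth_in M V f" "smooth_on T g" "f ` V \<subseteq> T"
  shows "smooth_in M V (\<lambda>x. g (f x))"
  unfolding smooth_in_def comp_def
proof
  fix a
  show "smooth_on (chart_map M a ` (V \<inter> chart_dom M a)) (\<lambda>x. g (f (chart_inv M a x)))"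
    by (rule smooth_on_compose[OF image_open[OF assms(1)] assms(2) _ assms(4)])
       (use assms in \<open>auto simp: smooth_in_def comp_def\<close>)
qed

lemma smooth_in_linear_solve:
  fixes A :: "'m \<Rightarrow> 'a::euclidean_space \<Rightarrow> 'b::euclidean_space"
  assumes "open V" "\<And>x. x \<in> V \<Longrightarrow> linear (A x)" "\<And>x. x \<in> V \<Longrightarrow> inj (A x)" "DIM('a) = DIM('b)"
    "\<And>v. smooth_in M V (\<lambda>x. A x v)" "smooth_in M V c" "\<And>x. x \<in> V \<Longrightarrow> A x (w x) = c x"
  shows "smooth_in M V w"
  unfolding smooth_in_def
proof
  fix a
  show "smooth_on (chart_map M a ` (V \<inter> chart_dom M a)) (w \<circ> chart_inv M a)"
    by (rule smooth_on_linear_solve[OF image_open[OF assms(1)], where A = "\<lambda>y. A (chart_inv M a y)" and c = "c \<circ> chart_inv M a"])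
       (use assms in \<open>auto simp: smooth_in_def comp_def\<close>)
qed

lemma smooth_in_chart: "smooth_in M (chart_dom M a) (chart_map M a)"
proof (rule smooth_in_chartI)
  show "smooth_on (chart_map M a ` chart_dom M a) (chart_map M a \<circ> chart_inv M a)"
    using chart_change_smooth[of a a] by simp
qed auto

lemma smooth_in_continuous:
  assumes "open V" "smooth_in M V f"
  shows "continuous_on V f"
proof (rule continuous_at_imp_continuous_on, intro ballI)
  fix x assume x: "x \<in> V"
  define W where "W = V \<inter> chart_dom M x"
  have W: "open W" "x \<in> W" "W \<subseteq> chart_dom M x" using x assms by (auto simp: W_def)
  have "continuous_on W (\<lambda>z. (f \<circ> chart_inv M x) (chart_map M x z))"
    by (rule continuous_on_compose2[OF smooth_on_continuous[OF smooth_inD[OF smooth_in_mono[OF assms(2)] W(3)]]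
          continuous_on_subset[OF chart_continuous W(3)]]) (auto simp: W_def)
  then have "continuous_on W f"
    by (rule continuous_on_eq) (use W in auto)
  then show "isCont f x" using W continuous_on_eq_continuous_at by blast
qed

lemma smooth_fun_iff: "smooth_fun M f \<longleftrightarrow> smooth_in M UNIV f"
  using smooth_in_continuous[of UNIV f] by (auto simp: smooth_map_iff comp_def)

subsection \<open>Directional derivatives\<close>

lemma smooth_in_deriv:
  assumes "open V" "x \<in> V" "smooth_in M V f" "x \<in> chart_dom M a"
  shows "((f \<circ> chart_inv M a) has_derivative frechet_derivative (f \<circ> chart_inv M a) (at (chart_map M a x))) (at (chart_map M a x))"
  using assms by (intro smooth_onD[of "chart_map M a ` (V \<inter> chart_dom M a)"]) (auto simp: smooth_in_def)

lemma has_dderiv: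
  assumes "open V" "x \<in> V" "smooth_in M V f"
  shows "((f \<circ> chart_inv M x) has_derivative dderiv M f x) (at (chart_map M x x))"
  using smooth_in_deriv[OF assms dom_mem] by (simp add: dderiv_def)

lemma has_dderiv':
  assumes "open V" "x \<in> V" "smooth_in M V f"
  shows "((\<lambda>z. f (chart_inv M x z)) has_derivative dderiv M f x) (at (chart_map M x x))"
  using has_dderiv[OF assms] by (simp add: comp_def)

lemma dderivI: "((\<lambda>z. f (chart_inv M x z)) has_derivative f') (at (chart_map M x x)) \<Longrightarrow> dderiv M f x = f'"
  unfolding dderiv_def comp_def using frechet_derivative_at by metis

lemma linear_dderiv: "open V \<Longrightarrow> x \<in> V \<Longrightarrow> smooth_in M V f \<Longrightarrow> linear (dderiv M f x)"
  using has_dderiv has_derivative_linear by blast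

lemma dderiv_cong:
  assumes "open W" "x \<in> W" "\<And>y. y \<in> W \<Longrightarrow> f y = g y"
  shows "dderiv M f x = dderiv M g x"
  unfolding dderiv_def
  by (rule frechet_derivative_cong_open[OF image_open[OF assms(1)], of _ x]) (use assms in auto)

lemma dderiv_const [simp]: "dderiv M (\<lambda>x. c) x u = 0"
  by (simp add: dderiv_def comp_def)

context
  fixes V :: "'m set" and x assumes V: "open V" "x \<in> V"
begin

lemma dderiv_add:
  "smooth_in M V f \<Longrightarrow> smooth_in M V g \<Longrightarrow> dderiv M (\<lambda>y. f y + g y) x u = dderiv M f x u + dderiv M g x u"
  using dderivI[of "\<lambda>y. f y + g y", OF has_derivative_add[OF has_dderiv'[OF V, of f] has_dderiv'[OF V, of g]]] by simp

lemma dderiv_diff: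
  "smooth_in M V f \<Longrightarrow> smooth_in M V g \<Longrightarrow> dderiv M (\<lambda>y. f y - g y) x u = dderiv M f x u - dderiv M g x u"
  using dderivI[of "\<lambda>y. f y - g y", OF has_derivative_diff[OF has_dderiv'[OF V, of f] has_dderiv'[OF V, of g]]] by simp

lemma dderiv_bilinear:
  "bounded_bilinear L \<Longrightarrow> smooth_in M V f \<Longrightarrow> smooth_in M V g \<Longrightarrow>
    dderiv M (\<lambda>y. L (f y) (g y)) x u = L (f x) (dderiv M g x u) + L (dderiv M f x u) (g x)"
  using dderivI[of "\<lambda>y. L (f y) (g y)", OF bounded_bilinear.FDERIV[OF _ has_dderiv'[OF V, of f] has_dderiv'[OF V, of g]]]
  by simp

lemma dderiv_bounded_linear:
  "bounded_linear L \<Longrightarrow> smooth_in M V f \<Longrightarrow> dderiv M (\<lambda>y. L (f y)) x u = L (dderiv M f x u)"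
  using dderivI[of "\<lambda>y. L (f y)", OF bounded_linear.has_derivative[OF _ has_dderiv'[OF V, of f]]] by simp

lemma dderiv_sum:
  "(\<And>i. i \<in> I \<Longrightarrow> smooth_in M V (f i)) \<Longrightarrow> dderiv M (\<lambda>y. \<Sum>i\<in>I. f i y) x u = (\<Sum>i\<in>I. dderiv M (f i) x u)"
  by (induction I rule: infinite_finite_induct) (auto simp: dderiv_add smooth_in_sum[OF V(1)])

lemmas dderiv_scaleR = dderiv_bilinear[OF bounded_bilinear_scaleR]
lemmas dderiv_mult = dderiv_bilinear[OF bounded_bilinear_mult]
lemmas dderiv_inner = dderiv_bilinear[OF bounded_bilinear_inner]
lemmas dderiv_linear_add = linear_add[OF linear_dderiv[OF V]]
lemmas dderiv_linear_scale = linear_scale[OF linear_dderiv[OF V]]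
lemmas dderiv_linear_0 = linear_0[OF linear_dderiv[OF V]]

lemma dderiv_exp:
  fixes f :: "'m \<Rightarrow> real"
  shows "smooth_in M V f \<Longrightarrow> dderiv M (\<lambda>y. exp (f y)) x u = exp (f x) * dderiv M f x u"
  using dderivI[of "\<lambda>y. exp (f y)", OF has_derivative_exp[OF has_dderiv'[OF V, of f]]] by simp

end

lemma linear_vec_to_chart: "x \<in> chart_dom M a \<Longrightarrow> linear (vec_to_chart M a x)"
  unfolding vec_to_chart_eq_dderiv by (rule linear_dderiv[OF dom_open _ smooth_in_chart])

lemma dderiv_in_chart:
  assumes V: "open V" "x \<in> V" and f: "smooth_in M V f" and a: "x \<in> chart_dom M a"
  shows "dderiv M f x u = frechet_derivative (f \<circ> chart_inv M a) (at (chart_map M a x)) (vec_to_chart M a x u)"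
proof -
  have 1: "((chart_map M a \<circ> chart_inv M x) has_derivative vec_to_chart M a x) (at (chart_map M x x))"
    unfolding vec_to_chart_eq_dderiv by (rule has_dderiv[OF dom_open a smooth_in_chart])
  have 2: "((f \<circ> chart_inv M a) has_derivative frechet_derivative (f \<circ> chart_inv M a) (at (chart_map M a x))) (at ((chart_map M a \<circ> chart_inv M x) (chart_map M x x)))"
    using smooth_in_deriv[OF V f a] by simp
  have "((\<lambda>z. (f \<circ> chart_inv M a) ((chart_map M a \<circ> chart_inv M x) z)) has_derivative
      (\<lambda>u. frechet_derivative (f \<circ> chart_inv M a) (at (chart_map M a x)) (vec_to_chart M a x u))) (at (chart_map M x x))"
    using has_derivative_compose[OF 1 2] .
  then have "((f \<circ> chart_inv M x) has_derivative
      (\<lambda>u. frechet_derivative (f \<circ> chart_inv M a) (at (chart_map M a x)) (vec_to_chart M a x u))) (at (chart_map M x x))"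
    by (rule has_derivative_transform_within_open[OF _ image_open[of "chart_dom M a"], of _ _ _ _ x]) (use a in auto)
  then show ?thesis using dderivI[of f x] by (simp add: comp_def)
qed

lemma vec_to_chart_self [simp]: "vec_to_chart M x x u = u"
proof -
  have "((chart_map M x \<circ> chart_inv M x) has_derivative (\<lambda>u. u)) (at (chart_map M x x))"
    by (rule has_derivative_transform_within_open[OF has_derivative_ident img_open[of x]]) auto
  then show ?thesis
    unfolding vec_to_chart_def using frechet_derivative_at[symmetric] by fastforce
qed

lemma vec_of_to_chart [simp]:
  assumes "x \<in> chart_dom M a"
  shows "vec_of_chart M a x (vec_to_chart M a x u) = u"
  using dderiv_in_chart[OF dom_open dom_mem smooth_in_chart assms, of u]
  by (simp add: vec_of_chart_def vec_to_chart_eq_dderiv[symmetric])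

lemma linear_vec_of_chart: "x \<in> chart_dom M a \<Longrightarrow> linear (vec_of_chart M a x)"
  unfolding vec_of_chart_def
  by (rule has_derivative_linear[OF smooth_in_deriv[OF dom_open[of x] dom_mem smooth_in_chart]])

lemma vec_to_of_chart [simp]:
  assumes "x \<in> chart_dom M a"
  shows "vec_to_chart M a x (vec_of_chart M a x v) = v"
proof -
  have "vec_of_chart M a x \<circ> vec_to_chart M a x = id" using assms by (simp add: fun_eq_iff)
  then have "vec_to_chart M a x \<circ> vec_of_chart M a x = id"
    using linear_inverse_left[OF linear_vec_of_chart[OF assms] linear_vec_to_chart[OF assms]] by blast
  then show ?thesis by (simp add: fun_eq_iff)
qed

lemma vec_of_chart_self [simp]: "vec_of_chart M x x u = u"
  using vec_of_to_chart[OF dom_mem, of x u] by simp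

lemma smooth_in_dderiv:
  assumes V: "open V" and f: "smooth_in M V f" and X: "vf_in M V X"
  shows "smooth_in M V (\<lambda>x. dderiv M f x (X x))"
proof (rule smooth_in_local)
  fix x assume x: "x \<in> V"
  define W where "W = V \<inter> chart_dom M x"
  have W: "open W" "x \<in> W" "W \<subseteq> V" "W \<subseteq> chart_dom M x" using V x by (auto simp: W_def)
  have "smooth_in M W (\<lambda>z. frechet_derivative (f \<circ> chart_inv M x) (at (chart_map M x z)) (vec_to_chart M x z (X z)))"
  proof (rule smooth_in_chartI[OF W(1,4)])
    have "smooth_on (chart_map M x ` W) (\<lambda>z. frechet_derivative (f \<circ> chart_inv M x) (at z) (((\<lambda>z. vec_to_chart M x z (X z)) \<circ> chart_inv M x) z))"
      by (intro smooth_on_derivative smooth_inD[OF smooth_in_mono[OF f W(3)] W(4)] smooth_inD[OF _ W(4)] image_open' W)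
         (use X in \<open>auto simp: vf_in_def W_def\<close>)
    then show "smooth_on (chart_map M x ` W) ((\<lambda>z. frechet_derivative (f \<circ> chart_inv M x) (at (chart_map M x z)) (vec_to_chart M x z (X z))) \<circ> chart_inv M x)"
      by (rule smooth_on_cong[OF image_open'[OF W(1,4)], rotated]) (use W in auto)
  qed
  moreover have "frechet_derivative (f \<circ> chart_inv M x) (at (chart_map M x z)) (vec_to_chart M x z (X z)) = dderiv M f z (X z)" if "z \<in> W" for z
    by (rule dderiv_in_chart[OF V _ f, symmetric]) (use that W in auto)
  ultimately have "smooth_in M W (\<lambda>x. dderiv M f x (X x))"
    by (rule smooth_in_cong[OF W(1), rotated])
  then show "\<exists>W. open W \<and> x \<in> W \<and> smooth_in M W (\<lambda>x. dderiv M f x (X x))" using W by blast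
qed

subsection \<open>Smooth vector fields\<close>

lemma vf_in_mono: "vf_in M V X \<Longrightarrow> W \<subseteq> V \<Longrightarrow> vf_in M W X"
  unfolding vf_in_def by (auto intro: smooth_in_mono[of "V \<inter> _"])

lemma vf_in_local:
  assumes "\<And>x. x \<in> V \<Longrightarrow> \<exists>W. open W \<and> x \<in> W \<and> vf_in M W X"
  shows "vf_in M V X"
  unfolding vf_in_def
proof (intro allI smooth_in_local)
  fix a x assume "x \<in> V \<inter> chart_dom M a"
  moreover from this obtain W where "open W" "x \<in> W" "vf_in M W X" using assms by blast
  ultimately show "\<exists>W. open W \<and> x \<in> W \<and> smooth_in M W (\<lambda>x. vec_to_chart M a x (X x))"
    by (intro exI[of _ "W \<inter> chart_dom M a"]) (auto simp: vf_in_def)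
qed

text \<open>
  One chart suffices: the components in another chart are obtained by applying the derivative of the
  change of charts.
\<close>

lemma vf_in_chartI:
  assumes V: "open V" "V \<subseteq> chart_dom M a" and X: "smooth_in M V (\<lambda>x. vec_to_chart M a x (X x))"
  shows "vf_in M V X"
  unfolding vf_in_def
proof
  fix b
  define W where "W = V \<inter> chart_dom M b"
  have W: "open W" "W \<subseteq> V" "W \<subseteq> chart_dom M b" "W \<subseteq> chart_dom M a" using V by (auto simp: W_def)
  have "smooth_in M W (\<lambda>x. frechet_derivative (chart_map M b \<circ> chart_inv M a) (at (chart_map M a x)) (vec_to_chart M a x (X x)))"
  proof (rule smooth_in_chartI[OF W(1,4)])
    have "smooth_on (chart_map M a ` W) (\<lambda>z. frechet_derivative (chart_map M b \<circ> chart_inv M a) (at z) (((\<lambda>x. vec_to_chart M a x (X x)) \<circ> chart_inv M a) z))"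
      by (intro smooth_on_derivative smooth_inD[OF smooth_in_mono[OF smooth_in_chart W(3)] W(4)] smooth_inD[OF smooth_in_mono[OF X W(2)] W(4)] image_open' W)
    then show "smooth_on (chart_map M a ` W) ((\<lambda>x. frechet_derivative (chart_map M b \<circ> chart_inv M a) (at (chart_map M a x)) (vec_to_chart M a x (X x))) \<circ> chart_inv M a)"
      by (rule smooth_on_cong[OF image_open'[OF W(1,4)], rotated]) (use W in auto)
  qed
  moreover have "frechet_derivative (chart_map M b \<circ> chart_inv M a) (at (chart_map M a x)) (vec_to_chart M a x (X x)) = vec_to_chart M b x (X x)"
    if "x \<in> W" for x
    unfolding vec_to_chart_eq_dderiv[of M b x]
    by (rule dderiv_in_chart[OF dom_open _ smooth_in_chart, symmetric]) (use that W in auto)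
  ultimately show "smooth_in M (V \<inter> chart_dom M b) (\<lambda>x. vec_to_chart M b x (X x))"
    unfolding W_def[symmetric] by (rule smooth_in_cong[OF W(1), rotated])
qed

lemma vf_in_cong:
  assumes "open V" "\<And>x. x \<in> V \<Longrightarrow> X x = Y x" "vf_in M V X"
  shows "vf_in M V Y"
  unfolding vf_in_def
proof
  fix a show "smooth_in M (V \<inter> chart_dom M a) (\<lambda>x. vec_to_chart M a x (Y x))"
    by (rule smooth_in_cong[of _ "\<lambda>x. vec_to_chart M a x (X x)"]) (use assms in \<open>auto simp: vf_in_def\<close>)
qed

lemma smooth_vf_iff: "smooth_vf M X \<longleftrightarrow> vf_in M UNIV X"
proof
  assume "smooth_vf M X"
  then have "smooth_in M (chart_dom M a) (\<lambda>x. vec_to_chart M a x (X x))" for a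
    by (intro smooth_in_chartI) (auto simp: smooth_vf_def chart_img_def loc_vf_eq)
  then show "vf_in M UNIV X" by (simp add: vf_in_def)
next
  assume "vf_in M UNIV X"
  then have "smooth_in M (chart_dom M a) (\<lambda>x. vec_to_chart M a x (X x))" for a
    by (simp add: vf_in_def)
  from smooth_inD[OF this order_refl] show "smooth_vf M X"
    by (simp add: smooth_vf_def chart_img_def loc_vf_eq)
qed

lemma vf_in_add: "open V \<Longrightarrow> vf_in M V X \<Longrightarrow> vf_in M V Y \<Longrightarrow> vf_in M V (\<lambda>x. X x + Y x)"
  unfolding vf_in_def
proof
  fix a assume V: "open V" and XY: "\<forall>a. smooth_in M (V \<inter> chart_dom M a) (\<lambda>x. vec_to_chart M a x (X x))"
     "\<forall>a. smooth_in M (V \<inter> chart_dom M a) (\<lambda>x. vec_to_chart M a x (Y x))"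
  have "smooth_in M (V \<inter> chart_dom M a) (\<lambda>x. vec_to_chart M a x (X x) + vec_to_chart M a x (Y x))"
    using V XY by (intro smooth_in_add) auto
  then show "smooth_in M (V \<inter> chart_dom M a) (\<lambda>x. vec_to_chart M a x (X x + Y x))"
    by (rule smooth_in_cong[rotated 2]) (use V in \<open>auto simp: linear_add[OF linear_vec_to_chart]\<close>)
qed

lemma vf_in_scaleR: "open V \<Longrightarrow> smooth_in M V f \<Longrightarrow> vf_in M V X \<Longrightarrow> vf_in M V (\<lambda>x. f x *\<^sub>R X x)"
  unfolding vf_in_def
proof
  fix a assume V: "open V" and f: "smooth_in M V f" and X: "\<forall>a. smooth_in M (V \<inter> chart_dom M a) (\<lambda>x. vec_to_chart M a x (X x))"
  have "smooth_in M (V \<inter> chart_dom M a) (\<lambda>x. f x *\<^sub>R vec_to_chart M a x (X x))"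
    using V X by (intro smooth_in_scaleR smooth_in_mono[OF f]) auto
  then show "smooth_in M (V \<inter> chart_dom M a) (\<lambda>x. vec_to_chart M a x (f x *\<^sub>R X x))"
    by (rule smooth_in_cong[rotated 2]) (use V in \<open>auto simp: linear_scale[OF linear_vec_to_chart]\<close>)
qed

lemma vf_in_zero: "vf_in M V (\<lambda>x. 0)"
  unfolding vf_in_def
proof
  fix a
  have "smooth_in M (chart_dom M a) (\<lambda>x. vec_to_chart M a x 0)"
    by (rule smooth_in_cong[OF _ _ smooth_in_const[of _ 0]]) (auto simp: linear_0[OF linear_vec_to_chart])
  then show "smooth_in M (V \<inter> chart_dom M a) (\<lambda>x. vec_to_chart M a x 0)" by (rule smooth_in_mono) auto
qed

lemma vf_in_sum: "open V \<Longrightarrow> (\<And>i. i \<in> I \<Longrightarrow> vf_in M V (X i)) \<Longrightarrow> vf_in M V (\<lambda>x. \<Sum>i\<in>I. X i x)"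
  by (induction I rule: infinite_finite_induct) (auto intro: vf_in_zero vf_in_add)

lemma vf_in_minus: "open V \<Longrightarrow> vf_in M V X \<Longrightarrow> vf_in M V (\<lambda>x. - X x)"
  using vf_in_scaleR[OF _ smooth_in_const[of V "-1"]] by simp

lemma vf_in_diff: "open V \<Longrightarrow> vf_in M V X \<Longrightarrow> vf_in M V Y \<Longrightarrow> vf_in M V (\<lambda>x. X x - Y x)"
  using vf_in_add[of V X "\<lambda>x. - Y x"] vf_in_minus[of V Y] by simp

lemma vf_in_coordinate: "vf_in M (chart_dom M a) (\<lambda>x. vec_of_chart M a x v)"
  by (rule vf_in_chartI[where a = a], simp, simp, rule smooth_in_cong[OF _ _ smooth_in_const[of _ v]]) auto

subsection \<open>The Lie bracket\<close>

text \<open>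
  The bracket acts on functions as the commutator of derivations. As charts are functions, this
  determines the bracket, and its properties become identities between derivations.
\<close>

text \<open>
  Written in the chart at \<open>x\<close>, the two iterated derivatives differ in their first-order parts only,
  which make up the bracket; the second-order parts cancel.
\<close>

lemma dderiv_lie_bracket:
  assumes V: "open V" "x \<in> V" and f: "smooth_in M V f" and X: "vf_in M V X" and Y: "vf_in M V Y"
  shows "dderiv M f x (lie_bracket M X Y x) =
    dderiv M (\<lambda>y. dderiv M f y (Y y)) x (X x) - dderiv M (\<lambda>y. dderiv M f y (X y)) x (Y x)"
proof -
  define W where "W = V \<inter> chart_dom M x"
  have W: "open W" "x \<in> W" "W \<subseteq> V" "W \<subseteq> chart_dom M x" using V by (auto simp: W_def)
  define S where "S = chart_map M x ` W"
  define z where "z = chart_map M x x"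
  have S: "open S" "z \<in> S" using W image_open' by (auto simp: S_def z_def)
  define F where "F = f \<circ> chart_inv M x"
  have F: "smooth_on S F" unfolding F_def S_def by (rule smooth_inD[OF smooth_in_mono[OF f W(3)] W(4)])
  define L where "L X = (\<lambda>y. vec_to_chart M x y (X y)) \<circ> chart_inv M x" for X
  have L: "smooth_on S (L X)" if "vf_in M V X" for X
    using that W(4) unfolding L_def S_def by (intro smooth_inD) (auto simp: vf_in_def W_def)
  have 1: "dderiv M (\<lambda>y. dderiv M f y (Y y)) x u =
     dderiv M f x (frechet_derivative (L Y) (at z) u) + frechet_derivative (\<lambda>z'. frechet_derivative F (at z') (Y x)) (at z) u"
    if Y: "vf_in M V Y" for Y u
  proof -
    have "dderiv M (\<lambda>y. dderiv M f y (Y y)) x = frechet_derivative (\<lambda>z. frechet_derivative F (at z) (L Y z)) (at z)"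
      unfolding dderiv_def[of M "\<lambda>y. dderiv M f y (Y y)"] z_def[symmetric]
    proof (rule frechet_derivative_cong_open[OF S])
      fix y assume "y \<in> S"
      then obtain w where w: "w \<in> W" "y = chart_map M x w" by (auto simp: S_def)
      show "((\<lambda>y. dderiv M f y (Y y)) \<circ> chart_inv M x) y = frechet_derivative F (at y) (L Y y)"
        using dderiv_in_chart[OF V(1) _ f, of w x] w W subsetD[OF W(3) w(1)] subsetD[OF W(4) w(1)]
        by (simp add: F_def L_def)
    qed
    moreover have "L Y z = Y x" by (simp add: L_def z_def)
    moreover have "dderiv M f x = frechet_derivative F (at z)" by (simp add: F_def z_def dderiv_def)
    ultimately show ?thesis using frechet_derivative_along[OF S F L[OF Y]] by simp
  qed
  have "lie_bracket M X Y x = frechet_derivative (L Y) (at z) (X x) - frechet_derivative (L X) (at z) (Y x)"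
    by (simp add: lie_bracket_def loc_vf_eq L_def z_def)
  then show ?thesis
    unfolding 1[OF X] 1[OF Y] second_derivative_symmetric[OF S F, of "Y x" "X x"]
    by (simp add: linear_diff[OF linear_dderiv[OF V f]])
qed

lemma vec_to_chart_lie_bracket:
  assumes "open V" "x \<in> V" "x \<in> chart_dom M a" "vf_in M V X" "vf_in M V Y"
  shows "vec_to_chart M a x (lie_bracket M X Y x) =
    dderiv M (\<lambda>y. vec_to_chart M a y (Y y)) x (X x) - dderiv M (\<lambda>y. vec_to_chart M a y (X y)) x (Y x)"
  unfolding vec_to_chart_eq_dderiv
  by (rule dderiv_lie_bracket[of "V \<inter> chart_dom M a"])
     (use assms smooth_in_mono[OF smooth_in_chart] vf_in_mono in auto)

lemma dderiv_chart_self [simp]: "dderiv M (chart_map M x) x u = u"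
  by (simp add: vec_to_chart_eq_dderiv[symmetric])

lemma vf_in_lie_bracket:
  assumes V: "open V" and X: "vf_in M V X" and Y: "vf_in M V Y"
  shows "vf_in M V (lie_bracket M X Y)"
  unfolding vf_in_def
proof
  fix a
  let ?W = "V \<inter> chart_dom M a"
  have W: "open ?W" using V by auto
  have v: "vf_in M ?W X" "vf_in M ?W Y" using X Y vf_in_mono by auto
  have "smooth_in M ?W (\<lambda>x. dderiv M (\<lambda>y. vec_to_chart M a y (Y y)) x (X x) - dderiv M (\<lambda>y. vec_to_chart M a y (X y)) x (Y x))"
    using v X Y by (intro smooth_in_diff smooth_in_dderiv W) (auto simp: vf_in_def)
  then show "smooth_in M ?W (\<lambda>x. vec_to_chart M a x (lie_bracket M X Y x))"
    by (rule smooth_in_cong[OF W, rotated]) (use vec_to_chart_lie_bracket[OF V _ _ X Y] in auto)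
qed

end

context smooth_mfd
begin

lemma smooth_in_vec_to_chart: "vf_in M V X \<Longrightarrow> W \<subseteq> V \<Longrightarrow> W \<subseteq> chart_dom M a \<Longrightarrow> smooth_in M W (\<lambda>y. vec_to_chart M a y (X y))"
  unfolding vf_in_def by (meson le_inf_iff smooth_in_mono)

context
  fixes x :: 'm and W assumes W: "W = chart_dom M x"
begin

lemma smooth_in_own_chart: "vf_in M UNIV X \<Longrightarrow> smooth_in M W (\<lambda>y. vec_to_chart M x y (X y))"
  using smooth_in_vec_to_chart[of UNIV X W x] W by simp

lemma own_chart_nbhd: "open W" "x \<in> W" using W by auto

lemma lie_bracket_add_left:
  assumes X: "vf_in M UNIV X" "vf_in M UNIV X'" "vf_in M UNIV Y"
  shows "lie_bracket M (\<lambda>y. X y + X' y) Y x = lie_bracket M X Y x + lie_bracket M X' Y x"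
proof -
  have "dderiv M (\<lambda>y. vec_to_chart M x y (X y + X' y)) x u =
     dderiv M (\<lambda>y. vec_to_chart M x y (X y) + vec_to_chart M x y (X' y)) x u" for u
    using W by (intro fun_cong[OF dderiv_cong[OF own_chart_nbhd]]) (simp add: linear_add[OF linear_vec_to_chart])
  then show ?thesis
    unfolding lie_bracket_eq
    by (simp add: dderiv_add[OF own_chart_nbhd smooth_in_own_chart smooth_in_own_chart] dderiv_linear_add[OF own_chart_nbhd smooth_in_own_chart] X)
qed

lemma lie_bracket_scaleR_left:
  assumes X: "vf_in M UNIV X" "vf_in M UNIV Y" and g: "smooth_in M UNIV g"
  shows "lie_bracket M (\<lambda>y. g y *\<^sub>R X y) Y x = g x *\<^sub>R lie_bracket M X Y x - dderiv M g x (Y x) *\<^sub>R X x"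
proof -
  have "dderiv M (\<lambda>y. vec_to_chart M x y (g y *\<^sub>R X y)) x u =
     dderiv M (\<lambda>y. g y *\<^sub>R vec_to_chart M x y (X y)) x u" for u
    using W by (intro fun_cong[OF dderiv_cong[OF own_chart_nbhd]]) (simp add: linear_scale[OF linear_vec_to_chart])
  then show ?thesis
    unfolding lie_bracket_eq
    using smooth_in_mono[OF g subset_UNIV, of W]
    by (simp add: dderiv_scaleR[OF own_chart_nbhd _ smooth_in_own_chart] dderiv_linear_scale[OF own_chart_nbhd smooth_in_own_chart] X algebra_simps)
qed

end

lemma lie_bracket_add_right:
  assumes X: "vf_in M UNIV X" "vf_in M UNIV Y" "vf_in M UNIV Y'"
  shows "lie_bracket M X (\<lambda>y. Y y + Y' y) x = lie_bracket M X Y x + lie_bracket M X Y' x"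
  using lie_bracket_add_left[OF refl X(2,3,1), of x] by (simp add: lie_bracket_antisym[of M X])

lemma lie_bracket_scaleR_right:
  assumes X: "vf_in M UNIV X" "vf_in M UNIV Y" and g: "smooth_in M UNIV g"
  shows "lie_bracket M X (\<lambda>y. g y *\<^sub>R Y y) x = g x *\<^sub>R lie_bracket M X Y x + dderiv M g x (X x) *\<^sub>R Y x"
  using lie_bracket_scaleR_left[OF refl X(2,1) g, of x] by (simp add: lie_bracket_antisym[of M X])

text \<open>
  Applied to the chart at \<open>x\<close>, the three double brackets become commutators of derivations, whose
  twelve terms cancel in pairs.
\<close>

lemma lie_bracket_jacobi:
  assumes X: "vf_in M UNIV X" and Y: "vf_in M UNIV Y" and Z: "vf_in M UNIV Z"
  shows "lie_bracket M X (lie_bracket M Y Z) x + lie_bracket M Y (lie_bracket M Z X) x + lie_bracket M Z (lie_bracket M X Y) x = 0"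
proof -
  define W where "W = chart_dom M x"
  have W: "open W" "x \<in> W" by (auto simp: W_def)
  let ?f = "chart_map M x"
  define L where "L = (\<lambda>X f y. dderiv M f y (X y :: 'e) :: 'e)"
  have f: "smooth_in M W ?f" unfolding W_def by (rule smooth_in_chart)
  have vW: "vf_in M W V" if "vf_in M UNIV V" for V using vf_in_mono[OF that] by simp
  have sL: "smooth_in M W (L V g)" if "vf_in M UNIV V" "smooth_in M W g" for V g
    unfolding L_def by (rule smooth_in_dderiv[OF W(1) that(2) vW[OF that(1)]])
  have lb: "vf_in M UNIV (lie_bracket M V V')" if "vf_in M UNIV V" "vf_in M UNIV V'" for V V'
    by (rule vf_in_lie_bracket[OF open_UNIV that])
  have c: "dderiv M ?f x (lie_bracket M V (lie_bracket M V' V'') x) =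
      L V (L V' (L V'' ?f)) x - L V (L V'' (L V' ?f)) x - L V' (L V'' (L V ?f)) x + L V'' (L V' (L V ?f)) x"
    if v: "vf_in M UNIV V" "vf_in M UNIV V'" "vf_in M UNIV V''" for V V' V''
  proof -
    have "dderiv M (\<lambda>y. dderiv M ?f y (lie_bracket M V' V'' y)) x (V x) =
        dderiv M (\<lambda>y. L V' (L V'' ?f) y - L V'' (L V' ?f) y) x (V x)"
    proof (rule fun_cong[OF dderiv_cong[OF W]])
      fix y assume "y \<in> W"
      then show "dderiv M ?f y (lie_bracket M V' V'' y) = L V' (L V'' ?f) y - L V'' (L V' ?f) y"
        unfolding L_def by (rule dderiv_lie_bracket[OF W(1) _ f vW[OF v(2)] vW[OF v(3)]])
    qed
    then have 1: "dderiv M (\<lambda>y. dderiv M ?f y (lie_bracket M V' V'' y)) x (V x) = L V (L V' (L V'' ?f)) x - L V (L V'' (L V' ?f)) x"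
      using dderiv_diff[OF W sL[OF v(2) sL[OF v(3) f]] sL[OF v(3) sL[OF v(2) f]], of "V x"] by (simp add: L_def)
    have 2: "dderiv M (\<lambda>y. dderiv M ?f y (V y)) x (lie_bracket M V' V'' x) = L V' (L V'' (L V ?f)) x - L V'' (L V' (L V ?f)) x"
      using dderiv_lie_bracket[OF W sL[OF v(1) f] vW[OF v(2)] vW[OF v(3)]] by (simp add: L_def)
    show ?thesis
      using dderiv_lie_bracket[OF W f vW[OF v(1)] vW[OF lb[OF v(2,3)]]] 1 2 by simp
  qed
  show ?thesis
    using c[OF X Y Z] c[OF Y Z X] c[OF Z X Y] by simp
qed

subsection \<open>Bump functions and the extension of local objects\<close>

lemma bump_function:
  assumes V: "open V" "x \<in> V"
  obtains \<psi> :: "'m \<Rightarrow> real" and K W where "smooth_in M UNIV \<psi>" "open W" "x \<in> W" "W \<subseteq> V"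
    "\<And>y. y \<in> W \<Longrightarrow> \<psi> y = 1" "closed K" "K \<subseteq> V" "\<And>y. y \<notin> K \<Longrightarrow> \<psi> y = 0"
proof -
  define z where "z = chart_map M x x"
  let ?S = "chart_map M x ` (V \<inter> chart_dom M x)"
  have "open ?S" "z \<in> ?S" using V image_open by (auto simp: z_def)
  then obtain e where e: "e > 0" "cball z e \<subseteq> ?S" using open_contains_cball by blast
  define r where "r = e / 2"
  have r: "r > 0" "cball z (2 * r) \<subseteq> ?S" using e by (auto simp: r_def)
  obtain g :: "'e \<Rightarrow> real" where g: "smooth_on UNIV g" "\<And>y. dist y z \<le> r \<Longrightarrow> g y = 1" "\<And>y. dist y z \<ge> 2 * r \<Longrightarrow> g y = 0"
    using smooth_bump_ball[OF r(1)] by blast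
  define K where "K = chart_inv M x ` cball z (2 * r)"
  define \<psi> where "\<psi> y = (if y \<in> chart_dom M x then g (chart_map M x y) else 0)" for y
  define W where "W = V \<inter> (chart_dom M x \<inter> chart_map M x -` ball z r)"
  have "open (chart_dom M x \<inter> chart_map M x -` ball z r)"
    using chart_continuous by (intro continuous_open_preimage) auto
  then have W: "open W" "x \<in> W" "W \<subseteq> V" using V r by (auto simp: W_def z_def)
  \<comment> \<open>Closedness in the manifold comes from compactness, the space being Hausdorff.\<close>
  have "compact K" unfolding K_def
    by (rule compact_continuous_image[OF continuous_on_subset[OF chart_inv_continuous]]) (use r in auto)
  then have K: "closed K" by (rule compact_imp_closed)
  have KV: "K \<subseteq> V" using r by (force simp: K_def)
  have \<psi>K: "\<psi> y = 0" if "y \<notin> K" for y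
  proof (cases "y \<in> chart_dom M x")
    case True
    then have "chart_map M x y \<notin> cball z (2 * r)" using that unfolding K_def by force
    then show ?thesis using g(3)[of "chart_map M x y"] True by (simp add: \<psi>_def dist_commute)
  qed (simp add: \<psi>_def)
  have "smooth_in M UNIV \<psi>"
  proof (rule smooth_in_local)
    fix y :: 'm
    show "\<exists>W. open W \<and> y \<in> W \<and> smooth_in M W \<psi>"
    proof (cases "y \<in> chart_dom M x")
      case True
      have "smooth_in M (chart_dom M x) (\<lambda>y. g (chart_map M x y))"
        by (rule smooth_in_compose_euclid[OF dom_open open_UNIV smooth_in_chart g(1)]) auto
      then have "smooth_in M (chart_dom M x) \<psi>"
        by (rule smooth_in_cong[OF dom_open, rotated]) (simp add: \<psi>_def)
      then show ?thesis using True dom_open by blast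
    next
      case False
      have "K \<subseteq> chart_dom M x" using r by (force simp: K_def)
      moreover have "smooth_in M (- K) \<psi>"
        by (rule smooth_in_cong[OF _ _ smooth_in_const[of _ 0]]) (use K \<psi>K in auto)
      ultimately show ?thesis using False K by (intro exI[of _ "- K"]) auto
    qed
  qed
  moreover have "\<psi> y = 1" if "y \<in> W" for y
    using that g(2)[of "chart_map M x y"] by (auto simp: W_def \<psi>_def dist_commute)
  ultimately show ?thesis using that W K KV \<psi>K by blast
qed

lemma smooth_in_cutoff:
  assumes V: "open V" and \<psi>: "smooth_in M UNIV \<psi>" and K: "closed K" "K \<subseteq> V" "\<And>y. y \<notin> K \<Longrightarrow> \<psi> y = 0" and f: "smooth_in M V f"
  shows "smooth_in M UNIV (\<lambda>y. if y \<in> V then \<psi> y *\<^sub>R f y else 0)"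
proof (rule smooth_in_local)
  fix x
  let ?g = "\<lambda>y. if y \<in> V then \<psi> y *\<^sub>R f y else 0"
  show "\<exists>W. open W \<and> x \<in> W \<and> smooth_in M W ?g"
  proof (cases "x \<in> V")
    case True
    have "smooth_in M V ?g"
      by (rule smooth_in_cong[OF V _ smooth_in_scaleR[OF V smooth_in_mono[OF \<psi>] f]]) auto
    with True V show ?thesis by blast
  next
    case False
    have "smooth_in M (- K) ?g"
      by (rule smooth_in_cong[OF _ _ smooth_in_const[of _ 0]]) (use K in auto)
    then show ?thesis using False K by (intro exI[of _ "- K"]) auto
  qed
qed

text \<open>
  Near a point of \<open>V\<close> the field is a product of smooth objects; near any other point it
  vanishes, because the support \<open>K\<close> of the bump function is closed in the whole manifold.
\<close>

lemma vf_in_cutoff: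
  assumes V: "open V" and \<psi>: "smooth_in M UNIV \<psi>" and K: "closed K" "K \<subseteq> V" "\<And>y. y \<notin> K \<Longrightarrow> \<psi> y = 0" and X: "vf_in M V X"
  shows "vf_in M UNIV (\<lambda>y. if y \<in> V then \<psi> y *\<^sub>R X y else 0)"
proof (rule vf_in_local)
  fix x
  let ?g = "\<lambda>y. if y \<in> V then \<psi> y *\<^sub>R X y else 0"
  show "\<exists>W. open W \<and> x \<in> W \<and> vf_in M W ?g"
  proof (cases "x \<in> V")
    case True
    have "vf_in M V ?g"
      by (rule vf_in_cong[OF V _ vf_in_scaleR[OF V smooth_in_mono[OF \<psi>] X]]) auto
    with True V show ?thesis by blast
  next
    case False
    have "vf_in M (- K) ?g"
      by (rule vf_in_cong[OF _ _ vf_in_zero]) (use K in auto)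
    then show ?thesis using False K by (intro exI[of _ "- K"]) auto
  qed
qed

lemma extend_vf:
  assumes V: "open V" "x \<in> V" and X: "vf_in M V X"
  obtains X' W where "vf_in M UNIV X'" "open W" "x \<in> W" "W \<subseteq> V" "\<And>y. y \<in> W \<Longrightarrow> X' y = X y"
proof -
  obtain \<psi> :: "'m \<Rightarrow> real" and K W where b: "smooth_in M UNIV \<psi>" "open W" "x \<in> W" "W \<subseteq> V"
    "\<And>y. y \<in> W \<Longrightarrow> \<psi> y = 1" "closed K" "K \<subseteq> V" "\<And>y. y \<notin> K \<Longrightarrow> \<psi> y = 0"
    by (rule bump_function[OF V]) (rule that)
  show ?thesis
    by (rule that[OF vf_in_cutoff[OF V(1) b(1,6,7,8) X] b(2-4)]) (use b in auto)
qed

lemma coordinate_extension: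
  obtains X W where "vf_in M UNIV X" "open W" "x \<in> W" "W \<subseteq> chart_dom M x" "\<And>y. y \<in> W \<Longrightarrow> X y = vec_of_chart M x y u"
  using extend_vf[OF dom_open dom_mem vf_in_coordinate, of x u] by blast

lemma vf_with_value: obtains X where "vf_in M UNIV X" "X x = u"
  using coordinate_extension[of x u] vec_of_chart_self by metis

subsection \<open>Tensoriality\<close>

text \<open>
  An operation that is linear over smooth functions depends only on the value of its argument at
  the point: with a bump function \<open>\<psi>\<close> around \<open>x\<close>, the field \<open>\<psi>\<^sup>2 X\<close> is a combination of global fields
  with smooth coefficients that are the components of \<open>X\<close> at \<open>x\<close>.
\<close>

lemma local_frame_expansion:
  assumes X: "vf_in M UNIV X"
  obtains \<psi> :: "'m \<Rightarrow> real" and F :: "'e \<Rightarrow> 'm \<Rightarrow> 'e" and c W where "smooth_in M UNIV \<psi>"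
    "open W" "x \<in> W" "W \<subseteq> chart_dom M x" "\<And>y. y \<in> W \<Longrightarrow> \<psi> y = 1"
    "\<And>b. vf_in M UNIV (F b)" "\<And>b y. y \<in> W \<Longrightarrow> F b y = vec_of_chart M x y b"
    "\<And>b. smooth_in M UNIV (c b)" "\<And>b y. y \<in> W \<Longrightarrow> c b y = vec_to_chart M x y (X y) \<bullet> b"
    "\<And>y. \<psi> y *\<^sub>R \<psi> y *\<^sub>R X y = (\<Sum>b\<in>Basis. c b y *\<^sub>R F b y)"
proof -
  let ?V = "chart_dom M x"
  obtain \<psi> :: "'m \<Rightarrow> real" and K W where b: "smooth_in M UNIV \<psi>" "open W" "x \<in> W" "W \<subseteq> ?V"
    "\<And>y. y \<in> W \<Longrightarrow> \<psi> y = 1" "closed K" "K \<subseteq> ?V" "\<And>y. y \<notin> K \<Longrightarrow> \<psi> y = 0"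
    by (rule bump_function[OF dom_open dom_mem]) (rule that)
  define F where "F b y = (if y \<in> ?V then \<psi> y *\<^sub>R vec_of_chart M x y b else 0)" for b y
  define c where "c b y = (if y \<in> ?V then \<psi> y *\<^sub>R (vec_to_chart M x y (X y) \<bullet> b) else 0)" for b y
  have F: "vf_in M UNIV (F b')" for b'
    unfolding F_def by (rule vf_in_cutoff[OF dom_open b(1,6,7,8) vf_in_coordinate])
  have c: "smooth_in M UNIV (c b')" for b'
    unfolding c_def by (intro smooth_in_cutoff[OF dom_open b(1,6,7,8)] smooth_in_inner smooth_in_const
        smooth_in_vec_to_chart[OF X] dom_open) auto
  have e: "\<psi> y *\<^sub>R \<psi> y *\<^sub>R X y = (\<Sum>b\<in>Basis. c b y *\<^sub>R F b y)" for y
  proof (cases "y \<in> ?V")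
    case True
    have "X y = vec_of_chart M x y (vec_to_chart M x y (X y))" using True by simp
    also have "\<dots> = (\<Sum>b\<in>Basis. (vec_to_chart M x y (X y) \<bullet> b) *\<^sub>R vec_of_chart M x y b)"
      by (rule linear_basis_expand[OF linear_vec_of_chart[OF True]])
    finally have "\<psi> y *\<^sub>R \<psi> y *\<^sub>R X y = \<psi> y *\<^sub>R \<psi> y *\<^sub>R (\<Sum>b\<in>Basis. (vec_to_chart M x y (X y) \<bullet> b) *\<^sub>R vec_of_chart M x y b)"
      by presburger
    also have "\<dots> = (\<Sum>b\<in>Basis. c b y *\<^sub>R F b y)"
      using True by (simp add: scaleR_sum_right c_def F_def algebra_simps)
    finally show ?thesis .
  next
    case False
    then have "\<psi> y = 0" using b by blast
    then show ?thesis using False by (simp add: c_def)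
  qed
  show ?thesis by (rule that[OF b(1-5) F _ c _ e]) (use b in \<open>auto simp: F_def c_def\<close>)
qed

lemma local_frame:
  obtains F V where "open V" "x \<in> V" "V \<subseteq> chart_dom M x" "\<And>b. vf_in M UNIV (F b)" "\<And>b y. y \<in> V \<Longrightarrow> F b y = vec_of_chart M x y b"
  by (rule local_frame_expansion[OF vf_in_zero]) (rule that)

lemma linear_over_functions_sum:
  fixes A :: "('m \<Rightarrow> 'e) \<Rightarrow> 'v::real_vector"
  assumes add: "\<And>X Y. vf_in M UNIV X \<Longrightarrow> vf_in M UNIV Y \<Longrightarrow> A (\<lambda>y. X y + Y y) = A X + A Y"
    and scale: "\<And>g X. smooth_in M UNIV g \<Longrightarrow> vf_in M UNIV X \<Longrightarrow> A (\<lambda>y. g y *\<^sub>R X y) = g x *\<^sub>R A X"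
    and c: "\<And>i. i \<in> I \<Longrightarrow> smooth_in M UNIV (c i)" and F: "\<And>i. i \<in> I \<Longrightarrow> vf_in M UNIV (F i)"
  shows "A (\<lambda>y. \<Sum>i\<in>I. c i y *\<^sub>R F i y) = (\<Sum>i\<in>I. c i x *\<^sub>R A (F i))"
proof -
  have z: "A (\<lambda>y. 0) = 0" using scale[OF smooth_in_const[of _ 0] vf_in_zero] by simp
  show ?thesis using c F
  proof (induction I rule: infinite_finite_induct)
    case (insert i I)
    then have "A (\<lambda>y. c i y *\<^sub>R F i y + (\<Sum>i\<in>I. c i y *\<^sub>R F i y)) = A (\<lambda>y. c i y *\<^sub>R F i y) + A (\<lambda>y. \<Sum>i\<in>I. c i y *\<^sub>R F i y)"
      by (intro add vf_in_sum vf_in_scaleR) auto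
    with insert scale show ?case by simp
  qed (use z in auto)
qed

lemma tensorial_zero:
  fixes A :: "('m \<Rightarrow> 'e) \<Rightarrow> 'v::real_vector"
  assumes add: "\<And>X Y. vf_in M UNIV X \<Longrightarrow> vf_in M UNIV Y \<Longrightarrow> A (\<lambda>y. X y + Y y) = A X + A Y"
    and scale: "\<And>g X. smooth_in M UNIV g \<Longrightarrow> vf_in M UNIV X \<Longrightarrow> A (\<lambda>y. g y *\<^sub>R X y) = g x *\<^sub>R A X"
    and X: "vf_in M UNIV X" "X x = 0"
  shows "A X = 0"
proof -
  obtain \<psi> :: "'m \<Rightarrow> real" and F :: "'e \<Rightarrow> 'm \<Rightarrow> 'e" and c W where f: "smooth_in M UNIV \<psi>"
    "open W" "x \<in> W" "W \<subseteq> chart_dom M x" "\<And>y. y \<in> W \<Longrightarrow> \<psi> y = 1"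
    "\<And>b. vf_in M UNIV (F b)" "\<And>b y. y \<in> W \<Longrightarrow> F b y = vec_of_chart M x y b"
    "\<And>b. smooth_in M UNIV (c b)" "\<And>b y. y \<in> W \<Longrightarrow> c b y = vec_to_chart M x y (X y) \<bullet> b"
    "\<And>y. \<psi> y *\<^sub>R \<psi> y *\<^sub>R X y = (\<Sum>b\<in>Basis. c b y *\<^sub>R F b y)"
    by (rule local_frame_expansion[OF X(1)]) (rule that)
  have "A (\<lambda>y. \<psi> y *\<^sub>R \<psi> y *\<^sub>R X y) = \<psi> x *\<^sub>R \<psi> x *\<^sub>R A X"
    by (simp only: scale[OF f(1) vf_in_scaleR[OF open_UNIV f(1) X(1)]] scale[OF f(1) X(1)])
  also have "\<dots> = A X" using f by simp
  finally have "A X = A (\<lambda>y. \<Sum>b\<in>Basis. c b y *\<^sub>R F b y)" using f(10) by simp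
  also have "\<dots> = (\<Sum>b\<in>Basis. c b x *\<^sub>R A (F b))"
    by (rule linear_over_functions_sum[OF add scale]) (use f in auto)
  also have "\<dots> = 0" using f(3,9) X(2) by simp
  finally show ?thesis .
qed

lemma tensorial_eq:
  fixes A :: "('m \<Rightarrow> 'e) \<Rightarrow> 'v::real_vector"
  assumes add: "\<And>X Y. vf_in M UNIV X \<Longrightarrow> vf_in M UNIV Y \<Longrightarrow> A (\<lambda>y. X y + Y y) = A X + A Y"
    and scale: "\<And>g X. smooth_in M UNIV g \<Longrightarrow> vf_in M UNIV X \<Longrightarrow> A (\<lambda>y. g y *\<^sub>R X y) = g x *\<^sub>R A X"
    and X: "vf_in M UNIV X" "vf_in M UNIV Y" "X x = Y x"
  shows "A X = A Y"
proof -
  have "A (\<lambda>y. X y - Y y) = 0"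
    by (rule tensorial_zero[OF add scale]) (use X in \<open>auto intro: vf_in_diff\<close>)
  moreover have "A (\<lambda>y. (X y - Y y) + Y y) = A (\<lambda>y. X y - Y y) + A Y"
    using X by (intro add) (auto intro: vf_in_diff)
  ultimately show ?thesis by simp
qed

lemma linear_at_point:
  fixes A :: "('m \<Rightarrow> 'e) \<Rightarrow> 'v::real_vector" and B :: "'e \<Rightarrow> 'v"
  assumes add: "\<And>X Y. vf_in M UNIV X \<Longrightarrow> vf_in M UNIV Y \<Longrightarrow> A (\<lambda>y. X y + Y y) = A X + A Y"
    and scale: "\<And>g X. smooth_in M UNIV g \<Longrightarrow> vf_in M UNIV X \<Longrightarrow> A (\<lambda>y. g y *\<^sub>R X y) = g x *\<^sub>R A X"
    and B: "\<And>X. vf_in M UNIV X \<Longrightarrow> A X = B (X x)"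
  shows "linear B"
proof (rule linearI)
  fix u v and r :: real
  obtain X where X: "vf_in M UNIV X" "X x = u" using vf_with_value by blast
  obtain Y where Y: "vf_in M UNIV Y" "Y x = v" using vf_with_value by blast
  show "B (u + v) = B u + B v"
    using add[OF X(1) Y(1)] B[OF X(1)] B[OF Y(1)] B[OF vf_in_add[OF _ X(1) Y(1)]] X Y by simp
  show "B (r *\<^sub>R u) = r *\<^sub>R B u"
    using scale[OF smooth_in_const X(1), of r] B[OF X(1)] B[OF vf_in_scaleR[OF _ smooth_in_const X(1)], of r] X by simp
qed

subsection \<open>Covariant tensors\<close>

lemma smooth_in_form1:
  assumes \<alpha>: "smooth_form1 M \<alpha>" and V: "open V" and X: "vf_in M V X"
  shows "smooth_in M V (\<lambda>x. \<alpha> x (X x))"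
proof (rule smooth_in_local)
  fix x assume x: "x \<in> V"
  define W where "W = V \<inter> chart_dom M x"
  have W: "open W" "x \<in> W" "W \<subseteq> V" "W \<subseteq> chart_dom M x" using V x by (auto simp: W_def)
  have a: "smooth_in M W (\<lambda>y. \<alpha> y (vec_of_chart M x y b))" for b
  proof (rule smooth_in_mono[OF smooth_in_chartI[OF dom_open order_refl] W(4)])
    show "smooth_on (chart_map M x ` chart_dom M x) ((\<lambda>y. \<alpha> y (vec_of_chart M x y b)) \<circ> chart_inv M x)"
      using \<alpha> by (simp add: smooth_form1_def loc_form1_def Let_def chart_img_def comp_def)
  qed
  have "smooth_in M W (\<lambda>y. \<Sum>b\<in>Basis. (vec_to_chart M x y (X y) \<bullet> b) *\<^sub>R \<alpha> y (vec_of_chart M x y b))"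
    by (intro smooth_in_sum smooth_in_scaleR smooth_in_inner smooth_in_const a W smooth_in_vec_to_chart[OF X])
  then have "smooth_in M W (\<lambda>y. \<alpha> y (X y))"
  proof (rule smooth_in_cong[OF W(1), rotated])
    fix y assume y: "y \<in> W"
    have "linear (\<lambda>v. \<alpha> y (vec_of_chart M x y v))"
      using \<alpha> linear_compose[OF linear_vec_of_chart, of y x "\<alpha> y"] y W(4) by (auto simp: smooth_form1_def comp_def)
    from linear_basis_expand[OF this, of "vec_to_chart M x y (X y)"]
    show "(\<Sum>b\<in>Basis. (vec_to_chart M x y (X y) \<bullet> b) *\<^sub>R \<alpha> y (vec_of_chart M x y b)) = \<alpha> y (X y)"
      using y W(4) by (metis (no_types, lifting) subsetD sum.cong vec_of_to_chart)
  qed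
  then show "\<exists>W. open W \<and> x \<in> W \<and> smooth_in M W (\<lambda>x. \<alpha> x (X x))" using W by blast
qed

text \<open>
  Global fields suffice as test fields, since each coordinate field agrees near a given point with a
  global one.
\<close>

lemma smooth_form1I:
  assumes lin: "\<And>x. linear (\<alpha> x)" and s: "\<And>X. vf_in M UNIV X \<Longrightarrow> smooth_in M UNIV (\<lambda>x. \<alpha> x (X x))"
  shows "smooth_form1 M \<alpha>"
  unfolding smooth_form1_def
proof (intro conjI allI lin)
  fix a v
  have "smooth_in M (chart_dom M a) (\<lambda>x. \<alpha> x (vec_of_chart M a x v))"
  proof (rule smooth_in_local)
    fix x assume "x \<in> chart_dom M a"
    from extend_vf[OF dom_open this vf_in_coordinate, of v]
    obtain X W where X: "vf_in M UNIV X" "open W" "x \<in> W" "W \<subseteq> chart_dom M a" "\<And>y. y \<in> W \<Longrightarrow> X y = vec_of_chart M a y v" by blast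
    have "smooth_in M W (\<lambda>x. \<alpha> x (vec_of_chart M a x v))"
      by (rule smooth_in_cong[OF X(2) _ smooth_in_mono[OF s[OF X(1)]]]) (use X in auto)
    then show "\<exists>W. open W \<and> x \<in> W \<and> smooth_in M W (\<lambda>x. \<alpha> x (vec_of_chart M a x v))" using X by blast
  qed
  from smooth_inD[OF this order_refl] show "smooth_on (chart_img M a) (\<lambda>y. loc_form1 M a \<alpha> y v)"
    by (simp add: loc_form1_def Let_def chart_img_def comp_def)
qed

lemma smooth_in_tensor2:
  assumes b: "smooth_tensor2 M b" and V: "open V" and X: "vf_in M V X" and Y: "vf_in M V Y"
  shows "smooth_in M V (\<lambda>x. b x (X x) (Y x))"
proof (rule smooth_in_local)
  fix x assume x: "x \<in> V"
  define W where "W = V \<inter> chart_dom M x"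
  have W: "open W" "x \<in> W" "W \<subseteq> V" "W \<subseteq> chart_dom M x" using V x by (auto simp: W_def)
  have a: "smooth_in M W (\<lambda>y. b y (vec_of_chart M x y i) (vec_of_chart M x y j))" for i j
  proof (rule smooth_in_mono[OF smooth_in_chartI[OF dom_open order_refl] W(4)])
    show "smooth_on (chart_map M x ` chart_dom M x) ((\<lambda>y. b y (vec_of_chart M x y i) (vec_of_chart M x y j)) \<circ> chart_inv M x)"
      using b by (simp add: smooth_tensor2_def loc_tensor2_def Let_def chart_img_def comp_def)
  qed
  have "smooth_in M W (\<lambda>y. \<Sum>i\<in>Basis. (vec_to_chart M x y (X y) \<bullet> i) *\<^sub>R (\<Sum>j\<in>Basis. (vec_to_chart M x y (Y y) \<bullet> j) *\<^sub>R b y (vec_of_chart M x y i) (vec_of_chart M x y j)))"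
    by (intro smooth_in_sum smooth_in_scaleR smooth_in_inner smooth_in_const a W smooth_in_vec_to_chart[OF X] smooth_in_vec_to_chart[OF Y])
  then have "smooth_in M W (\<lambda>y. b y (X y) (Y y))"
  proof (rule smooth_in_cong[OF W(1), rotated])
    fix y assume y: "y \<in> W"
    then have yd: "y \<in> chart_dom M x" using W by auto
    have bl: "bilinear (b y)" using b by (simp add: smooth_tensor2_def)
    have 1: "linear (\<lambda>v. b y (vec_of_chart M x y v) w)" for w
      using bl linear_compose[OF linear_vec_of_chart[OF yd], of "\<lambda>u. b y u w"] by (simp add: bilinear_def comp_def)
    have 2: "linear (\<lambda>v. b y w (vec_of_chart M x y v))" for w
      using bl linear_compose[OF linear_vec_of_chart[OF yd], of "b y w"] by (simp add: bilinear_def comp_def)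
    show "(\<Sum>i\<in>Basis. (vec_to_chart M x y (X y) \<bullet> i) *\<^sub>R (\<Sum>j\<in>Basis. (vec_to_chart M x y (Y y) \<bullet> j) *\<^sub>R b y (vec_of_chart M x y i) (vec_of_chart M x y j))) = b y (X y) (Y y)"
      unfolding linear_basis_expand[OF 2, symmetric] linear_basis_expand[OF 1, symmetric] using yd by simp
  qed
  then show "\<exists>W. open W \<and> x \<in> W \<and> smooth_in M W (\<lambda>x. b x (X x) (Y x))" using W by blast
qed

lemma smooth_tensor2I:
  assumes lin: "\<And>x. bilinear (b x)" and s: "\<And>X Y. vf_in M UNIV X \<Longrightarrow> vf_in M UNIV Y \<Longrightarrow> smooth_in M UNIV (\<lambda>x. b x (X x) (Y x))"
  shows "smooth_tensor2 M b"
  unfolding smooth_tensor2_def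
proof (intro conjI allI lin)
  fix a u v
  have "smooth_in M (chart_dom M a) (\<lambda>x. b x (vec_of_chart M a x u) (vec_of_chart M a x v))"
  proof (rule smooth_in_local)
    fix x assume x: "x \<in> chart_dom M a"
    obtain X W where X: "vf_in M UNIV X" "open W" "x \<in> W" "W \<subseteq> chart_dom M a" "\<And>y. y \<in> W \<Longrightarrow> X y = vec_of_chart M a y u"
      using extend_vf[OF dom_open x vf_in_coordinate, of u] by blast
    obtain Y W' where Y: "vf_in M UNIV Y" "open W'" "x \<in> W'" "W' \<subseteq> chart_dom M a" "\<And>y. y \<in> W' \<Longrightarrow> Y y = vec_of_chart M a y v"
      using extend_vf[OF dom_open x vf_in_coordinate, of v] by blast
    have "smooth_in M (W \<inter> W') (\<lambda>x. b x (vec_of_chart M a x u) (vec_of_chart M a x v))"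
      by (rule smooth_in_cong[OF _ _ smooth_in_mono[OF s[OF X(1) Y(1)]]]) (use X Y in auto)
    then show "\<exists>W. open W \<and> x \<in> W \<and> smooth_in M W (\<lambda>x. b x (vec_of_chart M a x u) (vec_of_chart M a x v))"
      using X Y by (intro exI[of _ "W \<inter> W'"]) auto
  qed
  from smooth_inD[OF this order_refl] show "smooth_on (chart_img M a) (\<lambda>y. loc_tensor2 M a b y u v)"
    by (simp add: loc_tensor2_def Let_def chart_img_def comp_def)
qed

lemma ext_d1_dderiv:
  "ext_d1 M \<alpha> x u v = dderiv M (\<lambda>y. \<alpha> y (vec_of_chart M x y v)) x u - dderiv M (\<lambda>y. \<alpha> y (vec_of_chart M x y u)) x v"
  by (simp add: ext_d1_def dderiv_def loc_form1_def Let_def comp_def)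

lemma ext_d2_dderiv:
  "ext_d2 M b x u v w = dderiv M (\<lambda>y. b y (vec_of_chart M x y v) (vec_of_chart M x y w)) x u
     - dderiv M (\<lambda>y. b y (vec_of_chart M x y u) (vec_of_chart M x y w)) x v
     + dderiv M (\<lambda>y. b y (vec_of_chart M x y u) (vec_of_chart M x y v)) x w"
  by (simp add: ext_d2_def dderiv_def loc_tensor2_def Let_def comp_def)

text \<open>
  In the chart at \<open>x\<close>, differentiating \<open>\<alpha>(Y)\<close> yields the derivative of the coefficients of \<open>\<alpha>\<close> and \<open>\<alpha>\<close>
  of the derivative of the components of \<open>Y\<close>; the terms of the second kind add up to \<open>\<alpha>\<close> of the bracket.
\<close>

lemma ext_d1_fields:
  assumes \<alpha>: "smooth_form1 M \<alpha>" and X: "vf_in M UNIV X" and Y: "vf_in M UNIV Y"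
  shows "ext_d1 M \<alpha> x (X x) (Y x) = dderiv M (\<lambda>y. \<alpha> y (Y y)) x (X x) - dderiv M (\<lambda>y. \<alpha> y (X y)) x (Y x) - \<alpha> x (lie_bracket M X Y x)"
proof -
  define W where "W = chart_dom M x"
  have W: "open W" "x \<in> W" by (auto simp: W_def)
  have lin: "linear (\<alpha> y)" for y using \<alpha> by (simp add: smooth_form1_def)
  define a where "a v y = \<alpha> y (vec_of_chart M x y v)" for v y
  have a: "smooth_in M W (a v)" for v
    unfolding a_def W_def by (rule smooth_in_form1[OF \<alpha> dom_open vf_in_coordinate])
  have la: "linear (\<lambda>v. a v y)" if "y \<in> W" for y
    using linear_compose[OF linear_vec_of_chart lin, of y x] that by (simp add: a_def comp_def W_def)
  have ea: "dderiv M (a v) x u = (\<Sum>b\<in>Basis. (v \<bullet> b) * dderiv M (a b) x u)" for v u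
  proof -
    have "dderiv M (a v) x u = dderiv M (\<lambda>y. \<Sum>b\<in>Basis. (v \<bullet> b) *\<^sub>R a b y) x u"
      using linear_basis_expand[OF la] by (intro fun_cong[OF dderiv_cong[OF W]]) auto
    also have "\<dots> = (\<Sum>b\<in>Basis. dderiv M (\<lambda>y. (v \<bullet> b) *\<^sub>R a b y) x u)"
      by (intro dderiv_sum[OF W] smooth_in_scaleR smooth_in_const a W)
    finally show ?thesis by (simp add: dderiv_scaleR[OF W smooth_in_const a, simplified])
  qed
  have 1: "dderiv M (\<lambda>y. \<alpha> y (Y y)) x u = \<alpha> x (dderiv M (\<lambda>y. vec_to_chart M x y (Y y)) x u) + dderiv M (a (Y x)) x u"
    if Y: "vf_in M UNIV Y" for Y u
  proof -
    have sY: "smooth_in M W (\<lambda>y. vec_to_chart M x y (Y y))" using smooth_in_own_chart[OF W_def Y] .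
    have "dderiv M (\<lambda>y. \<alpha> y (Y y)) x u = dderiv M (\<lambda>y. \<Sum>b\<in>Basis. (vec_to_chart M x y (Y y) \<bullet> b) *\<^sub>R a b y) x u"
    proof (rule fun_cong[OF dderiv_cong[OF W]])
      fix y assume y: "y \<in> W"
      show "\<alpha> y (Y y) = (\<Sum>b\<in>Basis. (vec_to_chart M x y (Y y) \<bullet> b) *\<^sub>R a b y)"
        using linear_basis_expand[OF la[OF y], of "vec_to_chart M x y (Y y)"] y by (simp add: a_def W_def)
    qed
    also have "\<dots> = (\<Sum>b\<in>Basis. dderiv M (\<lambda>y. (vec_to_chart M x y (Y y) \<bullet> b) *\<^sub>R a b y) x u)"
      by (intro dderiv_sum[OF W] smooth_in_scaleR smooth_in_inner smooth_in_const sY a W)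
    also have "\<dots> = (\<Sum>b\<in>Basis. (Y x \<bullet> b) * dderiv M (a b) x u + (dderiv M (\<lambda>y. vec_to_chart M x y (Y y)) x u \<bullet> b) * a b x)"
      by (intro sum.cong refl)
         (simp add: dderiv_scaleR[OF W smooth_in_inner[OF W(1) sY smooth_in_const] a, simplified] dderiv_inner[OF W sY smooth_in_const])
    also have "\<dots> = dderiv M (a (Y x)) x u + a (dderiv M (\<lambda>y. vec_to_chart M x y (Y y)) x u) x"
      unfolding linear_basis_expand[OF la[OF W(2)], of "dderiv M (\<lambda>y. vec_to_chart M x y (Y y)) x u"] ea[of "Y x"]
      by (simp add: sum.distrib)
    finally show ?thesis by (simp add: a_def)
  qed
  show ?thesis
    unfolding 1[OF X] 1[OF Y] lie_bracket_eq ext_d1_dderiv linear_diff[OF lin] by (simp add: a_def[abs_def])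
qed

lemma ext_d2_fields:
  assumes X: "open W" "x \<in> W" "W \<subseteq> chart_dom M x"
    "\<And>y. y \<in> W \<Longrightarrow> X y = vec_of_chart M x y u" "\<And>y. y \<in> W \<Longrightarrow> Y y = vec_of_chart M x y v" "\<And>y. y \<in> W \<Longrightarrow> Z y = vec_of_chart M x y w"
  shows "ext_d2 M b x u v w = dderiv M (\<lambda>y. b y (Y y) (Z y)) x u - dderiv M (\<lambda>y. b y (X y) (Z y)) x v
     + dderiv M (\<lambda>y. b y (X y) (Y y)) x w"
proof -
  have "dderiv M (\<lambda>y. b y (vec_of_chart M x y v) (vec_of_chart M x y w)) x = dderiv M (\<lambda>y. b y (Y y) (Z y)) x"
    "dderiv M (\<lambda>y. b y (vec_of_chart M x y u) (vec_of_chart M x y w)) x = dderiv M (\<lambda>y. b y (X y) (Z y)) x"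
    "dderiv M (\<lambda>y. b y (vec_of_chart M x y u) (vec_of_chart M x y v)) x = dderiv M (\<lambda>y. b y (X y) (Y y)) x"
    by (rule dderiv_cong[OF X(1,2)], simp add: X)+
  then show ?thesis by (simp add: ext_d2_dderiv)
qed

lemma lie_bracket_coordinate_fields:
  assumes X: "open W" "x \<in> W" "W \<subseteq> chart_dom M x"
    "\<And>y. y \<in> W \<Longrightarrow> X y = vec_of_chart M x y u" "\<And>y. y \<in> W \<Longrightarrow> Y y = vec_of_chart M x y v"
  shows "lie_bracket M X Y x = 0"
proof -
  have "dderiv M (\<lambda>y. vec_to_chart M x y (Y y)) x = dderiv M (\<lambda>y. v) x"
    "dderiv M (\<lambda>y. vec_to_chart M x y (X y)) x = dderiv M (\<lambda>y. u) x"
    using X by (intro dderiv_cong[OF X(1,2)]; auto)+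
  then show ?thesis by (simp add: lie_bracket_eq)
qed

end

subsection \<open>Smooth maps and their differentials\<close>

locale smooth_mfd_map = M: smooth_mfd M + N: smooth_mfd N
  for M :: "('m::{t2_space,second_countable_topology}, 'e::euclidean_space) manifold"
  and N :: "('n::{t2_space,second_countable_topology}, 'f::euclidean_space) manifold" +
  fixes F :: "'m \<Rightarrow> 'n"
  assumes F: "smooth_map M N F"
begin

lemma continuous: "continuous_on UNIV F"
  using F by (simp add: smooth_map_def)

lemma open_vimage_F: "open W \<Longrightarrow> open (F -` W)"
  using open_vimage[OF _ continuous] .

lemma smooth_in_chart_comp: "smooth_in M (F -` chart_dom N b) (\<lambda>x. chart_map N b (F x))"
  using F by (simp add: smooth_map_iff comp_def)

lemma smooth_in_comp:
  assumes W: "open W" and g: "smooth_in N W g"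
  shows "smooth_in M (F -` W) (\<lambda>x. g (F x))"
proof (rule M.smooth_in_local)
  fix x assume x: "x \<in> F -` W"
  let ?b = "F x"
  let ?V = "F -` (W \<inter> chart_dom N ?b)"
  have o: "open ?V" by (rule open_vimage_F[OF open_Int[OF W N.dom_open]])
  have "smooth_in M ?V (\<lambda>y. (g \<circ> chart_inv N ?b) (chart_map N ?b (F y)))"
    by (rule M.smooth_in_compose_euclid[OF o N.image_open[OF W] M.smooth_in_mono[OF smooth_in_chart_comp]])
       (use g in \<open>auto simp: smooth_in_def comp_def\<close>)
  then have "smooth_in M ?V (\<lambda>x. g (F x))"
    by (rule M.smooth_in_cong[OF o, rotated]) auto
  then show "\<exists>W. open W \<and> x \<in> W \<and> smooth_in M W (\<lambda>x. g (F x))" using o x by (intro exI[of _ ?V]) auto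
qed

lemma smooth_in_comp_UNIV: "smooth_in N UNIV g \<Longrightarrow> smooth_in M UNIV (\<lambda>x. g (F x))"
  using smooth_in_comp[OF open_UNIV] by simp

lemma linear_tmap: "linear (tmap M N F x)"
  unfolding tmap_eq_dderiv comp_def
  by (rule M.linear_dderiv[OF open_vimage_F[OF N.dom_open] _ smooth_in_chart_comp]) simp

text \<open>
  The chain rule, from which functoriality of the differential and naturality of the bracket follow
  by taking charts for \<open>g\<close>.
\<close>

lemma dderiv_comp:
  assumes W: "open W" "F x \<in> W" and g: "smooth_in N W g"
  shows "dderiv M (\<lambda>y. g (F y)) x u = dderiv N g (F x) (tmap M N F x u)"
proof -
  let ?b = "F x"
  have 1: "((\<lambda>z. chart_map N ?b (F (chart_inv M x z))) has_derivative tmap M N F x) (at (chart_map M x x))"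
    unfolding tmap_eq_dderiv comp_def
    by (rule M.has_dderiv'[OF open_vimage_F[OF N.dom_open] _ smooth_in_chart_comp]) simp
  have 2: "((g \<circ> chart_inv N ?b) has_derivative dderiv N g ?b) (at (chart_map N ?b (F (chart_inv M x (chart_map M x x)))))"
    using N.has_dderiv[OF W g] by simp
  have "((\<lambda>z. (g \<circ> chart_inv N ?b) (chart_map N ?b (F (chart_inv M x z)))) has_derivative
      (\<lambda>u. dderiv N g ?b (tmap M N F x u))) (at (chart_map M x x))"
    by (rule has_derivative_compose[OF 1 2])
  then have "((\<lambda>z. g (F (chart_inv M x z))) has_derivative
      (\<lambda>u. dderiv N g ?b (tmap M N F x u))) (at (chart_map M x x))"
    by (rule has_derivative_transform_within_open[OF _ M.image_open[of "F -` chart_dom N ?b"], of _ _ _ _ x])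
       (use open_vimage_F[OF N.dom_open] in auto)
  from M.dderivI[OF this] show ?thesis by simp
qed

lemma vec_to_chart_tmap:
  assumes "F x \<in> chart_dom N b"
  shows "vec_to_chart N b (F x) (tmap M N F x u) = dderiv M (\<lambda>y. chart_map N b (F y)) x u"
  unfolding vec_to_chart_eq_dderiv by (rule dderiv_comp[OF N.dom_open assms N.smooth_in_chart, symmetric])

lemma smooth_in_tmap:
  assumes V: "open V" "V \<subseteq> F -` chart_dom N b" and X: "vf_in M V X"
  shows "smooth_in M V (\<lambda>x. vec_to_chart N b (F x) (tmap M N F x (X x)))"
  by (rule M.smooth_in_cong[OF V(1) _ M.smooth_in_dderiv[OF V(1) M.smooth_in_mono[OF smooth_in_chart_comp V(2)] X]])
     (use V in \<open>auto simp: vec_to_chart_tmap\<close>)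

text \<open>
  The derivatives of \<open>g \<circ> F\<close> along related fields are the derivatives of \<open>g\<close>, composed with \<open>F\<close>; so the
  commutators agree as well. Take for \<open>g\<close> the chart at \<open>F x\<close>.
\<close>

lemma lie_bracket_related:
  assumes X: "vf_in M UNIV X" "vf_in M UNIV Y" and X': "vf_in N UNIV X'" "vf_in N UNIV Y'"
    and rel: "\<And>x. tmap M N F x (X x) = X' (F x)" "\<And>x. tmap M N F x (Y x) = Y' (F x)"
  shows "tmap M N F x (lie_bracket M X Y x) = lie_bracket N X' Y' (F x)"
proof -
  let ?W = "chart_dom N (F x)" and ?g = "chart_map N (F x)"
  let ?V = "F -` ?W"
  have V: "open ?V" "x \<in> ?V" using open_vimage_F[OF N.dom_open] by auto
  note g = N.smooth_in_chart[of "F x"]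
  have vW: "vf_in N ?W Z" if "vf_in N UNIV Z" for Z using N.vf_in_mono[OF that] by simp
  have vV: "vf_in M ?V Z" if "vf_in M UNIV Z" for Z using M.vf_in_mono[OF that] by simp
  have 1: "dderiv M (\<lambda>y. dderiv M (\<lambda>y. ?g (F y)) y (Y y)) x (X x) = dderiv N (\<lambda>y. dderiv N ?g y (Y' y)) (F x) (X' (F x))"
    if "vf_in N UNIV Y'" "\<And>x. tmap M N F x (Y x) = Y' (F x)" "\<And>x. tmap M N F x (X x) = X' (F x)" for X Y X' Y'
  proof -
    have "dderiv M (\<lambda>y. dderiv M (\<lambda>y. ?g (F y)) y (Y y)) x (X x) = dderiv M (\<lambda>y. dderiv N ?g (F y) (Y' (F y))) x (X x)"
      by (intro fun_cong[OF M.dderiv_cong[OF V]]) (simp add: dderiv_comp[OF N.dom_open _ g] that)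
    also have "\<dots> = dderiv N (\<lambda>y. dderiv N ?g y (Y' y)) (F x) (X' (F x))"
      using dderiv_comp[OF N.dom_open _ N.smooth_in_dderiv[OF N.dom_open g vW[OF that(1)]], of x] that by simp
    finally show ?thesis .
  qed
  have "dderiv M (\<lambda>y. ?g (F y)) x (lie_bracket M X Y x) = dderiv N ?g (F x) (lie_bracket N X' Y' (F x))"
    unfolding M.dderiv_lie_bracket[OF V smooth_in_chart_comp vV[OF X(1)] vV[OF X(2)]]
      N.dderiv_lie_bracket[OF N.dom_open N.dom_mem g vW[OF X'(1)] vW[OF X'(2)]]
    by (simp add: 1[OF X'(2) rel(2,1)] 1[OF X'(1) rel(1,2)])
  then show ?thesis
    by (simp add: dderiv_comp[OF N.dom_open _ g])
qed

end

lemma smooth_map_compose: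
  assumes "smooth_mfd_map M N F" "smooth_mfd_map N L G"
  shows "smooth_map M L (G \<circ> F)"
proof -
  interpret F: smooth_mfd_map M N F by fact
  interpret G: smooth_mfd_map N L G by fact
  have "smooth_in M (F -` (G -` chart_dom L b)) (\<lambda>x. chart_map L b (G (F x)))" for b
    by (rule F.smooth_in_comp[OF G.open_vimage_F[OF G.N.dom_open] G.smooth_in_chart_comp])
  then show ?thesis
    using continuous_on_compose2[OF G.continuous F.continuous]
    by (simp add: smooth_map_iff comp_def vimage_def)
qed

lemma tmap_compose:
  assumes "smooth_mfd_map M N F" "smooth_mfd_map N L G"
  shows "tmap M L (G \<circ> F) x u = tmap N L G (F x) (tmap M N F x u)"
proof -
  interpret F: smooth_mfd_map M N F by fact
  interpret G: smooth_mfd_map N L G by fact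
  show ?thesis
    using F.dderiv_comp[OF G.open_vimage_F[OF G.N.dom_open] _ G.smooth_in_chart_comp, of x "G (F x)" u]
    by (simp add: tmap_eq_dderiv comp_def)
qed

section \<open>Linear algebra of symplectic vector spaces\<close>

lemma lin_trace_cong: "(\<And>x. A x = B x) \<Longrightarrow> lin_trace A = lin_trace B"
  by presburger

lemma lin_trace_add: "lin_trace (\<lambda>x. A x + B x) = lin_trace A + lin_trace B"
  by (simp add: lin_trace_def inner_left_distrib sum.distrib)

lemma lin_trace_diff: "lin_trace (\<lambda>x. A x - B x) = lin_trace A - lin_trace B"
  by (simp add: lin_trace_def inner_diff_left sum_subtractf)

lemma lin_trace_scaleR: "lin_trace (\<lambda>x. c *\<^sub>R A x) = c * lin_trace A"
  by (simp add: lin_trace_def sum_distrib_left)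

lemma lin_trace_minus: "lin_trace (\<lambda>x. - A x) = - lin_trace A"
  by (simp add: lin_trace_def sum_negf)

lemma lin_trace_zero [simp]: "lin_trace (\<lambda>x. 0) = 0"
  by (simp add: lin_trace_def)

lemma lin_trace_ident: "lin_trace (\<lambda>x::'a::euclidean_space. x) = DIM('a)"
  by (simp add: lin_trace_def)

lemma lin_trace_rank_one:
  fixes \<phi> :: "'a::euclidean_space \<Rightarrow> real"
  assumes "linear \<phi>"
  shows "lin_trace (\<lambda>x. \<phi> x *\<^sub>R v) = \<phi> v"
  using linear_basis_expand[OF assms, of v] by (simp add: lin_trace_def mult.commute)

lemma lin_trace_commute:
  fixes A :: "'a::euclidean_space \<Rightarrow> 'b::euclidean_space"
  assumes A: "linear A" and B: "linear B"
  shows "lin_trace (\<lambda>x. A (B x)) = lin_trace (\<lambda>x. B (A x))"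
proof -
  have "lin_trace (\<lambda>x. A (B x)) = (\<Sum>b\<in>Basis. \<Sum>a\<in>Basis. (B b \<bullet> a) * (A a \<bullet> b))"
    unfolding lin_trace_def by (subst linear_basis_expand[OF A]) (simp add: inner_sum_left)
  also have "\<dots> = (\<Sum>a\<in>Basis. \<Sum>b\<in>Basis. (A a \<bullet> b) * (B b \<bullet> a))"
    by (subst sum.swap) (simp add: mult.commute)
  also have "\<dots> = lin_trace (\<lambda>x. B (A x))"
    unfolding lin_trace_def by (subst linear_basis_expand[OF B]) (simp add: inner_sum_left)
  finally show ?thesis .
qed

locale symplectic_space =
  fixes \<omega> :: "'e::euclidean_space \<Rightarrow> 'e \<Rightarrow> real"
  assumes bilin: "bilinear \<omega>" and alt: "\<And>u. \<omega> u u = 0" and nondeg: "\<And>u. (\<And>v. \<omega> u v = 0) \<Longrightarrow> u = 0"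
begin

lemma lin1: "linear (\<lambda>u. \<omega> u v)" and lin2: "linear (\<omega> u)"
  using bilin by (auto simp: bilinear_def)

lemmas form_simps = bilinear_ladd[OF bilin] bilinear_radd[OF bilin] bilinear_lmul[OF bilin] bilinear_rmul[OF bilin]
  bilinear_lzero[OF bilin] bilinear_rzero[OF bilin] bilinear_lsub[OF bilin] bilinear_rsub[OF bilin]
  bilinear_lneg[OF bilin] bilinear_rneg[OF bilin]

lemma antisym: "\<omega> u v = - \<omega> v u"
  using alt[of "u + v", unfolded form_simps] by (simp add: alt add_eq_0_iff)

lemma nondeg_right: "(\<And>u. \<omega> u v = 0) \<Longrightarrow> v = 0"
  using nondeg antisym by (metis neg_equal_0_iff_equal)

lemma eqI_right: "(\<And>u. \<omega> u v = \<omega> u w) \<Longrightarrow> v = w"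
  using nondeg_right[of "v - w"] by (simp add: form_simps)

text \<open>The vector that represents \<open>\<omega>(u,\<cdot>)\<close> with respect to the inner product.\<close>

definition flat :: "'e \<Rightarrow> 'e" where "flat u = (\<Sum>b\<in>Basis. \<omega> u b *\<^sub>R b)"

lemma flat_inner: "flat u \<bullet> v = \<omega> u v"
  unfolding flat_def inner_sum_left
  using linear_basis_expand[OF lin2, of u v] by (simp add: inner_commute mult.commute)

lemma linear_flat: "linear flat"
  by (rule linearI; rule euclidean_eqI) (simp_all add: flat_inner inner_left_distrib form_simps)

lemma inj_flat: "inj flat"
  unfolding linear_injective_0[OF linear_flat]
proof (intro allI impI nondeg)
  fix u v assume "flat u = 0"
  then show "\<omega> u v = 0" using flat_inner[of u v] by simp
qed

lemma flat_inverse: obtains K where "linear K" "\<And>x. flat (K x) = x" "\<And>x. K (flat x) = x"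
  using linear_injective_isomorphism[OF linear_flat inj_flat] by auto

lemma represent: 
  assumes "linear \<phi>"
  shows "\<exists>!w. \<forall>u. \<phi> u = \<omega> u w"
proof -
  obtain K where K: "\<And>x. flat (K x) = x" using flat_inverse by metis
  define w where "w = - K (\<Sum>b\<in>Basis. \<phi> b *\<^sub>R b)"
  have "\<phi> u = \<omega> u w" for u
  proof -
    have "\<omega> u w = flat (K (\<Sum>b\<in>Basis. \<phi> b *\<^sub>R b)) \<bullet> u"
      unfolding flat_inner antisym[of u] by (simp add: w_def form_simps)
    also have "\<dots> = (\<Sum>b\<in>Basis. \<phi> b *\<^sub>R b) \<bullet> u" by (simp only: K)
    also have "\<dots> = \<phi> u"
      unfolding inner_sum_left
      using linear_basis_expand[OF assms, of u] by (simp add: inner_commute mult.commute)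
    finally show ?thesis by simp
  qed
  then show ?thesis using eqI_right by metis
qed

text \<open>Conjugating \<open>T\<close> with \<open>flat\<close> turns it into minus its transpose.\<close>

lemma trace_symplectic_zero:
  assumes T: "linear T" and sym: "\<And>u v. \<omega> (T u) v = \<omega> (T v) u"
  shows "lin_trace T = 0"
proof -
  obtain K where K: "linear K" "\<And>x. flat (K x) = x" "\<And>x. K (flat x) = x" by (rule flat_inverse) (rule that)
  have "linear (\<lambda>x. T (K x))" using linear_compose[OF K(1) T] by (simp add: comp_def)
  from lin_trace_commute[OF linear_flat this]
  have "lin_trace T = lin_trace (\<lambda>x. flat (T (K x)))" by (simp add: K)
  also have "\<dots> = (\<Sum>b\<in>Basis. - (flat (K b) \<bullet> T b))"
    unfolding lin_trace_def by (intro sum.cong refl) (simp only: flat_inner sym antisym[of "K _" "T _"] minus_minus)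
  also have "\<dots> = - lin_trace T" by (simp add: K lin_trace_def sum_negf inner_commute)
  finally show ?thesis by simp
qed

text \<open>
  For \<open>w\<close> the vector with \<open>m = \<omega>(\<cdot>, w)\<close>, the hypothesis says that \<open>m z \<cdot> y + \<omega>(y,z) w - m y \<cdot> z = 0\<close> for
  all \<open>y\<close>; the trace over \<open>y\<close> is \<open>(dim - 2) m z\<close>.
\<close>

lemma cyclic_wedge_zero:
  assumes dim: "DIM('e) > 2" and m: "linear m"
    and cyc: "\<And>x y z. \<omega> x y * m z + \<omega> y z * m x + \<omega> z x * m y = 0"
  shows "m z = (0::real)"
proof -
  obtain w where w: "\<And>u. m u = \<omega> u w" using represent[OF m] by blast
  have "m z *\<^sub>R y + \<omega> y z *\<^sub>R w - m y *\<^sub>R z = 0" for y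
    by (rule nondeg_right) (use cyc[of _ y z] w antisym[of z] in \<open>simp add: form_simps algebra_simps\<close>)
  then have "lin_trace (\<lambda>y. m z *\<^sub>R y + \<omega> y z *\<^sub>R w - m y *\<^sub>R z) = 0" by simp
  then have "m z * DIM('e) + \<omega> w z - m z = 0"
    by (simp add: lin_trace_add lin_trace_diff lin_trace_scaleR lin_trace_rank_one[OF lin1] lin_trace_rank_one[OF m] lin_trace_ident)
  moreover have "\<omega> w z = - m z" using w antisym by metis
  ultimately have "m z * (real DIM('e) - 2) = 0" by (simp add: algebra_simps)
  then show ?thesis using dim by simp
qed

end

section \<open>Linear connections\<close>

locale lin_conn = smooth_mfd M
  for M :: "('m::{t2_space,second_countable_topology}, 'e::euclidean_space) manifold" +
  fixes D :: "('m \<Rightarrow> 'e) \<Rightarrow> ('m \<Rightarrow> 'e) \<Rightarrow> 'm \<Rightarrow> 'e"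
  assumes conn: "linear_connection M D"
begin

abbreviation VF where "VF X \<equiv> vf_in M UNIV X"

lemma vf_smooth [intro]: "VF X \<Longrightarrow> VF Y \<Longrightarrow> VF (D X Y)"
  and D_add_left: "VF X \<Longrightarrow> VF X' \<Longrightarrow> VF Y \<Longrightarrow> D (\<lambda>x. X x + X' x) Y = (\<lambda>x. D X Y x + D X' Y x)"
  and D_add_right: "VF X \<Longrightarrow> VF Y \<Longrightarrow> VF Y' \<Longrightarrow> D X (\<lambda>x. Y x + Y' x) = (\<lambda>x. D X Y x + D X Y' x)"
  and D_scaleR_left: "smooth_in M UNIV g \<Longrightarrow> VF X \<Longrightarrow> VF Y \<Longrightarrow> D (\<lambda>x. g x *\<^sub>R X x) Y = (\<lambda>x. g x *\<^sub>R D X Y x)"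
  and D_scaleR_right: "smooth_in M UNIV g \<Longrightarrow> VF X \<Longrightarrow> VF Y \<Longrightarrow> D X (\<lambda>x. g x *\<^sub>R Y x) = (\<lambda>x. dderiv M g x (X x) *\<^sub>R Y x + g x *\<^sub>R D X Y x)"
  using conn unfolding linear_connection_def smooth_vf_iff smooth_fun_iff vf_app_eq_dderiv by blast+

lemmas vf_intros [intro] = vf_in_add[OF open_UNIV] vf_in_diff[OF open_UNIV] vf_in_minus[OF open_UNIV]
  vf_in_scaleR[OF open_UNIV] vf_in_zero vf_in_lie_bracket[OF open_UNIV]

lemma D_minus_left: "VF X \<Longrightarrow> VF Y \<Longrightarrow> D (\<lambda>x. - X x) Y = (\<lambda>x. - D X Y x)"
  using D_scaleR_left[OF smooth_in_const[of _ "-1"]] by simp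

lemma D_minus_right: "VF X \<Longrightarrow> VF Y \<Longrightarrow> D X (\<lambda>x. - Y x) = (\<lambda>x. - D X Y x)"
  using D_scaleR_right[OF smooth_in_const[of _ "-1"]] by simp

lemma D_cscaleR_right: "VF X \<Longrightarrow> VF Y \<Longrightarrow> D X (\<lambda>x. c *\<^sub>R Y x) = (\<lambda>x. c *\<^sub>R D X Y x)"
  using D_scaleR_right[OF smooth_in_const[of _ c]] by simp

lemma D_diff_left: "VF X \<Longrightarrow> VF X' \<Longrightarrow> VF Y \<Longrightarrow> D (\<lambda>x. X x - X' x) Y = (\<lambda>x. D X Y x - D X' Y x)"
  using D_add_left[of X "\<lambda>x. - X' x" Y] D_minus_left[of X' Y] vf_in_minus by simp

lemma D_diff_right: "VF X \<Longrightarrow> VF Y \<Longrightarrow> VF Y' \<Longrightarrow> D X (\<lambda>x. Y x - Y' x) = (\<lambda>x. D X Y x - D X Y' x)"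
  using D_add_right[of X Y "\<lambda>x. - Y' x"] D_minus_right[of X Y'] vf_in_minus by simp

lemma D_zero_left: "VF Y \<Longrightarrow> D (\<lambda>x. 0) Y = (\<lambda>x. 0)"
  using D_scaleR_left[OF smooth_in_const[of _ 0] vf_in_zero] by simp

lemma D_zero_right: "VF X \<Longrightarrow> D X (\<lambda>x. 0) = (\<lambda>x. 0)"
  using D_scaleR_right[OF smooth_in_const[of _ 0] _ vf_in_zero] by simp

subsection \<open>Curvature\<close>

lemma vf_curv [intro]: "VF X \<Longrightarrow> VF Y \<Longrightarrow> VF Z \<Longrightarrow> VF (curv M D X Y Z)"
  unfolding curv_def[abs_def] by (intro vf_intros vf_smooth)

lemma curv_antisym: "VF X \<Longrightarrow> VF Y \<Longrightarrow> VF Z \<Longrightarrow> curv M D X Y Z x = - curv M D Y X Z x"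
proof -
  assume v: "VF X" "VF Y" "VF Z"
  have "lie_bracket M X Y = (\<lambda>x. - lie_bracket M Y X x)" by (rule ext) (rule lie_bracket_antisym)
  then show ?thesis using v by (simp add: curv_def D_minus_left vf_in_lie_bracket)
qed

lemma curv_add_1: "VF X \<Longrightarrow> VF X' \<Longrightarrow> VF Y \<Longrightarrow> VF Z \<Longrightarrow> curv M D (\<lambda>x. X x + X' x) Y Z x = curv M D X Y Z x + curv M D X' Y Z x"
proof -
  assume v: "VF X" "VF X'" "VF Y" "VF Z"
  have l: "lie_bracket M (\<lambda>x. X x + X' x) Y = (\<lambda>x. lie_bracket M X Y x + lie_bracket M X' Y x)"
    using lie_bracket_add_left[OF refl] v by blast
  show ?thesis
    using v by (simp add: curv_def l D_add_left D_add_right vf_smooth vf_in_lie_bracket)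
qed

lemma curv_scaleR_1: "smooth_in M UNIV g \<Longrightarrow> VF X \<Longrightarrow> VF Y \<Longrightarrow> VF Z \<Longrightarrow> curv M D (\<lambda>x. g x *\<^sub>R X x) Y Z x = g x *\<^sub>R curv M D X Y Z x"
proof -
  assume v: "smooth_in M UNIV g" "VF X" "VF Y" "VF Z"
  have l: "lie_bracket M (\<lambda>x. g x *\<^sub>R X x) Y = (\<lambda>x. g x *\<^sub>R lie_bracket M X Y x - dderiv M g x (Y x) *\<^sub>R X x)"
    using lie_bracket_scaleR_left[OF refl] v by blast
  have s: "smooth_in M UNIV (\<lambda>x. dderiv M g x (Y x))" using v smooth_in_dderiv by blast
  show ?thesis
    using v s by (simp add: curv_def l D_diff_left D_scaleR_left D_scaleR_right vf_smooth vf_in_lie_bracket vf_in_scaleR algebra_simps)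
qed

lemma curv_add_3: "VF X \<Longrightarrow> VF Y \<Longrightarrow> VF Z \<Longrightarrow> VF Z' \<Longrightarrow> curv M D X Y (\<lambda>x. Z x + Z' x) x = curv M D X Y Z x + curv M D X Y Z' x"
  by (simp add: curv_def D_add_right vf_smooth vf_in_lie_bracket)

text \<open>
  The derivatives of \<open>g\<close> cancel: the first-order ones in pairs, and the second-order ones against
  the derivative of \<open>g\<close> along the bracket.
\<close>

lemma curv_scaleR_3: "smooth_in M UNIV g \<Longrightarrow> VF X \<Longrightarrow> VF Y \<Longrightarrow> VF Z \<Longrightarrow> curv M D X Y (\<lambda>x. g x *\<^sub>R Z x) x = g x *\<^sub>R curv M D X Y Z x"
proof -
  assume v: "smooth_in M UNIV g" "VF X" "VF Y" "VF Z"
  have s: "smooth_in M UNIV (\<lambda>x. dderiv M g x (X x))" "smooth_in M UNIV (\<lambda>x. dderiv M g x (Y x))" using v smooth_in_dderiv by blast+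
  have e: "dderiv M g x (lie_bracket M X Y x) = dderiv M (\<lambda>y. dderiv M g y (Y y)) x (X x) - dderiv M (\<lambda>y. dderiv M g y (X y)) x (Y x)"
    by (rule dderiv_lie_bracket[OF open_UNIV UNIV_I v(1-3)])
  show ?thesis
    using v s by (simp add: curv_def D_add_right D_scaleR_right vf_smooth vf_in_lie_bracket vf_in_scaleR e algebra_simps)
qed

lemma curv_add_2: "VF X \<Longrightarrow> VF Y \<Longrightarrow> VF Y' \<Longrightarrow> VF Z \<Longrightarrow> curv M D X (\<lambda>x. Y x + Y' x) Z x = curv M D X Y Z x + curv M D X Y' Z x"
  using curv_add_1[of Y Y' X Z x] by (simp add: curv_antisym[of X] vf_in_add)

lemma curv_scaleR_2: "smooth_in M UNIV g \<Longrightarrow> VF X \<Longrightarrow> VF Y \<Longrightarrow> VF Z \<Longrightarrow> curv M D X (\<lambda>x. g x *\<^sub>R Y x) Z x = g x *\<^sub>R curv M D X Y Z x"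
  using curv_scaleR_1[of g Y X Z x] by (simp add: curv_antisym[of X] vf_in_scaleR)

text \<open>
  Linearity over the functions in each of the three arguments makes the value at \<open>x\<close> depend on the
  values of the fields at \<open>x\<close> only; so the description defining \<open>curv_at\<close> has a unique solution.
\<close>

lemma curv_at_eq:
  assumes "VF X" "VF Y" "VF Z"
  shows "curv_at M D x (X x) (Y x) (Z x) = curv M D X Y Z x"
  unfolding curv_at_def smooth_vf_iff
proof (rule the_equality)
  have "curv M D X' Y' Z' x = curv M D X Y Z x" if "VF X' \<and> VF Y' \<and> VF Z' \<and> X' x = X x \<and> Y' x = Y x \<and> Z' x = Z x" for X' Y' Z'
  proof -
    have "curv M D X' Y' Z' x = curv M D X Y' Z' x"
      by (rule tensorial_eq[where A = "\<lambda>X. curv M D X Y' Z' x"]) (use that assms curv_add_1 curv_scaleR_1 in auto)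
    also have "\<dots> = curv M D X Y Z' x"
      by (rule tensorial_eq[where A = "\<lambda>Y. curv M D X Y Z' x"]) (use that assms curv_add_2 curv_scaleR_2 in auto)
    also have "\<dots> = curv M D X Y Z x"
      by (rule tensorial_eq[where A = "\<lambda>Z. curv M D X Y Z x"]) (use that assms curv_add_3 curv_scaleR_3 in auto)
    finally show ?thesis .
  qed
  then show "\<forall>X' Y' Z'. VF X' \<and> VF Y' \<and> VF Z' \<and> X' x = X x \<and> Y' x = Y x \<and> Z' x = Z x \<longrightarrow> curv M D X' Y' Z' x = curv M D X Y Z x"
    by blast
qed (use assms in auto)

lemma linear_curv_at_1: "linear (\<lambda>u. curv_at M D x u v w)"
proof -
  obtain Y where Y: "VF Y" "Y x = v" using vf_with_value by blast
  obtain Z where Z: "VF Z" "Z x = w" using vf_with_value by blast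
  show ?thesis
    by (rule linear_at_point[where A = "\<lambda>X. curv M D X Y Z x"])
       (use Y Z curv_at_eq[of _ Y Z x] in \<open>auto simp: curv_add_1 curv_scaleR_1\<close>)
qed

lemma linear_curv_at_2: "linear (\<lambda>v. curv_at M D x u v w)"
proof -
  obtain X where X: "VF X" "X x = u" using vf_with_value by blast
  obtain Z where Z: "VF Z" "Z x = w" using vf_with_value by blast
  show ?thesis
    by (rule linear_at_point[where A = "\<lambda>Y. curv M D X Y Z x"])
       (use X Z curv_at_eq[of X _ Z x] in \<open>auto simp: curv_add_2 curv_scaleR_2\<close>)
qed

lemma linear_curv_at_3: "linear (\<lambda>w. curv_at M D x u v w)"
proof -
  obtain X where X: "VF X" "X x = u" using vf_with_value by blast
  obtain Y where Y: "VF Y" "Y x = v" using vf_with_value by blast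
  show ?thesis
    by (rule linear_at_point[where A = "\<lambda>Z. curv M D X Y Z x"])
       (use X Y curv_at_eq[of X Y _ x] in \<open>auto simp: curv_add_3 curv_scaleR_3\<close>)
qed

lemmas curv_at_linear = linear_add[OF linear_curv_at_1] linear_add[OF linear_curv_at_2] linear_add[OF linear_curv_at_3]
  linear_diff[OF linear_curv_at_1] linear_diff[OF linear_curv_at_2] linear_diff[OF linear_curv_at_3]
  linear_scale[OF linear_curv_at_1] linear_scale[OF linear_curv_at_2] linear_scale[OF linear_curv_at_3]
  linear_0[OF linear_curv_at_1] linear_0[OF linear_curv_at_2] linear_0[OF linear_curv_at_3]

lemma curv_at_antisym: "curv_at M D x u v w = - curv_at M D x v u w"
proof -
  obtain X where X: "VF X" "X x = u" using vf_with_value by blast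
  obtain Y where Y: "VF Y" "Y x = v" using vf_with_value by blast
  obtain Z where Z: "VF Z" "Z x = w" using vf_with_value by blast
  show ?thesis using curv_antisym[OF X(1) Y(1) Z(1), of x] X Y Z curv_at_eq by metis
qed

text \<open>The second Bianchi identity, with the Lie brackets that torsion-freeness would replace.\<close>

lemma second_bianchi:
  assumes v: "VF X" "VF Y" "VF Z" "VF T"
  shows "(D X (curv M D Y Z T) x - curv M D Y Z (D X T) x - curv M D (lie_bracket M X Y) Z T x)
       + (D Y (curv M D Z X T) x - curv M D Z X (D Y T) x - curv M D (lie_bracket M Y Z) X T x)
       + (D Z (curv M D X Y T) x - curv M D X Y (D Z T) x - curv M D (lie_bracket M Z X) Y T x) = 0"
proof -
  let ?B = "lie_bracket M"
  have e: "D X (curv M D Y Z T) x = D X (D Y (D Z T)) x - D X (D Z (D Y T)) x - D X (D (?B Y Z) T) x"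
    if "VF X" "VF Y" "VF Z" for X Y Z
    unfolding curv_def[abs_def] using that v by (simp add: D_diff_right vf_smooth vf_intros)
  have j: "D (?B (?B X Y) Z) T x + D (?B (?B Y Z) X) T x + D (?B (?B Z X) Y) T x = 0"
  proof -
    have "(\<lambda>x. ?B (?B X Y) Z x + ?B (?B Y Z) X x + ?B (?B Z X) Y x) = (\<lambda>x. 0)"
    proof
      fix x
      have "?B Z (?B X Y) x = - ?B (?B X Y) Z x" "?B X (?B Y Z) x = - ?B (?B Y Z) X x" "?B Y (?B Z X) x = - ?B (?B Z X) Y x"
        by (rule lie_bracket_antisym)+
      then show "?B (?B X Y) Z x + ?B (?B Y Z) X x + ?B (?B Z X) Y x = 0"
        using lie_bracket_jacobi[OF v(1-3), of x] by (simp add: algebra_simps add_eq_0_iff)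
    qed
    then have "D (\<lambda>x. ?B (?B X Y) Z x + ?B (?B Y Z) X x + ?B (?B Z X) Y x) T x = 0"
      using D_zero_left[OF v(4)] by simp
    then show ?thesis using v by (simp add: D_add_left vf_intros)
  qed
  show ?thesis
    unfolding e[OF v(1-3)] e[OF v(2,3,1)] e[OF v(3,1,2)]
    using j by (simp add: curv_def algebra_simps)
qed

end

text \<open>
  For coordinate fields the brackets vanish, so that \<open>D X Y = D Y X\<close>; written out with the parallelism of
  \<open>b\<close>, the derivative is an alternating sum whose terms cancel in pairs.
\<close>

lemma (in lin_conn) parallel_imp_closed:
  assumes b: "smooth_tensor2 M b" "\<And>x u. b x u u = 0" and tf: "torsion_free M D" and par: "parallel2 M D b"
  shows "ext_d2 M b x u v w = 0"
proof -
  obtain X W1 where X: "VF X" "open W1" "x \<in> W1" "W1 \<subseteq> chart_dom M x" "\<And>y. y \<in> W1 \<Longrightarrow> X y = vec_of_chart M x y u" using coordinate_extension[of x u] by blast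
  obtain Y W2 where Y: "VF Y" "open W2" "x \<in> W2" "W2 \<subseteq> chart_dom M x" "\<And>y. y \<in> W2 \<Longrightarrow> Y y = vec_of_chart M x y v" using coordinate_extension[of x v] by blast
  obtain Z W3 where Z: "VF Z" "open W3" "x \<in> W3" "W3 \<subseteq> chart_dom M x" "\<And>y. y \<in> W3 \<Longrightarrow> Z y = vec_of_chart M x y w" using coordinate_extension[of x w] by blast
  let ?W = "W1 \<inter> W2 \<inter> W3"
  have W: "open ?W" "x \<in> ?W" "?W \<subseteq> chart_dom M x" using X Y Z by auto
  have val: "X x = u" "Y x = v" "Z x = w" using X Y Z by simp_all
  have bl: "bilinear (b x)" using b by (simp add: smooth_tensor2_def)
  have anti: "b x p q = - b x q p" for p q
    using b(2)[of x "p + q", unfolded bilinear_ladd[OF bl] bilinear_radd[OF bl]] by (simp add: b(2) add_eq_0_iff)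
  have s: "D A B x = D B A x" if "VF A" "VF B" "lie_bracket M A B x = 0" for A B
    using tf that unfolding torsion_free_def smooth_vf_iff by (metis eq_iff_diff_eq_0 diff_zero)
  have s3: "D X Y x = D Y X x" "D X Z x = D Z X x" "D Y Z x = D Z Y x"
    using X Y Z by (auto intro!: s lie_bracket_coordinate_fields[OF W])
  have p: "dderiv M (\<lambda>y. b y (B y) (C y)) x (A x) = b x (D A B x) (C x) + b x (B x) (D A C x)" if "VF A" "VF B" "VF C" for A B C
    using par that unfolding parallel2_def smooth_vf_iff vf_app_eq_dderiv by (simp add: algebra_simps)
  have "ext_d2 M b x u v w = dderiv M (\<lambda>y. b y (Y y) (Z y)) x u - dderiv M (\<lambda>y. b y (X y) (Z y)) x v + dderiv M (\<lambda>y. b y (X y) (Y y)) x w"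
    by (rule ext_d2_fields[OF W]) (use X Y Z in auto)
  also have "\<dots> = 0"
    using p[OF X(1) Y(1) Z(1)] p[OF Y(1) X(1) Z(1)] p[OF Z(1) X(1) Y(1)] anti[of "Y x" "D X Z x"] anti[of "Y x" "D Z X x"]
    by (simp add: val s3 anti[of u])
  finally show ?thesis .
qed

locale symp_mfd = smooth_mfd M
  for M :: "('m::{t2_space,second_countable_topology}, 'e::euclidean_space) manifold" +
  fixes \<omega> :: "'m \<Rightarrow> 'e \<Rightarrow> 'e \<Rightarrow> real"
  assumes symp: "symplectic_form M \<omega>"
begin

lemma symplectic_space: "symplectic_space (\<omega> x)"
  using symp by (auto simp: symplectic_form_def smooth_tensor2_def symplectic_space_def)

lemma smooth_omega: "smooth_tensor2 M \<omega>"
  using symp by (simp add: symplectic_form_def)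

text \<open>In a local frame, the components of \<open>W\<close> solve a linear system with smooth coefficients.\<close>

lemma vf_represent:
  assumes W: "\<And>x u. \<theta> x u = \<omega> x u (W x)" and \<theta>: "\<And>X. vf_in M UNIV X \<Longrightarrow> smooth_in M UNIV (\<lambda>x. \<theta> x (X x))"
  shows "vf_in M UNIV W"
proof (rule vf_in_local)
  fix x
  obtain F V where f: "open V" "x \<in> V" "V \<subseteq> chart_dom M x" "\<And>b. vf_in M UNIV (F b)" "\<And>b y. y \<in> V \<Longrightarrow> F b y = vec_of_chart M x y b"
    by (rule local_frame) (rule that)
  have lin: "linear (vec_of_chart M x y)" if "y \<in> V" for y using linear_vec_of_chart f that by blast
  define A where "A y w = (\<Sum>b\<in>Basis. \<omega> y (F b y) (vec_of_chart M x y w) *\<^sub>R b)" for y w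
  have "smooth_in M V (\<lambda>y. vec_to_chart M x y (W y))"
  proof (rule smooth_in_linear_solve[OF f(1), where A = A and c = "\<lambda>y. \<Sum>b\<in>Basis. \<theta> y (F b y) *\<^sub>R b"])
    fix y assume y: "y \<in> V"
    interpret symplectic_space "\<omega> y" by (rule symplectic_space)
    show l: "linear (A y)"
      by (rule linearI) (simp_all add: A_def form_simps linear_add[OF lin[OF y]] linear_scale[OF lin[OF y]] scaleR_sum_right sum.distrib scaleR_left_distrib)
    show "inj (A y)"
      unfolding linear_injective_0[OF l]
    proof (intro allI impI)
      fix w assume "A y w = 0"
      have 0: "\<omega> y (F b y) (vec_of_chart M x y w) = 0" if b: "b \<in> Basis" for b
      proof -
        have "A y w \<bullet> b = \<omega> y (F b y) (vec_of_chart M x y w)"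
          using b by (simp add: A_def inner_sum_left inner_Basis if_distrib[of "\<lambda>t. _ * t"] cong: if_cong)
        then show ?thesis using \<open>A y w = 0\<close> by simp
      qed
      have "\<omega> y u (vec_of_chart M x y w) = 0" for u
      proof -
        have "u = vec_of_chart M x y (vec_to_chart M x y u)" using y f(3) by auto
        also have "\<dots> = (\<Sum>b\<in>Basis. (vec_to_chart M x y u \<bullet> b) *\<^sub>R F b y)"
          unfolding linear_basis_expand[OF lin[OF y], of "vec_to_chart M x y u"] using f(5)[OF y] by simp
        finally show ?thesis
          using linear_sum[OF lin1, of "\<lambda>b. (vec_to_chart M x y u \<bullet> b) *\<^sub>R F b y" Basis "vec_of_chart M x y w"]
          by (simp add: form_simps 0)
      qed
      then have "vec_of_chart M x y w = 0" by (rule nondeg_right)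
      then show "w = 0" using y f(3) vec_to_of_chart[of y x w] linear_0[OF linear_vec_to_chart, of y x] by auto
    qed
    show "A y (vec_to_chart M x y (W y)) = (\<Sum>b\<in>Basis. \<theta> y (F b y) *\<^sub>R b)"
      using y f(3) by (simp add: A_def W subset_iff)
  next
    fix v
    show "smooth_in M V (\<lambda>y. A y v)"
      unfolding A_def
      by (intro smooth_in_sum smooth_in_scaleR smooth_in_const f(1) smooth_in_tensor2[OF smooth_omega]
          vf_in_mono[OF vf_in_coordinate f(3)] vf_in_mono[OF f(4) subset_UNIV])
    show "smooth_in M V (\<lambda>y. \<Sum>b\<in>Basis. \<theta> y (F b y) *\<^sub>R b)"
      by (intro smooth_in_sum smooth_in_scaleR smooth_in_const f(1) smooth_in_mono[OF \<theta>[OF f(4)]]) auto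
  qed simp
  then show "\<exists>V. open V \<and> x \<in> V \<and> vf_in M V W"
    using vf_in_chartI[OF f(1,3)] f(1,2) by blast
qed

end

text \<open>
  The identification of a tangent space with the model space may jump with the point, but the trace
  is the same in the components of a fixed chart.
\<close>

lemma (in smooth_mfd) smooth_in_lin_trace:
  assumes lin: "\<And>x. linear (T x)" and T: "\<And>X. vf_in M UNIV X \<Longrightarrow> vf_in M UNIV (\<lambda>x. T x (X x))"
  shows "smooth_in M UNIV (\<lambda>x. lin_trace (T x))"
proof (rule smooth_in_local)
  fix x
  obtain F V where f: "open V" "x \<in> V" "V \<subseteq> chart_dom M x" "\<And>b. vf_in M UNIV (F b)" "\<And>b y. y \<in> V \<Longrightarrow> F b y = vec_of_chart M x y b"
    by (rule local_frame) (rule that)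
  have "smooth_in M V (\<lambda>y. \<Sum>b\<in>Basis. vec_to_chart M x y (T y (F b y)) \<bullet> b)"
    by (intro smooth_in_sum smooth_in_inner smooth_in_const f(1,3) smooth_in_vec_to_chart[OF T[OF f(4)]]) auto
  then have "smooth_in M V (\<lambda>y. lin_trace (T y))"
  proof (rule smooth_in_cong[OF f(1), rotated])
    fix y assume y: "y \<in> V"
    then have yd: "y \<in> chart_dom M x" using f by auto
    have "linear (\<lambda>w. T y (vec_of_chart M x y w))" using linear_compose[OF linear_vec_of_chart[OF yd] lin] by (simp add: comp_def)
    from lin_trace_commute[OF linear_vec_to_chart[OF yd] this]
    show "(\<Sum>b\<in>Basis. vec_to_chart M x y (T y (F b y)) \<bullet> b) = lin_trace (T y)"
      using yd f(5)[OF y] by (simp add: lin_trace_def[of "\<lambda>w. vec_to_chart M x y (T y (vec_of_chart M x y w))"])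
  qed
  then show "\<exists>V. open V \<and> x \<in> V \<and> smooth_in M V (\<lambda>x. lin_trace (T x))" using f by blast
qed

section \<open>Symplectic connections\<close>

locale symp_conn = symp_mfd M \<omega> + lin_conn M D
  for M :: "('m::{t2_space,second_countable_topology}, 'e::euclidean_space) manifold"
  and \<omega> :: "'m \<Rightarrow> 'e \<Rightarrow> 'e \<Rightarrow> real"
  and D :: "('m \<Rightarrow> 'e) \<Rightarrow> ('m \<Rightarrow> 'e) \<Rightarrow> 'm \<Rightarrow> 'e" +
  assumes tf: "torsion_free M D" and par: "parallel2 M D \<omega>"
begin

lemma torsion: "VF X \<Longrightarrow> VF Y \<Longrightarrow> D X Y x - D Y X x = lie_bracket M X Y x"
  using tf by (simp add: torsion_free_def smooth_vf_iff)

lemma parallel: "VF X \<Longrightarrow> VF Y \<Longrightarrow> VF Z \<Longrightarrow>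
    dderiv M (\<lambda>y. \<omega> y (Y y) (Z y)) x (X x) = \<omega> x (D X Y x) (Z x) + \<omega> x (Y x) (D X Z x)"
  using par unfolding parallel2_def smooth_vf_iff vf_app_eq_dderiv by (simp add: algebra_simps)

text \<open>Torsion-freeness turns the cyclic sum into the cyclic sum of double brackets.\<close>

lemma first_bianchi:
  assumes v: "VF X" "VF Y" "VF Z"
  shows "curv M D X Y Z x + curv M D Y Z X x + curv M D Z X Y x = 0"
proof -
  let ?B = "lie_bracket M"
  have e: "D X (D Y Z) x - D X (D Z Y) x - D (?B Y Z) X x = ?B X (?B Y Z) x" if v: "VF X" "VF Y" "VF Z" for X Y Z
  proof -
    have "D X (\<lambda>x. D Y Z x - D Z Y x) = D X (?B Y Z)"
      using torsion[OF v(2,3)] by simp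
    then have "(\<lambda>x. D X (D Y Z) x - D X (D Z Y) x) = D X (?B Y Z)" using v by (simp add: D_diff_right vf_smooth)
    from fun_cong[OF this, of x] have "D X (D Y Z) x - D X (D Z Y) x = D X (?B Y Z) x" .
    then show ?thesis using torsion[OF v(1) vf_in_lie_bracket[OF open_UNIV v(2,3)], of x] by simp
  qed
  show ?thesis
    using e[OF v] e[OF v(2,3,1)] e[OF v(3,1,2)] lie_bracket_jacobi[OF v, of x]
    by (simp add: curv_def algebra_simps)
qed

text \<open>
  As \<open>\<omega>\<close> is parallel, the identity \<open>X Y g - Y X g = [X,Y] g\<close> for the function \<open>g = \<omega>(Z,W)\<close> reads
  \<open>\<omega>(R(X,Y)Z, W) + \<omega>(Z, R(X,Y)W) = 0\<close>.
\<close>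

lemma curv_symplectic:
  assumes v: "VF X" "VF Y" "VF Z" "VF W"
  shows "\<omega> x (curv M D X Y Z x) (W x) = \<omega> x (curv M D X Y W x) (Z x)"
proof -
  interpret x: symplectic_space "\<omega> x" by (rule symplectic_space)
  let ?f = "\<lambda>y. \<omega> y (Z y) (W y)"
  have s: "smooth_in M UNIV (\<lambda>y. \<omega> y (A y) (B y))" if "VF A" "VF B" for A B
    by (rule smooth_in_tensor2[OF smooth_omega open_UNIV that])
  have e: "dderiv M (\<lambda>y. dderiv M ?f y (Y y)) x (X x) =
    \<omega> x (D X (D Y Z) x) (W x) + \<omega> x (D Y Z x) (D X W x) + (\<omega> x (D X Z x) (D Y W x) + \<omega> x (Z x) (D X (D Y W) x))"
    if "VF X" "VF Y" for X Y
    using that v by (simp add: parallel dderiv_add[OF open_UNIV UNIV_I s s] vf_smooth)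
  have "dderiv M ?f x (lie_bracket M X Y x) = \<omega> x (D (lie_bracket M X Y) Z x) (W x) + \<omega> x (Z x) (D (lie_bracket M X Y) W x)"
    using v by (intro parallel vf_in_lie_bracket) auto
  then have "\<omega> x (curv M D X Y Z x) (W x) + \<omega> x (Z x) (curv M D X Y W x) = 0"
    using dderiv_lie_bracket[OF open_UNIV UNIV_I s[OF v(3,4)] v(1,2), of x] e[OF v(1,2)] e[OF v(2,1)]
    by (simp add: curv_def x.form_simps)
  then show ?thesis using x.antisym[of "Z x"] by simp
qed

lemma first_bianchi_at: "curv_at M D x u v w + curv_at M D x v w u + curv_at M D x w u v = 0"
proof -
  obtain X where X: "VF X" "X x = u" using vf_with_value by blast
  obtain Y where Y: "VF Y" "Y x = v" using vf_with_value by blast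
  obtain Z where Z: "VF Z" "Z x = w" using vf_with_value by blast
  show ?thesis using first_bianchi[OF X(1) Y(1) Z(1), of x] X Y Z curv_at_eq by metis
qed

lemma curv_at_symplectic: "\<omega> x (curv_at M D x u v w) t = \<omega> x (curv_at M D x u v t) w"
proof -
  obtain X where X: "VF X" "X x = u" using vf_with_value by blast
  obtain Y where Y: "VF Y" "Y x = v" using vf_with_value by blast
  obtain Z where Z: "VF Z" "Z x = w" using vf_with_value by blast
  obtain T where T: "VF T" "T x = t" using vf_with_value by blast
  show ?thesis using curv_symplectic[OF X(1) Y(1) Z(1) T(1), of x] X Y Z T curv_at_eq by metis
qed

text \<open>By the first Bianchi identity, \<open>r(u,v) - r(v,u)\<close> is the trace of \<open>R(u,v)\<close>, which is in the symplectic Lie algebra.\<close>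

lemma ricci_symmetric: "ricci M D x u v = ricci M D x v u"
proof -
  interpret x: symplectic_space "\<omega> x" by (rule symplectic_space)
  have "ricci M D x u v - ricci M D x v u = lin_trace (\<lambda>w. curv_at M D x u v w)"
    unfolding ricci_def lin_trace_diff[symmetric]
  proof (rule lin_trace_cong)
    fix w show "curv_at M D x u w v - curv_at M D x v w u = curv_at M D x u v w"
      using first_bianchi_at[of x u v w] curv_at_antisym[of x w u v] by (simp add: algebra_simps add_eq_0_iff)
  qed
  also have "\<dots> = 0"
    by (rule x.trace_symplectic_zero[OF linear_curv_at_3]) (rule curv_at_symplectic)
  finally show ?thesis by simp
qed

lemma bilinear_ricci: "bilinear (ricci M D x)"
  unfolding bilinear_def ricci_def
  by (auto intro!: linearI simp: curv_at_linear lin_trace_add lin_trace_scaleR)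

lemma smooth_ricci: "smooth_tensor2 M (ricci M D)"
proof (rule smooth_tensor2I[OF bilinear_ricci])
  fix X Y assume "VF X" "VF Y"
  then show "smooth_in M UNIV (\<lambda>x. ricci M D x (X x) (Y x))"
    unfolding ricci_def by (intro smooth_in_lin_trace linear_curv_at_2) (simp add: curv_at_eq vf_curv)
qed

subsection \<open>The endomorphism of a bilinear form\<close>

context
  fixes b assumes b: "smooth_tensor2 M b"
begin

lemma endo_of: "b x u v = \<omega> x u (endo_of \<omega> b x v)"
proof -
  interpret x: symplectic_space "\<omega> x" by (rule symplectic_space)
  have l: "linear (\<lambda>u. b x u v)" using b by (simp add: smooth_tensor2_def bilinear_def)
  show ?thesis unfolding endo_of_def by (rule spec[OF theI'[OF x.represent[OF l]]])
qed

lemma linear_endo_of: "linear (endo_of \<omega> b x)"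
proof -
  interpret x: symplectic_space "\<omega> x" by (rule symplectic_space)
  have "bilinear (b x)" using b by (simp add: smooth_tensor2_def)
  then show ?thesis
    by (intro linearI x.eqI_right)
       (simp_all add: x.form_simps endo_of[symmetric] bilinear_radd bilinear_rmul)
qed

lemma vf_endo_of: "VF X \<Longrightarrow> VF (\<lambda>x. endo_of \<omega> b x (X x))"
  by (rule vf_represent[where \<theta> = "\<lambda>x u. b x u (X x)"])
     (use endo_of smooth_in_tensor2[OF b open_UNIV] in auto)

lemma endo_of_symplectic:
  assumes "\<And>u v. b x u v = b x v u"
  shows "\<omega> x (endo_of \<omega> b x u) v = \<omega> x (endo_of \<omega> b x v) u"
proof -
  interpret x: symplectic_space "\<omega> x" by (rule symplectic_space)
  show ?thesis
    using assms[of u v] x.antisym[of "endo_of \<omega> b x u" v] x.antisym[of "endo_of \<omega> b x v" u]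
      endo_of[of x u v] endo_of[of x v u] by linarith
qed

end

end

section \<open>The kernel of a contact form\<close>

text \<open>
  Only two properties of the exterior product matter: it is linear in each vector and it changes
  sign under permutations.
\<close>

definition multilinear_upto :: "nat \<Rightarrow> ((nat \<Rightarrow> 'f::real_vector) \<Rightarrow> real) \<Rightarrow> bool" where
  "multilinear_upto q \<beta> \<longleftrightarrow> (\<forall>i<q. \<forall>v. linear (\<lambda>u. \<beta> (v(i := u))))"

lemma multilinear_wedge:
  assumes \<alpha>: "multilinear_upto p \<alpha>" "\<And>v w. (\<And>i. i < p \<Longrightarrow> v i = w i) \<Longrightarrow> \<alpha> v = \<alpha> w" and \<beta>: "multilinear_upto q \<beta>"
  shows "multilinear_upto (p + q) (wedge p q \<alpha> \<beta>)"
  unfolding multilinear_upto_def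
proof (intro allI impI)
  fix i v assume i: "i < p + q"
  have term_linear: "linear (\<lambda>u. real_of_int (sign \<sigma>) * \<alpha> (\<lambda>k. (v(i := u)) (\<sigma> k)) * \<beta> (\<lambda>k. (v(i := u)) (\<sigma> (p + k))))"
    if \<sigma>: "\<sigma> permutes {..<p + q}" for \<sigma>
  proof -
    obtain k where k: "\<sigma> k = i" "k < p + q"
      using i permutes_image[OF \<sigma>] by (metis imageE lessThan_iff)
    have ki: "\<sigma> l = i \<longleftrightarrow> l = k" for l using permutes_inj[OF \<sigma>] k by (auto dest: injD)
    show ?thesis
    proof (cases "k < p")
      case True
      have "(\<lambda>l. (v(i := u)) (\<sigma> (p + l))) = (\<lambda>l. v (\<sigma> (p + l)))" for u using True ki by (auto simp: fun_eq_iff)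
      moreover have "(\<lambda>l. (v(i := u)) (\<sigma> l)) = (\<lambda>l. v (\<sigma> l))(k := u)" for u using ki by (auto simp: fun_eq_iff)
      moreover have L: "linear (\<lambda>u. \<alpha> ((\<lambda>l. v (\<sigma> l))(k := u)))" using \<alpha>(1) True by (simp add: multilinear_upto_def)
      ultimately show ?thesis
        by (auto intro!: linearI simp: linear_add[OF L] linear_scale[OF L] distrib_left distrib_right)
    next
      case False
      have "\<alpha> (\<lambda>l. (v(i := u)) (\<sigma> l)) = \<alpha> (\<lambda>l. v (\<sigma> l))" for u using False ki by (intro \<alpha>(2)) auto
      moreover have "(\<lambda>l. (v(i := u)) (\<sigma> (p + l))) = (\<lambda>l. v (\<sigma> (p + l)))(k - p := u)" for u using False ki by (auto simp: fun_eq_iff)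
      moreover have L: "linear (\<lambda>u. \<beta> ((\<lambda>l. v (\<sigma> (p + l)))(k - p := u)))" using \<beta> False k by (simp add: multilinear_upto_def)
      ultimately show ?thesis
        by (auto intro!: linearI simp: linear_add[OF L] linear_scale[OF L] distrib_left)
    qed
  qed
  show "linear (\<lambda>u. wedge p q \<alpha> \<beta> (v(i := u)))"
    unfolding wedge_def
  proof (rule linearI)
    fix x y and r :: real
    let ?t = "\<lambda>\<sigma> u. real_of_int (sign \<sigma>) * \<alpha> (\<lambda>k. (v(i := u)) (\<sigma> k)) * \<beta> (\<lambda>k. (v(i := u)) (\<sigma> (p + k)))"
    have "(\<Sum>\<sigma> | \<sigma> permutes {..<p + q}. ?t \<sigma> (x + y)) = (\<Sum>\<sigma> | \<sigma> permutes {..<p + q}. ?t \<sigma> x + ?t \<sigma> y)"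
      by (intro sum.cong refl) (use linear_add[OF term_linear] in auto)
    then show "(\<Sum>\<sigma> | \<sigma> permutes {..<p + q}. ?t \<sigma> (x + y)) / (fact p * fact q) =
       (\<Sum>\<sigma> | \<sigma> permutes {..<p + q}. ?t \<sigma> x) / (fact p * fact q) + (\<Sum>\<sigma> | \<sigma> permutes {..<p + q}. ?t \<sigma> y) / (fact p * fact q)"
      by (simp add: sum.distrib add_divide_distrib)
    have "(\<Sum>\<sigma> | \<sigma> permutes {..<p + q}. ?t \<sigma> (r *\<^sub>R x)) = (\<Sum>\<sigma> | \<sigma> permutes {..<p + q}. r * ?t \<sigma> x)"
      by (intro sum.cong refl) (use linear_scale[OF term_linear] in auto)
    then show "(\<Sum>\<sigma> | \<sigma> permutes {..<p + q}. ?t \<sigma> (r *\<^sub>R x)) / (fact p * fact q) =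
       r *\<^sub>R ((\<Sum>\<sigma> | \<sigma> permutes {..<p + q}. ?t \<sigma> x) / (fact p * fact q))"
      by (simp add: sum_distrib_left)
  qed
qed

lemma wedge_permute:
  assumes \<tau>: "\<tau> permutes {..<p + q}"
  shows "wedge p q \<alpha> \<beta> (\<lambda>i. v (\<tau> i)) = real_of_int (sign \<tau>) * wedge p q \<alpha> \<beta> v"
proof -
  let ?S = "{\<sigma>. \<sigma> permutes {..<p + q}}"
  let ?t = "\<lambda>\<sigma>. real_of_int (sign \<sigma>) * \<alpha> (\<lambda>i. v (\<sigma> i)) * \<beta> (\<lambda>i. v (\<sigma> (p + i)))"
  have st: "real_of_int (sign \<tau>) * real_of_int (sign \<tau>) = 1" by (simp add: sign_def)
  have "(\<Sum>\<sigma>\<in>?S. real_of_int (sign \<sigma>) * \<alpha> (\<lambda>i. v (\<tau> (\<sigma> i))) * \<beta> (\<lambda>i. v (\<tau> (\<sigma> (p + i)))))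
     = (\<Sum>\<sigma>\<in>?S. real_of_int (sign \<tau>) * ?t (\<tau> \<circ> \<sigma>))"
  proof (rule sum.cong[OF refl])
    fix \<sigma> assume "\<sigma> \<in> ?S"
    then have "sign (\<tau> \<circ> \<sigma>) = sign \<tau> * sign \<sigma>"
      using \<tau> by (intro sign_compose) (auto simp: permutation_permutes)
    then show "real_of_int (sign \<sigma>) * \<alpha> (\<lambda>i. v (\<tau> (\<sigma> i))) * \<beta> (\<lambda>i. v (\<tau> (\<sigma> (p + i)))) = real_of_int (sign \<tau>) * ?t (\<tau> \<circ> \<sigma>)"
      using st by (simp add: algebra_simps)
  qed
  also have "\<dots> = (\<Sum>\<sigma>\<in>?S. real_of_int (sign \<tau>) * ?t \<sigma>)"
    by (rule setum_permutations_compose_left[OF \<tau>, symmetric])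
  finally show ?thesis by (simp add: wedge_def sum_distrib_left)
qed

lemma wedge_equal_arguments:
  assumes "i < p + q" "j < p + q" "i \<noteq> j" "v i = v j"
  shows "wedge p q \<alpha> \<beta> v = 0"
proof -
  have "(\<lambda>k. v (Transposition.transpose i j k)) = v" using assms by (auto simp: Transposition.transpose_def fun_eq_iff)
  moreover have "Transposition.transpose i j permutes {..<p + q}" using assms by (intro permutes_swap_id) auto
  ultimately have "wedge p q \<alpha> \<beta> v = real_of_int (sign (Transposition.transpose i j)) * wedge p q \<alpha> \<beta> v"
    using wedge_permute[of "Transposition.transpose i j" p q \<alpha> \<beta> v] by simp
  then show ?thesis using assms by (simp add: sign_swap_id)
qed

text \<open>
  Vectors in a space of smaller dimension are dependent; expanding one of them in terms of the
  others produces wedge products with a repeated argument.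
\<close>

lemma wedge_dependent:
  fixes v :: "nat \<Rightarrow> 'f::euclidean_space"
  assumes ml: "multilinear_upto (p + q) (wedge p q \<alpha> \<beta>)" and dep: "v ` {..<p + q} \<subseteq> U" "subspace U" "dim U < p + q"
  shows "wedge p q \<alpha> \<beta> v = 0"
proof (cases "inj_on v {..<p + q}")
  case False
  then show ?thesis using wedge_equal_arguments unfolding inj_on_def by blast
next
  case True
  have "card (v ` {..<p + q}) = p + q" using True by (simp add: card_image)
  moreover have "card (v ` {..<p + q}) \<le> dim U" if "independent (v ` {..<p + q})"
    using independent_card_le_dim[OF dep(1) that] .
  ultimately have "dependent (v ` {..<p + q})" using dep(3) by fastforce
  then obtain i where i: "i < p + q" "v i \<in> span (v ` {..<p + q} - {v i})"
    unfolding dependent_def by auto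
  let ?I = "{..<p + q} - {i}"
  have "v ` {..<p + q} - {v i} = v ` ?I" using True i by (auto simp: inj_on_def)
  then have "v i \<in> span (v ` ?I)" using i by simp
  then obtain c where c: "v i = (\<Sum>w\<in>v ` ?I. c w *\<^sub>R w)"
    using span_finite[of "v ` ?I"] by auto
  have inj: "inj_on v ?I" using True by (rule inj_on_subset) auto
  have e: "v i = (\<Sum>j\<in>?I. c (v j) *\<^sub>R v j)" using c by (simp add: sum.reindex[OF inj])
  have lin: "linear (\<lambda>u. wedge p q \<alpha> \<beta> (v(i := u)))" using ml i by (simp add: multilinear_upto_def)
  have "wedge p q \<alpha> \<beta> v = wedge p q \<alpha> \<beta> (v(i := v i))" by simp
  also have "\<dots> = (\<Sum>j\<in>?I. c (v j) * wedge p q \<alpha> \<beta> (v(i := v j)))"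
    unfolding e using linear_sum[OF lin, of "\<lambda>j. c (v j) *\<^sub>R v j" ?I] by (simp add: linear_scale[OF lin])
  also have "\<dots> = 0"
  proof (intro sum.neutral ballI)
    fix j assume "j \<in> ?I"
    then show "c (v j) * wedge p q \<alpha> \<beta> (v(i := v j)) = 0"
      using i wedge_equal_arguments[of i p q j "v(i := v j)" \<alpha> \<beta>] by auto
  qed
  finally show ?thesis .
qed

lemma multilinear_wedge_pow2:
  fixes b :: "'f::real_vector \<Rightarrow> 'f \<Rightarrow> real"
  assumes b: "bilinear b"
  shows "multilinear_upto (2 * k) (wedge_pow2 (\<lambda>v. b (v 0) (v 1)) k)"
proof (induction k)
  case 0
  then show ?case by (simp add: multilinear_upto_def)
next
  case (Suc k)
  have "multilinear_upto 2 (\<lambda>v. b (v 0) (v 1))"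
    unfolding multilinear_upto_def
  proof (intro allI impI)
    fix i v assume "i < (2::nat)"
    then have "i = 0 \<or> i = 1" by auto
    then show "linear (\<lambda>u. b ((v(i := u)) 0) ((v(i := u)) 1))" using b by (auto simp: bilinear_def)
  qed
  then have "multilinear_upto (2 + 2 * k) (wedge 2 (2 * k) (\<lambda>v. b (v 0) (v 1)) (wedge_pow2 (\<lambda>v. b (v 0) (v 1)) k))"
    by (rule multilinear_wedge[OF _ _ Suc]) (metis numeral_2_eq_2 lessI less_2_cases_iff one_less_numeral_iff pos2 semiring_norm(76))
  then show ?case by simp
qed

lemma wedge_pow2_precompose:
  assumes "\<And>u v. b (Q u) (Q v) = b u v"
  shows "wedge_pow2 (\<lambda>v. b (v 0) (v 1)) k (\<lambda>i. Q (v i)) = wedge_pow2 (\<lambda>v. b (v 0) (v 1)) k v"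
proof (induction k arbitrary: v)
  case (Suc k)
  then show ?case by (simp add: wedge_def assms)
qed simp

text \<open>
  If \<open>z\<close> were a common null vector, the top form would not change when a projection along \<open>z\<close> is
  applied to its arguments; but then these lie in a hyperplane.
\<close>

lemma contact_no_null_vector:
  fixes a :: "'f::euclidean_space \<Rightarrow> real"
  assumes a: "linear a" and b: "bilinear b" and dim: "DIM('f) = 2 * n + 1"
    and nz: "wedge 1 (2 * n) (\<lambda>v. a (v 0)) (wedge_pow2 (\<lambda>v. b (v 0) (v 1)) n) v \<noteq> 0"
    and z: "a z = 0" "\<And>w. b z w = 0" "\<And>w. b w z = 0"
  shows "z = 0"
proof (rule ccontr)
  assume z0: "z \<noteq> 0"
  define Q where "Q u = u - ((u \<bullet> z) / (z \<bullet> z)) *\<^sub>R z" for u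
  have aQ: "a (Q u) = a u" for u using z by (simp add: Q_def linear_diff[OF a] linear_scale[OF a])
  have bQ: "b (Q u) (Q w) = b u w" for u w
    using z by (simp add: Q_def bilinear_lsub[OF b] bilinear_rsub[OF b] bilinear_lmul[OF b] bilinear_rmul[OF b])
  let ?U = "{u. z \<bullet> u = 0}"
  have "Q u \<in> ?U" for u using z0 by (simp add: Q_def inner_diff_right inner_commute)
  moreover have "dim ?U < 1 + 2 * n" using dim_hyperplane[OF z0] dim by simp
  moreover have "multilinear_upto (1 + 2 * n) (wedge 1 (2 * n) (\<lambda>v. a (v 0)) (wedge_pow2 (\<lambda>v. b (v 0) (v 1)) n))"
    by (rule multilinear_wedge[OF _ _ multilinear_wedge_pow2[OF b]]) (use a in \<open>auto simp: multilinear_upto_def\<close>)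
  ultimately have "wedge 1 (2 * n) (\<lambda>v. a (v 0)) (wedge_pow2 (\<lambda>v. b (v 0) (v 1)) n) (\<lambda>i. Q (v i)) = 0"
    by (intro wedge_dependent[where U = ?U] subspace_hyperplane) auto
  moreover have "wedge 1 (2 * n) (\<lambda>v. a (v 0)) (wedge_pow2 (\<lambda>v. b (v 0) (v 1)) n) (\<lambda>i. Q (v i))
      = wedge 1 (2 * n) (\<lambda>v. a (v 0)) (wedge_pow2 (\<lambda>v. b (v 0) (v 1)) n) v"
    by (simp add: wedge_def aQ wedge_pow2_precompose[of b Q, OF bQ] del: One_nat_def)
  ultimately show False using nz by simp
qed

section \<open>The product of a manifold with a Euclidean space\<close>

lemma smooth_on_Pair:
  assumes "open S" "smooth_on S f" "smooth_on S g"
  shows "smooth_on S (\<lambda>x. (f x, g x))"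
proof -
  have "smooth_on S (\<lambda>x. (f x, 0) + (0, g x))"
    by (intro smooth_on_add smooth_on_bounded_linear[of "\<lambda>u. (u, 0)"] smooth_on_bounded_linear[of "\<lambda>u. (0, u)"] assms
        bounded_linear_Pair bounded_linear_ident bounded_linear_zero)
  then show ?thesis by simp
qed

lemma (in smooth_mfd) smooth_in_Pair:
  "open V \<Longrightarrow> smooth_in M V f \<Longrightarrow> smooth_in M V g \<Longrightarrow> smooth_in M V (\<lambda>x. (f x, g x))"
  unfolding smooth_in_def comp_def by (intro allI, rule smooth_on_Pair; simp add: image_open)

context smooth_mfd
begin

lemma prod_chart [simp]:
  "chart_dom (P_mfd M) q = chart_dom M (fst q) \<times> UNIV"
  "chart_map (P_mfd M) q = (\<lambda>y. (chart_map M (fst q) (fst y), snd y))"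
  by (simp_all add: prod_mfd_def chart_dom_def[of "case_prod _"] chart_map_def[of "case_prod _"] split_beta fun_eq_iff)

lemma prod_image: "chart_map (P_mfd M) q ` (V \<times> T) = (chart_map M (fst q) ` V) \<times> T"
  by force

lemma prod_chart_inv:
  assumes "y \<in> chart_map M (fst q) ` chart_dom M (fst q)"
  shows "chart_inv (P_mfd M) q (y, t) = (chart_inv M (fst q) y, t)"
proof -
  obtain x where x: "x \<in> chart_dom M (fst q)" "y = chart_map M (fst q) x" using assms by blast
  have "inj_on (chart_map (P_mfd M) q) (chart_dom (P_mfd M) q)"
    by (rule inj_on_inverseI[where g = "\<lambda>y. (chart_inv M (fst q) (fst y), snd y)"]) auto
  from inv_into_f_f[OF this, of "(x, t)"] x show ?thesis by (simp add: chart_inv_def[of "P_mfd M"])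
qed

lemma smooth_manifold_prod: "smooth_manifold (P_mfd M)"
  unfolding smooth_manifold_def chart_img_def
proof (intro conjI allI)
  fix q r :: "'m \<times> real"
  show "q \<in> chart_dom (P_mfd M) q" by (cases q) auto
  show "open (chart_dom (P_mfd M) q)" by (simp add: open_Times)
  show "open (chart_map (P_mfd M) q ` chart_dom (P_mfd M) q)"
    unfolding prod_chart(1) prod_image by (simp add: open_Times)
  show "homeomorphism (chart_dom (P_mfd M) q) (chart_map (P_mfd M) q ` chart_dom (P_mfd M) q) (chart_map (P_mfd M) q) (chart_inv (P_mfd M) q)"
    unfolding homeomorphism_def prod_chart(1) prod_image
  proof (intro conjI)
    show "continuous_on (chart_dom M (fst q) \<times> UNIV) (chart_map (P_mfd M) q)"
      unfolding prod_chart by (intro continuous_intros continuous_on_compose2[OF chart_continuous]) auto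
    have "continuous_on (chart_map M (fst q) ` chart_dom M (fst q) \<times> UNIV) (\<lambda>y. (chart_inv M (fst q) (fst y), snd y :: real))"
      by (intro continuous_intros continuous_on_compose2[OF chart_inv_continuous]) auto
    then show "continuous_on (chart_map M (fst q) ` chart_dom M (fst q) \<times> UNIV) (chart_inv (P_mfd M) q)"
      by (rule continuous_on_eq) (auto simp: prod_chart_inv)
    show "chart_inv (P_mfd M) q ` (chart_map M (fst q) ` chart_dom M (fst q) \<times> UNIV) = chart_dom M (fst q) \<times> UNIV"
      by (force simp: prod_chart_inv)
  qed (auto simp: prod_chart_inv)
  let ?S = "chart_map (P_mfd M) q ` (chart_dom (P_mfd M) q \<inter> chart_dom (P_mfd M) r)"
  have S: "?S = chart_map M (fst q) ` (chart_dom M (fst q) \<inter> chart_dom M (fst r)) \<times> UNIV"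
    by (force simp: prod_chart)
  let ?T = "chart_map M (fst q) ` (chart_dom M (fst q) \<inter> chart_dom M (fst r))"
  have oT: "open ?T" by (intro image_open' open_Int) auto
  have o: "open (?T \<times> (UNIV :: real set))" by (intro open_Times oT open_UNIV)
  have "smooth_on (?T \<times> UNIV) (\<lambda>y. ((chart_map M (fst r) \<circ> chart_inv M (fst q)) (fst y), snd y :: real))"
    by (rule smooth_on_Pair[OF o smooth_on_compose[OF o oT smooth_on_bounded_linear[OF bounded_linear_fst o smooth_on_ident] chart_change_smooth]
        smooth_on_bounded_linear[OF bounded_linear_snd o smooth_on_ident]]) auto
  then show "smooth_on ?S (chart_map (P_mfd M) r \<circ> chart_inv (P_mfd M) q)"
    unfolding S by (rule smooth_on_cong[OF o, rotated]) (auto simp: S prod_chart_inv)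
qed

end

locale mfd_times_line = M: smooth_mfd M
  for M :: "('m::{t2_space,second_countable_topology}, 'e::euclidean_space) manifold"
begin

sublocale P: smooth_mfd "P_mfd M"
  by unfold_locales (rule M.smooth_manifold_prod)

lemma smooth_in_snd: "smooth_in (P_mfd M) V snd"
proof (rule P.smooth_in_mono[OF P.smooth_in_local subset_UNIV])
  fix q :: "'m \<times> real"
  have "smooth_in (P_mfd M) (chart_dom (P_mfd M) q) (\<lambda>y. snd (chart_map (P_mfd M) q y))"
    by (rule P.smooth_in_bounded_linear[OF bounded_linear_snd P.dom_open P.smooth_in_chart])
  then show "\<exists>W. open W \<and> q \<in> W \<and> smooth_in (P_mfd M) W snd"
    using P.dom_open[of q] P.dom_mem[of q] by (intro exI[of _ "chart_dom (P_mfd M) q"]) (simp del: P.dom_open)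
qed

lemma smooth_map_fst: "smooth_map (P_mfd M) M fst"
  unfolding smooth_map_iff
proof (intro conjI allI P.smooth_in_chartI)
  fix b
  have e: "fst -` chart_dom M b = chart_dom (P_mfd M) (b, 0)" by auto
  show "continuous_on UNIV (fst :: 'm \<times> real \<Rightarrow> 'm)" by (intro continuous_intros)
  have "smooth_in (P_mfd M) (chart_dom (P_mfd M) (b, 0)) (\<lambda>y. fst (chart_map (P_mfd M) (b, 0) y))"
    by (rule P.smooth_in_bounded_linear[OF bounded_linear_fst P.dom_open P.smooth_in_chart])
  then have "smooth_in (P_mfd M) (fst -` chart_dom M b) (chart_map M b \<circ> fst)"
    unfolding e by (simp add: comp_def)
  then show "smooth_on (chart_map (P_mfd M) (b, 0) ` (fst -` chart_dom M b)) ((chart_map M b \<circ> fst) \<circ> chart_inv (P_mfd M) (b, 0))"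
    by (rule P.smooth_inD) (auto simp: e)
  show "open (fst -` chart_dom M b :: ('m \<times> real) set)" unfolding e by (rule P.dom_open)
  show "fst -` chart_dom M b \<subseteq> chart_dom (P_mfd M) (b, 0)" unfolding e ..
qed

sublocale fst: smooth_mfd_map "P_mfd M" M fst
  by unfold_locales (rule smooth_map_fst)

lemma tmap_fst [simp]: "tmap (P_mfd M) M fst q u = fst u"
proof -
  have "dderiv (P_mfd M) (\<lambda>y. fst (chart_map (P_mfd M) q y)) q u = fst (dderiv (P_mfd M) (chart_map (P_mfd M) q) q u)"
    by (rule P.dderiv_bounded_linear[OF P.dom_open P.dom_mem bounded_linear_fst P.smooth_in_chart])
  then show ?thesis
    by (simp only: P.dderiv_chart_self) (simp add: tmap_eq_dderiv comp_def)
qed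

lemma dderiv_snd [simp]: "dderiv (P_mfd M) snd q u = snd u"
proof -
  have "dderiv (P_mfd M) (\<lambda>y. snd (chart_map (P_mfd M) q y)) q u = snd (dderiv (P_mfd M) (chart_map (P_mfd M) q) q u)"
    by (rule P.dderiv_bounded_linear[OF P.dom_open P.dom_mem bounded_linear_snd P.smooth_in_chart])
  then show ?thesis
    by (simp only: P.dderiv_chart_self) simp
qed

lemma fst_vec_of_chart:
  assumes "fst q \<in> chart_dom M (fst a)"
  shows "fst (vec_of_chart (P_mfd M) a q v) = vec_of_chart M (fst a) (fst q) (fst v)"
proof -
  have qa: "q \<in> chart_dom (P_mfd M) a" using assms by (cases q) auto
  let ?w = "vec_of_chart (P_mfd M) a q v"
  have "fst (dderiv (P_mfd M) (chart_map (P_mfd M) a) q ?w) = dderiv (P_mfd M) (\<lambda>y. fst (chart_map (P_mfd M) a y)) q ?w"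
    by (rule P.dderiv_bounded_linear[OF P.dom_open qa bounded_linear_fst P.smooth_in_chart, symmetric])
  also have "\<dots> = dderiv M (chart_map M (fst a)) (fst q) (fst ?w)"
    using fst.dderiv_comp[OF M.dom_open assms M.smooth_in_chart] by simp
  finally have "vec_to_chart M (fst a) (fst q) (fst ?w) = fst v"
    using P.vec_to_of_chart[OF qa, of v] by (simp only: vec_to_chart_eq_dderiv)
  then show ?thesis using M.vec_of_to_chart[OF assms, of "fst ?w"] by simp
qed

end

context smooth_mfd_map
begin

lemma smooth_in_pullback1:
  assumes \<alpha>: "smooth_form1 N \<alpha>" and V: "open V" and X: "vf_in M V X"
  shows "smooth_in M V (\<lambda>x. \<alpha> (F x) (tmap M N F x (X x)))"
proof (rule M.smooth_in_local)
  fix x assume x: "x \<in> V"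
  let ?b = "F x"
  define W where "W = V \<inter> F -` chart_dom N ?b"
  have W: "open W" "x \<in> W" "W \<subseteq> V" "W \<subseteq> F -` chart_dom N ?b" using V x open_vimage_F by (auto simp: W_def)
  have a: "smooth_in M W (\<lambda>y. \<alpha> (F y) (vec_of_chart N ?b (F y) i))" for i
    using smooth_in_comp[OF N.dom_open N.smooth_in_form1[OF \<alpha> N.dom_open N.vf_in_coordinate]] W(4) M.smooth_in_mono by blast
  have "smooth_in M W (\<lambda>y. \<Sum>i\<in>Basis. (vec_to_chart N ?b (F y) (tmap M N F y (X y)) \<bullet> i) *\<^sub>R \<alpha> (F y) (vec_of_chart N ?b (F y) i))"
    by (intro M.smooth_in_sum M.smooth_in_scaleR M.smooth_in_inner M.smooth_in_const a W smooth_in_tmap M.vf_in_mono[OF X])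
  then have "smooth_in M W (\<lambda>x. \<alpha> (F x) (tmap M N F x (X x)))"
  proof (rule M.smooth_in_cong[OF W(1), rotated])
    fix y assume y: "y \<in> W"
    then have yb: "F y \<in> chart_dom N ?b" using W by auto
    have l: "linear (\<lambda>v. \<alpha> (F y) (vec_of_chart N ?b (F y) v))"
      using \<alpha> linear_compose[OF N.linear_vec_of_chart[OF yb], of "\<alpha> (F y)"] by (simp add: smooth_form1_def comp_def)
    show "(\<Sum>i\<in>Basis. (vec_to_chart N ?b (F y) (tmap M N F y (X y)) \<bullet> i) *\<^sub>R \<alpha> (F y) (vec_of_chart N ?b (F y) i)) = \<alpha> (F y) (tmap M N F y (X y))"
      unfolding linear_basis_expand[OF l, symmetric] using yb by simp
  qed
  then show "\<exists>W. open W \<and> x \<in> W \<and> smooth_in M W (\<lambda>x. \<alpha> (F x) (tmap M N F x (X x)))" using W by blast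
qed

lemma smooth_in_pullback2:
  assumes b: "smooth_tensor2 N b" and V: "open V" and X: "vf_in M V X" and Y: "vf_in M V Y"
  shows "smooth_in M V (\<lambda>x. b (F x) (tmap M N F x (X x)) (tmap M N F x (Y x)))"
proof (rule M.smooth_in_local)
  fix x assume x: "x \<in> V"
  let ?b = "F x"
  define W where "W = V \<inter> F -` chart_dom N ?b"
  have W: "open W" "x \<in> W" "W \<subseteq> V" "W \<subseteq> F -` chart_dom N ?b" using V x open_vimage_F by (auto simp: W_def)
  have a: "smooth_in M W (\<lambda>y. b (F y) (vec_of_chart N ?b (F y) i) (vec_of_chart N ?b (F y) j))" for i j
    using smooth_in_comp[OF N.dom_open N.smooth_in_tensor2[OF b N.dom_open N.vf_in_coordinate N.vf_in_coordinate]] W(4) M.smooth_in_mono by blast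
  have "smooth_in M W (\<lambda>y. \<Sum>i\<in>Basis. (vec_to_chart N ?b (F y) (tmap M N F y (X y)) \<bullet> i) *\<^sub>R
      (\<Sum>j\<in>Basis. (vec_to_chart N ?b (F y) (tmap M N F y (Y y)) \<bullet> j) *\<^sub>R b (F y) (vec_of_chart N ?b (F y) i) (vec_of_chart N ?b (F y) j)))"
    by (intro M.smooth_in_sum M.smooth_in_scaleR M.smooth_in_inner M.smooth_in_const a W smooth_in_tmap M.vf_in_mono[OF X] M.vf_in_mono[OF Y])
  then have "smooth_in M W (\<lambda>x. b (F x) (tmap M N F x (X x)) (tmap M N F x (Y x)))"
  proof (rule M.smooth_in_cong[OF W(1), rotated])
    fix y assume y: "y \<in> W"
    then have yb: "F y \<in> chart_dom N ?b" using W by auto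
    have bl: "bilinear (b (F y))" using b by (simp add: smooth_tensor2_def)
    have 1: "linear (\<lambda>v. b (F y) (vec_of_chart N ?b (F y) v) w)" for w
      using bl linear_compose[OF N.linear_vec_of_chart[OF yb], of "\<lambda>u. b (F y) u w"] by (simp add: bilinear_def comp_def)
    have 2: "linear (\<lambda>v. b (F y) w (vec_of_chart N ?b (F y) v))" for w
      using bl linear_compose[OF N.linear_vec_of_chart[OF yb], of "b (F y) w"] by (simp add: bilinear_def comp_def)
    show "(\<Sum>i\<in>Basis. (vec_to_chart N ?b (F y) (tmap M N F y (X y)) \<bullet> i) *\<^sub>R
      (\<Sum>j\<in>Basis. (vec_to_chart N ?b (F y) (tmap M N F y (Y y)) \<bullet> j) *\<^sub>R b (F y) (vec_of_chart N ?b (F y) i) (vec_of_chart N ?b (F y) j)))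
      = b (F y) (tmap M N F y (X y)) (tmap M N F y (Y y))"
      unfolding linear_basis_expand[OF 2, symmetric] linear_basis_expand[OF 1, symmetric] using yb by simp
  qed
  then show "\<exists>W. open W \<and> x \<in> W \<and> smooth_in M W (\<lambda>x. b (F x) (tmap M N F x (X x)) (tmap M N F x (Y x)))" using W by blast
qed

end

section \<open>The induced symplectic manifold\<close>

locale contact_base =
  fixes n :: nat
    and M :: "('m::{t2_space,second_countable_topology}, 'e::euclidean_space) manifold"
    and N :: "('n::{t2_space,second_countable_topology}, 'f::euclidean_space) manifold"
    and \<alpha> :: "'n \<Rightarrow> 'f \<Rightarrow> real"
    and \<pi> :: "'n \<Rightarrow> 'm"
    and \<omega> :: "'m \<Rightarrow> 'e \<Rightarrow> 'e \<Rightarrow> real"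
  assumes quadruple: "contact_quadruple n M N \<alpha> \<pi> \<omega>"
begin

sublocale M: symp_mfd M \<omega>
  by unfold_locales (use quadruple in \<open>auto simp: contact_quadruple_def\<close>)

sublocale N: smooth_mfd N
  by unfold_locales (use quadruple in \<open>auto simp: contact_quadruple_def\<close>)

sublocale P: smooth_mfd "P_mfd N"
  by unfold_locales (rule N.smooth_manifold_prod)

sublocale NR: mfd_times_line N
  by unfold_locales

sublocale pi: smooth_mfd_map N M \<pi>
  by unfold_locales (use quadruple in \<open>auto simp: contact_quadruple_def surj_submersion_def\<close>)

sublocale p: smooth_mfd_map "P_mfd N" M "\<pi> \<circ> fst"
  by unfold_locales
     (rule smooth_map_compose[OF NR.fst.smooth_mfd_map_axioms pi.smooth_mfd_map_axioms])

abbreviation VFM :: "('m \<Rightarrow> 'e) \<Rightarrow> bool" where "VFM \<equiv> vf_in M UNIV"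
abbreviation VFP :: "('n \<times> real \<Rightarrow> 'f \<times> real) \<Rightarrow> bool" where "VFP \<equiv> vf_in (P_mfd N) UNIV"
abbreviation SFP :: "('n \<times> real \<Rightarrow> real) \<Rightarrow> bool" where "SFP \<equiv> smooth_in (P_mfd N) UNIV"
abbreviation prj :: "'n \<times> real \<Rightarrow> 'm" where "prj q \<equiv> \<pi> (fst q)"
abbreviation pT :: "'n \<times> real \<Rightarrow> 'f \<times> real \<Rightarrow> 'e" where "pT q w \<equiv> tmap N M \<pi> (fst q) (fst w)"
abbreviation a :: "'n \<times> real \<Rightarrow> 'f \<times> real \<Rightarrow> real" where "a q w \<equiv> \<alpha> (fst q) (fst w)"

lemma dim_M: "DIM('e) = 2 * n" and dim_N: "DIM('f) = 2 * n + 1"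
  and form_alpha: "smooth_form1 N \<alpha>" and surj_pi: "surj (tmap N M \<pi> x)"
  and d_alpha: "ext_d1 N \<alpha> x z w = \<omega> (\<pi> x) (tmap N M \<pi> x z) (tmap N M \<pi> x w)"
  using quadruple unfolding contact_quadruple_def contact_form_def surj_submersion_def
  by (auto simp: pullback2_def)

lemma linear_alpha: "linear (\<alpha> x)"
  using form_alpha by (simp add: smooth_form1_def)

lemma tmap_prj: "tmap (P_mfd N) M (\<pi> \<circ> fst) q w = pT q w"
  using tmap_compose[OF NR.fst.smooth_mfd_map_axioms pi.smooth_mfd_map_axioms] by simp

lemma tmap_prj': "tmap (P_mfd N) M (\<lambda>q. prj q) q w = pT q w"
  using tmap_prj by (simp add: comp_def)

lemmas tangent_simps [simp] = linear_add[OF pi.linear_tmap] linear_diff[OF pi.linear_tmap] linear_scale[OF pi.linear_tmap]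
  linear_0[OF pi.linear_tmap] linear_neg[OF pi.linear_tmap] linear_add[OF linear_alpha] linear_diff[OF linear_alpha] linear_scale[OF linear_alpha]
  linear_0[OF linear_alpha] linear_neg[OF linear_alpha]

text \<open>
  A vector \<open>z\<close> with \<open>\<pi>\<^sub>*z = 0\<close> is in the kernel of \<open>d\<alpha> = \<pi>\<^sup>*\<omega>\<close>; if also \<open>\<alpha>(z) = 0\<close>, it is a common null vector
  of \<open>\<alpha>\<close> and \<open>d\<alpha>\<close>.
\<close>

lemma tangent_N_zero:
  assumes "tmap N M \<pi> x z = 0" "\<alpha> x z = 0"
  shows "z = 0"
proof -
  interpret x: symplectic_space "\<omega> (\<pi> x)" by (rule M.symplectic_space)
  obtain v where v: "wedge 1 (2 * n) (\<lambda>v. \<alpha> x (v 0)) (wedge_pow2 (\<lambda>v. ext_d1 N \<alpha> x (v 0) (v 1)) n) v \<noteq> 0"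
    using quadruple unfolding contact_quadruple_def contact_form_def by blast
  show ?thesis
  proof (rule contact_no_null_vector[OF linear_alpha _ dim_N v])
    show "bilinear (ext_d1 N \<alpha> x)"
      by (auto simp: bilinear_def d_alpha x.form_simps intro!: linearI)
  qed (use assms in \<open>auto simp: d_alpha x.form_simps\<close>)
qed

lemma tangent_N_eqI: "tmap N M \<pi> x z = tmap N M \<pi> x w \<Longrightarrow> \<alpha> x z = \<alpha> x w \<Longrightarrow> z = w"
  using tangent_N_zero[of x "z - w"] by simp

lemma tangent_N_ex: "\<exists>!z. tmap N M \<pi> x z = u \<and> \<alpha> x z = c"
proof -
  let ?B = "\<lambda>z. (tmap N M \<pi> x z, \<alpha> x z)"
  have lin: "linear ?B" by (auto intro!: linearI)
  have "inj ?B" unfolding linear_injective_0[OF lin] using tangent_N_zero by (auto simp: zero_prod_def)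
  moreover have "DIM('f) = DIM('e \<times> real)" by (simp add: dim_M dim_N)
  ultimately have "surj ?B" using linear_injective_imp_surjective[OF lin] by (simp add: dim_UNIV)
  from surjD[OF this, of "(u, c)"] obtain z where "tmap N M \<pi> x z = u" "\<alpha> x z = c" by auto
  then show ?thesis using tangent_N_eqI by (intro ex1I[of _ z]) auto
qed

text \<open>
  The tangent vector of \<open>N\<close> with given projection and given value of \<open>\<alpha>\<close>. The horizontal lifts and the
  fields \<open>E\<close> and \<open>S\<close> of the induced connection are expressed by it.
\<close>

definition up :: "'n \<Rightarrow> 'e \<Rightarrow> real \<Rightarrow> 'f" where
  "up x u c = (THE z. tmap N M \<pi> x z = u \<and> \<alpha> x z = c)"

lemma up [simp]: "tmap N M \<pi> x (up x u c) = u" "\<alpha> x (up x u c) = c"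
  using theI'[OF tangent_N_ex[of x u c]] by (auto simp: up_def)

definition hl :: "'n \<times> real \<Rightarrow> 'e \<Rightarrow> 'f \<times> real" where "hl q u = (up (fst q) u 0, 0)"
definition E :: "'n \<times> real \<Rightarrow> 'f \<times> real" where "E q = (up (fst q) 0 1, 0)"
definition S :: "'n \<times> real \<Rightarrow> 'f \<times> real" where "S q = (0, 1)"

abbreviation HL :: "('m \<Rightarrow> 'e) \<Rightarrow> 'n \<times> real \<Rightarrow> 'f \<times> real" where "HL X \<equiv> (\<lambda>q. hl q (X (prj q)))"

lemma frame_simps [simp]:
  "pT q (hl q u) = u" "a q (hl q u) = 0" "snd (hl q u) = 0"
  "pT q (E q) = 0" "a q (E q) = 1" "snd (E q) = 0"
  "pT q (S q) = 0" "a q (S q) = 0" "snd (S q) = 1"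
  by (simp_all add: hl_def E_def S_def)

lemma tangent_eqI: "pT q v = pT q w \<Longrightarrow> a q v = a q w \<Longrightarrow> snd v = snd w \<Longrightarrow> v = w"
  using tangent_N_eqI by (simp add: prod_eq_iff)

lemma decompose: "w = hl q (pT q w) + a q w *\<^sub>R E q + snd w *\<^sub>R S q"
  by (rule tangent_eqI[of q]) simp_all

lemma linear_hl: "linear (hl q)"
  by (rule linearI; rule tangent_eqI[of q]) simp_all

lemmas hl_simps = linear_add[OF linear_hl] linear_diff[OF linear_hl] linear_scale[OF linear_hl] linear_0[OF linear_hl] linear_neg[OF linear_hl]

lemma ds_form_eq: "ds_form N q w = snd w"
  by (simp add: ds_form_def tmap_euclid)

lemma p1_alpha_eq: "p1_alpha N \<alpha> q w = a q w"
  by (simp add: p1_alpha_def pullback1_def)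

text \<open>As \<open>\<omega>\<close> is nondegenerate, the kernel of \<open>d\<alpha>\<close> is the kernel of \<open>\<pi>\<^sub>*\<close>.\<close>

lemma reeb_eq: "reeb N \<alpha> x = up x 0 1"
  unfolding reeb_def
proof (rule the_equality)
  interpret x: symplectic_space "\<omega> (\<pi> x)" by (rule M.symplectic_space)
  show "(\<forall>w. ext_d1 N \<alpha> x (up x 0 1) w = 0) \<and> \<alpha> x (up x 0 1) = 1" by (simp add: d_alpha x.form_simps)
  fix z assume z: "(\<forall>w. ext_d1 N \<alpha> x z w = 0) \<and> \<alpha> x z = 1"
  have "\<omega> (\<pi> x) (tmap N M \<pi> x z) v = 0" for v
    using z surjD[OF surj_pi[of x], of v] by (auto simp: d_alpha)
  then have "tmap N M \<pi> x z = 0" by (rule x.nondeg)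
  then show "z = up x 0 1" using z by (intro tangent_N_eqI[of x]) auto
qed

lemma E_field_eq: "E_field N \<alpha> = E"
  unfolding E_field_def by (rule ext, rule the_equality) (auto simp: ds_form_eq reeb_eq E_def prod_eq_iff)

lemma s_field_eq: "s_field N = S"
  unfolding s_field_def by (rule ext, rule the_equality) (auto simp: ds_form_eq S_def prod_eq_iff)

lemma hlift_eq: "hlift M N \<alpha> \<pi> X = HL X"
  unfolding hlift_def tmap_prj p1_alpha_eq ds_form_eq
proof (rule ext, rule the_equality)
  fix q w assume "pT q w = X ((\<pi> \<circ> fst) q) \<and> a q w = 0 \<and> snd w = 0"
  then show "w = HL X q" by (intro tangent_eqI[of q]) simp_all
qed simp

subsection \<open>Smoothness of the frame\<close>

lemma smooth_a: "VFP B \<Longrightarrow> SFP (\<lambda>q. a q (B q))"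
  using NR.fst.smooth_in_pullback1[OF form_alpha open_UNIV] by simp

lemma smooth_snd: "VFP B \<Longrightarrow> SFP (\<lambda>q. snd (B q))"
  using P.smooth_in_dderiv[OF open_UNIV NR.smooth_in_snd] by simp

lemma smooth_pT:
  "VFP B \<Longrightarrow> smooth_in (P_mfd N) ((\<lambda>q. prj q) -` chart_dom M b) (\<lambda>q. vec_to_chart M b (prj q) (pT q (B q)))"
  using p.smooth_in_tmap[OF p.open_vimage_F[OF M.dom_open] order_refl P.vf_in_mono[OF _ subset_UNIV], of B b]
  by (simp add: tmap_prj' comp_def vimage_def)

lemma open_prj: "open W \<Longrightarrow> open ((\<lambda>q. prj q) -` W)"
  using p.open_vimage_F by (simp add: comp_def)

text \<open>
  The components of \<open>B\<close> in a chart of \<open>P\<close> solve a linear system: its right-hand side consists of the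
  three given data, and its coefficients are the same data for the coordinate fields.
\<close>

lemma vf_P_I:
  assumes 1: "\<And>b. smooth_in (P_mfd N) ((\<lambda>q. prj q) -` chart_dom M b) (\<lambda>q. vec_to_chart M b (prj q) (pT q (B q)))"
    and 2: "SFP (\<lambda>q. a q (B q))" and 3: "SFP (\<lambda>q. snd (B q))"
  shows "VFP B"
proof (rule P.vf_in_local)
  fix r :: "'n \<times> real"
  define V where "V = chart_dom (P_mfd N) r \<inter> (\<lambda>q. prj q) -` chart_dom M (prj r)"
  have V: "open V" "r \<in> V" "V \<subseteq> chart_dom (P_mfd N) r" "V \<subseteq> (\<lambda>q. prj q) -` chart_dom M (prj r)"
    unfolding V_def by (auto intro!: open_Int open_prj simp: open_Times mem_Times_iff)
  define K where "K q v = vec_of_chart (P_mfd N) r q v" for q v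
  have lK: "linear (K q)" if "q \<in> V" for q unfolding K_def using P.linear_vec_of_chart that V by blast
  define A where "A q v = (vec_to_chart M (prj r) (prj q) (pT q (K q v)), a q (K q v), snd (K q v))" for q v
  have lv: "linear (vec_to_chart M (prj r) (prj q))" if "q \<in> V" for q using M.linear_vec_to_chart that V by blast
  have "smooth_in (P_mfd N) V (\<lambda>q. vec_to_chart (P_mfd N) r q (B q))"
  proof (rule P.smooth_in_linear_solve[OF V(1), where A = A])
    fix q assume q: "q \<in> V"
    show l: "linear (A q)"
      unfolding A_def
      by (rule linearI) (simp_all add: linear_add[OF lK[OF q]] linear_scale[OF lK[OF q]] linear_add[OF lv[OF q]] linear_scale[OF lv[OF q]])
    show "inj (A q)"
      unfolding linear_injective_0[OF l]
    proof (intro allI impI)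
      fix v assume v: "A q v = 0"
      then have "vec_of_chart M (prj r) (prj q) (vec_to_chart M (prj r) (prj q) (pT q (K q v))) = vec_of_chart M (prj r) (prj q) 0"
        by (simp add: A_def zero_prod_def)
      then have "pT q (K q v) = 0"
        using q V(4) linear_0[OF M.linear_vec_of_chart, of "prj q" "prj r"] by auto
      then have "K q v = 0" using v by (intro tangent_eqI[of q]) (simp_all add: A_def zero_prod_def)
      then have "vec_to_chart (P_mfd N) r q (K q v) = 0"
        using q V(3) linear_0[OF P.linear_vec_to_chart, of q r] by auto
      then show "v = 0" unfolding K_def using q V(3) P.vec_to_of_chart[of q r v] by auto
    qed
    show "A q (vec_to_chart (P_mfd N) r q (B q)) = (vec_to_chart M (prj r) (prj q) (pT q (B q)), a q (B q), snd (B q))"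
      using q V(3) P.vec_of_to_chart[of q r "B q"] by (auto simp: A_def K_def)
  next
    fix v
    obtain X W where X: "VFP X" "open W" "r \<in> W" "W \<subseteq> chart_dom (P_mfd N) r" "\<And>q. q \<in> W \<Longrightarrow> X q = vec_of_chart (P_mfd N) r q v"
      using P.coordinate_extension by metis
    show "smooth_in (P_mfd N) V (\<lambda>q. A q v)"
    proof (rule P.smooth_in_local)
      fix y assume y: "y \<in> V"
      obtain X W where X: "VFP X" "open W" "y \<in> W" "W \<subseteq> V" "\<And>q. q \<in> W \<Longrightarrow> X q = K q v"
        using P.extend_vf[OF V(1) y P.vf_in_mono[OF P.vf_in_coordinate V(3)], of v] unfolding K_def by metis
      have "smooth_in (P_mfd N) W (\<lambda>q. (vec_to_chart M (prj r) (prj q) (pT q (X q)), a q (X q), snd (X q)))"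
        using V(4) X(4)
        by (intro P.smooth_in_Pair X P.smooth_in_mono[OF smooth_pT[OF X(1)]] P.smooth_in_mono[OF smooth_a[OF X(1)]] P.smooth_in_mono[OF smooth_snd[OF X(1)]]) auto
      then have "smooth_in (P_mfd N) W (\<lambda>q. A q v)"
        by (rule P.smooth_in_cong[OF X(2), rotated]) (simp add: A_def X(5))
      then show "\<exists>W. open W \<and> y \<in> W \<and> smooth_in (P_mfd N) W (\<lambda>q. A q v)" using X by blast
    qed
  next
    show "smooth_in (P_mfd N) V (\<lambda>q. (vec_to_chart M (prj r) (prj q) (pT q (B q)), a q (B q), snd (B q)))"
      by (intro P.smooth_in_Pair V P.smooth_in_mono[OF 1 V(4)] P.smooth_in_mono[OF 2] P.smooth_in_mono[OF 3]) auto
  qed (simp add: dim_M dim_N)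
  then show "\<exists>W. open W \<and> r \<in> W \<and> vf_in (P_mfd N) W B"
    using P.vf_in_chartI[OF V(1,3)] V(1,2) by blast
qed

lemma smooth_prj: "smooth_in M UNIV g \<Longrightarrow> smooth_in (P_mfd N) UNIV (\<lambda>q. g (prj q))"
  using p.smooth_in_comp_UNIV by simp

lemma vf_HL [intro]: "VFM X \<Longrightarrow> VFP (HL X)"
proof (rule vf_P_I)
  fix b assume "VFM X"
  then have "smooth_in M (chart_dom M b) (\<lambda>x. vec_to_chart M b x (X x))" by (simp add: vf_in_def)
  from p.smooth_in_comp[OF M.dom_open this]
  show "smooth_in (P_mfd N) ((\<lambda>q. prj q) -` chart_dom M b) (\<lambda>q. vec_to_chart M b (prj q) (pT q (HL X q)))" by (simp add: comp_def)
qed (simp_all add: P.smooth_in_const)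

lemma vf_ES [intro, simp]: "VFP E" "VFP S"
proof -
  have *: "smooth_in (P_mfd N) ((\<lambda>q. prj q) -` chart_dom M b) (\<lambda>q. vec_to_chart M b (prj q) 0)" for b
    by (rule P.smooth_in_cong[OF open_prj[OF M.dom_open] _ P.smooth_in_const[of _ 0]])
       (simp add: linear_0[OF M.linear_vec_to_chart])
  show "VFP E" "VFP S" by (rule vf_P_I; simp add: P.smooth_in_const *)+
qed

lemma dderiv_prj: "smooth_in M UNIV g \<Longrightarrow> dderiv (P_mfd N) (\<lambda>q. g (prj q)) q w = dderiv M g (prj q) (pT q w)"
  using p.dderiv_comp[OF open_UNIV UNIV_I, of g q w] by (simp add: tmap_prj)

subsection \<open>Brackets\<close>

lemma ext_d1_p1_alpha: "ext_d1 (P_mfd N) (p1_alpha N \<alpha>) q u v = \<omega> (prj q) (pT q u) (pT q v)"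
proof -
  have W: "open (fst -` chart_dom N (fst q) :: ('n \<times> real) set)" "q \<in> fst -` chart_dom N (fst q)"
    using NR.fst.open_vimage_F[OF N.dom_open] by auto
  have "dderiv (P_mfd N) (\<lambda>y. p1_alpha N \<alpha> y (vec_of_chart (P_mfd N) q y v)) q u
     = dderiv N (\<lambda>y. \<alpha> y (vec_of_chart N (fst q) y (fst v))) (fst q) (fst u)" for u v
  proof -
    have "dderiv (P_mfd N) (\<lambda>y. p1_alpha N \<alpha> y (vec_of_chart (P_mfd N) q y v)) q u
      = dderiv (P_mfd N) (\<lambda>y. \<alpha> (fst y) (vec_of_chart N (fst q) (fst y) (fst v))) q u"
      by (intro fun_cong[OF P.dderiv_cong[OF W]]) (simp add: p1_alpha_eq NR.fst_vec_of_chart)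
    then show ?thesis
      using NR.fst.dderiv_comp[OF N.dom_open _ N.smooth_in_form1[OF form_alpha N.dom_open N.vf_in_coordinate], of q "fst q" "fst v" u]
      by simp
  qed
  then show ?thesis unfolding P.ext_d1_dderiv d_alpha[symmetric] N.ext_d1_dderiv by simp
qed

lemma form_p1_alpha: "smooth_form1 (P_mfd N) (p1_alpha N \<alpha>)"
  by (rule P.smooth_form1I) (auto intro!: linearI simp: p1_alpha_eq smooth_a)

text \<open>
  The horizontal part is determined by relatedness. The \<open>E\<close>-component is minus \<open>d(p\<^sub>1\<^sup>*\<alpha>)\<close> of the two fields, because
  the values of \<open>p\<^sub>1\<^sup>*\<alpha>\<close> on them are constant: it measures that horizontal directions are not integrable.
\<close>

lemma bracket_projectable:
  assumes A: "VFP A" "VFM A'" "\<And>q. pT q (A q) = A' (prj q)" "\<And>q. a q (A q) = c" "\<And>q. snd (A q) = d"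
    and B: "VFP B" "VFM B'" "\<And>q. pT q (B q) = B' (prj q)" "\<And>q. a q (B q) = c'" "\<And>q. snd (B q) = d'"
  shows "lie_bracket (P_mfd N) A B q = hl q (lie_bracket M A' B' (prj q)) - \<omega> (prj q) (A' (prj q)) (B' (prj q)) *\<^sub>R E q"
proof (rule tangent_eqI[of q])
  let ?b = "lie_bracket (P_mfd N) A B q"
  show "pT q ?b = pT q (hl q (lie_bracket M A' B' (prj q)) - \<omega> (prj q) (A' (prj q)) (B' (prj q)) *\<^sub>R E q)"
    using p.lie_bracket_related[OF A(1) B(1) A(2) B(2), of q] A(3) B(3) by (simp add: tmap_prj)
  show "a q ?b = a q (hl q (lie_bracket M A' B' (prj q)) - \<omega> (prj q) (A' (prj q)) (B' (prj q)) *\<^sub>R E q)"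
    using P.ext_d1_fields[OF form_p1_alpha A(1) B(1), of q] A(3,4) B(3,4) by (simp add: p1_alpha_eq ext_d1_p1_alpha)
  show "snd ?b = snd (hl q (lie_bracket M A' B' (prj q)) - \<omega> (prj q) (A' (prj q)) (B' (prj q)) *\<^sub>R E q)"
    using P.dderiv_lie_bracket[OF open_UNIV UNIV_I NR.smooth_in_snd A(1) B(1), of q] A(5) B(5) by simp
qed

lemma lie_bracket_zero_field [simp]: "VFM X \<Longrightarrow> lie_bracket M (\<lambda>x. 0) X x = 0" "VFM X \<Longrightarrow> lie_bracket M X (\<lambda>x. 0) x = 0"
  using M.lie_bracket_scaleR_left[OF refl M.vf_in_zero _ M.smooth_in_const[of _ 0], of X x]
    M.lie_bracket_scaleR_right[OF _ M.vf_in_zero M.smooth_in_const[of _ 0], of X x] by simp_all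

lemma bracket_HL: "VFM X \<Longrightarrow> VFM Y \<Longrightarrow> lie_bracket (P_mfd N) (HL X) (HL Y) q = HL (lie_bracket M X Y) q - \<omega> (prj q) (X (prj q)) (Y (prj q)) *\<^sub>R E q"
  by (rule bracket_projectable) auto

lemma bracket_vertical:
  assumes B: "VFP B" "\<And>q. pT q (B q) = 0" "\<And>q. a q (B q) = c'" "\<And>q. snd (B q) = d'"
    and A: "VFP A" "VFM A'" "\<And>q. pT q (A q) = A' (prj q)" "\<And>q. a q (A q) = c" "\<And>q. snd (A q) = d"
  shows "lie_bracket (P_mfd N) B A q = 0"
proof -
  interpret x: symplectic_space "\<omega> (prj q)" by (rule M.symplectic_space)
  show ?thesis
    using bracket_projectable[OF B(1) M.vf_in_zero B(2-) A, of q] A(2) by (simp add: x.form_simps hl_simps)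
qed

lemma bracket_frame [simp]:
  "VFM X \<Longrightarrow> lie_bracket (P_mfd N) E (HL X) q = 0" "VFM X \<Longrightarrow> lie_bracket (P_mfd N) S (HL X) q = 0"
  "lie_bracket (P_mfd N) E S q = 0" "lie_bracket (P_mfd N) S E q = 0" "lie_bracket (P_mfd N) E E q = 0" "lie_bracket (P_mfd N) S S q = 0"
  "VFM X \<Longrightarrow> lie_bracket (P_mfd N) (HL X) E q = 0" "VFM X \<Longrightarrow> lie_bracket (P_mfd N) (HL X) S q = 0"
proof -
  show "VFM X \<Longrightarrow> lie_bracket (P_mfd N) E (HL X) q = 0" "VFM X \<Longrightarrow> lie_bracket (P_mfd N) S (HL X) q = 0"
    by (rule bracket_vertical[where A' = X]; auto)+
  then show "VFM X \<Longrightarrow> lie_bracket (P_mfd N) (HL X) E q = 0" "VFM X \<Longrightarrow> lie_bracket (P_mfd N) (HL X) S q = 0"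
    using lie_bracket_antisym[of "P_mfd N" "HL X"] by simp_all
  show "lie_bracket (P_mfd N) E S q = 0" "lie_bracket (P_mfd N) S E q = 0" "lie_bracket (P_mfd N) E E q = 0" "lie_bracket (P_mfd N) S S q = 0"
    by (rule bracket_vertical[where A' = "\<lambda>x. 0"]; auto simp: M.vf_in_zero)+
qed

subsection \<open>The symplectic form\<close>

definition \<mu> :: "'n \<times> real \<Rightarrow> 'f \<times> real \<Rightarrow> 'f \<times> real \<Rightarrow> real" where
  "\<mu> q u v = exp (2 * snd q) * (2 * (snd u * a q v - snd v * a q u) + \<omega> (prj q) (pT q u) (pT q v))"

lemma P_form_eq: "P_form N \<alpha> = \<mu>"
  by (simp add: fun_eq_iff P_form_def \<mu>_def ds_form_eq p1_alpha_eq ext_d1_p1_alpha algebra_simps)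

lemma symplectic_space_mu: "symplectic_space (\<mu> q)"
proof
  interpret x: symplectic_space "\<omega> (prj q)" by (rule M.symplectic_space)
  show "bilinear (\<mu> q)" by (auto simp: bilinear_def \<mu>_def x.form_simps algebra_simps intro!: linearI)
  show "\<mu> q u u = 0" for u by (simp add: \<mu>_def x.alt)
  fix u assume u: "\<And>v. \<mu> q u v = 0"
  have "pT q u = 0"
    by (rule x.nondeg) (use u[of "hl q v" for v] in \<open>simp add: \<mu>_def\<close>)
  moreover have "snd u = 0" "a q u = 0"
    using u[of "E q"] u[of "S q"] by (simp_all add: \<mu>_def x.form_simps)
  ultimately show "u = 0" by (intro tangent_eqI[of q]) simp_all
qed

lemma smooth_mu: "smooth_tensor2 (P_mfd N) \<mu>"
proof (rule P.smooth_tensor2I)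
  show "bilinear (\<mu> q)" for q using symplectic_space_mu[of q] by (simp add: symplectic_space_def)
  fix A B assume v: "VFP A" "VFP B"
  have "SFP (\<lambda>q. \<omega> (prj q) (pT q (A q)) (pT q (B q)))"
    using p.smooth_in_pullback2[OF M.smooth_omega open_UNIV v] by (simp add: tmap_prj)
  then show "SFP (\<lambda>q. \<mu> q (A q) (B q))"
    unfolding \<mu>_def
    by (intro P.smooth_in_mult P.smooth_in_add P.smooth_in_diff P.smooth_in_exp P.smooth_in_const NR.smooth_in_snd
        smooth_a smooth_snd v open_UNIV)
qed

subsection \<open>The lifts span all vector fields\<close>

inductive spanned :: "('n \<times> real \<Rightarrow> 'f \<times> real) \<Rightarrow> bool" where
  spanned_HL: "VFM X \<Longrightarrow> spanned (HL X)"
| spanned_E: "spanned E"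
| spanned_S: "spanned S"
| spanned_add: "spanned A \<Longrightarrow> spanned B \<Longrightarrow> spanned (\<lambda>q. A q + B q)"
| spanned_scaleR: "SFP g \<Longrightarrow> spanned A \<Longrightarrow> spanned (\<lambda>q. g q *\<^sub>R A q)"

lemma spanned_vf: "spanned A \<Longrightarrow> VFP A"
  by (induction rule: spanned.induct) (auto intro: P.vf_in_add P.vf_in_scaleR)

lemma spanned_sum: "finite I \<Longrightarrow> (\<And>i. i \<in> I \<Longrightarrow> spanned (A i)) \<Longrightarrow> spanned (\<lambda>q. \<Sum>i\<in>I. A i q)"
proof (induction I rule: finite_induct)
  case empty
  show ?case using spanned_scaleR[OF P.smooth_in_const[of _ 0] spanned_E] by simp
next
  case (insert i I)
  then show ?case using spanned_add[of "A i" "\<lambda>q. \<Sum>i\<in>I. A i q"] by simp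
qed

text \<open>
  Lift a coordinate frame of \<open>M\<close>, cut off by a bump function \<open>\<psi>\<close>, and use the components of \<open>B\<close>, cut off
  likewise, as coefficients. This expresses \<open>\<psi>\<^sup>2 B\<close>.
\<close>

lemma locally_spanned:
  assumes B: "VFP B"
  obtains \<kappa> W where "SFP \<kappa>" "open W" "q \<in> W" "\<And>r. r \<in> W \<Longrightarrow> \<kappa> r = 1" "spanned (\<lambda>r. \<kappa> r *\<^sub>R B r)"
proof -
  let ?x = "prj q"
  let ?V = "chart_dom M ?x"
  obtain \<psi> :: "'m \<Rightarrow> real" and K W where b: "smooth_in M UNIV \<psi>" "open W" "?x \<in> W" "W \<subseteq> ?V"
    "\<And>y. y \<in> W \<Longrightarrow> \<psi> y = 1" "closed K" "K \<subseteq> ?V" "\<And>y. y \<notin> K \<Longrightarrow> \<psi> y = 0"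
    by (rule M.bump_function[OF M.dom_open M.dom_mem]) (rule that)
  define F where "F b y = (if y \<in> ?V then \<psi> y *\<^sub>R vec_of_chart M ?x y b else 0)" for b y
  have F: "VFM (F b')" for b'
    unfolding F_def by (rule M.vf_in_cutoff[OF M.dom_open b(1,6,7,8) M.vf_in_coordinate])
  define c where "c b r = (if r \<in> (\<lambda>q. prj q) -` ?V then \<psi> (prj r) *\<^sub>R (vec_to_chart M ?x (prj r) (pT r (B r)) \<bullet> b) else 0)" for b r
  have K: "closed ((\<lambda>q. prj q) -` K)" using closed_vimage[OF b(6) p.continuous] by (simp add: comp_def)
  have c: "SFP (c b')" for b'
    unfolding c_def
    by (rule P.smooth_in_cutoff[OF open_prj[OF M.dom_open] smooth_prj[OF b(1)] K])
       (use b in \<open>auto intro!: P.smooth_in_inner[OF open_prj] P.smooth_in_const smooth_pT B\<close>)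
  define \<kappa> where "\<kappa> r = \<psi> (prj r) * \<psi> (prj r)" for r
  have \<kappa>: "SFP \<kappa>" unfolding \<kappa>_def by (intro P.smooth_in_mult smooth_prj b open_UNIV)
  have "\<kappa> r *\<^sub>R B r = (\<Sum>b\<in>Basis. c b r *\<^sub>R HL (F b) r) + ((\<kappa> r * a r (B r)) *\<^sub>R E r + (\<kappa> r * snd (B r)) *\<^sub>R S r)" for r
  proof (rule tangent_eqI[of r])
    have "(\<Sum>b\<in>Basis. c b r *\<^sub>R F b (prj r)) = \<kappa> r *\<^sub>R pT r (B r)"
    proof (cases "prj r \<in> ?V")
      case True
      have "(\<Sum>b\<in>Basis. c b r *\<^sub>R F b (prj r)) = \<kappa> r *\<^sub>R (\<Sum>b\<in>Basis. (vec_to_chart M ?x (prj r) (pT r (B r)) \<bullet> b) *\<^sub>R vec_of_chart M ?x (prj r) b)"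
        using True by (simp add: scaleR_sum_right c_def F_def \<kappa>_def algebra_simps)
      also have "\<dots> = \<kappa> r *\<^sub>R pT r (B r)"
        unfolding linear_basis_expand[OF M.linear_vec_of_chart[OF True], symmetric] using True by simp
      finally show ?thesis .
    next
      case False
      then have "\<psi> (prj r) = 0" using b by blast
      then show ?thesis using False by (simp add: c_def \<kappa>_def)
    qed
    moreover have "pT r (\<Sum>b\<in>Basis. c b r *\<^sub>R HL (F b) r) = (\<Sum>b\<in>Basis. c b r *\<^sub>R F b (prj r))"
      by (simp add: fst_sum linear_sum[OF pi.linear_tmap])
    ultimately show "pT r (\<kappa> r *\<^sub>R B r) = pT r ((\<Sum>b\<in>Basis. c b r *\<^sub>R HL (F b) r) + ((\<kappa> r * a r (B r)) *\<^sub>R E r + (\<kappa> r * snd (B r)) *\<^sub>R S r))"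
      by simp
    have "a r (\<Sum>b\<in>Basis. c b r *\<^sub>R HL (F b) r) = 0" by (simp add: fst_sum linear_sum[OF linear_alpha])
    then show "a r (\<kappa> r *\<^sub>R B r) = a r ((\<Sum>b\<in>Basis. c b r *\<^sub>R HL (F b) r) + ((\<kappa> r * a r (B r)) *\<^sub>R E r + (\<kappa> r * snd (B r)) *\<^sub>R S r))"
      by simp
    show "snd (\<kappa> r *\<^sub>R B r) = snd ((\<Sum>b\<in>Basis. c b r *\<^sub>R HL (F b) r) + ((\<kappa> r * a r (B r)) *\<^sub>R E r + (\<kappa> r * snd (B r)) *\<^sub>R S r))"
      by (simp add: snd_sum)
  qed
  moreover have "spanned (\<lambda>r. (\<Sum>b\<in>Basis. c b r *\<^sub>R HL (F b) r) + ((\<kappa> r * a r (B r)) *\<^sub>R E r + (\<kappa> r * snd (B r)) *\<^sub>R S r))"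
    by (intro spanned_add spanned_sum spanned_scaleR spanned_HL[OF F] spanned_E spanned_S c P.smooth_in_mult \<kappa> smooth_a smooth_snd B) auto
  ultimately have "spanned (\<lambda>r. \<kappa> r *\<^sub>R B r)" by presburger
  then show ?thesis
    by (rule that[OF \<kappa> open_prj[OF b(2)], rotated 2]) (use b in \<open>auto simp: \<kappa>_def\<close>)
qed

text \<open>
  The value at \<open>q\<close> of an operation that is linear over the functions does not change if its argument
  is multiplied by a function that is \<open>1\<close> at \<open>q\<close>; and such a multiple is spanned by the frame.
\<close>

lemma tensor_zero_on_frame:
  fixes T :: "('n \<times> real \<Rightarrow> 'f \<times> real) \<Rightarrow> 'v::real_vector"
  assumes add: "\<And>A B. VFP A \<Longrightarrow> VFP B \<Longrightarrow> T (\<lambda>r. A r + B r) = T A + T B"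
    and scale: "\<And>g A. SFP g \<Longrightarrow> VFP A \<Longrightarrow> T (\<lambda>r. g r *\<^sub>R A r) = g q *\<^sub>R T A"
    and gens: "\<And>X. VFM X \<Longrightarrow> T (HL X) = 0" "T E = 0" "T S = 0" and B: "VFP B"
  shows "T B = 0"
proof -
  have sp: "T A = 0" if "spanned A" for A
    using that by (induction rule: spanned.induct) (auto simp: gens add scale spanned_vf)
  obtain \<kappa> W where \<kappa>: "SFP \<kappa>" "open W" "q \<in> W" "\<And>r. r \<in> W \<Longrightarrow> \<kappa> r = 1" "spanned (\<lambda>r. \<kappa> r *\<^sub>R B r)"
    by (rule locally_spanned[OF B]) (rule that)
  have "T B = T (\<lambda>r. \<kappa> r *\<^sub>R B r)" using scale[OF \<kappa>(1) B] \<kappa>(3,4) by simp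
  then show ?thesis using sp[OF \<kappa>(5)] by simp
qed

end

section \<open>Existence and uniqueness of the induced connection\<close>

context lin_conn
begin

text \<open>
  The Christoffel symbols in the chart at \<open>x\<close>, evaluated at \<open>x\<close>: the covariant derivative of fields with constant
  components, which are extended globally by means of a bump function.
\<close>

definition const_field :: "'m \<Rightarrow> 'e \<Rightarrow> 'm \<Rightarrow> 'e" where
  "const_field x u = (SOME X. VF X \<and> (\<exists>W. open W \<and> x \<in> W \<and> W \<subseteq> chart_dom M x \<and> (\<forall>y\<in>W. X y = vec_of_chart M x y u)))"

definition christoffel :: "'m \<Rightarrow> 'e \<Rightarrow> 'e \<Rightarrow> 'e" where
  "christoffel x u v = D (const_field x u) (const_field x v) x"

lemma const_field:
  "VF (const_field x u) \<and> (\<exists>W. open W \<and> x \<in> W \<and> W \<subseteq> chart_dom M x \<and> (\<forall>y\<in>W. const_field x u y = vec_of_chart M x y u))"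
proof -
  obtain X W where "VF X" "open W" "x \<in> W" "W \<subseteq> chart_dom M x" "\<And>y. y \<in> W \<Longrightarrow> X y = vec_of_chart M x y u"
    by (rule coordinate_extension[of x u]) (rule that)
  then have "\<exists>X. VF X \<and> (\<exists>W. open W \<and> x \<in> W \<and> W \<subseteq> chart_dom M x \<and> (\<forall>y\<in>W. X y = vec_of_chart M x y u))"
    by blast
  then show ?thesis unfolding const_field_def by (rule someI_ex)
qed

lemma const_field_at [simp]: "const_field x u x = u"
  using const_field[of x u] by auto

context
  fixes x :: 'm
begin

text \<open>
  The covariant derivative minus the derivative of the components. It is linear over the functions
  in both arguments, hence it is given by the Christoffel symbols for all fields.
\<close>

definition defect :: "('m \<Rightarrow> 'e) \<Rightarrow> ('m \<Rightarrow> 'e) \<Rightarrow> 'e" where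
  "defect X Y = D X Y x - dderiv M (\<lambda>y. vec_to_chart M x y (Y y)) x (X x)"

lemma defect_linear:
  "VF X \<Longrightarrow> VF X' \<Longrightarrow> VF Y \<Longrightarrow> defect (\<lambda>y. X y + X' y) Y = defect X Y + defect X' Y"
  "smooth_in M UNIV g \<Longrightarrow> VF X \<Longrightarrow> VF Y \<Longrightarrow> defect (\<lambda>y. g y *\<^sub>R X y) Y = g x *\<^sub>R defect X Y"
  "VF X \<Longrightarrow> VF Y \<Longrightarrow> VF Y' \<Longrightarrow> defect X (\<lambda>y. Y y + Y' y) = defect X Y + defect X Y'"
  "smooth_in M UNIV g \<Longrightarrow> VF X \<Longrightarrow> VF Y \<Longrightarrow> defect X (\<lambda>y. g y *\<^sub>R Y y) = g x *\<^sub>R defect X Y"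
proof -
  note W = own_chart_nbhd[OF refl, of x] and so = smooth_in_own_chart[OF refl, of _ x]
  show "VF X \<Longrightarrow> VF X' \<Longrightarrow> VF Y \<Longrightarrow> defect (\<lambda>y. X y + X' y) Y = defect X Y + defect X' Y"
    by (simp add: defect_def D_add_left dderiv_linear_add[OF W so])
  show "smooth_in M UNIV g \<Longrightarrow> VF X \<Longrightarrow> VF Y \<Longrightarrow> defect (\<lambda>y. g y *\<^sub>R X y) Y = g x *\<^sub>R defect X Y"
    by (simp add: defect_def D_scaleR_left dderiv_linear_scale[OF W so] algebra_simps)
  have "dderiv M (\<lambda>y. vec_to_chart M x y (Y y + Y' y)) x u = dderiv M (\<lambda>y. vec_to_chart M x y (Y y) + vec_to_chart M x y (Y' y)) x u" for u Y Y'
    by (intro fun_cong[OF dderiv_cong[OF W]]) (simp add: linear_add[OF linear_vec_to_chart])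
  then show "VF X \<Longrightarrow> VF Y \<Longrightarrow> VF Y' \<Longrightarrow> defect X (\<lambda>y. Y y + Y' y) = defect X Y + defect X Y'"
    by (simp add: defect_def D_add_right dderiv_add[OF W so so])
  assume v: "smooth_in M UNIV g" "VF X" "VF Y"
  have "dderiv M (\<lambda>y. vec_to_chart M x y (g y *\<^sub>R Y y)) x u = dderiv M (\<lambda>y. g y *\<^sub>R vec_to_chart M x y (Y y)) x u" for u Y
    by (intro fun_cong[OF dderiv_cong[OF W]]) (simp add: linear_scale[OF linear_vec_to_chart])
  with v show "defect X (\<lambda>y. g y *\<^sub>R Y y) = g x *\<^sub>R defect X Y"
    by (simp add: defect_def D_scaleR_right dderiv_scaleR[OF W smooth_in_mono[OF v(1) subset_UNIV] so] algebra_simps)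
qed

lemma defect_eq:
  assumes "VF X" "VF Y"
  shows "defect X Y = christoffel x (X x) (Y x)"
proof -
  have c: "VF (const_field x u)" for u using const_field by blast
  have "defect X Y = defect (const_field x (X x)) Y"
    by (rule tensorial_eq[where A = "\<lambda>X. defect X Y" and x = x]) (use assms c defect_linear in auto)
  also have "\<dots> = defect (const_field x (X x)) (const_field x (Y x))"
    by (rule tensorial_eq[where A = "\<lambda>Y. defect _ Y" and x = x]) (use assms c defect_linear in auto)
  also have "\<dots> = christoffel x (X x) (Y x)"
  proof -
    obtain W where W: "open W" "x \<in> W" "W \<subseteq> chart_dom M x" "\<forall>y\<in>W. const_field x (Y x) y = vec_of_chart M x y (Y x)"
      using const_field by blast
    have "dderiv M (\<lambda>y. vec_to_chart M x y (const_field x (Y x) y)) x = dderiv M (\<lambda>y. Y x) x"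
      by (rule dderiv_cong[OF W(1,2)]) (use W in auto)
    then show ?thesis by (simp add: defect_def christoffel_def)
  qed
  finally show ?thesis .
qed

lemma linear_christoffel_1: "linear (\<lambda>u. christoffel x u v)"
  using const_field[of x v]
  by (intro linear_at_point[where A = "\<lambda>X. defect X (const_field x v)" and x = x]) (simp_all add: defect_linear defect_eq)

lemma linear_christoffel_2: "linear (\<lambda>v. christoffel x u v)"
  using const_field[of x u]
  by (intro linear_at_point[where A = "\<lambda>Y. defect (const_field x u) Y" and x = x]) (simp_all add: defect_linear defect_eq)

end

lemma D_christoffel:
  "VF X \<Longrightarrow> VF Y \<Longrightarrow> D X Y x = dderiv M (\<lambda>y. vec_to_chart M x y (Y y)) x (X x) + christoffel x (X x) (Y x)"
  using defect_eq[of X Y x] by (simp add: defect_def algebra_simps)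

end

locale contact_conn = contact_base n M N \<alpha> \<pi> \<omega>
  for n :: nat
    and M :: "('m::{t2_space,second_countable_topology}, 'e::euclidean_space) manifold"
    and N :: "('n::{t2_space,second_countable_topology}, 'f::euclidean_space) manifold"
    and \<alpha> :: "'n \<Rightarrow> 'f \<Rightarrow> real"
    and \<pi> :: "'n \<Rightarrow> 'm"
    and \<omega> :: "'m \<Rightarrow> 'e \<Rightarrow> 'e \<Rightarrow> real" +
  fixes D :: "('m \<Rightarrow> 'e) \<Rightarrow> ('m \<Rightarrow> 'e) \<Rightarrow> 'm \<Rightarrow> 'e"
  assumes symp_conn: "symplectic_connection M \<omega> D"
begin

sublocale MD: symp_conn M \<omega> D
  by unfold_locales (use symp_conn in \<open>auto simp: symplectic_connection_def\<close>)

end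

locale induced = contact_conn n M N \<alpha> \<pi> \<omega> D
  for n :: nat
    and M :: "('m::{t2_space,second_countable_topology}, 'e::euclidean_space) manifold"
    and N :: "('n::{t2_space,second_countable_topology}, 'f::euclidean_space) manifold"
    and \<alpha> :: "'n \<Rightarrow> 'f \<Rightarrow> real"
    and \<pi> :: "'n \<Rightarrow> 'm"
    and \<omega> :: "'m \<Rightarrow> 'e \<Rightarrow> 'e \<Rightarrow> real"
    and D :: "('m \<Rightarrow> 'e) \<Rightarrow> ('m \<Rightarrow> 'e) \<Rightarrow> 'm \<Rightarrow> 'e" +
  fixes s :: "'m \<Rightarrow> 'e \<Rightarrow> 'e \<Rightarrow> real" and U :: "'m \<Rightarrow> 'e" and f :: "'m \<Rightarrow> real"
  assumes sym2: "smooth_sym2 M s" and vf_U: "vf_in M UNIV U" and smooth_f: "smooth_in M UNIV f"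
begin

definition \<sigma> :: "'m \<Rightarrow> 'e \<Rightarrow> 'e" where "\<sigma> = endo_of \<omega> s"

lemma smooth_s: "smooth_tensor2 M s" and s_sym: "s x u v = s x v u"
  using sym2 by (auto simp: smooth_sym2_def)

lemma bilinear_s: "bilinear (s x)"
  using smooth_s by (simp add: smooth_tensor2_def)

lemma bilinear_omega: "bilinear (\<omega> x)"
  using M.smooth_omega by (simp add: smooth_tensor2_def)

lemmas bil_simps [simp] = bilinear_ladd[OF bilinear_s] bilinear_radd[OF bilinear_s] bilinear_lmul[OF bilinear_s] bilinear_rmul[OF bilinear_s]
  bilinear_lzero[OF bilinear_s] bilinear_rzero[OF bilinear_s] bilinear_lsub[OF bilinear_s] bilinear_rsub[OF bilinear_s]
  bilinear_ladd[OF bilinear_omega] bilinear_radd[OF bilinear_omega] bilinear_lmul[OF bilinear_omega] bilinear_rmul[OF bilinear_omega]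
  bilinear_lzero[OF bilinear_omega] bilinear_rzero[OF bilinear_omega] bilinear_lsub[OF bilinear_omega] bilinear_rsub[OF bilinear_omega]
  bilinear_lneg[OF bilinear_omega] bilinear_rneg[OF bilinear_omega]

lemma linear_\<sigma>: "linear (\<sigma> x)"
  unfolding \<sigma>_def by (rule MD.linear_endo_of[OF smooth_s])

lemmas \<sigma>_simps [simp] = linear_add[OF linear_\<sigma>] linear_diff[OF linear_\<sigma>] linear_scale[OF linear_\<sigma>] linear_0[OF linear_\<sigma>] linear_neg[OF linear_\<sigma>]

lemma \<sigma>: "\<omega> x u (\<sigma> x v) = s x u v"
  unfolding \<sigma>_def by (rule MD.endo_of[OF smooth_s, symmetric])

lemma vf_\<sigma>: "VFM X \<Longrightarrow> VFM (\<lambda>x. \<sigma> x (X x))"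
  unfolding \<sigma>_def by (rule MD.vf_endo_of[OF smooth_s])

text \<open>
  A field \<open>B\<close> on \<open>P\<close> is a section of the pull-back of the tangent bundle of \<open>M\<close> together with two
  functions. The induced connection is the pull-back connection on the section, the trivial one on
  the functions, plus a tensor.
\<close>

definition pull_D :: "('n \<times> real \<Rightarrow> 'f \<times> real) \<Rightarrow> ('n \<times> real \<Rightarrow> 'f \<times> real) \<Rightarrow> 'n \<times> real \<Rightarrow> 'e" where
  "pull_D A B q = dderiv (P_mfd N) (\<lambda>r. vec_to_chart M (prj q) (prj r) (pT r (B r))) q (A q)
     + MD.christoffel (prj q) (pT q (A q)) (pT q (B q))"

definition tensor_part :: "'n \<times> real \<Rightarrow> 'f \<times> real \<Rightarrow> 'f \<times> real \<Rightarrow> 'f \<times> real" where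
  "tensor_part q u v = hl q ((2 * a q v) *\<^sub>R \<sigma> (prj q) (pT q u) + (2 * a q u) *\<^sub>R \<sigma> (prj q) (pT q v)
       + snd v *\<^sub>R pT q u + snd u *\<^sub>R pT q v - (2 * a q u * a q v) *\<^sub>R U (prj q))
     + (- 1 / 2 * \<omega> (prj q) (pT q u) (pT q v) + a q u * snd v + snd u * a q v) *\<^sub>R E q
     + (- s (prj q) (pT q u) (pT q v) + a q v * \<omega> (prj q) (pT q u) (U (prj q)) + a q u * \<omega> (prj q) (pT q v) (U (prj q))
         + a q u * a q v * f (prj q) + snd u * snd v) *\<^sub>R S q"

definition DP0 :: "('n \<times> real \<Rightarrow> 'f \<times> real) \<Rightarrow> ('n \<times> real \<Rightarrow> 'f \<times> real) \<Rightarrow> 'n \<times> real \<Rightarrow> 'f \<times> real" where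
  "DP0 A B q = hl q (pull_D A B q) + dderiv (P_mfd N) (\<lambda>r. a r (B r)) q (A q) *\<^sub>R E q
     + dderiv (P_mfd N) (\<lambda>r. snd (B r)) q (A q) *\<^sub>R S q + tensor_part q (A q) (B q)"

lemma tensor_part_linear:
  "tensor_part q (u + u') v = tensor_part q u v + tensor_part q u' v" "tensor_part q (c *\<^sub>R u) v = c *\<^sub>R tensor_part q u v"
  "tensor_part q u (v + v') = tensor_part q u v + tensor_part q u v'" "tensor_part q u (c *\<^sub>R v) = c *\<^sub>R tensor_part q u v"
  by (rule tangent_eqI[of q]; simp add: tensor_part_def algebra_simps)+

context
  fixes q :: "'n \<times> real"
begin

lemma prj_chart_nbhd: "open ((\<lambda>r. prj r) -` chart_dom M (prj q))" "q \<in> (\<lambda>r. prj r) -` chart_dom M (prj q)"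
  by (auto intro: open_prj)

lemma pull_D_linear:
  "VFP B \<Longrightarrow> pull_D (\<lambda>r. A r + A' r) B q = pull_D A B q + pull_D A' B q"
  "VFP B \<Longrightarrow> pull_D (\<lambda>r. g r *\<^sub>R A r) B q = g q *\<^sub>R pull_D A B q"
  "VFP B \<Longrightarrow> VFP B' \<Longrightarrow> pull_D A (\<lambda>r. B r + B' r) q = pull_D A B q + pull_D A B' q"
  "SFP g \<Longrightarrow> VFP B \<Longrightarrow> pull_D A (\<lambda>r. g r *\<^sub>R B r) q = dderiv (P_mfd N) g q (A q) *\<^sub>R pT q (B q) + g q *\<^sub>R pull_D A B q"
proof -
  note c1 = MD.linear_christoffel_1[of "prj q"] and c2 = MD.linear_christoffel_2[of "prj q"]
  show "VFP B \<Longrightarrow> pull_D (\<lambda>r. A r + A' r) B q = pull_D A B q + pull_D A' B q"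
    by (simp add: pull_D_def P.dderiv_linear_add[OF prj_chart_nbhd smooth_pT] linear_add[OF c1])
  show "VFP B \<Longrightarrow> pull_D (\<lambda>r. g r *\<^sub>R A r) B q = g q *\<^sub>R pull_D A B q"
    by (simp add: pull_D_def P.dderiv_linear_scale[OF prj_chart_nbhd smooth_pT] linear_scale[OF c1] algebra_simps)
  have "dderiv (P_mfd N) (\<lambda>r. vec_to_chart M (prj q) (prj r) (pT r (B r + B' r))) q w =
     dderiv (P_mfd N) (\<lambda>r. vec_to_chart M (prj q) (prj r) (pT r (B r)) + vec_to_chart M (prj q) (prj r) (pT r (B' r))) q w" for w
    by (intro fun_cong[OF P.dderiv_cong[OF prj_chart_nbhd]]) (simp add: linear_add[OF M.linear_vec_to_chart])
  then show "VFP B \<Longrightarrow> VFP B' \<Longrightarrow> pull_D A (\<lambda>r. B r + B' r) q = pull_D A B q + pull_D A B' q"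
    by (simp add: pull_D_def P.dderiv_add[OF prj_chart_nbhd smooth_pT smooth_pT] linear_add[OF c2])
  assume v: "SFP g" "VFP B"
  have "dderiv (P_mfd N) (\<lambda>r. vec_to_chart M (prj q) (prj r) (pT r (g r *\<^sub>R B r))) q w =
     dderiv (P_mfd N) (\<lambda>r. g r *\<^sub>R vec_to_chart M (prj q) (prj r) (pT r (B r))) q w" for w
    by (intro fun_cong[OF P.dderiv_cong[OF prj_chart_nbhd]]) (simp add: linear_scale[OF M.linear_vec_to_chart])
  then show "pull_D A (\<lambda>r. g r *\<^sub>R B r) q = dderiv (P_mfd N) g q (A q) *\<^sub>R pT q (B q) + g q *\<^sub>R pull_D A B q"
    using v by (simp add: pull_D_def P.dderiv_scaleR[OF prj_chart_nbhd P.smooth_in_mono[OF v(1) subset_UNIV] smooth_pT] linear_scale[OF c2] algebra_simps)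
qed

lemma pull_D_vertical:
  assumes "\<And>r. pT r (B r) = 0"
  shows "pull_D A B q = 0"
proof -
  have "dderiv (P_mfd N) (\<lambda>r. vec_to_chart M (prj q) (prj r) (pT r (B r))) q w = dderiv (P_mfd N) (\<lambda>r. 0) q w" for w
    by (intro fun_cong[OF P.dderiv_cong[OF prj_chart_nbhd]]) (simp add: assms linear_0[OF M.linear_vec_to_chart])
  then show ?thesis by (simp add: pull_D_def assms linear_0[OF MD.linear_christoffel_2])
qed

text \<open>
  The components of a lift are functions of the base point, so the chain rule gives the covariant
  derivative on \<open>M\<close> in the direction of the projected vector.
\<close>

lemma pull_D_HL:
  assumes Y: "VFM Y"
  shows "pull_D A (HL Y) q = dderiv M (\<lambda>y. vec_to_chart M (prj q) y (Y y)) (prj q) (pT q (A q)) + MD.christoffel (prj q) (pT q (A q)) (Y (prj q))"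
  using p.dderiv_comp[OF M.dom_open _ M.smooth_in_own_chart[OF refl Y], of q "prj q" "A q"] by (simp add: pull_D_def tmap_prj)

lemma pull_D_HL_HL: "VFM X \<Longrightarrow> VFM Y \<Longrightarrow> pull_D (HL X) (HL Y) q = D X Y (prj q)"
  by (simp add: pull_D_HL MD.D_christoffel)

lemma pull_D_vertical_HL: "VFM Y \<Longrightarrow> pT q (A q) = 0 \<Longrightarrow> pull_D A (HL Y) q = 0"
  by (simp add: pull_D_HL linear_0[OF MD.linear_christoffel_1] M.dderiv_linear_0[OF M.own_chart_nbhd[OF refl] M.smooth_in_own_chart[OF refl]])

end

lemma DP0_linear:
  "VFP B \<Longrightarrow> DP0 (\<lambda>r. A r + A' r) B = (\<lambda>q. DP0 A B q + DP0 A' B q)"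
  "VFP B \<Longrightarrow> DP0 (\<lambda>r. g r *\<^sub>R A r) B = (\<lambda>q. g q *\<^sub>R DP0 A B q)"
  "VFP B \<Longrightarrow> VFP B' \<Longrightarrow> DP0 A (\<lambda>r. B r + B' r) = (\<lambda>q. DP0 A B q + DP0 A B' q)"
  "SFP g \<Longrightarrow> VFP B \<Longrightarrow> DP0 A (\<lambda>r. g r *\<^sub>R B r) = (\<lambda>q. dderiv (P_mfd N) g q (A q) *\<^sub>R B q + g q *\<^sub>R DP0 A B q)"
proof -
  note U = open_UNIV UNIV_I
  show "VFP B \<Longrightarrow> DP0 (\<lambda>r. A r + A' r) B = (\<lambda>q. DP0 A B q + DP0 A' B q)"
    by (rule ext) (simp add: DP0_def pull_D_linear tensor_part_linear hl_simps P.dderiv_linear_add[OF U smooth_a] P.dderiv_linear_add[OF U smooth_snd] algebra_simps)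
  show "VFP B \<Longrightarrow> DP0 (\<lambda>r. g r *\<^sub>R A r) B = (\<lambda>q. g q *\<^sub>R DP0 A B q)"
    by (rule ext) (simp add: DP0_def pull_D_linear tensor_part_linear hl_simps P.dderiv_linear_scale[OF U smooth_a] P.dderiv_linear_scale[OF U smooth_snd] algebra_simps)
  show "VFP B \<Longrightarrow> VFP B' \<Longrightarrow> DP0 A (\<lambda>r. B r + B' r) = (\<lambda>q. DP0 A B q + DP0 A B' q)"
    by (rule ext) (simp add: DP0_def pull_D_linear tensor_part_linear hl_simps P.dderiv_add[OF U smooth_a smooth_a] P.dderiv_add[OF U smooth_snd smooth_snd] algebra_simps)
  assume v: "SFP g" "VFP B"
  show "DP0 A (\<lambda>r. g r *\<^sub>R B r) = (\<lambda>q. dderiv (P_mfd N) g q (A q) *\<^sub>R B q + g q *\<^sub>R DP0 A B q)"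
  proof
    fix q
    have "DP0 A (\<lambda>r. g r *\<^sub>R B r) q = dderiv (P_mfd N) g q (A q) *\<^sub>R (hl q (pT q (B q)) + a q (B q) *\<^sub>R E q + snd (B q) *\<^sub>R S q) + g q *\<^sub>R DP0 A B q"
      by (simp add: DP0_def pull_D_linear v tensor_part_linear hl_simps P.dderiv_mult[OF U v(1) smooth_a[OF v(2)]] P.dderiv_mult[OF U v(1) smooth_snd[OF v(2)]] algebra_simps)
    then show "DP0 A (\<lambda>r. g r *\<^sub>R B r) q = dderiv (P_mfd N) g q (A q) *\<^sub>R B q + g q *\<^sub>R DP0 A B q"
      unfolding decompose[symmetric] .
  qed
qed

lemma DP0_frame:
  "VFM X \<Longrightarrow> VFM Y \<Longrightarrow> DP0 (HL X) (HL Y) = (\<lambda>q. HL (D X Y) q - (1 / 2 * \<omega> (prj q) (X (prj q)) (Y (prj q))) *\<^sub>R E q - s (prj q) (X (prj q)) (Y (prj q)) *\<^sub>R S q)"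
  "VFM X \<Longrightarrow> DP0 E (HL X) = (\<lambda>q. 2 *\<^sub>R HL (\<lambda>x. \<sigma> x (X x)) q + \<omega> (prj q) (X (prj q)) (U (prj q)) *\<^sub>R S q)"
  "DP0 (HL X) E = (\<lambda>q. 2 *\<^sub>R HL (\<lambda>x. \<sigma> x (X x)) q + \<omega> (prj q) (X (prj q)) (U (prj q)) *\<^sub>R S q)"
  "VFM X \<Longrightarrow> DP0 S (HL X) = HL X" "DP0 (HL X) S = HL X"
  "DP0 E E = (\<lambda>q. f (prj q) *\<^sub>R S q - 2 *\<^sub>R HL U q)"
  "DP0 E S = E" "DP0 S E = E" "DP0 S S = S"
  by (rule ext, simp add: DP0_def pull_D_HL_HL pull_D_vertical pull_D_vertical_HL tensor_part_def hl_simps)+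

text \<open>Induction over the generation of both fields; on frame fields the values are explicit.\<close>

lemma smooth_DP0_spanned: "spanned A \<Longrightarrow> spanned B \<Longrightarrow> VFP (DP0 A B)"
proof -
  have left: "VFP (DP0 A B)" if "spanned A" "VFP B" "\<And>X. VFM X \<Longrightarrow> VFP (DP0 (HL X) B)" "VFP (DP0 E B)" "VFP (DP0 S B)" for A B
    using that by (induction rule: spanned.induct) (auto simp: DP0_linear intro: P.vf_in_add P.vf_in_scaleR)
  have c: "SFP (\<lambda>q. \<omega> (prj q) (X (prj q)) (Y (prj q)))" "SFP (\<lambda>q. s (prj q) (X (prj q)) (Y (prj q)))" if "VFM X" "VFM Y" for X Y
    using that by (auto intro!: smooth_prj[of "\<lambda>x. \<omega> x (X x) (Y x)"] smooth_prj[of "\<lambda>x. s x (X x) (Y x)"]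
        M.smooth_in_tensor2 smooth_s M.smooth_omega)
  note vi = P.vf_in_add[OF open_UNIV] P.vf_in_diff[OF open_UNIV] P.vf_in_scaleR[OF open_UNIV] P.smooth_in_mult[OF open_UNIV] P.smooth_in_const
  have HH: "VFP (DP0 (HL X) (HL Y))" if "VFM X" "VFM Y" for X Y
    unfolding DP0_frame(1)[OF that] using that by (intro vi c vf_HL vf_ES MD.vf_smooth)
  have EH1: "VFP (DP0 E (HL X))" if "VFM X" for X
    unfolding DP0_frame(2)[OF that] using that by (intro vi c vf_HL vf_ES vf_\<sigma> vf_U)
  have EH: "VFP (DP0 E (HL X))" "VFP (DP0 (HL X) E)" if "VFM X" for X
    using EH1[OF that] by (simp_all only: DP0_frame(2)[OF that] DP0_frame(3))
  have EE: "VFP (DP0 E E)"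
    unfolding DP0_frame(6) by (intro vi vf_HL vf_ES vf_U smooth_prj smooth_f)
  assume "spanned A" "spanned B"
  from this(2,1) show "VFP (DP0 A B)"
  proof (induction B arbitrary: A rule: spanned.induct)
    case (spanned_HL X)
    show ?case
      by (rule left[OF spanned_HL.prems]) (simp_all add: HH EH DP0_frame(4) vf_HL spanned_HL)
  next
    case spanned_E
    show ?case
      by (rule left[OF spanned_E.prems]) (simp_all add: EH EE DP0_frame(8))
  next
    case spanned_S
    show ?case
      by (rule left[OF spanned_S.prems]) (simp_all add: DP0_frame(5,7,9) vf_HL)
  next
    case (spanned_add B B')
    then show ?case by (auto simp: DP0_linear spanned_vf intro: P.vf_in_add)
  next
    case (spanned_scaleR g B)
    then have "SFP (\<lambda>q. dderiv (P_mfd N) g q (A q))"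
      using P.smooth_in_dderiv[OF open_UNIV] spanned_vf by blast
    then show ?case using spanned_scaleR by (simp add: DP0_linear spanned_vf P.vf_in_add P.vf_in_scaleR)
  qed
qed

text \<open>
  Near a given point both fields agree with fields spanned by the frame, and the value of a
  connection at a point depends only on the fields near it.
\<close>

lemma smooth_DP0:
  assumes A: "VFP A" and B: "VFP B"
  shows "VFP (DP0 A B)"
proof (rule P.vf_in_local)
  fix q
  obtain \<kappa> W where k: "SFP \<kappa>" "open W" "q \<in> W" "\<And>r. r \<in> W \<Longrightarrow> \<kappa> r = 1" "spanned (\<lambda>r. \<kappa> r *\<^sub>R A r)"
    by (rule locally_spanned[OF A]) (rule that)
  obtain \<kappa>' W' where k': "SFP \<kappa>'" "open W'" "q \<in> W'" "\<And>r. r \<in> W' \<Longrightarrow> \<kappa>' r = 1" "spanned (\<lambda>r. \<kappa>' r *\<^sub>R B r)"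
    by (rule locally_spanned[OF B]) (rule that)
  have "vf_in (P_mfd N) (W \<inter> W') (DP0 (\<lambda>r. \<kappa> r *\<^sub>R A r) (\<lambda>r. \<kappa>' r *\<^sub>R B r))"
    by (rule P.vf_in_mono[OF smooth_DP0_spanned[OF k(5) k'(5)]]) auto
  then have "vf_in (P_mfd N) (W \<inter> W') (DP0 A B)"
  proof (rule P.vf_in_cong[rotated 2])
    show "open (W \<inter> W')" using k k' by auto
    fix r assume r: "r \<in> W \<inter> W'"
    have "dderiv (P_mfd N) \<kappa>' r = dderiv (P_mfd N) (\<lambda>r. 1) r"
      by (rule P.dderiv_cong[OF k'(2)]) (use r k' in auto)
    then show "DP0 (\<lambda>r. \<kappa> r *\<^sub>R A r) (\<lambda>r. \<kappa>' r *\<^sub>R B r) r = DP0 A B r"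
      using r k k' B by (simp add: DP0_linear P.vf_in_scaleR)
  qed
  then show "\<exists>W. open W \<and> q \<in> W \<and> vf_in (P_mfd N) W (DP0 A B)" using k k' by blast
qed

definition DP :: "('n \<times> real \<Rightarrow> 'f \<times> real) \<Rightarrow> ('n \<times> real \<Rightarrow> 'f \<times> real) \<Rightarrow> 'n \<times> real \<Rightarrow> 'f \<times> real" where
  "DP A B = (if VFP A \<and> VFP B then DP0 A B else (\<lambda>q. 0))"

lemma DP_linear_connection: "linear_connection (P_mfd N) DP"
  unfolding linear_connection_def P.smooth_vf_iff P.smooth_fun_iff vf_app_eq_dderiv
  by (auto simp: DP_def smooth_DP0 DP0_linear P.vf_in_add P.vf_in_scaleR)

sublocale PD: lin_conn "P_mfd N" DP
  by unfold_locales (rule DP_linear_connection)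

lemma DP_frame:
  "VFM X \<Longrightarrow> VFM Y \<Longrightarrow> DP (HL X) (HL Y) = (\<lambda>q. HL (D X Y) q - (1 / 2 * \<omega> (prj q) (X (prj q)) (Y (prj q))) *\<^sub>R E q - s (prj q) (X (prj q)) (Y (prj q)) *\<^sub>R S q)"
  "VFM X \<Longrightarrow> DP E (HL X) = (\<lambda>q. 2 *\<^sub>R HL (\<lambda>x. \<sigma> x (X x)) q + \<omega> (prj q) (X (prj q)) (U (prj q)) *\<^sub>R S q)"
  "VFM X \<Longrightarrow> DP (HL X) E = (\<lambda>q. 2 *\<^sub>R HL (\<lambda>x. \<sigma> x (X x)) q + \<omega> (prj q) (X (prj q)) (U (prj q)) *\<^sub>R S q)"
  "VFM X \<Longrightarrow> DP S (HL X) = HL X" "VFM X \<Longrightarrow> DP (HL X) S = HL X"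
  "DP E E = (\<lambda>q. f (prj q) *\<^sub>R S q - 2 *\<^sub>R HL U q)"
  "DP E S = E" "DP S E = E" "DP S S = S"
  by (simp_all add: DP_def DP0_frame vf_HL)

lemma DP_is_induced: "is_induced_connection M N \<alpha> \<pi> \<omega> D s U f DP"
  unfolding is_induced_connection_def Let_def hlift_eq E_field_eq s_field_eq M.smooth_vf_iff \<sigma>_def[symmetric]
  by (simp add: DP_linear_connection DP_frame)

text \<open>Two induced connections differ by a tensor that vanishes on the lifts, which span.\<close>

lemma induced_unique:
  assumes "is_induced_connection M N \<alpha> \<pi> \<omega> D s U f D'"
  shows "D' = DP"
proof -
  note * = assms[unfolded is_induced_connection_def Let_def hlift_eq E_field_eq s_field_eq M.smooth_vf_iff \<sigma>_def[symmetric] comp_apply]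
  interpret D': lin_conn "P_mfd N" D' by unfold_locales (use * in blast)
  have fr: "VFM X \<Longrightarrow> VFM Y \<Longrightarrow> D' (HL X) (HL Y) = DP (HL X) (HL Y)" "VFM X \<Longrightarrow> D' E (HL X) = DP E (HL X)"
    "VFM X \<Longrightarrow> D' (HL X) E = DP (HL X) E" "VFM X \<Longrightarrow> D' S (HL X) = DP S (HL X)" "VFM X \<Longrightarrow> D' (HL X) S = DP (HL X) S"
    "D' E E = DP E E" "D' E S = DP E S" "D' S E = DP S E" "D' S S = DP S S" for X Y
    using * by (simp_all add: DP_frame)
  have eq: "D' A B q - DP A B q = 0" if v: "VFP A" "VFP B" for A B q
  proof -
    have right: "D' A B q - DP A B q = 0"
      if A: "VFP A" "\<And>X. VFM X \<Longrightarrow> D' A (HL X) = DP A (HL X)" "D' A E = DP A E" "D' A S = DP A S" and B: "VFP B" for A B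
      by (rule tensor_zero_on_frame[where T = "\<lambda>B. D' A B q - DP A B q" and q = q, OF _ _ _ _ _ B])
         (simp_all add: A D'.D_add_right PD.D_add_right D'.D_scaleR_right PD.D_scaleR_right algebra_simps)
    have gens: "D' (HL X) B q - DP (HL X) B q = 0" if "VFM X" for X
      using that by (intro right[OF _ _ _ _ v(2)]) (simp_all add: fr vf_HL)
    have ES: "D' E B q - DP E B q = 0" "D' S B q - DP S B q = 0"
      by (rule right[OF _ _ _ _ v(2)]; simp add: fr)+
    show ?thesis
      by (rule tensor_zero_on_frame[where T = "\<lambda>A. D' A B q - DP A B q" and q = q, OF _ _ gens ES v(1)])
         (simp_all add: v D'.D_add_left PD.D_add_left D'.D_scaleR_left PD.D_scaleR_left algebra_simps)
  qed
  show ?thesis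
  proof (intro ext)
    fix A B q
    show "D' A B q = DP A B q"
    proof (cases "VFP A \<and> VFP B")
      case True
      then show ?thesis using eq by simp
    next
      case False
      then have "D' A B = (\<lambda>q. 0)" using D'.conn unfolding linear_connection_def P.smooth_vf_iff by blast
      then show ?thesis using False by (auto simp: DP_def)
    qed
  qed
qed

lemma induced_connection_eq: "induced_connection M N \<alpha> \<pi> \<omega> D s U f = DP"
  unfolding induced_connection_def using DP_is_induced induced_unique by (rule the_equality)

end

section \<open>The induced connection is symplectic\<close>

context contact_base
begin

text \<open>Operations on fields that are linear over the functions, evaluated at \<open>q\<close>.\<close>

definition tensor_at :: "'n \<times> real \<Rightarrow> (('n \<times> real \<Rightarrow> 'f \<times> real) \<Rightarrow> 'v::real_vector) \<Rightarrow> bool" where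
  "tensor_at q T \<longleftrightarrow> (\<forall>A B. VFP A \<longrightarrow> VFP B \<longrightarrow> T (\<lambda>r. A r + B r) = T A + T B) \<and>
     (\<forall>g A. SFP g \<longrightarrow> VFP A \<longrightarrow> T (\<lambda>r. g r *\<^sub>R A r) = g q *\<^sub>R T A)"

text \<open>Lifts as an opaque operation, so that rewriting does not look inside them.\<close>

definition lift :: "('m \<Rightarrow> 'e) \<Rightarrow> 'n \<times> real \<Rightarrow> 'f \<times> real" where "lift X = HL X"

inductive frame_field :: "('n \<times> real \<Rightarrow> 'f \<times> real) \<Rightarrow> bool" where
  "VFM X \<Longrightarrow> frame_field (lift X)" | "frame_field E" | "frame_field S"

lemma lift_simps [simp]:
  "pT q (lift X q) = X (prj q)" "a q (lift X q) = 0" "snd (lift X q) = 0"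
  by (simp_all add: lift_def)

lemma vf_lift [simp, intro]: "VFM X \<Longrightarrow> VFP (lift X)"
  unfolding lift_def by (rule vf_HL)

lemma bracket_lift: "VFM X \<Longrightarrow> VFM Y \<Longrightarrow> lie_bracket (P_mfd N) (lift X) (lift Y) q = lift (lie_bracket M X Y) q - \<omega> (prj q) (X (prj q)) (Y (prj q)) *\<^sub>R E q"
  unfolding lift_def by (rule bracket_HL)

lemma bracket_lift_frame [simp]:
  "VFM X \<Longrightarrow> lie_bracket (P_mfd N) E (lift X) q = 0" "VFM X \<Longrightarrow> lie_bracket (P_mfd N) S (lift X) q = 0"
  "VFM X \<Longrightarrow> lie_bracket (P_mfd N) (lift X) E q = 0" "VFM X \<Longrightarrow> lie_bracket (P_mfd N) (lift X) S q = 0"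
  unfolding lift_def by simp_all

lemma vf_frame: "frame_field G \<Longrightarrow> VFP G"
  by (induction rule: frame_field.induct) auto

lemma tensor1_zero:
  assumes T: "tensor_at q T" and fr: "\<And>G. frame_field G \<Longrightarrow> T G = 0" and A: "VFP A"
  shows "T A = 0"
  by (rule tensor_zero_on_frame[where T = T and q = q, OF _ _ _ _ _ A])
     (use T fr frame_field.intros in \<open>auto simp: tensor_at_def lift_def[symmetric]\<close>)

lemma tensor2_zero:
  assumes T: "\<And>B. VFP B \<Longrightarrow> tensor_at q (\<lambda>A. T A B)" "\<And>A. VFP A \<Longrightarrow> tensor_at q (T A)"
    and fr: "\<And>G H. frame_field G \<Longrightarrow> frame_field H \<Longrightarrow> T G H = 0" and A: "VFP A" "VFP B"
  shows "T A B = 0"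
  by (rule tensor1_zero[OF T(1) _ A(1)]) (use tensor1_zero[OF T(2) _ A(2)] fr vf_frame A in auto)

lemma tensor3_zero:
  assumes T: "\<And>B C. VFP B \<Longrightarrow> VFP C \<Longrightarrow> tensor_at q (\<lambda>A. T A B C)" "\<And>A C. VFP A \<Longrightarrow> VFP C \<Longrightarrow> tensor_at q (\<lambda>B. T A B C)"
      "\<And>A B. VFP A \<Longrightarrow> VFP B \<Longrightarrow> tensor_at q (T A B)"
    and fr: "\<And>G H K. frame_field G \<Longrightarrow> frame_field H \<Longrightarrow> frame_field K \<Longrightarrow> T G H K = 0" and A: "VFP A" "VFP B" "VFP C"
  shows "T A B C = 0"
  by (rule tensor1_zero[OF T(1) _ A(1)]) (use tensor2_zero[OF T(2,3) _ A(2,3)] fr vf_frame A in auto)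

text \<open>The flows of \<open>E\<close> and \<open>S\<close> preserve the frame and all functions of the base point.\<close>

lemma lie_vertical_basic:
  assumes V: "V = E \<or> V = S"
  shows "VFM X \<Longrightarrow> lie_bracket (P_mfd N) V (lift X) q = 0" "lie_bracket (P_mfd N) V E q = 0" "lie_bracket (P_mfd N) V S q = 0"
    "smooth_in M UNIV g \<Longrightarrow> VFP B \<Longrightarrow> lie_bracket (P_mfd N) V (\<lambda>q. g (prj q) *\<^sub>R B q) q = g (prj q) *\<^sub>R lie_bracket (P_mfd N) V B q"
  using V by (auto simp: P.lie_bracket_scaleR_right smooth_prj dderiv_prj M.dderiv_linear_0[OF open_UNIV UNIV_I])

lemma dderiv_exp_prj:
  assumes "smooth_in M UNIV g"
  shows "dderiv (P_mfd N) (\<lambda>r. exp (2 * snd r) * g (prj r)) q w = exp (2 * snd q) * (2 * snd w * g (prj q) + dderiv M g (prj q) (pT q w))"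
proof -
  note U = open_UNIV UNIV_I[of q]
  have s: "SFP (\<lambda>r. 2 * snd r)" by (intro P.smooth_in_mult P.smooth_in_const NR.smooth_in_snd open_UNIV)
  have "dderiv (P_mfd N) (\<lambda>r. 2 * snd r) q w = 2 * snd w"
    using P.dderiv_mult[OF U P.smooth_in_const NR.smooth_in_snd] by simp
  then show ?thesis
    unfolding P.dderiv_mult[OF U P.smooth_in_exp[OF open_UNIV s] smooth_prj[OF assms]] P.dderiv_exp[OF U s] dderiv_prj[OF assms]
    by (simp add: algebra_simps)
qed

text \<open>On frame fields, \<open>\<mu>\<close> is \<open>exp (2s)\<close> times a function of the base point.\<close>

lemma mu_frame:
  "\<mu> q (lift X q) (lift Y q) = exp (2 * snd q) * \<omega> (prj q) (X (prj q)) (Y (prj q))"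
  "\<mu> q (lift X q) (E q) = 0" "\<mu> q (lift X q) (S q) = 0" "\<mu> q (E q) (lift X q) = 0" "\<mu> q (S q) (lift X q) = 0"
  "\<mu> q (E q) (E q) = 0" "\<mu> q (S q) (S q) = 0" "\<mu> q (E q) (S q) = - 2 * exp (2 * snd q)" "\<mu> q (S q) (E q) = 2 * exp (2 * snd q)"
proof -
  interpret x: symplectic_space "\<omega> (prj q)" by (rule M.symplectic_space)
  show "\<mu> q (lift X q) (lift Y q) = exp (2 * snd q) * \<omega> (prj q) (X (prj q)) (Y (prj q))"
  "\<mu> q (lift X q) (E q) = 0" "\<mu> q (lift X q) (S q) = 0" "\<mu> q (E q) (lift X q) = 0" "\<mu> q (S q) (lift X q) = 0"
  "\<mu> q (E q) (E q) = 0" "\<mu> q (S q) (S q) = 0" "\<mu> q (E q) (S q) = - 2 * exp (2 * snd q)" "\<mu> q (S q) (E q) = 2 * exp (2 * snd q)"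
    by (simp_all add: \<mu>_def x.form_simps)
qed

lemma dderiv_mu_frame:
  "VFM X \<Longrightarrow> VFM Y \<Longrightarrow> dderiv (P_mfd N) (\<lambda>r. \<mu> r (lift X r) (lift Y r)) q w =
     exp (2 * snd q) * (2 * snd w * \<omega> (prj q) (X (prj q)) (Y (prj q)) + dderiv M (\<lambda>x. \<omega> x (X x) (Y x)) (prj q) (pT q w))"
  "dderiv (P_mfd N) (\<lambda>r. \<mu> r (E r) (S r)) q w = - 4 * exp (2 * snd q) * snd w"
  "dderiv (P_mfd N) (\<lambda>r. \<mu> r (S r) (E r)) q w = 4 * exp (2 * snd q) * snd w"
proof -
  show "VFM X \<Longrightarrow> VFM Y \<Longrightarrow> dderiv (P_mfd N) (\<lambda>r. \<mu> r (lift X r) (lift Y r)) q w =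
     exp (2 * snd q) * (2 * snd w * \<omega> (prj q) (X (prj q)) (Y (prj q)) + dderiv M (\<lambda>x. \<omega> x (X x) (Y x)) (prj q) (pT q w))"
    unfolding mu_frame using dderiv_exp_prj[OF M.smooth_in_tensor2[OF M.smooth_omega open_UNIV], of X Y q w] by simp
  show "dderiv (P_mfd N) (\<lambda>r. \<mu> r (E r) (S r)) q w = - 4 * exp (2 * snd q) * snd w"
    unfolding mu_frame using dderiv_exp_prj[OF M.smooth_in_const[of _ "-2"], of q w] by (simp add: mult.commute)
  show "dderiv (P_mfd N) (\<lambda>r. \<mu> r (S r) (E r)) q w = 4 * exp (2 * snd q) * snd w"
    unfolding mu_frame using dderiv_exp_prj[OF M.smooth_in_const[of _ "2"], of q w] by (simp add: mult.commute)
qed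

lemma dderiv_mu_frame_zero:
  "dderiv (P_mfd N) (\<lambda>r. \<mu> r (lift X r) (E r)) q w = 0" "dderiv (P_mfd N) (\<lambda>r. \<mu> r (lift X r) (S r)) q w = 0"
  "dderiv (P_mfd N) (\<lambda>r. \<mu> r (E r) (lift X r)) q w = 0" "dderiv (P_mfd N) (\<lambda>r. \<mu> r (S r) (lift X r)) q w = 0"
  "dderiv (P_mfd N) (\<lambda>r. \<mu> r (E r) (E r)) q w = 0" "dderiv (P_mfd N) (\<lambda>r. \<mu> r (S r) (S r)) q w = 0"
  by (simp_all add: mu_frame)

lemma frame_field_cases:
  assumes "frame_field G"
  shows "(\<exists>X. VFM X \<and> G = lift X) \<or> G = E \<or> G = S"
  using assms by (cases rule: frame_field.cases) auto

lemma linear_mu [simp]: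
  "\<mu> q (u + u') v = \<mu> q u v + \<mu> q u' v" "\<mu> q u (v + v') = \<mu> q u v + \<mu> q u v'"
  "\<mu> q (u - u') v = \<mu> q u v - \<mu> q u' v" "\<mu> q u (v - v') = \<mu> q u v - \<mu> q u v'"
  "\<mu> q (c *\<^sub>R u) v = c * \<mu> q u v" "\<mu> q u (c *\<^sub>R v) = c * \<mu> q u v" "\<mu> q 0 v = 0" "\<mu> q u 0 = 0"
proof -
  interpret m: symplectic_space "\<mu> q" by (rule symplectic_space_mu)
  show "\<mu> q (u + u') v = \<mu> q u v + \<mu> q u' v" "\<mu> q u (v + v') = \<mu> q u v + \<mu> q u v'"
  "\<mu> q (u - u') v = \<mu> q u v - \<mu> q u' v" "\<mu> q u (v - v') = \<mu> q u v - \<mu> q u v'"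
  "\<mu> q (c *\<^sub>R u) v = c * \<mu> q u v" "\<mu> q u (c *\<^sub>R v) = c * \<mu> q u v" "\<mu> q 0 v = 0" "\<mu> q u 0 = 0"
    by (simp_all add: m.form_simps)
qed

lemma smooth_mu_fields: "VFP A \<Longrightarrow> VFP B \<Longrightarrow> SFP (\<lambda>r. \<mu> r (A r) (B r))"
  by (rule P.smooth_in_tensor2[OF smooth_mu open_UNIV])

lemma dderiv_mu_linear:
  "VFP A \<Longrightarrow> VFP A' \<Longrightarrow> VFP B \<Longrightarrow> dderiv (P_mfd N) (\<lambda>r. \<mu> r (A r) (B r) + \<mu> r (A' r) (B r)) q w =
    dderiv (P_mfd N) (\<lambda>r. \<mu> r (A r) (B r)) q w + dderiv (P_mfd N) (\<lambda>r. \<mu> r (A' r) (B r)) q w"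
  "VFP A \<Longrightarrow> VFP B \<Longrightarrow> VFP B' \<Longrightarrow> dderiv (P_mfd N) (\<lambda>r. \<mu> r (A r) (B r) + \<mu> r (A r) (B' r)) q w =
    dderiv (P_mfd N) (\<lambda>r. \<mu> r (A r) (B r)) q w + dderiv (P_mfd N) (\<lambda>r. \<mu> r (A r) (B' r)) q w"
  "SFP g \<Longrightarrow> VFP A \<Longrightarrow> VFP B \<Longrightarrow> dderiv (P_mfd N) (\<lambda>r. g r * \<mu> r (A r) (B r)) q w =
    g q * dderiv (P_mfd N) (\<lambda>r. \<mu> r (A r) (B r)) q w + dderiv (P_mfd N) g q w * \<mu> q (A q) (B q)"
  by (simp_all add: P.dderiv_add[OF open_UNIV UNIV_I] P.dderiv_mult[OF open_UNIV UNIV_I] smooth_mu_fields)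

text \<open>
  The brackets with the frame fields vanish, so on the frame the Lie derivative of \<open>\<mu>\<close> only differentiates
  the factor \<open>exp (2s)\<close>: it is annihilated by \<open>E\<close> and doubled by \<open>S\<close>.
\<close>

lemma vertical_scales_mu:
  assumes V: "V = E \<and> c = 0 \<or> V = S \<and> c = 2"
  shows "lie_scales2 (P_mfd N) V \<mu> c"
  unfolding lie_scales2_def P.smooth_vf_iff vf_app_eq_dderiv
proof (intro allI impI, elim conjE)
  fix A B q assume v: "VFP A" "VFP B"
  have vV: "VFP V" using V by auto
  let ?T = "\<lambda>A B. dderiv (P_mfd N) (\<lambda>r. \<mu> r (A r) (B r)) q (V q) - \<mu> q (lie_bracket (P_mfd N) V A q) (B q) - \<mu> q (A q) (lie_bracket (P_mfd N) V B q) - c * \<mu> q (A q) (B q)"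
  have "?T A B = 0"
  proof (rule tensor2_zero[where T = ?T and q = q, OF _ _ _ v])
    fix B assume "VFP B"
    then show "tensor_at q (\<lambda>A. ?T A B)"
      unfolding tensor_at_def by (simp add: dderiv_mu_linear P.lie_bracket_add_right P.lie_bracket_scaleR_right vV algebra_simps)
  next
    fix A assume "VFP A"
    then show "tensor_at q (?T A)"
      unfolding tensor_at_def by (simp add: dderiv_mu_linear P.lie_bracket_add_right P.lie_bracket_scaleR_right vV algebra_simps)
  next
    fix G H assume "frame_field G" "frame_field H"
    have z: "dderiv M g x 0 = 0" if "smooth_in M UNIV g" for g :: "'m \<Rightarrow> real" and x
      by (rule M.dderiv_linear_0[OF open_UNIV UNIV_I that])
    have o: "smooth_in M UNIV (\<lambda>x. \<omega> x (X x) (Y x))" if "VFM X" "VFM Y" for X Y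
      by (rule M.smooth_in_tensor2[OF M.smooth_omega open_UNIV that])
    from frame_field_cases[OF \<open>frame_field G\<close>] frame_field_cases[OF \<open>frame_field H\<close>] V show "?T G H = 0"
      by (elim disjE exE conjE; hypsubst; simp only: dderiv_mu_frame dderiv_mu_frame_zero; simp add: mu_frame z o)
  qed
  then show "dderiv (P_mfd N) (\<lambda>r. \<mu> r (A r) (B r)) q (V q) - \<mu> q (lie_bracket (P_mfd N) V A q) (B q) - \<mu> q (A q) (lie_bracket (P_mfd N) V B q) = c * \<mu> q (A q) (B q)"
    by simp
qed

end

context induced
begin

text \<open>
  The coefficients of the induced connection, as functions and fields on \<open>M\<close>; like the lifts they are
  kept opaque.
\<close>

definition om :: "('m \<Rightarrow> 'e) \<Rightarrow> ('m \<Rightarrow> 'e) \<Rightarrow> 'm \<Rightarrow> real" where "om X Y x = \<omega> x (X x) (Y x)"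
definition hom :: "('m \<Rightarrow> 'e) \<Rightarrow> ('m \<Rightarrow> 'e) \<Rightarrow> 'm \<Rightarrow> real" where "hom X Y x = 1 / 2 * \<omega> x (X x) (Y x)"
definition es :: "('m \<Rightarrow> 'e) \<Rightarrow> ('m \<Rightarrow> 'e) \<Rightarrow> 'm \<Rightarrow> real" where "es X Y x = s x (X x) (Y x)"
definition sig :: "('m \<Rightarrow> 'e) \<Rightarrow> 'm \<Rightarrow> 'e" where "sig X x = \<sigma> x (X x)"

lemma smooth_coeffs [simp]:
  "VFM X \<Longrightarrow> VFM Y \<Longrightarrow> smooth_in M UNIV (om X Y)" "VFM X \<Longrightarrow> VFM Y \<Longrightarrow> smooth_in M UNIV (hom X Y)"
  "VFM X \<Longrightarrow> VFM Y \<Longrightarrow> smooth_in M UNIV (es X Y)" "VFM X \<Longrightarrow> VFM (sig X)"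
  "smooth_in M UNIV f" "VFM U"
proof -
  show "VFM X \<Longrightarrow> VFM Y \<Longrightarrow> smooth_in M UNIV (om X Y)" "VFM X \<Longrightarrow> VFM Y \<Longrightarrow> smooth_in M UNIV (es X Y)"
    unfolding om_def[abs_def] es_def[abs_def] by (intro M.smooth_in_tensor2 M.smooth_omega smooth_s open_UNIV; assumption)+
  then show "VFM X \<Longrightarrow> VFM Y \<Longrightarrow> smooth_in M UNIV (hom X Y)"
    unfolding om_def[abs_def] hom_def[abs_def] by (intro M.smooth_in_mult M.smooth_in_const open_UNIV)
  show "VFM X \<Longrightarrow> VFM (sig X)" unfolding sig_def[abs_def] by (rule vf_\<sigma>)
qed (rule smooth_f vf_U)+

lemma DP_lift:
  "VFM X \<Longrightarrow> VFM Y \<Longrightarrow> DP (lift X) (lift Y) = (\<lambda>q. lift (D X Y) q - hom X Y (prj q) *\<^sub>R E q - es X Y (prj q) *\<^sub>R S q)"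
  "VFM X \<Longrightarrow> DP E (lift X) = (\<lambda>q. 2 *\<^sub>R lift (sig X) q + om X U (prj q) *\<^sub>R S q)"
  "VFM X \<Longrightarrow> DP (lift X) E = (\<lambda>q. 2 *\<^sub>R lift (sig X) q + om X U (prj q) *\<^sub>R S q)"
  "VFM X \<Longrightarrow> DP S (lift X) = lift X" "VFM X \<Longrightarrow> DP (lift X) S = lift X"
  "DP E E = (\<lambda>q. f (prj q) *\<^sub>R S q - 2 *\<^sub>R lift U q)"
  "DP E S = E" "DP S E = E" "DP S S = S"
  unfolding lift_def by (simp_all add: DP_frame om_def hom_def es_def sig_def)

lemma vf_simps [simp]:
  "VFP A \<Longrightarrow> VFP B \<Longrightarrow> VFP (\<lambda>q. A q + B q)" "VFP A \<Longrightarrow> VFP B \<Longrightarrow> VFP (\<lambda>q. A q - B q)"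
  "SFP g \<Longrightarrow> VFP A \<Longrightarrow> VFP (\<lambda>q. g q *\<^sub>R A q)" "smooth_in M UNIV h \<Longrightarrow> SFP (\<lambda>q. h (prj q))" "SFP (\<lambda>q. c)"
  "VFP A \<Longrightarrow> VFP B \<Longrightarrow> VFP (DP A B)" "VFP A \<Longrightarrow> VFP B \<Longrightarrow> VFP (lie_bracket (P_mfd N) A B)"
  "VFM X \<Longrightarrow> VFM Y \<Longrightarrow> VFM (D X Y)" "VFM X \<Longrightarrow> VFM Y \<Longrightarrow> VFM (lie_bracket M X Y)" "VFP (\<lambda>q. 0)"
  by (simp_all add: P.vf_in_add P.vf_in_diff P.vf_in_scaleR smooth_prj P.smooth_in_const PD.vf_smooth P.vf_in_lie_bracket
      MD.vf_smooth M.vf_in_lie_bracket P.vf_in_zero)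

text \<open>
  On two lifts, the \<open>E\<close>-component \<open>- \<omega>/2\<close> of the connection produces that of the bracket, and the symmetry
  of \<open>s\<close> cancels the \<open>S\<close>-components.
\<close>

lemma torsion_free_DP: "torsion_free (P_mfd N) DP"
  unfolding torsion_free_def P.smooth_vf_iff
proof (intro allI impI, elim conjE)
  fix A B q assume v: "VFP A" "VFP B"
  let ?T = "\<lambda>A B. DP A B q - DP B A q - lie_bracket (P_mfd N) A B q"
  show "?T A B = 0"
  proof (rule tensor2_zero[where T = ?T and q = q, OF _ _ _ v])
    fix B assume "VFP B"
    then show "tensor_at q (\<lambda>A. ?T A B)"
      unfolding tensor_at_def
      by (simp add: PD.D_add_left PD.D_add_right PD.D_scaleR_left PD.D_scaleR_right P.lie_bracket_add_left[OF refl] P.lie_bracket_scaleR_left[OF refl] algebra_simps)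
  next
    fix A assume "VFP A"
    then show "tensor_at q (?T A)"
      unfolding tensor_at_def
      by (simp add: PD.D_add_left PD.D_add_right PD.D_scaleR_left PD.D_scaleR_right P.lie_bracket_add_right P.lie_bracket_scaleR_right algebra_simps)
  next
    fix G H assume "frame_field G" "frame_field H"
    moreover have "DP (lift X) (lift Y) q - DP (lift Y) (lift X) q = lie_bracket (P_mfd N) (lift X) (lift Y) q" if "VFM X" "VFM Y" for X Y
    proof (rule tangent_eqI[of q])
      interpret x: symplectic_space "\<omega> (prj q)" by (rule M.symplectic_space)
      show "pT q (DP (lift X) (lift Y) q - DP (lift Y) (lift X) q) = pT q (lie_bracket (P_mfd N) (lift X) (lift Y) q)"
        using that MD.torsion[OF that, of "prj q"] by (simp add: DP_lift bracket_lift)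
      show "a q (DP (lift X) (lift Y) q - DP (lift Y) (lift X) q) = a q (lie_bracket (P_mfd N) (lift X) (lift Y) q)"
        using that x.antisym[of "Y (prj q)" "X (prj q)"] by (simp add: DP_lift bracket_lift om_def hom_def)
      show "snd (DP (lift X) (lift Y) q - DP (lift Y) (lift X) q) = snd (lie_bracket (P_mfd N) (lift X) (lift Y) q)"
        using that s_sym[of "prj q" "Y (prj q)" "X (prj q)"] by (simp add: DP_lift bracket_lift es_def)
    qed
    ultimately show "?T G H = 0"
      by (elim frame_field.cases) (simp_all add: DP_lift(2-))
  qed
qed

text \<open>
  The form and its covariant derivative are antisymmetric in the last two arguments, so that on the frame
  only four kinds of pairs have to be considered for each direction of differentiation. The symmetry
  of \<open>s\<close> accounts for a pair consisting of a lift and \<open>E\<close>.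
\<close>

lemma parallel_DP: "parallel2 (P_mfd N) DP \<mu>"
  unfolding parallel2_def P.smooth_vf_iff vf_app_eq_dderiv
proof (intro allI impI, elim conjE)
  fix A B C q assume v: "VFP A" "VFP B" "VFP C"
  let ?T = "\<lambda>A B C. dderiv (P_mfd N) (\<lambda>r. \<mu> r (B r) (C r)) q (A q) - \<mu> q (DP A B q) (C q) - \<mu> q (B q) (DP A C q)"
  interpret x: symplectic_space "\<omega> (prj q)" by (rule M.symplectic_space)
  note lin = P.dderiv_linear_add[OF open_UNIV UNIV_I smooth_mu_fields] P.dderiv_linear_scale[OF open_UNIV UNIV_I smooth_mu_fields]
  show "?T A B C = 0"
  proof (rule tensor3_zero[where T = ?T and q = q, OF _ _ _ _ v])
    fix B C assume "VFP B" "VFP C"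
    then show "tensor_at q (\<lambda>A. ?T A B C)"
      unfolding tensor_at_def by (simp add: lin PD.D_add_left PD.D_scaleR_left algebra_simps)
  next
    fix A C assume "VFP A" "VFP C"
    then show "tensor_at q (\<lambda>B. ?T A B C)"
      unfolding tensor_at_def by (simp add: dderiv_mu_linear PD.D_add_right PD.D_scaleR_right algebra_simps)
  next
    fix A B assume "VFP A" "VFP B"
    then show "tensor_at q (?T A B)"
      unfolding tensor_at_def by (simp add: dderiv_mu_linear PD.D_add_right PD.D_scaleR_right algebra_simps)
  next
    fix G H K assume fr: "frame_field G" "frame_field H" "frame_field K"
    have z: "dderiv M (\<lambda>x. \<omega> x (X x) (Y x)) x 0 = 0" if "VFM X" "VFM Y" for X Y x
      by (rule M.dderiv_linear_0[OF open_UNIV UNIV_I M.smooth_in_tensor2[OF M.smooth_omega open_UNIV that]])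
    have sg: "\<omega> (prj q) (\<sigma> (prj q) u) v = - s (prj q) u v" for u v
      using x.antisym[of "\<sigma> (prj q) u" v] \<sigma>[of "prj q" v u] s_sym[of "prj q" u v] by simp
    let ?F = "\<lambda>B. \<exists>X. VFM X \<and> B = lift X"
    have LLL: "?T (lift X) (lift Y) (lift Z) = 0" if "VFM X" "VFM Y" "VFM Z" for X Y Z
      unfolding dderiv_mu_frame(1)[OF that(2,3)] DP_lift(1)[OF that(1,2)] DP_lift(1)[OF that(1,3)]
      using MD.parallel[OF that, of "prj q"] by (simp add: mu_frame algebra_simps)
    have LLE: "?T (lift X) (lift Y) E = 0" if "VFM X" "VFM Y" for X Y
      unfolding dderiv_mu_frame_zero DP_lift(1)[OF that] DP_lift(3)[OF that(1)]
      using s_sym[of "prj q" "X (prj q)" "Y (prj q)"] by (simp add: mu_frame es_def sig_def \<sigma>)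
    have LLS: "?T (lift X) (lift Y) S = 0" if "VFM X" "VFM Y" for X Y
      unfolding dderiv_mu_frame_zero DP_lift(1)[OF that] DP_lift(5)[OF that(1)]
      using x.antisym[of "X (prj q)" "Y (prj q)"] by (simp add: mu_frame om_def hom_def)
    have LES: "?T (lift X) E S = 0" if "VFM X" for X
      unfolding dderiv_mu_frame DP_lift(3,5)[OF that] by (simp add: mu_frame)
    have ELL: "?T E (lift Y) (lift Z) = 0" if "VFM Y" "VFM Z" for Y Z
      unfolding dderiv_mu_frame(1)[OF that] DP_lift(2)[OF that(1)] DP_lift(2)[OF that(2)]
      using s_sym[of "prj q" "Y (prj q)" "Z (prj q)"] by (simp add: mu_frame z that sig_def \<sigma> sg)
    have ELE: "?T E (lift Y) E = 0" if "VFM Y" for Y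
      unfolding dderiv_mu_frame_zero DP_lift(2)[OF that] DP_lift(6) by (simp add: mu_frame om_def hom_def)
    have ELS: "?T E (lift Y) S = 0" if "VFM Y" for Y
      unfolding dderiv_mu_frame_zero DP_lift(2)[OF that] DP_lift(7) by (simp add: mu_frame)
    have EES: "?T E E S = 0"
      unfolding dderiv_mu_frame DP_lift(6,7) by (simp add: mu_frame)
    have SLL: "?T S (lift Y) (lift Z) = 0" if "VFM Y" "VFM Z" for Y Z
      unfolding dderiv_mu_frame(1)[OF that] DP_lift(4)[OF that(1)] DP_lift(4)[OF that(2)]
      by (simp add: mu_frame z that)
    have SLV: "?T S (lift Y) E = 0" "?T S (lift Y) S = 0" if "VFM Y" for Y
      unfolding dderiv_mu_frame_zero DP_lift(4)[OF that] DP_lift(8,9) by (simp_all add: mu_frame)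
    have SES: "?T S E S = 0"
      unfolding dderiv_mu_frame DP_lift(8,9) by (simp add: mu_frame)
    have anti: "?T A B C = - ?T A C B" if "VFP A" "VFP B" "VFP C" for A B C
    proof -
      have m: "\<mu> r u v = - \<mu> r v u" for r u v using symplectic_space.antisym[OF symplectic_space_mu] .
      have "dderiv (P_mfd N) (\<lambda>r. \<mu> r (B r) (C r)) q (A q) = dderiv (P_mfd N) (\<lambda>r. - 1 * \<mu> r (C r) (B r)) q (A q)"
        by (rule arg_cong[where f = "\<lambda>h. dderiv (P_mfd N) h q (A q)"], rule ext, subst m) simp
      also have "\<dots> = - dderiv (P_mfd N) (\<lambda>r. \<mu> r (C r) (B r)) q (A q)"
        using dderiv_mu_linear(3)[OF P.smooth_in_const[of _ "-1"] that(3,2), of q "A q"] by simp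
      finally show ?thesis using m[of q "DP A B q" "C q"] m[of q "B q" "DP A C q"] by simp
    qed
    have same: "?T A B B = 0" if "VFP A" "VFP B" for A B
      using anti[OF that that(2)] by simp
    have pairs: "?T A H K = 0 \<or> ?T A K H = 0"
      if "VFP A" "\<And>Y Z. VFM Y \<Longrightarrow> VFM Z \<Longrightarrow> ?T A (lift Y) (lift Z) = 0"
        "\<And>Y. VFM Y \<Longrightarrow> ?T A (lift Y) E = 0" "\<And>Y. VFM Y \<Longrightarrow> ?T A (lift Y) S = 0" "?T A E S = 0" for A
      using frame_field_cases[OF fr(2)] frame_field_cases[OF fr(3)]
    proof (elim disjE exE conjE)
      fix Y Z assume "VFM Y" "H = lift Y" "VFM Z" "K = lift Z"
      then show ?thesis using that(2)[of Y Z] by (simp only: simp_thms)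
    next
      fix Y assume "VFM Y" "H = lift Y" "K = E"
      then show ?thesis using that(3)[of Y] by (simp only: simp_thms)
    next
      fix Y assume "VFM Y" "H = lift Y" "K = S"
      then show ?thesis using that(4)[of Y] by (simp only: simp_thms)
    next
      fix Y assume "H = E" "VFM Y" "K = lift Y"
      then show ?thesis using that(3)[of Y] by (simp only: simp_thms)
    next
      fix Y assume "H = S" "VFM Y" "K = lift Y"
      then show ?thesis using that(4)[of Y] by (simp only: simp_thms)
    next
      assume "H = E" "K = E"
      then show ?thesis using same[OF that(1) vf_ES(1)] by (simp only: simp_thms)
    next
      assume "H = E" "K = S"
      then show ?thesis using that(5) by (simp only: simp_thms)
    next
      assume "H = S" "K = E"
      then show ?thesis using that(5) by (simp only: simp_thms)
    next
      assume "H = S" "K = S"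
      then show ?thesis using same[OF that(1) vf_ES(2)] by (simp only: simp_thms)
    qed
    have half: "?T G H K = 0 \<or> ?T G K H = 0"
      using frame_field_cases[OF fr(1)]
    proof (elim disjE exE conjE)
      fix X assume G: "VFM X" "G = lift X"
      show ?thesis unfolding G(2) by (rule pairs) (use G in \<open>simp_all only: LLL LLE LLS LES vf_lift\<close>)
    next
      assume G: "G = E"
      show ?thesis unfolding G by (rule pairs) (simp_all only: ELL ELE ELS EES vf_ES)
    next
      assume G: "G = S"
      show ?thesis unfolding G by (rule pairs) (simp_all only: SLL SLV SES vf_ES)
    qed
    then show "?T G H K = 0" using anti[OF vf_frame vf_frame vf_frame, OF fr] by linarith
  qed
qed

lemma symplectic_form_mu: "symplectic_form (P_mfd N) \<mu>"
  unfolding symplectic_form_def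
  using PD.parallel_imp_closed[OF smooth_mu _ torsion_free_DP parallel_DP] smooth_mu symplectic_space_mu
  by (auto simp: symplectic_space_def)

lemma symplectic_connection_DP: "symplectic_connection (P_mfd N) \<mu> DP"
  by (simp add: symplectic_connection_def P.smooth_mfd symplectic_form_mu DP_linear_connection torsion_free_DP parallel_DP)

sublocale PS: symp_conn "P_mfd N" \<mu> DP
  by unfold_locales (simp_all add: symplectic_form_mu torsion_free_DP parallel_DP)

text \<open>
  The Lie derivative of the connection is a tensor. On the frame it vanishes, because the
  coefficients of the connection are functions of the base point.
\<close>

lemma affine_vertical:
  assumes V: "V = E \<or> V = S"
  shows "affine_vf (P_mfd N) DP V"
  unfolding affine_vf_def P.smooth_vf_iff
proof (intro conjI allI impI; (elim conjE)?)
  show vV: "VFP V" using V by auto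
  fix A B q assume v: "VFP A" "VFP B"
  let ?b = "lie_bracket (P_mfd N)"
  let ?T = "\<lambda>A B. ?b V (DP A B) q - DP (?b V A) B q - DP A (?b V B) q"
  have ba: "?b V (\<lambda>r. A r + B r) = (\<lambda>r. ?b V A r + ?b V B r)" if "VFP A" "VFP B" for A B
    by (rule ext) (rule P.lie_bracket_add_right[OF vV that])
  have bs: "?b V (\<lambda>r. g r *\<^sub>R A r) = (\<lambda>r. g r *\<^sub>R ?b V A r + dderiv (P_mfd N) g r (V r) *\<^sub>R A r)" if "VFP A" "SFP g" for A g
    by (rule ext) (rule P.lie_bracket_scaleR_right[OF vV that])
  have sd: "SFP (\<lambda>r. dderiv (P_mfd N) g r (A r))" if "SFP g" "VFP A" for g :: "'n \<times> real \<Rightarrow> real" and A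
    by (rule P.smooth_in_dderiv[OF open_UNIV that])
  show "?T A B = 0"
  proof (rule tensor2_zero[where T = ?T and q = q, OF _ _ _ v])
    fix B assume "VFP B"
    then show "tensor_at q (\<lambda>A. ?T A B)"
      unfolding tensor_at_def by (simp add: ba bs sd vV PD.D_add_left PD.D_scaleR_left algebra_simps)
  next
    fix A assume A: "VFP A"
    have e: "dderiv (P_mfd N) g q (?b V A q) = dderiv (P_mfd N) (\<lambda>y. dderiv (P_mfd N) g y (A y)) q (V q) - dderiv (P_mfd N) (\<lambda>y. dderiv (P_mfd N) g y (V y)) q (A q)"
      if "SFP g" for g :: "'n \<times> real \<Rightarrow> real"
      by (rule P.dderiv_lie_bracket[OF open_UNIV UNIV_I that vV A])
    then show "tensor_at q (?T A)"
      using A unfolding tensor_at_def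
      by (simp add: ba bs sd vV PD.D_add_right PD.D_scaleR_right e) (simp add: algebra_simps)
  next
    fix G H assume fr: "frame_field G" "frame_field H"
    have b0: "?b V G = (\<lambda>r. 0)" if "frame_field G" for G
      using that by (induction rule: frame_field.induct) (auto simp: lie_vertical_basic[OF V])
    have bd: "?b V (\<lambda>r. A r - B r) q = ?b V A q - ?b V B q" if "VFP A" "VFP B" for A B
      using P.lie_bracket_add_right[OF vV that(1), of "\<lambda>r. (-1) *\<^sub>R B r" q] P.lie_bracket_scaleR_right[OF vV that(2) P.smooth_in_const[of _ "-1"], of q] that
      by (simp add: P.vf_in_minus)
    have bc: "?b V (\<lambda>r. c *\<^sub>R B r) q = c *\<^sub>R ?b V B q" if "VFP B" for c B
      using P.lie_bracket_scaleR_right[OF vV that P.smooth_in_const[of _ c], of q] by simp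
    have "?b V (DP G H) q = 0"
      using fr by (elim frame_field.cases) (simp_all add: DP_lift ba bd bc lie_vertical_basic[OF V])
    then show "?T G H = 0"
      by (simp add: b0 fr PD.D_zero_left PD.D_zero_right vf_frame)
  qed
qed

section \<open>The curvature of the induced connection\<close>

text \<open>The covariant derivative of \<open>S\<close> is the identity; all special properties of the curvature come from this.\<close>

lemma DP_S: "VFP A \<Longrightarrow> DP A S = A"
proof
  fix q assume A: "VFP A"
  have "DP A S q - A q = 0"
    by (rule tensor1_zero[where T = "\<lambda>A. DP A S q - A q" and q = q, OF _ _ A])
       (auto simp: tensor_at_def PD.D_add_left PD.D_scaleR_left algebra_simps DP_lift elim!: frame_field.cases)
  then show "DP A S q = A q" by simp
qed

lemma curv_S_3: "VFP A \<Longrightarrow> VFP B \<Longrightarrow> curv (P_mfd N) DP A B S q = 0"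
  using PS.torsion[of A B q] by (simp add: curv_def DP_S)

text \<open>As \<open>S\<close> is affine and its covariant derivative is the identity, \<open>R(S,A)B = (L\<^sub>S\<nabla>)(A,B) = 0\<close>.\<close>

lemma curv_S_1:
  assumes v: "VFP A" "VFP B"
  shows "curv (P_mfd N) DP S A B q = 0"
proof -
  have DS: "DP S B = (\<lambda>q. B q + lie_bracket (P_mfd N) S B q)" if "VFP B" for B
    using PS.torsion[OF vf_ES(2) that] DP_S[OF that] by (auto simp: fun_eq_iff algebra_simps)
  have "lie_bracket (P_mfd N) S (DP A B) q - DP (lie_bracket (P_mfd N) S A) B q - DP A (lie_bracket (P_mfd N) S B) q = 0"
    using affine_vertical[of S] v unfolding affine_vf_def P.smooth_vf_iff by blast
  then show ?thesis
    using v DS[of "DP A B"] DS[OF v(2)] by (simp add: curv_def PD.D_add_right algebra_simps)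
qed

abbreviation R :: "'n \<times> real \<Rightarrow> 'f \<times> real \<Rightarrow> 'f \<times> real \<Rightarrow> 'f \<times> real \<Rightarrow> 'f \<times> real" where
  "R \<equiv> curv_at (P_mfd N) DP"

lemma R_S [simp]: "R q u v (S q) = 0" "R q (S q) u v = 0" "R q u (S q) v = 0"
proof -
  have *: "R q u v (S q) = 0" "R q (S q) u v = 0" for u v
  proof -
    obtain A where A: "VFP A" "A q = u" using P.vf_with_value by blast
    obtain B where B: "VFP B" "B q = v" using P.vf_with_value by blast
    show "R q u v (S q) = 0" "R q (S q) u v = 0"
      using PD.curv_at_eq[OF A(1) B(1) vf_ES(2), of q] PD.curv_at_eq[OF vf_ES(2) A(1) B(1), of q] A B
        curv_S_3[OF A(1) B(1)] curv_S_1[OF A(1) B(1)] by simp_all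
  qed
  then show "R q u v (S q) = 0" "R q (S q) u v = 0" "R q u (S q) v = 0"
    using PD.curv_at_antisym[of q u "S q" v] by simp_all
qed

lemma mu_S_right: "\<mu> q w (S q) = - 2 * exp (2 * snd q) * a q w"
  and mu_E_right: "\<mu> q w (E q) = 2 * exp (2 * snd q) * snd w"
  and mu_hl_right: "\<mu> q w (hl q u) = exp (2 * snd q) * \<omega> (prj q) (pT q w) u"
  by (simp_all add: \<mu>_def)

text \<open>\<open>R\<close> takes values in the symplectic Lie algebra and kills \<open>S\<close>, so that its values have no component along \<open>E\<close>.\<close>

lemma a_R_zero [simp]: "a q (R q u v w) = 0"
  using PS.curv_at_symplectic[of q u v w "S q"] by (simp add: mu_S_right)

lemma R_symplectic_hl: "\<omega> (prj q) (pT q (R q u v (hl q x))) y = \<omega> (prj q) (pT q (R q u v (hl q y))) x"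
  using PS.curv_at_symplectic[of q u v "hl q x" "hl q y"] by (simp add: mu_hl_right)

lemma R_symplectic_E: "2 * snd (R q u v (hl q x)) = \<omega> (prj q) (pT q (R q u v (E q))) x"
  using PS.curv_at_symplectic[of q u v "hl q x" "E q"] by (simp add: mu_hl_right mu_E_right)

lemma R_fields: "VFP A \<Longrightarrow> VFP B \<Longrightarrow> VFP C \<Longrightarrow> curv (P_mfd N) DP A B C q = R q (A q) (B q) (C q)"
  by (rule PD.curv_at_eq[symmetric])

lemma bracket_lift_fun:
  "VFM X \<Longrightarrow> VFM Y \<Longrightarrow> lie_bracket (P_mfd N) (lift X) (lift Y) = (\<lambda>q. lift (lie_bracket M X Y) q - om X Y (prj q) *\<^sub>R E q)"
  "VFM X \<Longrightarrow> lie_bracket (P_mfd N) E (lift X) = (\<lambda>q. 0)"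
  by (auto simp: bracket_lift om_def hom_def)

lemmas DP_rules = PD.D_add_right PD.D_diff_right PD.D_scaleR_right PD.D_cscaleR_right PD.D_diff_left PD.D_scaleR_left PD.D_zero_left

text \<open>
  The horizontal parts of the curvature on the frame. Derivatives of the coefficients of \<open>E\<close> and \<open>S\<close> do not
  contribute to them.
\<close>

lemma curv_lift_horizontal:
  assumes "VFM X" "VFM Y" "VFM Z"
  shows "pT q (curv (P_mfd N) DP (lift X) (lift Y) (lift Z) q) = curv M D X Y Z (prj q)
     - \<omega> (prj q) (Y (prj q)) (Z (prj q)) *\<^sub>R \<sigma> (prj q) (X (prj q)) + \<omega> (prj q) (X (prj q)) (Z (prj q)) *\<^sub>R \<sigma> (prj q) (Y (prj q))
     - s (prj q) (Y (prj q)) (Z (prj q)) *\<^sub>R X (prj q) + s (prj q) (X (prj q)) (Z (prj q)) *\<^sub>R Y (prj q)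
     + (2 * \<omega> (prj q) (X (prj q)) (Y (prj q))) *\<^sub>R \<sigma> (prj q) (Z (prj q))"
  using assms
  by (simp add: curv_def bracket_lift_fun DP_lift DP_rules, simp add: om_def hom_def es_def sig_def algebra_simps)

lemma curv_E_lift_lift_horizontal:
  assumes "VFM Z" "VFM X"
  shows "pT q (curv (P_mfd N) DP E (lift Z) (lift X) q) =
     - 2 *\<^sub>R (D Z (sig X) (prj q) - \<sigma> (prj q) (D Z X (prj q))) + \<omega> (prj q) (Z (prj q)) (X (prj q)) *\<^sub>R U (prj q)
     - \<omega> (prj q) (X (prj q)) (U (prj q)) *\<^sub>R Z (prj q)"
  using assms
  by (simp add: curv_def bracket_lift_fun DP_lift DP_rules, simp add: om_def hom_def es_def sig_def algebra_simps)

lemma curv_E_lift_E_horizontal: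
  assumes "VFM X"
  shows "pT q (curv (P_mfd N) DP E (lift X) E q) =
     4 *\<^sub>R \<sigma> (prj q) (\<sigma> (prj q) (X (prj q))) - f (prj q) *\<^sub>R X (prj q) + 2 *\<^sub>R D X U (prj q)"
  using assms
  by (simp add: curv_def bracket_lift_fun DP_lift DP_rules, simp add: om_def hom_def es_def sig_def algebra_simps)

lemma lift_value: "\<exists>X. VFM X \<and> lift X q = hl q x \<and> X (prj q) = x"
  using M.vf_with_value[of "prj q" x] by (metis lift_def)

lemma R_horizontal:
  "pT q (R q (hl q x) (hl q y) (hl q z)) = curv_at M D (prj q) x y z
     - \<omega> (prj q) y z *\<^sub>R \<sigma> (prj q) x + \<omega> (prj q) x z *\<^sub>R \<sigma> (prj q) y
     - s (prj q) y z *\<^sub>R x + s (prj q) x z *\<^sub>R y + (2 * \<omega> (prj q) x y) *\<^sub>R \<sigma> (prj q) z"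
proof -
  obtain X where X: "VFM X" "lift X q = hl q x" "X (prj q) = x" using lift_value by blast
  obtain Y where Y: "VFM Y" "lift Y q = hl q y" "Y (prj q) = y" using lift_value by blast
  obtain Z where Z: "VFM Z" "lift Z q = hl q z" "Z (prj q) = z" using lift_value by blast
  show ?thesis
    using curv_lift_horizontal[OF X(1) Y(1) Z(1), of q] MD.curv_at_eq[OF X(1) Y(1) Z(1), of "prj q"]
    by (simp add: R_fields X Y Z)
qed

end

section \<open>The canonical choice\<close>

lemma (in contact_base) lift_apply: "lift X q = hl q (X (prj q))"
  by (simp add: lift_def)

text \<open>Tensoriality makes the description that defines \<open>endo_at\<close> well-posed.\<close>

lemma (in smooth_mfd) endo_at_field:
  assumes add: "\<And>X Y x. vf_in M UNIV X \<Longrightarrow> vf_in M UNIV Y \<Longrightarrow> A (\<lambda>y. X y + Y y) x = A X x + A Y x"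
    and scale: "\<And>g X x. smooth_in M UNIV g \<Longrightarrow> vf_in M UNIV X \<Longrightarrow> A (\<lambda>y. g y *\<^sub>R X y) x = g x *\<^sub>R A X x"
  shows "vf_in M UNIV V \<Longrightarrow> endo_at M A x (V x) = A V x" and "linear (endo_at M A x)"
proof -
  have eq: "endo_at M A x (V x) = A V x" if V: "vf_in M UNIV V" for V
    unfolding endo_at_def smooth_vf_iff
  proof (rule the_equality)
    show "\<forall>V'. vf_in M UNIV V' \<and> V' x = V x \<longrightarrow> A V' x = A V x"
      using tensorial_eq[where A = "\<lambda>X. A X x" and x = x, OF add scale _ V] by blast
  qed (use V in auto)
  then show "vf_in M UNIV V \<Longrightarrow> endo_at M A x (V x) = A V x" .
  show "linear (endo_at M A x)"
    by (rule linear_at_point[where A = "\<lambda>X. A X x" and x = x, OF add scale]) (simp_all add: eq)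
qed

context symp_conn
begin

text \<open>The endomorphism \<open>v \<mapsto> (\<nabla>\<^sub>v \<sigma>) X\<close>, where \<open>\<sigma>\<close> is the endomorphism of \<open>b\<close>.\<close>

definition nab_endo :: "('m \<Rightarrow> 'e \<Rightarrow> 'e \<Rightarrow> real) \<Rightarrow> ('m \<Rightarrow> 'e) \<Rightarrow> 'm \<Rightarrow> 'e \<Rightarrow> 'e" where
  "nab_endo b X = endo_at M (\<lambda>Y x. D Y (\<lambda>x. endo_of \<omega> b x (X x)) x - endo_of \<omega> b x (D Y X x))"

context
  fixes b assumes b: "smooth_tensor2 M b"
begin

lemma nab_endo:
  assumes "VF X"
  shows "VF V \<Longrightarrow> nab_endo b X x (V x) = D V (\<lambda>x. endo_of \<omega> b x (X x)) x - endo_of \<omega> b x (D V X x)"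
    and "linear (nab_endo b X x)"
proof -
  note l = linear_add[OF linear_endo_of[OF b]] linear_scale[OF linear_endo_of[OF b]]
  have *: "(\<lambda>Y x. D Y (\<lambda>x. endo_of \<omega> b x (X x)) x - endo_of \<omega> b x (D Y X x)) (\<lambda>y. Y y + Z y) x =
      (\<lambda>Y x. D Y (\<lambda>x. endo_of \<omega> b x (X x)) x - endo_of \<omega> b x (D Y X x)) Y x + (\<lambda>Y x. D Y (\<lambda>x. endo_of \<omega> b x (X x)) x - endo_of \<omega> b x (D Y X x)) Z x"
    if "VF Y" "VF Z" for Y Z x
    using assms that by (simp add: D_add_left vf_endo_of[OF b] l)
  have **: "(\<lambda>Y x. D Y (\<lambda>x. endo_of \<omega> b x (X x)) x - endo_of \<omega> b x (D Y X x)) (\<lambda>y. g y *\<^sub>R Y y) x =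
      g x *\<^sub>R (\<lambda>Y x. D Y (\<lambda>x. endo_of \<omega> b x (X x)) x - endo_of \<omega> b x (D Y X x)) Y x"
    if "smooth_in M UNIV g" "VF Y" for g Y x
    using assms that by (simp add: D_scaleR_left vf_endo_of[OF b] l scaleR_diff_right)
  show "VF V \<Longrightarrow> nab_endo b X x (V x) = D V (\<lambda>x. endo_of \<omega> b x (X x)) x - endo_of \<omega> b x (D V X x)"
    "linear (nab_endo b X x)"
    unfolding nab_endo_def
    by (rule endo_at_field[where A = "\<lambda>Y x. D Y (\<lambda>x. endo_of \<omega> b x (X x)) x - endo_of \<omega> b x (D Y X x)", OF * **], assumption+)+
qed

lemma nab_endo_linear:
  "VF X \<Longrightarrow> VF X' \<Longrightarrow> nab_endo b (\<lambda>x. X x + X' x) x v = nab_endo b X x v + nab_endo b X' x v"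
  "smooth_in M UNIV g \<Longrightarrow> VF X \<Longrightarrow> nab_endo b (\<lambda>x. g x *\<^sub>R X x) x v = g x *\<^sub>R nab_endo b X x v"
proof -
  obtain V where V: "VF V" "V x = v" using vf_with_value by blast
  note l = linear_add[OF linear_endo_of[OF b]] linear_scale[OF linear_endo_of[OF b]]
  show "VF X \<Longrightarrow> VF X' \<Longrightarrow> nab_endo b (\<lambda>x. X x + X' x) x v = nab_endo b X x v + nab_endo b X' x v"
    unfolding V(2)[symmetric] using V(1) by (simp add: nab_endo(1)[OF _ V(1)] vf_in_add D_add_right vf_endo_of[OF b] l)
  show "smooth_in M UNIV g \<Longrightarrow> VF X \<Longrightarrow> nab_endo b (\<lambda>x. g x *\<^sub>R X x) x v = g x *\<^sub>R nab_endo b X x v"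
    unfolding V(2)[symmetric] using V(1) by (simp add: nab_endo(1)[OF _ V(1)] vf_in_scaleR D_scaleR_right vf_endo_of[OF b] l algebra_simps)
qed

lemma smooth_trace_nab_endo:
  assumes "VF X" shows "smooth_in M UNIV (\<lambda>x. lin_trace (nab_endo b X x))"
proof (rule smooth_in_lin_trace)
  show "linear (nab_endo b X x)" for x by (rule nab_endo(2)[OF assms])
  fix V assume V: "VF V"
  have "VF (\<lambda>x. D V (\<lambda>x. endo_of \<omega> b x (X x)) x - endo_of \<omega> b x (D V X x))"
    using assms V by (intro vf_intros vf_smooth vf_endo_of[OF b])
  then show "VF (\<lambda>x. nab_endo b X x (V x))" by (simp add: nab_endo assms V)
qed

end

lemma endo_at_D:
  assumes "VF U"
  shows "VF V \<Longrightarrow> endo_at M (\<lambda>X. D X U) x (V x) = D V U x" "linear (endo_at M (\<lambda>X. D X U) x)"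
  by (rule endo_at_field; simp add: assms D_add_left D_scaleR_left)+

text \<open>
  The formulas define the three objects. That \<open>s\<close> is symmetric is the symmetry of the Ricci tensor; \<open>U\<close> exists and
  is smooth because the trace is linear over the functions in \<open>X\<close>, and \<open>\<omega>\<close> is nondegenerate.
\<close>

lemma canonical_choice_exists:
  "\<exists>s U f. smooth_sym2 M s \<and> smooth_vf M U \<and> smooth_fun M f \<and> canonical_choice n M \<omega> D s U f"
proof -
  define k where "k = - 1 / (2 * (real n + 1))"
  define s where "s x u v = k * ricci M D x u v" for x u v
  have s: "smooth_tensor2 M s"
  proof (rule smooth_tensor2I)
    show "bilinear (s x)" for x
      unfolding s_def bilinear_def[of "\<lambda>u v. k * ricci M D x u v"]
      by (auto intro!: linearI simp: bilinear_ladd[OF bilinear_ricci] bilinear_radd[OF bilinear_ricci]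
          bilinear_lmul[OF bilinear_ricci] bilinear_rmul[OF bilinear_ricci] distrib_left)
    show "smooth_in M UNIV (\<lambda>x. s x (X x) (Y x))" if "VF X" "VF Y" for X Y
      unfolding s_def by (intro smooth_in_mult smooth_in_const smooth_in_tensor2[OF smooth_ricci] open_UNIV that)
  qed
  define c where "c = 2 / (2 * real n + 1)"
  define B where "B X x = c * lin_trace (nab_endo s X x)" for X x
  define \<theta> where "\<theta> x v = B (SOME X. VF X \<and> X x = v) x" for x v
  have B_lin: "B (\<lambda>x. X x + X' x) x = B X x + B X' x"
    "smooth_in M UNIV g \<Longrightarrow> B (\<lambda>x. g x *\<^sub>R X x) x = g x *\<^sub>R B X x"
    if "VF X" "VF X'" for X X' x g
  proof -
    have 1: "nab_endo s (\<lambda>x. X x + X' x) x = (\<lambda>v. nab_endo s X x v + nab_endo s X' x v)"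
      using nab_endo_linear(1)[OF s that] by blast
    have 2: "nab_endo s (\<lambda>x. g x *\<^sub>R X x) x = (\<lambda>v. g x *\<^sub>R nab_endo s X x v)" if "smooth_in M UNIV g"
      using nab_endo_linear(2)[OF s that \<open>VF X\<close>] by blast
    show "B (\<lambda>x. X x + X' x) x = B X x + B X' x"
      unfolding B_def 1 lin_trace_add by (simp add: distrib_left)
    show "smooth_in M UNIV g \<Longrightarrow> B (\<lambda>x. g x *\<^sub>R X x) x = g x *\<^sub>R B X x"
      unfolding B_def by (simp add: 2 lin_trace_scaleR)
  qed
  have \<theta>: "B X x = \<theta> x (X x)" if "VF X" for X x
  proof -
    have "VF (SOME Y. VF Y \<and> Y x = X x) \<and> (SOME Y. VF Y \<and> Y x = X x) x = X x"
      by (rule someI_ex[of "\<lambda>Y. VF Y \<and> Y x = X x"]) (use that in blast)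
    then show ?thesis unfolding \<theta>_def
      by (intro tensorial_eq[where A = "\<lambda>X. B X x" and x = x, OF B_lin(1) B_lin(2)]) (use that in simp_all)
  qed
  have lin: "linear (\<theta> x)" for x
    by (rule linear_at_point[where A = "\<lambda>X. B X x" and x = x, OF B_lin(1) B_lin(2)]) (simp_all add: \<theta>)
  have "\<exists>w. \<forall>u. \<theta> x u = \<omega> x u w" for x
    using symplectic_space.represent[OF symplectic_space lin] by blast
  then obtain W where W: "\<And>x u. \<theta> x u = \<omega> x u (W x)" by metis
  have vW: "VF W"
  proof (rule vf_represent[OF W])
    fix X assume "VF X"
    then have "smooth_in M UNIV (B X)"
      unfolding B_def[abs_def] by (intro smooth_in_mult smooth_in_const smooth_trace_nab_endo[OF s] open_UNIV)
    then show "smooth_in M UNIV (\<lambda>x. \<theta> x (X x))" using \<open>VF X\<close> by (simp add: \<theta>[symmetric])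
  qed
  define U where "U x = - W x" for x
  have U: "VF U" unfolding U_def by (rule vf_in_minus[OF open_UNIV vW])
  have UW: "\<omega> x (U x) v = \<theta> x v" for x v
  proof -
    interpret x: symplectic_space "\<omega> x" by (rule symplectic_space)
    show ?thesis using x.antisym[of "W x" v] by (simp add: W U_def x.form_simps)
  qed
  define f where "f x = 1 / (2 * real n * (real n + 1)\<^sup>2) * lin_trace (ricci_endo M \<omega> D x \<circ> ricci_endo M \<omega> D x)
                 + 1 / real n * lin_trace (endo_at M (\<lambda>X. D X U) x)" for x
  have r: "linear (ricci_endo M \<omega> D x)" "VF X \<Longrightarrow> VF (\<lambda>x. ricci_endo M \<omega> D x (X x))" for X x
    unfolding ricci_endo_def by (rule linear_endo_of[OF smooth_ricci], rule vf_endo_of[OF smooth_ricci])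
  have "smooth_in M UNIV (\<lambda>x. lin_trace (endo_at M (\<lambda>X. D X U) x))"
    by (rule smooth_in_lin_trace) (use endo_at_D[OF U] U in \<open>auto simp: vf_smooth\<close>)
  moreover have "smooth_in M UNIV (\<lambda>x. lin_trace (ricci_endo M \<omega> D x \<circ> ricci_endo M \<omega> D x))"
    by (rule smooth_in_lin_trace) (use r in \<open>auto simp: linear_compose\<close>)
  ultimately have f: "smooth_in M UNIV f"
    unfolding f_def[abs_def] by (intro smooth_in_add smooth_in_mult smooth_in_const open_UNIV)
  have "canonical_choice n M \<omega> D s U f"
    unfolding canonical_choice_def Let_def smooth_vf_iff
  proof (intro conjI allI impI)
    fix X x assume "VF X"
    then show "\<omega> x (U x) (X x) = 2 / (2 * real n + 1) *
           lin_trace (endo_at M (\<lambda>Y x. D Y (\<lambda>x. endo_of \<omega> s x (X x)) x - endo_of \<omega> s x (D Y X x)) x)"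
      using \<theta>[of X x] by (simp add: UW B_def c_def nab_endo_def)
  qed (simp_all add: s_def k_def f_def)
  moreover have "smooth_sym2 M s"
    using s ricci_symmetric by (simp add: smooth_sym2_def s_def)
  ultimately show ?thesis using U f unfolding smooth_vf_iff smooth_fun_iff by blast
qed

end

locale canonical = induced n M N \<alpha> \<pi> \<omega> D s U f
  for n :: nat
    and M :: "('m::{t2_space,second_countable_topology}, 'e::euclidean_space) manifold"
    and N :: "('n::{t2_space,second_countable_topology}, 'f::euclidean_space) manifold"
    and \<alpha> :: "'n \<Rightarrow> 'f \<Rightarrow> real"
    and \<pi> :: "'n \<Rightarrow> 'm"
    and \<omega> :: "'m \<Rightarrow> 'e \<Rightarrow> 'e \<Rightarrow> real"
    and D :: "('m \<Rightarrow> 'e) \<Rightarrow> ('m \<Rightarrow> 'e) \<Rightarrow> 'm \<Rightarrow> 'e"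
    and s :: "'m \<Rightarrow> 'e \<Rightarrow> 'e \<Rightarrow> real" and U :: "'m \<Rightarrow> 'e" and f :: "'m \<Rightarrow> real" +
  assumes dim: "2 * n \<ge> 4" and canon: "canonical_choice n M \<omega> D s U f"
begin

lemma ricci_s: "ricci M D x u v = - (2 * (real n + 1)) * s x u v"
proof -
  have "s x u v = - 1 / (2 * (real n + 1)) * ricci M D x u v"
    using canon unfolding canonical_choice_def Let_def by blast
  moreover have "real n + 1 \<noteq> 0" by (simp add: add_nonneg_eq_0_iff)
  ultimately show ?thesis by (simp add: field_simps)
qed

lemma U_trace: "VFM X \<Longrightarrow> \<omega> x (U x) (X x) = 2 / (2 * real n + 1) * lin_trace (MD.nab_endo s X x)"
  using canon unfolding canonical_choice_def Let_def M.smooth_vf_iff MD.nab_endo_def by blast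

lemma \<rho>_\<sigma>: "ricci_endo M \<omega> D x v = - (2 * (real n + 1)) *\<^sub>R \<sigma> x v"
proof -
  interpret x: symplectic_space "\<omega> x" by (rule M.symplectic_space)
  show ?thesis
    by (rule x.eqI_right)
       (simp add: ricci_endo_def MD.endo_of[OF MD.smooth_ricci, symmetric] ricci_s x.form_simps \<sigma>)
qed

lemma f_trace: "2 * real n * f x = 4 * lin_trace (\<lambda>v. \<sigma> x (\<sigma> x v)) + 2 * lin_trace (endo_at M (\<lambda>X. D X U) x)"
proof -
  define k where "k = 2 * (real n + 1)"
  have k: "k \<noteq> 0" by (simp add: k_def add_nonneg_eq_0_iff)
  have n: "real n \<noteq> 0" using dim by simp
  have \<rho>: "ricci_endo M \<omega> D x v = - k *\<^sub>R \<sigma> x v" for v unfolding k_def by (rule \<rho>_\<sigma>)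
  have "(\<lambda>v. (ricci_endo M \<omega> D x \<circ> ricci_endo M \<omega> D x) v) = (\<lambda>v. (k * k) *\<^sub>R \<sigma> x (\<sigma> x v))"
    by (simp add: \<rho>)
  then have t: "lin_trace (ricci_endo M \<omega> D x \<circ> ricci_endo M \<omega> D x) = k * k * lin_trace (\<lambda>v. \<sigma> x (\<sigma> x v))"
    by (simp add: comp_def lin_trace_scaleR)
  have "f x = 1 / (2 * real n * (k / 2)\<^sup>2) * (k * k * lin_trace (\<lambda>v. \<sigma> x (\<sigma> x v))) + 1 / real n * lin_trace (endo_at M (\<lambda>X. D X U) x)"
  proof -
    have "(real n + 1)\<^sup>2 = (k / 2)\<^sup>2" by (simp add: k_def)
    moreover have "f x = 1 / (2 * real n * (real n + 1)\<^sup>2) * lin_trace (ricci_endo M \<omega> D x \<circ> ricci_endo M \<omega> D x) + 1 / real n * lin_trace (endo_at M (\<lambda>X. D X U) x)"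
      using canon unfolding canonical_choice_def Let_def by blast
    ultimately show ?thesis by (simp only: t)
  qed
  also have "1 / (2 * real n * (k / 2)\<^sup>2) * (k * k * lin_trace (\<lambda>v. \<sigma> x (\<sigma> x v))) = 2 / real n * lin_trace (\<lambda>v. \<sigma> x (\<sigma> x v))"
    using k n by (simp add: power2_eq_square field_simps)
  finally show ?thesis using n by (simp add: field_simps)
qed

text \<open>The horizontal part of the curvature is the Weyl part of the curvature of \<open>\<nabla>\<close>.\<close>

lemma R_horizontal_weyl: "pT q (R q (hl q x) (hl q y) (hl q z)) = weyl_part n M \<omega> D (prj q) x y z"
proof -
  define k where "k = 2 * (real n + 1)"
  have k: "k \<noteq> 0" by (simp add: k_def add_nonneg_eq_0_iff)
  let ?Y = "(2 * \<omega> (prj q) x y) *\<^sub>R \<sigma> (prj q) z - \<omega> (prj q) y z *\<^sub>R \<sigma> (prj q) x + \<omega> (prj q) x z *\<^sub>R \<sigma> (prj q) y - s (prj q) y z *\<^sub>R x + s (prj q) x z *\<^sub>R y"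
  have "ricci_part n M \<omega> D (prj q) x y z = (1 / k) *\<^sub>R (- k *\<^sub>R ?Y)"
    unfolding ricci_part_def Let_def \<rho>_\<sigma> ricci_s k_def[symmetric] by (simp add: algebra_simps)
  also have "\<dots> = - ?Y" using k unfolding scaleR_scaleR by simp
  finally show ?thesis
    by (simp add: weyl_part_def R_horizontal algebra_simps)
qed

subsection \<open>Ricci-flatness\<close>

lemma lin_trace_frame:
  assumes F: "linear F"
  shows "lin_trace F = lin_trace (\<lambda>x. pT q (F (hl q x))) + a q (F (E q)) + snd (F (S q))"
proof -
  have lp: "linear (pT q)" "linear (a q)" "linear (\<lambda>w. snd w :: real)" by (auto intro!: linearI)
  have lF: "linear (\<lambda>x. F (hl q x))" using linear_compose[OF linear_hl F] by (simp add: comp_def)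
  have "F = (\<lambda>w. F (hl q (pT q w) + a q w *\<^sub>R E q + snd w *\<^sub>R S q))"
    unfolding decompose[symmetric] ..
  then have "F = (\<lambda>w. F (hl q (pT q w)) + a q w *\<^sub>R F (E q) + snd w *\<^sub>R F (S q))"
    by (simp add: linear_add[OF F] linear_scale[OF F])
  then have "lin_trace F = lin_trace (\<lambda>w. F (hl q (pT q w)) + a q w *\<^sub>R F (E q) + snd w *\<^sub>R F (S q))"
    by (rule arg_cong)
  also have "\<dots> = lin_trace (\<lambda>w. F (hl q (pT q w))) + a q (F (E q)) + snd (F (S q))"
    by (simp only: lin_trace_add lin_trace_rank_one[OF lp(2)] lin_trace_rank_one[OF lp(3)])
  finally have "lin_trace F = lin_trace (\<lambda>w. F (hl q (pT q w))) + a q (F (E q)) + snd (F (S q))" .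
  then show ?thesis using lin_trace_commute[OF lF lp(1)] by simp
qed

lemma ricci_horizontal: "ricci (P_mfd N) DP q u v = lin_trace (\<lambda>x. pT q (R q u (hl q x) v))"
  unfolding ricci_def lin_trace_frame[OF PD.linear_curv_at_2, of _ u v q] by simp

lemma trace_\<sigma>: "lin_trace (\<sigma> x) = 0"
  unfolding \<sigma>_def
  by (rule symplectic_space.trace_symplectic_zero[OF M.symplectic_space MD.linear_endo_of[OF smooth_s]])
     (rule MD.endo_of_symplectic[OF smooth_s s_sym])

lemma \<sigma>_left: "\<omega> x (\<sigma> x u) v = - s x u v"
  using symplectic_space.antisym[OF M.symplectic_space, of x "\<sigma> x u" v] \<sigma>[of x v u] s_sym[of x u v] by simp

lemma linear_forms: "linear (\<lambda>x. \<omega> p x v)" "linear (\<lambda>x. \<omega> p v x)" "linear (\<lambda>x. 2 * \<omega> p v x)" "linear (\<lambda>x. s p x v)"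
  by (auto intro!: linearI simp: algebra_simps)

lemmas trace_simps = lin_trace_add lin_trace_diff lin_trace_scaleR lin_trace_minus lin_trace_ident
  lin_trace_rank_one[OF linear_forms(1)] lin_trace_rank_one[OF linear_forms(2)] lin_trace_rank_one[OF linear_forms(3)] lin_trace_rank_one[OF linear_forms(4)]

text \<open>
  The traces of the three horizontal parts vanish; each of them is one of the equations for \<open>s\<close>, \<open>U\<close>
  and \<open>f\<close>. As \<open>R\<close> kills \<open>S\<close> and has no \<open>E\<close>-component, these traces are values of the Ricci tensor.
\<close>

lemma ricci_hl_hl: "ricci (P_mfd N) DP q (hl q u) (hl q v) = 0"
  unfolding ricci_horizontal R_horizontal
  by (simp add: trace_simps trace_\<sigma> \<sigma> \<sigma>_left dim_M ricci_def[symmetric] ricci_s algebra_simps)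

lemma ricci_E_hl: "ricci (P_mfd N) DP q (E q) (hl q v) = 0"
proof -
  obtain X where X: "VFM X" "lift X q = hl q v" "X (prj q) = v" using lift_value by blast
  have "pT q (R q (E q) (hl q z) (hl q v)) = - 2 *\<^sub>R MD.nab_endo s X (prj q) z + \<omega> (prj q) z v *\<^sub>R U (prj q) - \<omega> (prj q) v (U (prj q)) *\<^sub>R z" for z
  proof -
    obtain Z where Z: "VFM Z" "lift Z q = hl q z" "Z (prj q) = z" using lift_value by blast
    show ?thesis
      using curv_E_lift_lift_horizontal[OF Z(1) X(1), of q] MD.nab_endo(1)[OF smooth_s X(1) Z(1), of "prj q"]
      by (simp add: R_fields X Z sig_def[abs_def] \<sigma>_def)
  qed
  then have "ricci (P_mfd N) DP q (E q) (hl q v) = - 2 * lin_trace (MD.nab_endo s X (prj q)) + \<omega> (prj q) (U (prj q)) v - \<omega> (prj q) v (U (prj q)) * (2 * real n)"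
    unfolding ricci_horizontal by (simp add: trace_simps dim_M lin_trace_scaleR[of 2 "MD.nab_endo s X (prj q)"])
  moreover have "lin_trace (MD.nab_endo s X (prj q)) = (2 * real n + 1) / 2 * \<omega> (prj q) (U (prj q)) v"
    using U_trace[OF X(1), of "prj q"] X(3) by (simp add: field_simps add_nonneg_eq_0_iff)
  ultimately show ?thesis
    using symplectic_space.antisym[OF M.symplectic_space, of "prj q" v "U (prj q)"] by (simp add: field_simps)
qed

lemma ricci_E_E: "ricci (P_mfd N) DP q (E q) (E q) = 0"
proof -
  have "pT q (R q (E q) (hl q z) (E q)) = 4 *\<^sub>R \<sigma> (prj q) (\<sigma> (prj q) z) - f (prj q) *\<^sub>R z + 2 *\<^sub>R endo_at M (\<lambda>X. D X U) (prj q) z" for z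
  proof -
    obtain Z where Z: "VFM Z" "lift Z q = hl q z" "Z (prj q) = z" using lift_value by blast
    show ?thesis
      using curv_E_lift_E_horizontal[OF Z(1), of q] MD.endo_at_D(1)[OF vf_U Z(1), of "prj q"] by (simp add: R_fields Z)
  qed
  then have "ricci (P_mfd N) DP q (E q) (E q) = 4 * lin_trace (\<lambda>z. \<sigma> (prj q) (\<sigma> (prj q) z)) - f (prj q) * (2 * real n) + 2 * lin_trace (endo_at M (\<lambda>X. D X U) (prj q))"
    unfolding ricci_horizontal by (simp add: trace_simps dim_M lin_trace_scaleR[of 2 "endo_at M (\<lambda>X. D X U) (prj q)"])
  then show ?thesis using f_trace[of "prj q"] by (simp add: mult.commute)
qed

text \<open>The Ricci tensor is symmetric, and it vanishes whenever an argument is \<open>S\<close>.\<close>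

lemma ricci_DP_zero: "ricci (P_mfd N) DP q u v = 0"
proof -
  have S: "ricci (P_mfd N) DP q w (S q) = 0" for w by (simp add: ricci_horizontal)
  have b: "ricci (P_mfd N) DP q (hl q x + c *\<^sub>R E q + d *\<^sub>R S q) (hl q x' + c' *\<^sub>R E q + d' *\<^sub>R S q) = 0" for x x' c c' d d'
    using S ricci_hl_hl[of q x x'] ricci_E_hl[of q x] ricci_E_hl[of q x'] ricci_E_E[of q] PS.ricci_symmetric[of q "hl q x" "E q"] PS.ricci_symmetric[of q "S q"]
    by (simp add: bilinear_ladd[OF PS.bilinear_ricci] bilinear_radd[OF PS.bilinear_ricci] bilinear_lmul[OF PS.bilinear_ricci] bilinear_rmul[OF PS.bilinear_ricci])
  show ?thesis
    by (subst decompose[of u q], subst decompose[of v q]) (rule b)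
qed

lemma ricci_flat_DP: "ricci_flat (P_mfd N) DP"
  by (simp add: ricci_flat_def ricci_DP_zero)

lemma trace_curv_zero: "lin_trace (\<lambda>x. pT q (R q u (hl q x) v)) = 0"
  using ricci_DP_zero[of q u v] by (simp add: ricci_horizontal)

subsection \<open>Flatness\<close>

lemma flatI: "(\<And>q u v w. R q u v w = 0) \<Longrightarrow> flat_connection (P_mfd N) DP"
  unfolding flat_connection_def P.smooth_vf_iff by (simp add: R_fields)

lemma flat_imp_ricci_type:
  assumes "\<And>q u v w. R q u v w = 0"
  shows "ricci_type n M \<omega> D"
  unfolding ricci_type_def
proof (intro allI)
  fix x u v w
  have "surj \<pi>" using quadruple by (simp add: contact_quadruple_def surj_submersion_def)
  then obtain y where "\<pi> y = x" by (metis surjD)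
  then show "weyl_part n M \<omega> D x u v w = 0"
    using R_horizontal_weyl[of "(y, 0)" u v w] assms by simp
qed

text \<open>Differentiating \<open>R(A,B)S = 0\<close> gives \<open>(\<nabla>\<^sub>CR)(A,B)S = - R(A,B)C\<close>.\<close>

lemma locally_symmetric_imp_flat:
  assumes "locally_symmetric (P_mfd N) DP"
  shows "R q u v w = 0"
proof -
  obtain A where A: "VFP A" "A q = u" using P.vf_with_value by blast
  obtain B where B: "VFP B" "B q = v" using P.vf_with_value by blast
  obtain C where C: "VFP C" "C q = w" using P.vf_with_value by blast
  have "DP C (curv (P_mfd N) DP A B S) q - curv (P_mfd N) DP (DP C A) B S q - curv (P_mfd N) DP A (DP C B) S q - curv (P_mfd N) DP A B (DP C S) q = 0"
    using assms A B C vf_ES unfolding locally_symmetric_def P.smooth_vf_iff by blast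
  moreover have "curv (P_mfd N) DP A B S = (\<lambda>q. 0)" using curv_S_3[OF A(1) B(1)] by blast
  ultimately have "curv (P_mfd N) DP A B C q = 0"
    using A B C by (simp add: curv_S_3 DP_S PD.D_zero_right)
  then show ?thesis using R_fields[OF A(1) B(1) C(1), of q] A B C by simp
qed

lemma vertical_S: "pT q w = 0 \<Longrightarrow> a q w = 0 \<Longrightarrow> w = snd w *\<^sub>R S q"
  by (rule tangent_eqI[of q]) simp_all

text \<open>
  The second Bianchi identity on lifts, for a field \<open>C\<close> on which the curvature of lifts is vertical:
  the brackets of the lifts contribute the terms with \<open>\<omega>\<close>.
\<close>

lemma bianchi_lift:
  fixes q
  assumes X: "VFM X" "VFM Y" "VFM Z" and C: "VFP C" and vert: "\<And>q x y. pT q (R q (hl q x) (hl q y) (C q)) = 0"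
  defines "A \<equiv> \<lambda>Y Z. snd (R q (lift Y q) (lift Z q) (C q))"
    and "Q \<equiv> \<lambda>X Y Z. pT q (R q (lift Y q) (lift Z q) (DP (lift X) C q))"
    and "B \<equiv> \<lambda>Z. pT q (R q (E q) (lift Z q) (C q))"
  shows "(A Y Z *\<^sub>R X (prj q) - Q X Y Z + om X Y (prj q) *\<^sub>R B Z)
    + (A Z X *\<^sub>R Y (prj q) - Q Y Z X + om Y Z (prj q) *\<^sub>R B X)
    + (A X Y *\<^sub>R Z (prj q) - Q Z X Y + om Z X (prj q) *\<^sub>R B Y) = 0"
proof -
  have term_eq: "pT q (DP (lift X) (curv (P_mfd N) DP (lift Y) (lift Z) C) q - curv (P_mfd N) DP (lift Y) (lift Z) (DP (lift X) C) q
       - curv (P_mfd N) DP (lie_bracket (P_mfd N) (lift X) (lift Y)) (lift Z) C q) = A Y Z *\<^sub>R X (prj q) - Q X Y Z + om X Y (prj q) *\<^sub>R B Z"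
    if v: "VFM X" "VFM Y" "VFM Z" for X Y Z
  proof -
    let ?h = "\<lambda>r. snd (curv (P_mfd N) DP (lift Y) (lift Z) C r)"
    have vh: "VFP (curv (P_mfd N) DP (lift Y) (lift Z) C)" using v C by (intro PD.vf_curv vf_lift)
    have "curv (P_mfd N) DP (lift Y) (lift Z) C = (\<lambda>r. ?h r *\<^sub>R S r)"
    proof
      fix r show "curv (P_mfd N) DP (lift Y) (lift Z) C r = ?h r *\<^sub>R S r"
        by (rule vertical_S) (use v C vert[of r "Y (prj r)" "Z (prj r)"] in \<open>simp_all add: R_fields lift_apply\<close>)
    qed
    then have "DP (lift X) (curv (P_mfd N) DP (lift Y) (lift Z) C) = DP (lift X) (\<lambda>r. ?h r *\<^sub>R S r)" by simp
    also have "\<dots> = (\<lambda>r. dderiv (P_mfd N) ?h r (lift X r) *\<^sub>R S r + ?h r *\<^sub>R lift X r)"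
      using v smooth_snd[OF vh] by (simp add: PD.D_scaleR_right DP_lift)
    finally have 1: "pT q (DP (lift X) (curv (P_mfd N) DP (lift Y) (lift Z) C) q) = A Y Z *\<^sub>R X (prj q)"
      using v C by (simp add: A_def R_fields)
    have 2: "curv (P_mfd N) DP (lie_bracket (P_mfd N) (lift X) (lift Y)) (lift Z) C q =
       R q (lift (lie_bracket M X Y) q) (lift Z q) (C q) - om X Y (prj q) *\<^sub>R R q (E q) (lift Z q) (C q)"
      using v C by (simp add: R_fields bracket_lift_fun PD.curv_at_linear)
    have 3: "pT q (R q (lift (lie_bracket M X Y) q) (lift Z q) (C q)) = 0"
      using vert[of q "lie_bracket M X Y (prj q)" "Z (prj q)"] by (simp add: lift_apply)
    show ?thesis
      using v C 3 by (simp add: 1 2 R_fields Q_def B_def)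
  qed
  have add: "pT q (u + v + w) = pT q u + pT q v + pT q w" for u v w by simp
  show ?thesis
    unfolding term_eq[OF X, symmetric] term_eq[OF X(2,3,1), symmetric] term_eq[OF X(3,1,2), symmetric] add[symmetric]
      PD.second_bianchi[OF vf_lift[OF X(1)] vf_lift[OF X(2)] vf_lift[OF X(3)] C, of q]
    by simp
qed

text \<open>This is where the dimension of \<open>M\<close> has to be at least four.\<close>

lemma cyclic_zero:
  fixes F :: "'e \<Rightarrow> 'v::euclidean_space"
  assumes F: "linear F" and cyc: "\<And>x y z. \<omega> p x y *\<^sub>R F z + \<omega> p y z *\<^sub>R F x + \<omega> p z x *\<^sub>R F y = 0"
  shows "F z = 0"
proof (rule euclidean_eqI)
  fix b :: 'v assume "b \<in> Basis"
  interpret w: symplectic_space "\<omega> p" by (rule M.symplectic_space)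
  have "F z \<bullet> b = 0"
  proof (rule w.cyclic_wedge_zero[where m = "\<lambda>z. F z \<bullet> b"])
    show "2 < DIM('e)" using dim dim_M by simp
    show "linear (\<lambda>z. F z \<bullet> b)" by (auto intro!: linearI simp: linear_add[OF F] linear_scale[OF F] inner_left_distrib)
    fix x y z
    show "\<omega> p x y * (F z \<bullet> b) + \<omega> p y z * (F x \<bullet> b) + \<omega> p z x * (F y \<bullet> b) = 0"
      using arg_cong[OF cyc[of x y z], of "\<lambda>v. v \<bullet> b"] by (simp add: inner_left_distrib)
  qed
  then show "F z \<bullet> b = 0 \<bullet> b" by simp
qed

context
  assumes horizontal_zero: "\<And>q x y z. pT q (R q (hl q x) (hl q y) (hl q z)) = 0"
begin

text \<open>
  The additional terms with \<open>\<omega>(\<cdot>,t)\<close> come from the \<open>E\<close>-component of the covariant derivative of a lift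
  along a lift.
\<close>

lemma bianchi_hl:
  "(snd (R q (hl q y) (hl q z) (hl q t)) *\<^sub>R x + (1 / 2 * \<omega> (prj q) x t) *\<^sub>R pT q (R q (hl q y) (hl q z) (E q)) + \<omega> (prj q) x y *\<^sub>R pT q (R q (E q) (hl q z) (hl q t)))
   + (snd (R q (hl q z) (hl q x) (hl q t)) *\<^sub>R y + (1 / 2 * \<omega> (prj q) y t) *\<^sub>R pT q (R q (hl q z) (hl q x) (E q)) + \<omega> (prj q) y z *\<^sub>R pT q (R q (E q) (hl q x) (hl q t)))
   + (snd (R q (hl q x) (hl q y) (hl q t)) *\<^sub>R z + (1 / 2 * \<omega> (prj q) z t) *\<^sub>R pT q (R q (hl q x) (hl q y) (E q)) + \<omega> (prj q) z x *\<^sub>R pT q (R q (E q) (hl q y) (hl q t))) = 0"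
proof -
  obtain X where X: "VFM X" "lift X q = hl q x" "X (prj q) = x" using lift_value by blast
  obtain Y where Y: "VFM Y" "lift Y q = hl q y" "Y (prj q) = y" using lift_value by blast
  obtain Z where Z: "VFM Z" "lift Z q = hl q z" "Z (prj q) = z" using lift_value by blast
  obtain T where T: "VFM T" "lift T q = hl q t" "T (prj q) = t" using lift_value by blast
  have Q: "pT q (R q (hl q u) (hl q v) (DP (lift W) (lift T) q)) = - (1 / 2 * \<omega> (prj q) (W (prj q)) t) *\<^sub>R pT q (R q (hl q u) (hl q v) (E q))"
    if "VFM W" for u v W
    using horizontal_zero[of q u v "D W T (prj q)"] that T
    by (simp add: DP_lift hom_def PD.curv_at_linear lift_apply)
  have vert: "pT r (R r (hl r u) (hl r v) (lift T r)) = 0" for r u v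
    using horizontal_zero by (simp add: lift_apply)
  show ?thesis
    using bianchi_lift[OF X(1) Y(1) Z(1) vf_lift[OF T(1)] vert, of q]
    by (simp add: X Y Z T Q om_def)
qed

text \<open>
  Take the trace over \<open>x\<close> of the Bianchi identity. In the notation of the proof, the traces of \<open>B\<close> and \<open>B'\<close> are values of the Ricci tensor, hence zero;
  by the first Bianchi identity and the symplectic symmetries \<open>B\<close> and \<open>B'\<close> are expressed by
  \<open>A\<close>, and the sum of the remaining terms is \<open>(2n + 1) A y z t\<close>.
\<close>

lemma snd_R_hl_hl_hl: "snd (R q (hl q y) (hl q z) (hl q t)) = 0"
proof -
  interpret w: symplectic_space "\<omega> (prj q)" by (rule M.symplectic_space)
  define A where "A x y z = snd (R q (hl q x) (hl q y) (hl q z))" for x y z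
  define B where "B x y = pT q (R q (E q) (hl q x) (hl q y))" for x y
  define B' where "B' x y = pT q (R q (hl q x) (hl q y) (E q))" for x y
  have lA: "linear (\<lambda>x. A z x t)" "linear (\<lambda>x. A x z t)" for z t
    by (auto intro!: linearI simp: A_def hl_simps PD.curv_at_linear)
  have A_anti: "A x y z = - A y x z" for x y z
    using PD.curv_at_antisym[of q "hl q x" "hl q y"] by (simp add: A_def)
  have B': "B' x y = B y x - B x y" for x y
  proof -
    have "R q (hl q x) (hl q y) (E q) = R q (E q) (hl q y) (hl q x) - R q (E q) (hl q x) (hl q y)"
      using PS.first_bianchi_at[of q "hl q x" "hl q y" "E q"] PD.curv_at_antisym[of q "hl q y" "E q" "hl q x"]
      by (simp add: algebra_simps add_eq_0_iff)
    then show ?thesis by (simp add: B_def B'_def)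
  qed
  have AB: "2 * A x y z = \<omega> (prj q) (B' x y) z" for x y z
    unfolding A_def B'_def by (rule R_symplectic_E)
  have Bsym: "\<omega> (prj q) (B x y) z = \<omega> (prj q) (B x z) y" for x y z
    unfolding B_def by (rule R_symplectic_hl)
  have tB: "lin_trace (\<lambda>x. B x t) = 0" unfolding B_def by (rule trace_curv_zero)
  have tB'1: "lin_trace (\<lambda>x. B' z x) = 0" for z unfolding B'_def by (rule trace_curv_zero)
  have "(\<lambda>x. B' x y) = (\<lambda>x. - B' y x)" using B' by auto
  then have tB'2: "lin_trace (\<lambda>x. B' x y) = 0" using tB'1[of y] by (simp add: lin_trace_minus)
  have "lin_trace (\<lambda>x. (A y z t *\<^sub>R x + (1 / 2 * \<omega> (prj q) x t) *\<^sub>R B' y z + \<omega> (prj q) x y *\<^sub>R B z t)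
     + (A z x t *\<^sub>R y + (1 / 2 * \<omega> (prj q) y t) *\<^sub>R B' z x + \<omega> (prj q) y z *\<^sub>R B x t)
     + (A x y t *\<^sub>R z + (1 / 2 * \<omega> (prj q) z t) *\<^sub>R B' x y + \<omega> (prj q) z x *\<^sub>R B y t)) = 0"
    unfolding A_def B_def B'_def bianchi_hl by simp
  moreover have "linear (\<lambda>x. 1 / 2 * \<omega> (prj q) x t)" by (auto intro!: linearI simp: algebra_simps)
  note half = lin_trace_rank_one[OF this]
  ultimately have "A y z t * (2 * real n) + 1 / 2 * \<omega> (prj q) (B' y z) t + \<omega> (prj q) (B z t) y
     + A z y t + A z y t + \<omega> (prj q) z (B y t) = 0"
    unfolding lin_trace_add lin_trace_scaleR half
    by (simp only: lin_trace_rank_one[OF w.lin1] lin_trace_rank_one[OF w.lin2] lin_trace_rank_one[OF lA(1)] lin_trace_rank_one[OF lA(2)]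
        lin_trace_ident dim_M tB tB'1 tB'2)
  moreover have "\<omega> (prj q) (B z t) y + \<omega> (prj q) z (B y t) = 2 * A y z t"
    using Bsym[of z t y] Bsym[of y t z] w.antisym[of z "B y t"] AB[of y z t] by (simp add: B' w.form_simps)
  ultimately have "(2 * real n + 1) * A y z t = 0"
    using A_anti[of z y t] AB[of y z t] by (simp add: algebra_simps)
  then show ?thesis by (simp add: A_def add_nonneg_eq_0_iff)
qed

lemma R_hl_hl_hl: "R q (hl q x) (hl q y) (hl q z) = 0"
  by (rule tangent_eqI[of q]) (simp_all add: horizontal_zero snd_R_hl_hl_hl)

lemma pT_R_hl_hl_E: "pT q (R q (hl q x) (hl q y) (E q)) = 0"
  by (rule symplectic_space.nondeg[OF M.symplectic_space, of "prj q"])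
     (simp add: R_symplectic_E[symmetric] snd_R_hl_hl_hl)

lemma pT_R_E_hl_hl: "pT q (R q (E q) (hl q z) (hl q t)) = 0"
proof (rule cyclic_zero[where F = "\<lambda>z. pT q (R q (E q) (hl q z) (hl q t))" and p = "prj q"])
  show "linear (\<lambda>z. pT q (R q (E q) (hl q z) (hl q t)))"
    by (auto intro!: linearI simp: hl_simps PD.curv_at_linear)
  fix x y z
  show "\<omega> (prj q) x y *\<^sub>R pT q (R q (E q) (hl q z) (hl q t)) + \<omega> (prj q) y z *\<^sub>R pT q (R q (E q) (hl q x) (hl q t)) + \<omega> (prj q) z x *\<^sub>R pT q (R q (E q) (hl q y) (hl q t)) = 0"
    using bianchi_hl[of q y z t x] by (simp add: snd_R_hl_hl_hl pT_R_hl_hl_E)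
qed

lemma bianchi_E:
  "(snd (R q (hl q y) (hl q z) (E q)) *\<^sub>R x + \<omega> (prj q) x y *\<^sub>R pT q (R q (E q) (hl q z) (E q)))
   + (snd (R q (hl q z) (hl q x) (E q)) *\<^sub>R y + \<omega> (prj q) y z *\<^sub>R pT q (R q (E q) (hl q x) (E q)))
   + (snd (R q (hl q x) (hl q y) (E q)) *\<^sub>R z + \<omega> (prj q) z x *\<^sub>R pT q (R q (E q) (hl q y) (E q))) = 0"
proof -
  obtain X where X: "VFM X" "lift X q = hl q x" "X (prj q) = x" using lift_value by blast
  obtain Y where Y: "VFM Y" "lift Y q = hl q y" "Y (prj q) = y" using lift_value by blast
  obtain Z where Z: "VFM Z" "lift Z q = hl q z" "Z (prj q) = z" using lift_value by blast
  have Q: "pT q (R q (hl q u) (hl q v) (DP (lift W) E q)) = 0" if "VFM W" for u v W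
    using R_hl_hl_hl[of q u v "sig W (prj q)"] that
    by (simp add: DP_lift PD.curv_at_linear lift_apply)
  show ?thesis
    using bianchi_lift[OF X(1) Y(1) Z(1) vf_ES(1) pT_R_hl_hl_E, of q]
    by (simp add: X Y Z Q om_def)
qed

text \<open>
  The trace over \<open>x\<close> of the Bianchi identity for \<open>E\<close> is \<open>2n\<close> times the component in question, by Ricci-flatness
  and the symmetries of \<open>R\<close>.
\<close>

lemma snd_R_hl_hl_E: "snd (R q (hl q y) (hl q z) (E q)) = 0"
proof -
  interpret w: symplectic_space "\<omega> (prj q)" by (rule M.symplectic_space)
  define h where "h x y = snd (R q (hl q x) (hl q y) (E q))" for x y
  define C where "C x = pT q (R q (E q) (hl q x) (E q))" for x
  have lh: "linear (\<lambda>x. h z x)" "linear (\<lambda>x. h x z)" for z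
    by (auto intro!: linearI simp: h_def hl_simps PD.curv_at_linear)
  have h_anti: "h x y = - h y x" for x y
    using PD.curv_at_antisym[of q "hl q x" "hl q y"] by (simp add: h_def)
  have g: "2 * snd (R q (E q) (hl q x) (hl q y)) = \<omega> (prj q) (C x) y" for x y
    unfolding C_def by (rule R_symplectic_E)
  have hC: "2 * h x y = \<omega> (prj q) (C y) x - \<omega> (prj q) (C x) y" for x y
    using arg_cong[OF PS.first_bianchi_at[of q "hl q x" "hl q y" "E q"], of snd] PD.curv_at_antisym[of q "hl q y" "E q" "hl q x"] g[of x y] g[of y x]
    by (simp add: h_def)
  have tC: "lin_trace C = 0" unfolding C_def by (rule trace_curv_zero)
  have "lin_trace (\<lambda>x. (h y z *\<^sub>R x + \<omega> (prj q) x y *\<^sub>R C z) + (h z x *\<^sub>R y + \<omega> (prj q) y z *\<^sub>R C x) + (h x y *\<^sub>R z + \<omega> (prj q) z x *\<^sub>R C y)) = 0"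
    unfolding h_def C_def bianchi_E by simp
  then have "h y z * (2 * real n) + \<omega> (prj q) (C z) y + h z y + h z y + \<omega> (prj q) z (C y) = 0"
    unfolding lin_trace_add lin_trace_scaleR
    by (simp only: lin_trace_rank_one[OF w.lin1] lin_trace_rank_one[OF w.lin2] lin_trace_rank_one[OF lh(1)] lin_trace_rank_one[OF lh(2)]
        lin_trace_ident dim_M tC)
  then have "2 * real n * h y z = 0"
    using h_anti[of z y] hC[of y z] w.antisym[of z "C y"] mult.commute[of "h y z" "2 * real n"] by linarith
  then show ?thesis using dim by (simp add: h_def)
qed

lemma R_hl_hl_E: "R q (hl q x) (hl q y) (E q) = 0"
  by (rule tangent_eqI[of q]) (simp_all add: pT_R_hl_hl_E snd_R_hl_hl_E)

text \<open>
  The curvature of lifts now vanishes on lifts and on \<open>E\<close>, and only the bracket terms of the second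
  Bianchi identity remain.
\<close>

lemma R_E_hl_E: "R q (E q) (hl q z) (E q) = 0"
proof (rule cyclic_zero[where F = "\<lambda>z. R q (E q) (hl q z) (E q)" and p = "prj q"])
  show "linear (\<lambda>z. R q (E q) (hl q z) (E q))"
    by (auto intro!: linearI simp: hl_simps PD.curv_at_linear)
  fix x y z
  obtain X where X: "VFM X" "lift X q = hl q x" "X (prj q) = x" using lift_value by blast
  obtain Y where Y: "VFM Y" "lift Y q = hl q y" "Y (prj q) = y" using lift_value by blast
  obtain Z where Z: "VFM Z" "lift Z q = hl q z" "Z (prj q) = z" using lift_value by blast
  have "DP (lift X) (curv (P_mfd N) DP (lift Y) (lift Z) E) q - curv (P_mfd N) DP (lift Y) (lift Z) (DP (lift X) E) q
       - curv (P_mfd N) DP (lie_bracket (P_mfd N) (lift X) (lift Y)) (lift Z) E q = \<omega> (prj q) (X (prj q)) (Y (prj q)) *\<^sub>R R q (E q) (lift Z q) (E q)"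
    if v: "VFM X" "VFM Y" "VFM Z" for X Y Z
  proof -
    have "curv (P_mfd N) DP (lift Y) (lift Z) E = (\<lambda>r. 0)"
      by (rule ext, subst R_fields[OF vf_lift[OF v(2)] vf_lift[OF v(3)] vf_ES(1)]) (simp add: lift_apply R_hl_hl_E)
    then have 1: "DP (lift X) (curv (P_mfd N) DP (lift Y) (lift Z) E) q = 0"
      using v by (simp add: PD.D_zero_right)
    have 2: "curv (P_mfd N) DP (lift Y) (lift Z) (DP (lift X) E) q = 0"
    proof -
      have c: "VFP (DP (lift X) E)" using v by simp
      show ?thesis
        unfolding R_fields[OF vf_lift[OF v(2)] vf_lift[OF v(3)] c]
        using v R_hl_hl_hl[of q "Y (prj q)" "Z (prj q)" "sig X (prj q)"] by (simp add: DP_lift PD.curv_at_linear lift_apply)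
    qed
    have "curv (P_mfd N) DP (lie_bracket (P_mfd N) (lift X) (lift Y)) (lift Z) E q =
       R q (lift (lie_bracket M X Y) q) (lift Z q) (E q) - om X Y (prj q) *\<^sub>R R q (E q) (lift Z q) (E q)"
      using v by (simp add: R_fields bracket_lift_fun PD.curv_at_linear)
    then show ?thesis
      using R_hl_hl_E[of q "lie_bracket M X Y (prj q)" "Z (prj q)"] by (simp add: 1 2 om_def lift_apply)
  qed
  note e = this
  show "\<omega> (prj q) x y *\<^sub>R R q (E q) (hl q z) (E q) + \<omega> (prj q) y z *\<^sub>R R q (E q) (hl q x) (E q) + \<omega> (prj q) z x *\<^sub>R R q (E q) (hl q y) (E q) = 0"
    using PD.second_bianchi[OF vf_lift[OF X(1)] vf_lift[OF Y(1)] vf_lift[OF Z(1)] vf_ES(1), of q]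
    unfolding e[OF X(1) Y(1) Z(1)] e[OF Y(1) Z(1) X(1)] e[OF Z(1) X(1) Y(1)] X Y Z .
qed

lemma R_E_hl_hl: "R q (E q) (hl q x) (hl q y) = 0"
  by (rule tangent_eqI[of q])
     (use R_symplectic_E[of q "E q" "hl q x" y] in \<open>simp_all add: pT_R_E_hl_hl R_E_hl_E\<close>)

lemma R_zero: "R q u v w = 0"
proof -
  have E: "R q (E q) (E q) w = 0" for w
  proof -
    have "R q (E q) (E q) w + R q (E q) (E q) w = 0"
      using PD.curv_at_antisym[of q "E q" "E q" w] by (simp only: eq_neg_iff_add_eq_0)
    then show ?thesis by (simp only: scaleR_2[symmetric] scaleR_eq_0_iff) simp
  qed
  have hE: "R q (hl q x) (E q) w = - R q (E q) (hl q x) w" for x w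
    by (rule PD.curv_at_antisym)
  have "R q (hl q x + c *\<^sub>R E q + d *\<^sub>R S q) (hl q x' + c' *\<^sub>R E q + d' *\<^sub>R S q) (hl q x'' + c'' *\<^sub>R E q + d'' *\<^sub>R S q) = 0"
    for x x' x'' c c' c'' d d' d''
    by (simp add: PD.curv_at_linear R_hl_hl_hl R_hl_hl_E R_E_hl_E R_E_hl_hl E hE)
  then show ?thesis
    by (subst decompose[of u q], subst decompose[of v q], subst decompose[of w q])
qed

end

lemma ricci_type_imp_flat:
  assumes "ricci_type n M \<omega> D"
  shows "R q u v w = 0"
  by (rule R_zero) (use assms in \<open>simp add: R_horizontal_weyl ricci_type_def\<close>)

end

section \<open>The theorem\<close>

theorem theorem4p1:
  fixes n :: nat
    and M :: "('m::{t2_space,second_countable_topology}, 'e::euclidean_space) manifold"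
    and N :: "('n::{t2_space,second_countable_topology}, 'f::euclidean_space) manifold"
    and \<alpha> :: "'n \<Rightarrow> 'f \<Rightarrow> real"
    and \<pi> :: "'n \<Rightarrow> 'm"
    and \<omega> :: "'m \<Rightarrow> 'e \<Rightarrow> 'e \<Rightarrow> real"
    and D :: "('m \<Rightarrow> 'e) \<Rightarrow> ('m \<Rightarrow> 'e) \<Rightarrow> 'm \<Rightarrow> 'e"
  assumes "2 * n \<ge> 4"
    and "contact_quadruple n M N \<alpha> \<pi> \<omega>"
    and "symplectic_connection M \<omega> D"
  shows
    "(\<forall>s U f. smooth_sym2 M s \<and> smooth_vf M U \<and> smooth_fun M f \<longrightarrow>
       (\<exists>!DP. is_induced_connection M N \<alpha> \<pi> \<omega> D s U f DP) \<and>
       (let DP = induced_connection M N \<alpha> \<pi> \<omega> D s U f in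
          symplectic_connection (P_mfd N) (P_form N \<alpha>) DP \<and>
          affine_vf (P_mfd N) DP (E_field N \<alpha>) \<and>
          symplectic_vf (P_mfd N) (P_form N \<alpha>) (E_field N \<alpha>) \<and>
          affine_vf (P_mfd N) DP (s_field N) \<and>
          lie_scales2 (P_mfd N) (s_field N) (P_form N \<alpha>) 2)) \<and>
     (\<exists>s U f. smooth_sym2 M s \<and> smooth_vf M U \<and> smooth_fun M f \<and> canonical_choice n M \<omega> D s U f) \<and>
     (\<forall>s U f. smooth_sym2 M s \<and> smooth_vf M U \<and> smooth_fun M f \<and> canonical_choice n M \<omega> D s U f \<longrightarrow>
       (let DP = induced_connection M N \<alpha> \<pi> \<omega> D s U f in
          ricci_flat (P_mfd N) DP \<and>
          (ricci_type n M \<omega> D \<longrightarrow> flat_connection (P_mfd N) DP) \<and>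
          (locally_symmetric (P_mfd N) DP \<longrightarrow>
             ricci_type n M \<omega> D \<and> flat_connection (P_mfd N) DP)))"
proof -
  interpret contact_conn n M N \<alpha> \<pi> \<omega> D
    by unfold_locales (fact assms)+
  have ind: "induced n M N \<alpha> \<pi> \<omega> D s U f" if "smooth_sym2 M s" "smooth_vf M U" "smooth_fun M f" for s U f
    using that by unfold_locales (simp_all add: M.smooth_vf_iff M.smooth_fun_iff)
  have general: "(\<exists>!DP. is_induced_connection M N \<alpha> \<pi> \<omega> D s U f DP) \<and>
       (let DP = induced_connection M N \<alpha> \<pi> \<omega> D s U f in
          symplectic_connection (P_mfd N) (P_form N \<alpha>) DP \<and>
          affine_vf (P_mfd N) DP (E_field N \<alpha>) \<and>
          symplectic_vf (P_mfd N) (P_form N \<alpha>) (E_field N \<alpha>) \<and>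
          affine_vf (P_mfd N) DP (s_field N) \<and>
          lie_scales2 (P_mfd N) (s_field N) (P_form N \<alpha>) 2)"
    if "smooth_sym2 M s \<and> smooth_vf M U \<and> smooth_fun M f" for s U f
  proof -
    interpret induced n M N \<alpha> \<pi> \<omega> D s U f by (rule ind) (use that in auto)
    show ?thesis
      unfolding Let_def induced_connection_eq P_form_eq E_field_eq s_field_eq
    proof (intro conjI)
      show "\<exists>!DP. is_induced_connection M N \<alpha> \<pi> \<omega> D s U f DP"
        by (rule ex1I[where a = DP]) (rule DP_is_induced, rule induced_unique)
      show "symplectic_connection (P_mfd N) \<mu> DP" by (rule symplectic_connection_DP)
      show "affine_vf (P_mfd N) DP E" "affine_vf (P_mfd N) DP S" by (rule affine_vertical; simp)+
      show "symplectic_vf (P_mfd N) \<mu> E" "lie_scales2 (P_mfd N) S \<mu> 2"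
        using vertical_scales_mu[of E 0] vertical_scales_mu[of S 2] by (simp_all add: symplectic_vf_def P.smooth_vf_iff)
    qed
  qed
  have special: "(let DP = induced_connection M N \<alpha> \<pi> \<omega> D s U f in
          ricci_flat (P_mfd N) DP \<and>
          (ricci_type n M \<omega> D \<longrightarrow> flat_connection (P_mfd N) DP) \<and>
          (locally_symmetric (P_mfd N) DP \<longrightarrow>
             ricci_type n M \<omega> D \<and> flat_connection (P_mfd N) DP))"
    if "smooth_sym2 M s \<and> smooth_vf M U \<and> smooth_fun M f \<and> canonical_choice n M \<omega> D s U f" for s U f
  proof -
    interpret canonical n M N \<alpha> \<pi> \<omega> D s U f
      by (intro canonical.intro ind canonical_axioms.intro) (use that assms in auto)
    show ?thesis
      unfolding Let_def induced_connection_eq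
      using ricci_flat_DP flatI[OF ricci_type_imp_flat] flatI[OF locally_symmetric_imp_flat] flat_imp_ricci_type[OF locally_symmetric_imp_flat]
      by blast
  qed
  show ?thesis
    using general special MD.canonical_choice_exists by blast
qed

end
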